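(* The constrained NE existence problem for RP games is $\mathsf{EXPTIME}$-complete. The hardness holds even for two players, i.e., the problem is $\mathsf{EXPTIME}$-hard even when restricted to RP games with two players.
   Context: **Arenas.** An arena is $A=(V,E,\mathcal P,(V_i)_{i\in\mathcal P})$ with $V$ a finite set of vertices, $E\subseteq V\times V$ such that every vertex has at least one successor, $\mathcal P$ a finite set of players, and $(V_i)_{i\in\mathcal P}$ a partition of $V$ ($V_i$ is the set of vertices owned by player $i$). A play (resp. history) is an infinite (resp. finite) sequence of vertices following edges. **Games.** A game $\mathcal G=(A,(\mathsf{pay}_i)_{i\in\mathcal P})$ consists of an arena and, for each player $i$, a payoff function $\mathsf{pay}_i:V^\omega\to P_i$, where $P_i$ is a set equipped with a binary relation $\ltimes_i\subseteq P_i\times P_i$ (the preference relation; $p\ltimes_i p'$ means $p'$ is preferred to $p$). It is a *regular-payoff game* (RP game) if, for each $i$, $P_i$ is finite and $\mathsf{pay}_i^{-1}(p)$ is $\omega$-regular for each $p\in P_i$. No condition is imposed on $\ltimes_i$. As an input to a decision problem, an RP game is given by its arena, the finite sets $P_i$ and relations $\ltimes_i$ listed explicitly, and, for each $i$ and each $p\in P_i$, a deterministic parity automaton over the alphabet $V$ accepting $\mathsf{pay}_i^{-1}(p)$. **Strategies and equilibria.** A strategy $\sigma_i$ of player $i$ maps each history $hv$ with $v\in V_i$ to a successor of $v$. A strategy profile is $\bar\sigma=(\sigma_i)_{i\in\mathcal P}$; its outcome $\langle\bar\sigma\rangle_v$ is the unique play from $v$ consistent with all $\sigma_i$; $\bar\sigma_{-i}=(\sigma_j)_{j\neq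 i}$. A profile $\bar\sigma$ is a Nash equilibrium (NE) from $v$ if for every player $i$ and every strategy $\tau_i$ of player $i$, it is not the case that $\mathsf{pay}_i(\langle\bar\sigma\rangle_v)\ltimes_i\mathsf{pay}_i(\langle(\tau_i,\bar\sigma_{-i})\rangle_v)$. **Problem.** The constrained NE existence problem: given an RP game, a vertex $v$ and a payoff $p_i\in P_i$ for each player $i$, decide whether there exists an NE $\bar\sigma$ from $v$ such that for all $i\in\mathcal P$, $p_i=\mathsf{pay}_i(\langle\bar\sigma\rangle_v)$ or $p_i\ltimes_i\mathsf{pay}_i(\langle\bar\sigma\rangle_v)$. *)

theory Defs
  imports "HOL-Library.Landau_Symbols" "HOL-Library.Omega_Words_Fun" "HOL-Library.Disjoint_Sets"
begin

section \<open>Deterministic multi-tape Turing machines\<close>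

datatype direction = Move_Left | Stay | Move_Right

text \<open>
  A tape is two-way infinite; it is given by its contents and the position of the head.
  States and tape symbols are natural numbers.  The blank is \<^term>\<open>0::nat\<close>, the input symbols
  are \<^term>\<open>1::nat\<close> (for \<^const>\<open>False\<close>) and \<^term>\<open>2::nat\<close> (for \<^const>\<open>True\<close>).
\<close>

type_synonym tape = "(int \<Rightarrow> nat) \<times> int"
type_synonym config = "nat \<times> tape list"

record tm =
  num_tapes :: nat
  num_states :: nat
  num_symbols :: nat
  start_state :: nat
  accept_state :: nat
  reject_state :: nat
  transition :: "nat \<Rightarrow> nat list \<Rightarrow> nat \<times> (nat \<times> direction) list"

definition wf_tm :: "tm \<Rightarrow> bool" where
  "wf_tm M \<longleftrightarrow>
     num_tapes M \<ge> 1 \<and> num_symbols M \<ge> 3 \<and>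
     start_state M < num_states M \<and> accept_state M < num_states M \<and>
     reject_state M < num_states M \<and> accept_state M \<noteq> reject_state M \<and>
     (\<forall>q < num_states M. \<forall>ss. length ss = num_tapes M \<and> set ss \<subseteq> {..<num_symbols M} \<longrightarrow>
        fst (transition M q ss) < num_states M \<and>
        length (snd (transition M q ss)) = num_tapes M \<and>
        (\<forall>(s, d) \<in> set (snd (transition M q ss)). s < num_symbols M))"

fun offset :: "direction \<Rightarrow> int" where
  "offset Move_Left = - 1"
| "offset Stay = 0"
| "offset Move_Right = 1"

fun read_tape :: "tape \<Rightarrow> nat" where
  "read_tape (c, h) = c h"

fun act_tape :: "tape \<Rightarrow> nat \<times> direction \<Rightarrow> tape" where
  "act_tape (c, h) (s, d) = (c(h := s), h + offset d)"

definition halting :: "tm \<Rightarrow> config \<Rightarrow> bool" where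
  "halting M cf \<longleftrightarrow> fst cf \<in> {accept_state M, reject_state M}"

definition step :: "tm \<Rightarrow> config \<Rightarrow> config" where
  "step M cf =
     (if halting M cf then cf
      else let (q, acts) = transition M (fst cf) (map read_tape (snd cf))
           in (q, map2 act_tape (snd cf) acts))"

definition string_contents :: "bool list \<Rightarrow> int \<Rightarrow> nat" where
  "string_contents x j =
     (if 0 \<le> j \<and> nat j < length x then (if x ! nat j then 2 else 1) else 0)"

definition init_config :: "tm \<Rightarrow> bool list \<Rightarrow> config" where
  "init_config M x =
     (start_state M,
      (string_contents x, 0) # replicate (num_tapes M - 1) (string_contents [], 0))"

text \<open>A machine reads its input from the first tape and leaves its output on the last one.\<close>

definition decides_within :: "tm \<Rightarrow> bool list set \<Rightarrow> (nat \<Rightarrow> nat) \<Rightarrow> bool" where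
  "decides_within M L T \<longleftrightarrow>
     (\<forall>x. \<exists>t \<le> T (length x).
        fst ((step M ^^ t) (init_config M x)) =
          (if x \<in> L then accept_state M else reject_state M))"

definition computes_within :: "tm \<Rightarrow> (bool list \<Rightarrow> bool list) \<Rightarrow> (nat \<Rightarrow> nat) \<Rightarrow> bool" where
  "computes_within M f T \<longleftrightarrow>
     (\<forall>x. \<exists>t \<le> T (length x).
        let cf = (step M ^^ t) (init_config M x)
        in halting M cf \<and> fst (last (snd cf)) = string_contents (f x))"


section \<open>Exponential time, polynomial-time reductions, hardness\<close>

definition DTIME :: "(nat \<Rightarrow> real) \<Rightarrow> bool list set set" where
  "DTIME f = {L. \<exists>M T. wf_tm M \<and> decides_within M L T \<and> (\<lambda>n. real (T n)) \<in> O(f)}"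

definition EXPTIME :: "bool list set set" where
  "EXPTIME = (\<Union>k::nat. DTIME (\<lambda>n. 2 ^ (n ^ k)))"

definition polytime_computable :: "(bool list \<Rightarrow> bool list) \<Rightarrow> bool" where
  "polytime_computable f \<longleftrightarrow>
     (\<exists>M T. \<exists>k::nat. wf_tm M \<and> computes_within M f T \<and>
        (\<lambda>n. real (T n)) \<in> O(\<lambda>n. real n ^ k))"

text \<open>
  \<open>EXPTIME_hard_on D L\<close>: the decision problem \<open>L\<close> is hard when restricted to the set \<open>D\<close> of
  instances, i.e. the reductions only produce instances in \<open>D\<close>.
\<close>

definition EXPTIME_hard_on :: "bool list set \<Rightarrow> bool list set \<Rightarrow> bool" where
  "EXPTIME_hard_on D L \<longleftrightarrow>
     (\<forall>L' \<in> EXPTIME. \<exists>f. polytime_computable f \<and> (\<forall>x. f x \<in> D \<and> (x \<in> L' \<longleftrightarrow> f x \<in> L)))"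

definition EXPTIME_hard :: "bool list set \<Rightarrow> bool" where
  "EXPTIME_hard L \<longleftrightarrow> EXPTIME_hard_on UNIV L"

definition EXPTIME_complete :: "bool list set \<Rightarrow> bool" where
  "EXPTIME_complete L \<longleftrightarrow> L \<in> EXPTIME \<and> EXPTIME_hard L"


section \<open>Omega-regular languages and deterministic parity automata\<close>

definition omega_words :: "'a set \<Rightarrow> 'a word set" where
  "omega_words \<Sigma> = {w. range w \<subseteq> \<Sigma>}"

text \<open>Recognisability by a finite nondeterministic Buechi automaton \<open>(Q, I, \<Delta>, F)\<close>.\<close>

definition omega_regular :: "'a set \<Rightarrow> 'a word set \<Rightarrow> bool" where
  "omega_regular \<Sigma> L \<longleftrightarrow>
     (\<exists>(Q :: nat set) I \<Delta> F.
        finite Q \<and> I \<subseteq> Q \<and> \<Delta> \<subseteq> Q \<times> \<Sigma> \<times> Q \<and> F \<subseteq> Q \<and>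
        L = {w \<in> omega_words \<Sigma>. \<exists>r. r 0 \<in> I \<and> (\<forall>n. (r n, w n, r (Suc n)) \<in> \<Delta>) \<and>
                                  (\<exists>\<^sub>\<infinity>n. r n \<in> F)})"

record ('q, 'a) dpa =
  states :: "'q set"
  initial :: 'q
  delta :: "'q \<Rightarrow> 'a \<Rightarrow> 'q"
  priority :: "'q \<Rightarrow> nat"

definition wf_dpa :: "'a set \<Rightarrow> ('q, 'a) dpa \<Rightarrow> bool" where
  "wf_dpa \<Sigma> A \<longleftrightarrow> finite (states A) \<and> initial A \<in> states A \<and>
     (\<forall>q \<in> states A. \<forall>a \<in> \<Sigma>. delta A q a \<in> states A)"

primrec dpa_run :: "('q, 'a) dpa \<Rightarrow> 'a word \<Rightarrow> nat \<Rightarrow> 'q" where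
  "dpa_run A w 0 = initial A"
| "dpa_run A w (Suc n) = delta A (dpa_run A w n) (w n)"

text \<open>Max-even acceptance.\<close>

definition dpa_language :: "'a set \<Rightarrow> ('q, 'a) dpa \<Rightarrow> 'a word set" where
  "dpa_language \<Sigma> A = {w \<in> omega_words \<Sigma>. even (Max (limit (priority A \<circ> dpa_run A w)))}"

lemma omega_regularI:
  fixes Q :: "'q set"
  assumes fin: "finite Q" and sub: "I \<subseteq> Q" "\<Delta> \<subseteq> Q \<times> \<Sigma> \<times> Q" "F \<subseteq> Q"
    and L: "L = {w \<in> omega_words \<Sigma>. \<exists>r. r 0 \<in> I \<and> (\<forall>n. (r n, w n, r (Suc n)) \<in> \<Delta>) \<and>
                                  (\<exists>\<^sub>\<infinity>n. r n \<in> F)}"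
  shows "omega_regular \<Sigma> L"
proof -
  obtain g :: "'q \<Rightarrow> nat" where g: "inj_on g Q"
    using finite_imp_inj_to_nat_seg[OF fin] by blast
  let ?D = "(\<lambda>(q, a, q'). (g q, a, g q')) ` \<Delta>"
  have L': "L = {w \<in> omega_words \<Sigma>. \<exists>r. r 0 \<in> g ` I \<and> (\<forall>n. (r n, w n, r (Suc n)) \<in> ?D) \<and>
                                  (\<exists>\<^sub>\<infinity>n. r n \<in> g ` F)}" (is "_ = ?R")
  proof (intro equalityI subsetI)
    fix w assume "w \<in> L"
    then obtain r where r: "w \<in> omega_words \<Sigma>" "r 0 \<in> I" "\<forall>n. (r n, w n, r (Suc n)) \<in> \<Delta>"
      "\<exists>\<^sub>\<infinity>n. r n \<in> F" unfolding L by blast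
    have "\<exists>\<^sub>\<infinity>n. g (r n) \<in> g ` F" using r(4) by (rule INFM_mono) blast
    moreover have "\<forall>n. (g (r n), w n, g (r (Suc n))) \<in> ?D"
      using r(3) by (force simp: image_iff)
    ultimately show "w \<in> ?R" using r(1,2) by (intro CollectI conjI exI[of _ "\<lambda>n. g (r n)"]) auto
  next
    fix w assume "w \<in> ?R"
    then obtain r where r: "w \<in> omega_words \<Sigma>" "r 0 \<in> g ` I" "\<forall>n. (r n, w n, r (Suc n)) \<in> ?D"
      "\<exists>\<^sub>\<infinity>n. r n \<in> g ` F" by blast
    let ?h = "inv_into Q g"
    have h: "?h (g q) = q" if "q \<in> Q" for q using g that by simp
    have "?h (r 0) \<in> I" using r(2) sub(1) h by auto
    moreover have "\<forall>n. (?h (r n), w n, ?h (r (Suc n))) \<in> \<Delta>"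
    proof
      fix n
      obtain q q' where "(q, w n, q') \<in> \<Delta>" "r n = g q" "r (Suc n) = g q'"
        using r(3)[rule_format, of n] by auto
      then show "(?h (r n), w n, ?h (r (Suc n))) \<in> \<Delta>" using sub(2) h by auto
    qed
    moreover have "\<exists>\<^sub>\<infinity>n. ?h (r n) \<in> F"
      using r(4) by (rule INFM_mono) (use sub(3) h in auto)
    ultimately show "w \<in> L" unfolding L using r(1)
      by (intro CollectI conjI exI[of _ "\<lambda>n. ?h (r n)"]) auto
  qed
  have "?D \<subseteq> g ` Q \<times> \<Sigma> \<times> g ` Q" using sub(2) by auto
  moreover have "finite (g ` Q)" "g ` I \<subseteq> g ` Q" "g ` F \<subseteq> g ` Q" using fin sub by auto
  ultimately show ?thesis unfolding omega_regular_def using L' by blast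
qed

lemma dpa_run_in_states:
  assumes "wf_dpa \<Sigma> A" "w \<in> omega_words \<Sigma>"
  shows "dpa_run A w n \<in> states A"
  using assms by (induction n) (auto simp: wf_dpa_def omega_words_def)

text \<open>
  In state \<open>(q, 0)\<close> the Buechi automaton just simulates \<open>A\<close>; in state \<open>(q, Suc c)\<close> it has guessed
  that the priorities are at most \<open>c\<close> from now on.
\<close>

lemma omega_regular_dpa_language:
  assumes wf: "wf_dpa \<Sigma> A"
  shows "omega_regular \<Sigma> (dpa_language \<Sigma> A)"
proof -
  let ?C = "priority A ` states A"
  let ?Q = "states A \<times> insert 0 (Suc ` ?C)"
  let ?I = "{(initial A, 0::nat)}"
  let ?D = "{((q, k), a, (q', k')). (q, k) \<in> ?Q \<and> a \<in> \<Sigma> \<and> (q', k') \<in> ?Q \<and> q' = delta A q a \<and>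
     (k = 0 \<or> k' = k) \<and> (\<forall>c. k' = Suc c \<longrightarrow> even c \<and> priority A q' \<le> c)}"
  let ?F = "{(q, Suc c) | q c. (q, Suc c) \<in> ?Q \<and> priority A q = c}"
  have fin: "finite (states A)" using wf by (simp add: wf_dpa_def)
  show ?thesis
  proof (rule omega_regularI[of ?Q ?I ?D _ ?F])
    show "finite ?Q" using fin by simp
    show "?I \<subseteq> ?Q" using wf by (auto simp: wf_dpa_def)
    show "?D \<subseteq> ?Q \<times> \<Sigma> \<times> ?Q" by auto
    show "?F \<subseteq> ?Q" by auto
    show "dpa_language \<Sigma> A = {w \<in> omega_words \<Sigma>. \<exists>r. r 0 \<in> ?I \<and>
        (\<forall>n. (r n, w n, r (Suc n)) \<in> ?D) \<and> (\<exists>\<^sub>\<infinity>n. r n \<in> ?F)}" (is "_ = ?R")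
    proof (intro equalityI subsetI)
      fix w assume w: "w \<in> dpa_language \<Sigma> A"
      let ?\<rho> = "dpa_run A w"
      let ?p = "priority A \<circ> ?\<rho>"
      from w have wS: "w \<in> omega_words \<Sigma>" and ev: "even (Max (limit ?p))"
        by (auto simp: dpa_language_def)
      have st: "?\<rho> n \<in> states A" for n using dpa_run_in_states[OF wf wS] .
      have rng: "range ?p \<subseteq> ?C" using st by auto
      then have finr: "finite (range ?p)" using fin finite_subset by blast
      have finl: "finite (limit ?p)" using finr limit_in_range finite_subset by metis
      have ne: "limit ?p \<noteq> {}" using limit_nonempty[OF finr] by blast
      define c where "c = Max (limit ?p)"
      have cl: "c \<in> limit ?p" using Max_in[OF finl ne] by (simp add: c_def)
      obtain k where k: "limit ?p = range (suffix k ?p)"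
        using limit_is_suffix[OF finr] by blast
      have le: "?p n \<le> c" if "n \<ge> k" for n
      proof -
        have "?p n = suffix k ?p (n - k)" using that by (simp add: suffix_def)
        then have "?p n \<in> limit ?p" unfolding k by (metis rangeI)
        then show ?thesis using finl by (simp add: c_def)
      qed
      have cC: "c \<in> ?C" by (rule subsetD[OF rng subsetD[OF limit_in_range cl]])
      define r where "r = (\<lambda>n. (?\<rho> n, if n \<le> k then 0 else Suc c))"
      have rQ: "r n \<in> ?Q" for n using st cC by (auto simp: r_def)
      have "(r n, w n, r (Suc n)) \<in> ?D" for n
        using rQ[of n] rQ[of "Suc n"] wS le[of "Suc n"] ev
        by (auto simp: r_def omega_words_def c_def[symmetric] range_subsetD split: if_splits)
      moreover have "r 0 \<in> ?I" by (simp add: r_def)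
      moreover have "\<exists>\<^sub>\<infinity>n. r n \<in> ?F"
      proof -
        have 1: "\<exists>\<^sub>\<infinity>n. ?p n = c" using cl by (simp add: limit_def)
        have 2: "\<forall>\<^sub>\<infinity>n. n > k" using MOST_nat by blast
        show ?thesis using INFM_conjI[OF 1 2]
          by (rule INFM_mono) (use st cC in \<open>auto simp: r_def\<close>)
      qed
      ultimately show "w \<in> ?R" using wS by blast
    next
      fix w assume "w \<in> ?R"
      then obtain r where wS: "w \<in> omega_words \<Sigma>" and r0: "r 0 \<in> ?I"
        and D: "\<And>n. (r n, w n, r (Suc n)) \<in> ?D" and F: "\<exists>\<^sub>\<infinity>n. r n \<in> ?F" by blast
      let ?\<rho> = "dpa_run A w"
      let ?p = "priority A \<circ> ?\<rho>"
      have st: "?\<rho> n \<in> states A" for n using dpa_run_in_states[OF wf wS] .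
      have rng: "range ?p \<subseteq> ?C" using st by auto
      then have finr: "finite (range ?p)" using fin finite_subset by blast
      have finl: "finite (limit ?p)" using finr limit_in_range finite_subset by metis
      have r1: "fst (r n) = ?\<rho> n" for n
      proof (induction n)
        case 0 then show ?case using r0 by simp
      next
        case (Suc n)
        have "fst (r (Suc n)) = delta A (fst (r n)) (w n)" using D[of n] by (auto split: prod.splits)
        then show ?case using Suc by simp
      qed
      obtain m where m: "r m \<in> ?F" using INFM_EX[OF F] by blast
      then obtain c where c: "snd (r m) = Suc c" by auto
      have stay: "snd (r n) = Suc c" if "n \<ge> m" for n
        using that
      proof (induction n rule: dec_induct)
        case base then show ?case by (rule c)
      next
        case (step n) then show ?case using D[of n] by (auto split: prod.splits)
      qed
      have bnd: "even c \<and> ?p n \<le> c" if mn: "n > m" for n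
      proof -
        obtain n' where n: "n = Suc n'" "n' \<ge> m" using mn that by (cases n) auto
        have "snd (r (Suc n')) = Suc c" using stay n by simp
        then have "even c \<and> priority A (fst (r (Suc n'))) \<le> c" using D[of n'] by (auto split: prod.splits)
        then show ?thesis using r1 n by simp
      qed
      have cl: "c \<in> limit ?p"
      proof -
        have 2: "\<forall>\<^sub>\<infinity>n. n > m" using MOST_nat by blast
        have "\<exists>\<^sub>\<infinity>n. ?p n = c"
        proof (rule INFM_mono[OF INFM_conjI[OF F 2]])
          fix n assume n: "r n \<in> ?F \<and> m < n"
          then have "snd (r n) = Suc (priority A (fst (r n)))" by auto
          then show "?p n = c" using stay[of n] n r1[of n] by simp
        qed
        then show ?thesis by (simp add: limit_def)
      qed
      have "x \<le> c" if "x \<in> limit ?p" for x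
      proof -
        have "\<exists>n>m. ?p n = x" using that by (auto simp: limit_def INFM_nat)
        then show ?thesis using bnd by blast
      qed
      then have "Max (limit ?p) = c" using finl cl by (intro Max_eqI) auto
      then show "w \<in> dpa_language \<Sigma> A" using wS bnd[of "Suc m"] by (simp add: dpa_language_def)
    qed
  qed
qed


section \<open>Games, strategies and Nash equilibria\<close>

record ('v, 'i) arena =
  verts :: "'v set"
  edges :: "('v \<times> 'v) set"
  players :: "'i set"
  owned :: "'i \<Rightarrow> 'v set"

definition wf_arena :: "('v, 'i, 'z) arena_scheme \<Rightarrow> bool" where
  "wf_arena A \<longleftrightarrow>
     finite (verts A) \<and> edges A \<subseteq> verts A \<times> verts A \<and>
     (\<forall>u \<in> verts A. \<exists>w. (u, w) \<in> edges A) \<and>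
     finite (players A) \<and>
     (\<Union>i \<in> players A. owned A i) = verts A \<and>
     disjoint_family_on (owned A) (players A)"

text \<open>The pair \<open>(x, y)\<close> is in \<open>pref G i\<close> if player \<open>i\<close> prefers the payoff \<open>y\<close> to \<open>x\<close>.\<close>

record ('v, 'i, 'p) game = "('v, 'i) arena" +
  payoffs :: "'i \<Rightarrow> 'p set"
  pref :: "'i \<Rightarrow> ('p \<times> 'p) set"
  pay :: "'i \<Rightarrow> 'v word \<Rightarrow> 'p"

definition wf_game :: "('v, 'i, 'p) game \<Rightarrow> bool" where
  "wf_game G \<longleftrightarrow> wf_arena G \<and>
     (\<forall>i \<in> players G. pref G i \<subseteq> payoffs G i \<times> payoffs G i \<and>
        (\<forall>w \<in> omega_words (verts G). pay G i w \<in> payoffs G i))"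

definition pay_preimage :: "('v, 'i, 'p) game \<Rightarrow> 'i \<Rightarrow> 'p \<Rightarrow> 'v word set" where
  "pay_preimage G i p = {w \<in> omega_words (verts G). pay G i w = p}"

definition rp_game :: "('v, 'i, 'p) game \<Rightarrow> bool" where
  "rp_game G \<longleftrightarrow> wf_game G \<and>
     (\<forall>i \<in> players G. finite (payoffs G i) \<and>
        (\<forall>p \<in> payoffs G i. omega_regular (verts G) (pay_preimage G i p)))"

definition play :: "('v, 'i, 'z) arena_scheme \<Rightarrow> 'v word \<Rightarrow> bool" where
  "play A w \<longleftrightarrow> w \<in> omega_words (verts A) \<and> (\<forall>n. (w n, w (Suc n)) \<in> edges A)"

definition history :: "('v, 'i, 'z) arena_scheme \<Rightarrow> 'v list \<Rightarrow> bool" where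
  "history A h \<longleftrightarrow> h \<noteq> [] \<and> set h \<subseteq> verts A \<and> successively (\<lambda>u w. (u, w) \<in> edges A) h"

definition strategy :: "('v, 'i, 'z) arena_scheme \<Rightarrow> 'i \<Rightarrow> ('v list \<Rightarrow> 'v) \<Rightarrow> bool" where
  "strategy A i s \<longleftrightarrow>
     (\<forall>h. history A h \<and> last h \<in> owned A i \<longrightarrow> (last h, s h) \<in> edges A)"

definition strategy_profile ::
    "('v, 'i, 'z) arena_scheme \<Rightarrow> ('i \<Rightarrow> 'v list \<Rightarrow> 'v) \<Rightarrow> bool" where
  "strategy_profile A \<sigma> \<longleftrightarrow> (\<forall>i \<in> players A. strategy A i (\<sigma> i))"

definition consistent ::
    "('v, 'i, 'z) arena_scheme \<Rightarrow> 'i \<Rightarrow> ('v list \<Rightarrow> 'v) \<Rightarrow> 'v word \<Rightarrow> bool" where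
  "consistent A i s w \<longleftrightarrow> (\<forall>n. w n \<in> owned A i \<longrightarrow> w (Suc n) = s (map w [0..<Suc n]))"

definition outcome ::
    "('v, 'i, 'z) arena_scheme \<Rightarrow> ('i \<Rightarrow> 'v list \<Rightarrow> 'v) \<Rightarrow> 'v \<Rightarrow> 'v word" where
  "outcome A \<sigma> v =
     (THE w. play A w \<and> w 0 = v \<and> (\<forall>i \<in> players A. consistent A i (\<sigma> i) w))"

lemma outcome_unique:
  assumes wf: "wf_arena A" and prof: "strategy_profile A \<sigma>" and v: "v \<in> verts A"
  shows "\<exists>!w. play A w \<and> w 0 = v \<and> (\<forall>i \<in> players A. consistent A i (\<sigma> i) w)"
proof -
  define own where "own = (\<lambda>u. THE i. i \<in> players A \<and> u \<in> owned A i)"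
  have own1: "\<exists>!i. i \<in> players A \<and> u \<in> owned A i" if "u \<in> verts A" for u
    using wf that unfolding wf_arena_def disjoint_family_on_def by blast
  have own: "own u \<in> players A \<and> u \<in> owned A (own u)" if "u \<in> verts A" for u
    unfolding own_def by (rule theI'[OF own1[OF that]])
  have own_eq: "own u = i" if "u \<in> verts A" "i \<in> players A" "u \<in> owned A i" for u i
    using own1[OF that(1)] own[OF that(1)] that by blast
  define H where "H = rec_nat [v] (\<lambda>_ h. h @ [\<sigma> (own (last h)) h])"
  have H0: "H 0 = [v]" and HS: "H (Suc n) = H n @ [\<sigma> (own (last (H n))) (H n)]" for n
    by (simp_all add: H_def)
  define w where "w = (\<lambda>n. last (H n))"
  have Hw: "H n = map w [0..<Suc n]" for n
    by (induction n) (simp_all add: H0 HS w_def)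
  have edge: "(last (H n), \<sigma> (own (last (H n))) (H n)) \<in> edges A" if "history A (H n)" for n
  proof -
    have "last (H n) \<in> verts A" using that by (auto simp: history_def)
    then show ?thesis using own prof that by (auto simp: strategy_profile_def strategy_def)
  qed
  have hist: "history A (H n)" for n
  proof (induction n)
    case 0 then show ?case using v by (simp add: H0 history_def)
  next
    case (Suc n)
    then show ?case using edge[OF Suc] wf
      by (auto simp: HS history_def successively_append_iff wf_arena_def)
  qed
  have wS: "w (Suc n) = \<sigma> (own (w n)) (map w [0..<Suc n])" for n
    using HS[of n] by (metis Hw w_def last_snoc)
  have wV: "w n \<in> verts A" for n using hist[of n] by (auto simp: w_def history_def)
  have "play A w"
    unfolding play_def omega_words_def using wV edge[OF hist]
    by (auto simp: w_def HS)
  moreover have "w 0 = v" by (simp add: w_def H0)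
  moreover have "\<forall>i \<in> players A. consistent A i (\<sigma> i) w"
    unfolding consistent_def using wS wV own_eq by metis
  moreover have "w' = w" if w': "play A w'" "w' 0 = v" "\<forall>i \<in> players A. consistent A i (\<sigma> i) w'" for w'
  proof -
    have V: "w' n \<in> verts A" for n using w'(1) by (auto simp: play_def omega_words_def)
    have S: "w' (Suc n) = \<sigma> (own (w' n)) (map w' [0..<Suc n])" for n
      using w'(3) own[OF V[of n]] by (auto simp: consistent_def)
    have "\<forall>m \<le> n. w' m = w m" for n
    proof (induction n)
      case 0 then show ?case using w'(2) \<open>w 0 = v\<close> by simp
    next
      case (Suc n)
      have "map w' [0..<Suc n] = map w [0..<Suc n]" using Suc by simp
      then have "w' (Suc n) = w (Suc n)" using S[of n] wS[of n] Suc by (metis order_refl)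
      then show ?case using Suc by (auto simp: le_Suc_eq)
    qed
    then show ?thesis by blast
  qed
  ultimately show ?thesis by blast
qed

definition nash_equilibrium ::
    "('v, 'i, 'p) game \<Rightarrow> 'v \<Rightarrow> ('i \<Rightarrow> 'v list \<Rightarrow> 'v) \<Rightarrow> bool" where
  "nash_equilibrium G v \<sigma> \<longleftrightarrow> strategy_profile G \<sigma> \<and>
     (\<forall>i \<in> players G. \<forall>\<tau>. strategy G i \<tau> \<longrightarrow>
        (pay G i (outcome G \<sigma> v), pay G i (outcome G (\<sigma>(i := \<tau>)) v)) \<notin> pref G i)"

definition constrained_NE_exists :: "('v, 'i, 'p) game \<Rightarrow> 'v \<Rightarrow> ('i \<Rightarrow> 'p) \<Rightarrow> bool" where
  "constrained_NE_exists G v p \<longleftrightarrow>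
     (\<exists>\<sigma>. nash_equilibrium G v \<sigma> \<and>
        (\<forall>i \<in> players G. p i = pay G i (outcome G \<sigma> v) \<or>
                         (p i, pay G i (outcome G \<sigma> v)) \<in> pref G i))"


section \<open>Finite presentations of RP games\<close>

text \<open>
  In a presentation, vertices, players, the payoffs of each player and the states of each
  automaton are initial segments of the natural numbers.  A parity automaton is given by its
  initial state and a table with one row per state, consisting of the priority of the state and
  its successors under the letters \<open>0, 1, \<dots>\<close>.
\<close>

record dpa_table =
  table_initial :: nat
  table_rows :: "(nat \<times> nat list) list"

text \<open>The payoffs of a player are the indices of the list \<open>pay_automata\<close>.\<close>

record player_data =
  pay_automata :: "dpa_table list"
  pref_list :: "(nat \<times> nat) list"

text \<open>
  The vertices are the indices of the list \<open>owner_list\<close>, the players are those of \<open>player_list\<close>.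
  An instance consists of a game, a vertex and one payoff for each player.
\<close>

record cne_instance =
  owner_list :: "nat list"
  edge_list :: "(nat \<times> nat) list"
  player_list :: "player_data list"
  start_vertex :: nat
  thresholds :: "nat list"

definition dpa_of :: "dpa_table \<Rightarrow> (nat, nat) dpa" where
  "dpa_of t = \<lparr> states = {..<length (table_rows t)}, initial = table_initial t,
     delta = (\<lambda>q a. snd (table_rows t ! q) ! a), priority = (\<lambda>q. fst (table_rows t ! q)) \<rparr>"

definition num_verts :: "cne_instance \<Rightarrow> nat" where
  "num_verts X = length (owner_list X)"

definition num_players :: "cne_instance \<Rightarrow> nat" where
  "num_players X = length (player_list X)"

definition num_payoffs :: "cne_instance \<Rightarrow> nat \<Rightarrow> nat" where
  "num_payoffs X i = length (pay_automata (player_list X ! i))"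

definition pay_dpa :: "cne_instance \<Rightarrow> nat \<Rightarrow> nat \<Rightarrow> (nat, nat) dpa" where
  "pay_dpa X i p = dpa_of (pay_automata (player_list X ! i) ! p)"

definition game_of :: "cne_instance \<Rightarrow> (nat, nat, nat) game" where
  "game_of X = \<lparr>
     verts = {..<num_verts X},
     edges = set (edge_list X),
     players = {..<num_players X},
     owned = (\<lambda>i. {u. u < num_verts X \<and> owner_list X ! u = i}),
     payoffs = (\<lambda>i. {..<num_payoffs X i}),
     pref = (\<lambda>i. set (pref_list (player_list X ! i))),
     pay = (\<lambda>i w. THE p. p < num_payoffs X i \<and> w \<in> dpa_language {..<num_verts X} (pay_dpa X i p)) \<rparr>"

text \<open>
  Well-formedness of the tables is that of the automata they stand for, except that the rows
  must have the right length.  The last condition on the automata says that exactly one of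
  the automata of a player accepts any given word.
\<close>

definition valid_instance :: "cne_instance \<Rightarrow> bool" where
  "valid_instance X \<longleftrightarrow>
     rp_game (game_of X) \<and>
     (\<forall>i < num_players X. \<forall>t \<in> set (pay_automata (player_list X ! i)).
        wf_dpa {..<num_verts X} (dpa_of t) \<and>
        (\<forall>(c, row) \<in> set (table_rows t). length row = num_verts X)) \<and>
     (\<forall>i < num_players X. \<forall>p < num_payoffs X i.
        dpa_language {..<num_verts X} (pay_dpa X i p) = pay_preimage (game_of X) i p) \<and>
     start_vertex X \<in> verts (game_of X) \<and>
     length (thresholds X) = num_players X \<and>
     (\<forall>i < num_players X. thresholds X ! i \<in> payoffs (game_of X) i)"


section \<open>Binary encoding and the decision problem\<close>

text \<open>Least significant bit first, without leading zeros; \<open>0\<close> is the empty list.\<close>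

fun bits :: "nat \<Rightarrow> bool list" where
  "bits n = (if n = 0 then [] else odd n # bits (n div 2))"

declare bits.simps [simp del]

text \<open>Every element is preceded by \<^const>\<open>True\<close>, and \<^const>\<open>False\<close> ends the list.\<close>

definition enc_list :: "('a \<Rightarrow> bool list) \<Rightarrow> 'a list \<Rightarrow> bool list" where
  "enc_list e xs = concat (map (\<lambda>x. True # e x) xs) @ [False]"

definition enc_nat :: "nat \<Rightarrow> bool list" where
  "enc_nat n = enc_list (\<lambda>b. [b]) (bits n)"

definition enc_pair :: "('a \<Rightarrow> bool list) \<Rightarrow> ('b \<Rightarrow> bool list) \<Rightarrow> 'a \<times> 'b \<Rightarrow> bool list" where
  "enc_pair e f p = e (fst p) @ f (snd p)"

definition enc_dpa :: "dpa_table \<Rightarrow> bool list" where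
  "enc_dpa t = enc_nat (table_initial t) @
     enc_list (enc_pair enc_nat (enc_list enc_nat)) (table_rows t)"

definition enc_player :: "player_data \<Rightarrow> bool list" where
  "enc_player d = enc_list enc_dpa (pay_automata d) @
     enc_list (enc_pair enc_nat enc_nat) (pref_list d)"

definition encode :: "cne_instance \<Rightarrow> bool list" where
  "encode X = enc_list enc_nat (owner_list X) @
     enc_list (enc_pair enc_nat enc_nat) (edge_list X) @
     enc_list enc_player (player_list X) @
     enc_nat (start_vertex X) @
     enc_list enc_nat (thresholds X)"

text \<open>The encodings used here are injective and even prefix-free.\<close>

definition prefix_code :: "('a \<Rightarrow> bool list) \<Rightarrow> bool" where
  "prefix_code e \<longleftrightarrow> (\<forall>x y u w. e x @ u = e y @ w \<longrightarrow> x = y \<and> u = w)"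

lemma prefix_codeD: "prefix_code e \<Longrightarrow> e x @ u = e y @ w \<longleftrightarrow> x = y \<and> u = w"
  unfolding prefix_code_def by blast

lemma prefix_code_list:
  assumes e: "prefix_code e"
  shows "prefix_code (enc_list e)"
proof -
  have "enc_list e xs @ u = enc_list e ys @ w \<Longrightarrow> xs = ys \<and> u = w" for xs ys u w
  proof (induction xs arbitrary: ys)
    case Nil then show ?case by (cases ys) (auto simp: enc_list_def)
  next
    case (Cons x xs)
    then obtain y ys' where "ys = y # ys'" by (cases ys) (auto simp: enc_list_def)
    with Cons show ?case by (auto simp: enc_list_def prefix_codeD[OF e])
  qed
  then show ?thesis unfolding prefix_code_def by blast
qed

lemma bits_inject: "bits m = bits n \<longleftrightarrow> m = n"
proof -
  have "bits m = bits n \<Longrightarrow> m = n"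
  proof (induction m arbitrary: n rule: less_induct)
    case (less m)
    show ?case
    proof (cases "m = 0 \<or> n = 0")
      case True
      then show ?thesis using less.prems by (auto simp: bits.simps[of m] bits.simps[of n] split: if_splits)
    next
      case False
      then have eq: "odd m = odd n" "bits (m div 2) = bits (n div 2)"
        using less.prems by (simp_all add: bits.simps[of m] bits.simps[of n])
      have "m div 2 = n div 2" using less.IH[OF _ eq(2)] False by simp
      then show ?thesis using eq(1) by (metis bit_eq_rec)
    qed
  qed
  then show ?thesis by blast
qed

lemma prefix_code_nat: "prefix_code enc_nat"
proof -
  have "prefix_code (\<lambda>b. [b])" by (simp add: prefix_code_def)
  from prefix_codeD[OF prefix_code_list[OF this]] show ?thesis
    unfolding prefix_code_def enc_nat_def by (simp add: bits_inject)
qed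

lemma prefix_code_pair: "prefix_code e \<Longrightarrow> prefix_code f \<Longrightarrow> prefix_code (enc_pair e f)"
  unfolding prefix_code_def[of "enc_pair e f"]
  by (auto simp: enc_pair_def prefix_codeD prod_eq_iff)

lemmas prefix_code_basic = prefix_code_list prefix_code_nat prefix_code_pair

lemma prefix_code_dpa: "prefix_code enc_dpa"
  unfolding prefix_code_def
  by (auto simp: enc_dpa_def prefix_codeD prefix_code_basic)

lemma prefix_code_player: "prefix_code enc_player"
  unfolding prefix_code_def
  by (auto simp: enc_player_def prefix_codeD prefix_code_basic prefix_code_dpa)

lemma prefix_code_encode: "prefix_code encode"
  unfolding prefix_code_def
  by (auto simp: encode_def prefix_codeD prefix_code_basic prefix_code_player)

lemma inj_encode: "inj encode"
  using prefix_code_encode unfolding prefix_code_def inj_def by (metis append_Nil2)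

definition constrained_NE_problem :: "bool list set" where
  "constrained_NE_problem =
     {encode X | X. valid_instance X \<and>
        constrained_NE_exists (game_of X) (start_vertex X) (\<lambda>i. thresholds X ! i)}"

definition two_player_instances :: "bool list set" where
  "two_player_instances = {encode X | X. valid_instance X \<and> card (players (game_of X)) = 2}"

end

theory Submission
  imports Defs "HOL-Library.Countable" "HOL-Library.Sublist"
begin

text \<open>
  Membership.  A prover claims a play and the payoffs along it; a challenger may at any stage
  let one player deviate.  The prover wins if the play has the claimed payoffs, and no deviating
  player gets a payoff preferred to the claimed one.  A constrained equilibrium exists if and only
  if the prover wins.  The winning condition depends on the set of colours (states of the
  automata) seen infinitely often, so this is a Muller game.  Its winning region is given by
  nested bounded fixpoints over decreasing sets of colours, which can be tabulated in
  exponential time; the same game also decides whether the automata of each player partition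
  the words.  Programs are written in a small language with stacks, compiled to Turing machines.

  Hardness.  A machine running in exponential time accepts if and only if the prover can defend
  a claim about the symbol at a given time and distance from the head, by claims about the
  previous configuration among which the challenger selects.  Time and distance have
  exponentially large values, so they are kept bit by bit in registers that are not part of the
  arena: the prover announces the bits, and the challenger may stop and bet that the last
  announcement about some register is wrong.  Each bet is a payoff of player 1, recognised by an
  automaton that follows this register only.
\<close>

section \<open>A programming language for Turing machines\<close>

text \<open>Membership and hardness rest on the same fact: every payoff has its own small automaton,
  and only the product of the automata is exponential. The prover-challenger game has exponentially
  many positions but polynomially many colours; a path through the nested fixpoints is a sequence of
  at most that many pairs of a colour and an index below an exponential bound, so a table of all
  paths is still of exponential size. Preferences are arbitrary relations, so the payoffs that
  refute an equilibrium have no order structure. The condition after a deviation is a Boolean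
  combination of acceptance conditions; this is why the game is a Muller game and not a parity game.
  A strategy is also a deviation from itself, so a payoff preferred to itself never occurs in an
  equilibrium. For hardness, player 0 is indifferent. The threshold of player 1 admits exactly the
  outcomes without a won bet, and every won bet is preferred to all of these. So a constrained
  equilibrium exists if and only if the prover can keep the challenger from ever winning a bet. The
  preferences used for this are not transitive.\<close>

datatype reg = RA | RM | RB | RN

text \<open>\<open>PushW\<close> and \<open>Rej\<close> have no rule in \<open>exec\<close>:
  \<open>PushW\<close> is the control state between the two machine steps of \<open>Push\<close>,
  and \<open>Rej\<close> is where the machine rejects.\<close>

datatype com =
    Skip | Push reg bool | PushW reg bool | Pop reg | Out bool | Seq com com
  | Ite reg "bool option" com com | Loop reg "bool option" com | Rej

instance reg :: countable by countable_datatype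
instance com :: countable by countable_datatype

type_synonym st = "(reg \<Rightarrow> bool list) \<times> bool list"

fun holds :: "bool option \<Rightarrow> bool list \<Rightarrow> bool" where
  "holds None xs \<longleftrightarrow> xs \<noteq> []"
| "holds (Some b) xs \<longleftrightarrow> xs \<noteq> [] \<and> hd xs = b"

text \<open>The time is the exact number of steps of the compiled machine; \<open>Push\<close> takes
  2, one to move the head and one to write.\<close>

inductive exec :: "com \<Rightarrow> st \<Rightarrow> nat \<Rightarrow> st \<Rightarrow> bool" where
  Skip: "exec Skip s 1 s"
| Push: "exec (Push r b) (s, w) 2 (s(r := b # s r), w)"
| Pop: "exec (Pop r) (s, w) 1 (s(r := tl (s r)), w)"
| Out: "exec (Out b) (s, w) 1 (s, w @ [b])"
| Seq: "exec c s t s' \<Longrightarrow> exec d s' t' s'' \<Longrightarrow> exec (Seq c d) s (Suc (t + t')) s''"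
| IteT: "holds p (fst s r) \<Longrightarrow> exec c s t s' \<Longrightarrow> exec (Ite r p c d) s (Suc t) s'"
| IteF: "\<not> holds p (fst s r) \<Longrightarrow> exec d s t s' \<Longrightarrow> exec (Ite r p c d) s (Suc t) s'"
| LoopT: "holds p (fst s r) \<Longrightarrow> exec c s t s' \<Longrightarrow> exec (Loop r p c) s' t' s'' \<Longrightarrow>
    exec (Loop r p c) s (Suc (t + t')) s''"
| LoopF: "\<not> holds p (fst s r) \<Longrightarrow> exec (Loop r p c) s 1 s"

fun ridx :: "reg \<Rightarrow> nat" where
  "ridx RA = 0" | "ridx RM = 1" | "ridx RB = 2" | "ridx RN = 3"

definition sym :: "bool \<Rightarrow> nat" where "sym b = (if b then 2 else 1)"

fun ptest :: "bool option \<Rightarrow> nat \<Rightarrow> bool" where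
  "ptest None n \<longleftrightarrow> n \<noteq> 0"
| "ptest (Some b) n \<longleftrightarrow> n = sym b"

definition keep :: "nat list \<Rightarrow> (nat \<times> direction) list" where
  "keep ss = map (\<lambda>s. (s, Stay)) ss"

text \<open>The control states of the Turing machine are the continuations of the program.\<close>

fun nxt :: "com list \<Rightarrow> nat list \<Rightarrow> com list \<times> (nat \<times> direction) list" where
  "nxt [] ss = ([], keep ss)"
| "nxt (Skip # k) ss = (k, keep ss)"
| "nxt (Push r b # k) ss = (PushW r b # k, (keep ss)[ridx r := (ss ! ridx r, Move_Left)])"
| "nxt (PushW r b # k) ss = (k, (keep ss)[ridx r := (sym b, Stay)])"
| "nxt (Pop r # k) ss = (k, (keep ss)[ridx r := (0, Move_Right)])"
| "nxt (Out b # k) ss = (k, (keep ss)[4 := (sym b, Move_Right)])"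
| "nxt (Seq c d # k) ss = (c # d # k, keep ss)"
| "nxt (Ite r p c d # k) ss = ((if ptest p (ss ! ridx r) then c else d) # k, keep ss)"
| "nxt (Loop r p c # k) ss = (if ptest p (ss ! ridx r) then c # Loop r p c # k else k, keep ss)"
| "nxt (Rej # k) ss = (Rej # k, keep ss)"

text \<open>The control states met while \<open>c\<close> runs in front of \<open>k\<close>, without
  \<open>k\<close> itself. The body of a loop is followed by the loop again, so the recursion is on
  \<open>c\<close> alone and the set is finite.\<close>

fun conts :: "com \<Rightarrow> com list \<Rightarrow> com list set" where
  "conts (Push r b) k = {Push r b # k, PushW r b # k}"
| "conts (Seq c d) k = insert (Seq c d # k) (conts c (d # k) \<union> conts d k)"
| "conts (Ite r p c d) k = insert (Ite r p c d # k) (conts c k \<union> conts d k)"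
| "conts (Loop r p c) k = insert (Loop r p c # k) (conts c (Loop r p c # k))"
| "conts c k = {c # k}"

lemma finite_conts: "finite (conts c k)"
  by (induction c k rule: conts.induct) auto

lemma conts_self: "c # k \<in> conts c k"
  by (cases c) auto

lemma conts_closed: "x \<in> conts c k \<Longrightarrow> fst (nxt x ss) \<in> insert k (conts c k)"
proof (induction c k rule: conts.induct)
  case (2 c d k)
  then show ?case using conts_self[of c "d # k"] conts_self[of d k] by auto
next
  case (3 r p c d k)
  then show ?case using conts_self[of c k] conts_self[of d k] by auto
next
  case (4 r p c k)
  then show ?case using conts_self[of c "Loop r p c # k"] by (auto split: if_splits)
qed (auto split: if_splits)

definition ctrl :: "com \<Rightarrow> com list set" where
  "ctrl c = conts c [] \<union> {[], [Rej]}"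

text \<open>Codes of control states need not be consecutive; the numbers in between loop in place.
  Tapes 0 to 3 are the stacks, with the input tape as \<open>RA\<close>, and tape 4 is the
  output.\<close>

definition machine :: "com \<Rightarrow> tm" where
  "machine c = \<lparr> num_tapes = 5, num_states = Suc (Max (to_nat ` ctrl c)), num_symbols = 3,
     start_state = to_nat [c], accept_state = to_nat ([] :: com list),
     reject_state = to_nat [Rej],
     transition = (\<lambda>q ss. if q \<in> to_nat ` ctrl c
        then (to_nat (fst (nxt (from_nat q) ss)), snd (nxt (from_nat q) ss)) else (q, keep ss)) \<rparr>"

lemma finite_ctrl: "finite (ctrl c)"
  by (simp add: ctrl_def finite_conts)

lemma ctrl_closed: "x \<in> ctrl c \<Longrightarrow> fst (nxt x ss) \<in> ctrl c"
  using conts_closed[of x c "[]" ss] by (auto simp: ctrl_def)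

lemma length_keep [simp]: "length (keep ss) = length ss"
  by (simp add: keep_def)

lemma length_nxt: "length (snd (nxt k ss)) = length ss"
  by (induction k ss rule: nxt.induct) auto

lemma set_keep: "set ss \<subseteq> {..<3} \<Longrightarrow> x \<in> set (keep ss) \<Longrightarrow> fst x < 3"
  by (auto simp: keep_def)

lemma symbols_nxt:
  assumes "length ss = 5" "set ss \<subseteq> {..<3}" "x \<in> set (snd (nxt k ss))"
  shows "fst x < 3"
proof -
  have r: "ss ! ridx r < 3" for r
  proof -
    have "ridx r < length ss" using assms(1) by (cases r) auto
    then show ?thesis using assms(2) nth_mem by blast
  qed
  have upd: "fst x < 3" if "x \<in> set ((keep ss)[i := y])" "fst y < 3" for i y
    using subsetD[OF set_update_subset_insert that(1)] that(2) set_keep[OF assms(2)] by blast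
  show ?thesis
    using assms(3) r upd set_keep[OF assms(2)]
    by (cases "(k, ss)" rule: nxt.cases) (auto simp: sym_def split: if_splits)
qed

lemma machine_wf: "wf_tm (machine c)"
proof -
  have le: "to_nat x < num_states (machine c)" if "x \<in> ctrl c" for x
    using that finite_ctrl[of c] by (simp add: machine_def le_imp_less_Suc)
  have ctl: "[c] \<in> ctrl c" "[] \<in> ctrl c" "[Rej] \<in> ctrl c"
    by (auto simp: ctrl_def conts_self)
  have "to_nat ([] :: com list) \<noteq> to_nat [Rej]" by simp
  moreover have main: "fst (transition (machine c) q ss) < num_states (machine c) \<and>
        length (snd (transition (machine c) q ss)) = num_tapes (machine c) \<and>
        (\<forall>(s, d) \<in> set (snd (transition (machine c) q ss)). s < num_symbols (machine c))"
    if q: "q < num_states (machine c)" and ss: "length ss = num_tapes (machine c)"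
      "set ss \<subseteq> {..<num_symbols (machine c)}" for q ss
  proof (cases "q \<in> to_nat ` ctrl c")
    case True
    then obtain k where k: "k \<in> ctrl c" "q = to_nat k" by blast
    have 5: "length ss = 5" "set ss \<subseteq> {..<3}" using ss by (auto simp: machine_def)
    have "transition (machine c) q ss = (to_nat (fst (nxt k ss)), snd (nxt k ss))"
      using True k by (simp add: machine_def)
    then show ?thesis
      using le[OF ctrl_closed[OF k(1)]] 5 symbols_nxt[OF 5] length_nxt[of k ss]
      by (auto simp: machine_def)
  next
    case False
    then show ?thesis using q ss by (auto simp: machine_def keep_def)
  qed
  moreover have "start_state (machine c) < num_states (machine c)"
    "accept_state (machine c) < num_states (machine c)"
    "reject_state (machine c) < num_states (machine c)"
    using le[OF ctl(1)] le[OF ctl(2)] le[OF ctl(3)] by (auto simp: machine_def)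
  moreover have "num_tapes (machine c) \<ge> 1" "num_symbols (machine c) \<ge> 3"
    "accept_state (machine c) \<noteq> reject_state (machine c)" by (auto simp: machine_def)
  ultimately show ?thesis unfolding wf_tm_def by blast
qed

section \<open>Simulation of programs by the machine\<close>

definition stack_tape :: "bool list \<Rightarrow> int \<Rightarrow> tape" where
  "stack_tape xs h =
     ((\<lambda>j. if h \<le> j \<and> nat (j - h) < length xs then sym (xs ! nat (j - h)) else 0), h)"

text \<open>The head stands on the top of a stack, the rest lies to its right and all other cells
  are blank. Pushing and popping make the heads drift, so their positions are existentially
  quantified.\<close>

definition rep :: "st \<Rightarrow> tape list \<Rightarrow> bool" where
  "rep s ts \<longleftrightarrow> (\<exists>ha hm hb hn. ts = [stack_tape (fst s RA) ha, stack_tape (fst s RM) hm,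
     stack_tape (fst s RB) hb, stack_tape (fst s RN) hn,
     (string_contents (snd s), int (length (snd s)))])"

lemma read_stack: "read_tape (stack_tape xs h) = (case xs of [] \<Rightarrow> 0 | b # _ \<Rightarrow> sym b)"
  by (cases xs) (auto simp: stack_tape_def)

lemma ptest_read: "ptest p (read_tape (stack_tape xs h)) = holds p xs"
  by (cases p; cases xs) (auto simp: read_stack sym_def)

lemma act_keep: "act_tape t (read_tape t, Stay) = t"
  by (cases t) auto

lemma act_pop: "act_tape (stack_tape xs h) (0, Move_Right) = stack_tape (tl xs) (h + 1)"
proof (cases xs)
  case Nil then show ?thesis by (auto simp: stack_tape_def)
next
  case (Cons a l)
  have "nat (j - h) = Suc (nat (j - (h + 1)))" if "j > h" for j using that by simp
  then show ?thesis using Cons by (fastforce simp: stack_tape_def fun_eq_iff)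
qed

lemma act_push:
  "act_tape (act_tape (stack_tape xs h) (read_tape (stack_tape xs h), Move_Left)) (sym b, Stay) =
   stack_tape (b # xs) (h - 1)"
proof -
  have "nat (j - (h - 1)) = Suc (nat (j - h))" if "j \<ge> h" for j using that by simp
  then show ?thesis by (fastforce simp: stack_tape_def fun_eq_iff)
qed

lemma act_out: "act_tape (string_contents w, int (length w)) (sym b, Move_Right) =
    (string_contents (w @ [b]), int (length (w @ [b])))"
  by (auto simp: string_contents_def fun_eq_iff sym_def nth_append)

lemma step_machine:
  assumes "k \<in> ctrl c" "k \<noteq> []" "hd k \<noteq> Rej"
  shows "step (machine c) (to_nat k, ts) = (to_nat (fst (nxt k (map read_tape ts))),
    map2 act_tape ts (snd (nxt k (map read_tape ts))))"
proof -
  have "\<not> halting (machine c) (to_nat k, ts)"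
    using assms(2,3) by (auto simp: halting_def machine_def)
  then show ?thesis using assms(1) by (simp add: step_def machine_def)
qed

lemma map2_keep: "map2 act_tape ts (keep (map read_tape ts)) = ts"
  by (induction ts) (auto simp: keep_def act_keep)

text \<open>\<open>k\<close> is general in the induction, because the first half of a sequence runs
  with the second half as continuation, and the body of a loop with the loop.\<close>

lemma sim:
  assumes "exec c s t s'" "conts c k \<subseteq> ctrl p" "rep s ts"
  shows "\<exists>ts'. rep s' ts' \<and> (step (machine p) ^^ t) (to_nat (c # k), ts) = (to_nat k, ts')"
  using assms
proof (induction arbitrary: k ts rule: exec.induct)
  case (Skip s)
  then show ?case by (auto simp: step_machine map2_keep)
next
  case (Push r b s w)
  obtain ha hm hb hn where ts: "ts = [stack_tape (s RA) ha, stack_tape (s RM) hm,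
     stack_tape (s RB) hb, stack_tape (s RN) hn, (string_contents w, int (length w))]"
    using Push(2) by (auto simp: rep_def)
  have c: "Push r b # k \<in> ctrl p" "PushW r b # k \<in> ctrl p" using Push(1) by auto
  have 1: "step (machine p) (to_nat (Push r b # k), ts) = (to_nat (PushW r b # k),
      map2 act_tape ts ((keep (map read_tape ts))[ridx r := (map read_tape ts ! ridx r, Move_Left)]))"
    "step (machine p) (to_nat (PushW r b # k), ts) = (to_nat k,
      map2 act_tape ts ((keep (map read_tape ts))[ridx r := (sym b, Stay)]))" for ts
    using step_machine[OF c(1)] step_machine[OF c(2)] by simp_all
  show ?case using 1 unfolding numeral_2_eq_2
    by (cases r) (auto simp: keep_def ts rep_def
        act_keep act_push simp del: act_tape.simps read_tape.simps)
next
  case (Pop r s w)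
  obtain ha hm hb hn where ts: "ts = [stack_tape (s RA) ha, stack_tape (s RM) hm,
     stack_tape (s RB) hb, stack_tape (s RN) hn, (string_contents w, int (length w))]"
    using Pop(2) by (auto simp: rep_def)
  have c: "Pop r # k \<in> ctrl p" using Pop(1) by auto
  have 1: "step (machine p) (to_nat (Pop r # k), ts) = (to_nat k,
      map2 act_tape ts ((keep (map read_tape ts))[ridx r := (0, Move_Right)]))"
    using step_machine[OF c(1)] by simp
  show ?case using 1
    by (cases r) (auto simp: keep_def ts rep_def
        act_keep act_pop simp del: act_tape.simps read_tape.simps)
next
  case (Out b s w)
  obtain ha hm hb hn where ts: "ts = [stack_tape (s RA) ha, stack_tape (s RM) hm,
     stack_tape (s RB) hb, stack_tape (s RN) hn, (string_contents w, int (length w))]"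
    using Out(2) by (auto simp: rep_def)
  have c: "Out b # k \<in> ctrl p" using Out(1) by auto
  show ?case
    by (auto simp: step_machine[OF c(1)] keep_def ts rep_def
        act_keep act_out simp del: act_tape.simps read_tape.simps)
next
  case (Seq c s t s' d t' s'')
  have q: "Seq c d # k \<in> ctrl p" "conts c (d # k) \<subseteq> ctrl p" "conts d k \<subseteq> ctrl p"
    using Seq.prems(1) by auto
  obtain ts1 where 1: "rep s' ts1"
    "(step (machine p) ^^ t) (to_nat (c # d # k), ts) = (to_nat (d # k), ts1)"
    using Seq.IH(1)[OF q(2) Seq.prems(2)] by blast
  obtain ts2 where 2: "rep s'' ts2"
    "(step (machine p) ^^ t') (to_nat (d # k), ts1) = (to_nat k, ts2)"
    using Seq.IH(2)[OF q(3) 1(1)] by blast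
  have "step (machine p) (to_nat (Seq c d # k), ts) = (to_nat (c # d # k), ts)"
    by (simp add: step_machine[OF q(1)] map2_keep)
  then have "(step (machine p) ^^ Suc (t' + t)) (to_nat (Seq c d # k), ts) = (to_nat k, ts2)"
    using 1(2) 2(2) by (simp only: funpow_Suc_right o_apply funpow_add)
  then show ?case using 2(1) by (metis add.commute)
next
  case (IteT pp s r c t s' d)
  have q: "Ite r pp c d # k \<in> ctrl p" "conts c k \<subseteq> ctrl p" using IteT.prems(1) by auto
  have "ptest pp (map read_tape ts ! ridx r)"
    using IteT.prems(2) IteT.hyps(1)
    by (cases r) (auto simp: rep_def ptest_read simp del: read_tape.simps)
  then have "step (machine p) (to_nat (Ite r pp c d # k), ts) = (to_nat (c # k), ts)"
    by (simp add: step_machine[OF q(1)] map2_keep)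
  then show ?case using IteT.IH[OF q(2) IteT.prems(2)]
    by (simp only: funpow_Suc_right o_apply)
next
  case (IteF pp s r d t s' c)
  have q: "Ite r pp c d # k \<in> ctrl p" "conts d k \<subseteq> ctrl p" using IteF.prems(1) by auto
  have "\<not> ptest pp (map read_tape ts ! ridx r)"
    using IteF.prems(2) IteF.hyps(1)
    by (cases r) (auto simp: rep_def ptest_read simp del: read_tape.simps)
  then have "step (machine p) (to_nat (Ite r pp c d # k), ts) = (to_nat (d # k), ts)"
    by (simp add: step_machine[OF q(1)] map2_keep)
  then show ?case using IteF.IH[OF q(2) IteF.prems(2)]
    by (simp only: funpow_Suc_right o_apply)
next
  case (LoopT pp s r c t s' t' s'')
  let ?l = "Loop r pp c"
  have q: "?l # k \<in> ctrl p" "conts c (?l # k) \<subseteq> ctrl p" using LoopT.prems(1) by auto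
  obtain ts1 where 1: "rep s' ts1"
    "(step (machine p) ^^ t) (to_nat (c # ?l # k), ts) = (to_nat (?l # k), ts1)"
    using LoopT.IH(1)[OF q(2) LoopT.prems(2)] by blast
  obtain ts2 where 2: "rep s'' ts2"
    "(step (machine p) ^^ t') (to_nat (?l # k), ts1) = (to_nat k, ts2)"
    using LoopT.IH(2)[OF LoopT.prems(1) 1(1)] by blast
  have "ptest pp (map read_tape ts ! ridx r)"
    using LoopT.prems(2) LoopT.hyps(1)
    by (cases r) (auto simp: rep_def ptest_read simp del: read_tape.simps)
  then have "step (machine p) (to_nat (?l # k), ts) = (to_nat (c # ?l # k), ts)"
    by (simp add: step_machine[OF q(1)] map2_keep)
  then have "(step (machine p) ^^ Suc (t' + t)) (to_nat (?l # k), ts) = (to_nat k, ts2)"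
    using 1(2) 2(2) by (simp only: funpow_Suc_right o_apply funpow_add)
  then show ?case using 2(1) by (metis add.commute)
next
  case (LoopF pp s r c)
  have q: "Loop r pp c # k \<in> ctrl p" using LoopF.prems(1) by auto
  have "\<not> ptest pp (map read_tape ts ! ridx r)"
    using LoopF.prems(2) LoopF.hyps(1)
    by (cases r) (auto simp: rep_def ptest_read simp del: read_tape.simps)
  then have "step (machine p) (to_nat (Loop r pp c # k), ts) = (to_nat k, ts)"
    by (simp add: step_machine[OF q(1)] map2_keep)
  then show ?case using LoopF.prems(2) by auto
qed

definition inp :: "bool list \<Rightarrow> st" where
  "inp x = ((\<lambda>r. if r = RA then x else []), [])"

lemma rep_init: "rep (inp x) (snd (init_config (machine c) x))"
proof -
  have 1: "(string_contents x, 0) = stack_tape x 0" for x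
    by (auto simp: string_contents_def stack_tape_def sym_def fun_eq_iff)
  have 4: "replicate 4 a = [a, a, a, a]" for a :: tape
    by (simp add: eval_nat_numeral)
  have "snd (init_config (machine c) x) =
      [stack_tape x 0, stack_tape [] 0, stack_tape [] 0, stack_tape [] 0, (string_contents [], 0)]"
    by (simp add: init_config_def machine_def 1 4)
  then show ?thesis unfolding rep_def by (intro exI[of _ 0]) (simp add: inp_def)
qed

lemma machine_computes:
  assumes "\<And>x. \<exists>t \<le> T (length x). \<exists>s. exec c (inp x) t (s, f x)"
  shows "computes_within (machine c) f T"
  unfolding computes_within_def
proof
  fix x
  obtain t s where t: "t \<le> T (length x)" "exec c (inp x) t (s, f x)" using assms by blast
  obtain ts' where "rep (s, f x) ts'"
    "(step (machine c) ^^ t) (to_nat [c], snd (init_config (machine c) x)) = (to_nat ([] :: com list), ts')"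
    using sim[OF t(2), of "[]" c, OF _ rep_init] by (auto simp: ctrl_def)
  moreover have "init_config (machine c) x = (to_nat [c], snd (init_config (machine c) x))"
    by (simp add: init_config_def machine_def)
  ultimately show "\<exists>t \<le> T (length x). let cf = (step (machine c) ^^ t) (init_config (machine c) x)
        in halting (machine c) cf \<and> fst (last (snd cf)) = string_contents (f x)"
    using t(1) by (intro exI[of _ t]) (auto simp: halting_def machine_def rep_def)
qed

definition answer :: com where "answer = Ite RM (Some True) Skip Rej"

text \<open>The three \<open>Suc\<close> pay for unfolding the outer \<open>Seq\<close>, for the
  test in \<open>answer\<close> and for \<open>Skip\<close>.\<close>

lemma machine_decides:
  assumes "\<And>x. \<exists>t s. Suc (Suc (Suc t)) \<le> T (length x) \<and> exec c (inp x) t s \<and> holds (Some True) (fst s RM) = (x \<in> L)"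
  shows "decides_within (machine (Seq c answer)) L T"
  unfolding decides_within_def
proof
  fix x
  let ?M = "machine (Seq c answer)"
  obtain t s where t: "Suc (Suc (Suc t)) \<le> T (length x)" "exec c (inp x) t s"
    "holds (Some True) (fst s RM) = (x \<in> L)" using assms by blast
  have q: "[Seq c answer] \<in> ctrl (Seq c answer)" "[answer] \<in> ctrl (Seq c answer)"
    "conts c [answer] \<subseteq> ctrl (Seq c answer)" "[Skip] \<in> ctrl (Seq c answer)"
    by (auto simp: ctrl_def answer_def)
  obtain ts where ts: "ts = snd (init_config ?M x)" by blast
  obtain ts' where ts': "rep s ts'"
    "(step ?M ^^ t) (to_nat [c, answer], ts) = (to_nat [answer], ts')"
    using sim[OF t(2) q(3) rep_init] unfolding ts by blast
  have init: "init_config ?M x = (to_nat [Seq c answer], ts)"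
    unfolding ts by (simp add: init_config_def machine_def)
  have "step ?M (to_nat [Seq c answer], ts) = (to_nat [c, answer], ts)"
    by (simp add: step_machine[OF q(1)] map2_keep)
  then have 1: "(step ?M ^^ Suc t) (init_config ?M x) = (to_nat [answer], ts')"
    using ts'(2) by (simp only: funpow_Suc_right o_apply init)
  have pt: "ptest (Some True) (map read_tape ts' ! ridx RM) = (x \<in> L)"
    using ts'(1) t(3)
    by (auto simp: rep_def ptest_read simp del: read_tape.simps ptest.simps holds.simps)
  have n: "nxt [answer] ss = (if ptest (Some True) (ss ! ridx RM) then [Skip] else [Rej], keep ss)" for ss
    by (simp add: answer_def)
  have hd: "hd [answer] \<noteq> Rej" by (simp add: answer_def)
  have 2: "step ?M (to_nat [answer], ts') = (if x \<in> L then to_nat [Skip] else to_nat [Rej], ts')"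
    using step_machine[OF q(2) _ hd, of ts'] unfolding n pt by (simp add: map2_keep)
  have st: "accept_state ?M = to_nat ([] :: com list)" "reject_state ?M = to_nat [Rej]"
    by (simp_all add: machine_def)
  show "\<exists>t\<le>T (length x). fst ((step ?M ^^ t) (init_config ?M x)) =
     (if x \<in> L then accept_state ?M else reject_state ?M)"
  proof (cases "x \<in> L")
    case True
    have "step ?M (to_nat [Skip], ts') = (to_nat ([] :: com list), ts')"
      by (simp add: step_machine[OF q(4)] map2_keep)
    then have "fst ((step ?M ^^ Suc (Suc (Suc t))) (init_config ?M x)) = to_nat ([] :: com list)"
      using 1 2 True by (simp only: funpow.simps o_apply if_True fst_conv)
    then show ?thesis using t(1) True unfolding st by auto
  next
    case False
    have "fst ((step ?M ^^ Suc (Suc t)) (init_config ?M x)) = to_nat [Rej]"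
      using 1 2 False by (simp only: funpow.simps o_apply if_False fst_conv)
    moreover have "Suc (Suc t) \<le> T (length x)" using t(1) by simp
    ultimately show ?thesis using False unfolding st by auto
  qed
qed

section \<open>Trees on a stack\<close>

definition runs :: "com \<Rightarrow> st \<Rightarrow> st \<Rightarrow> nat \<Rightarrow> bool" where
  "runs c s s' n \<longleftrightarrow> (\<exists>t \<le> n. exec c s t s')"

lemma runsI: "exec c s t s' \<Longrightarrow> runs c s s' t"
  unfolding runs_def by blast

lemma runs_mono: "runs c s s' m \<Longrightarrow> m \<le> n \<Longrightarrow> runs c s s' n"
  unfolding runs_def using le_trans by blast

lemma runs_Seq: "runs c s s' m \<Longrightarrow> runs d s' s'' n \<Longrightarrow> runs (Seq c d) s s'' (Suc (m + n))"
  unfolding runs_def by (meson exec.Seq Suc_le_mono add_mono)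

lemma runs_IteT: "holds p (fst s r) \<Longrightarrow> runs c s s' n \<Longrightarrow> runs (Ite r p c d) s s' (Suc n)"
  unfolding runs_def by (meson exec.IteT Suc_le_mono)

lemma runs_IteF: "\<not> holds p (fst s r) \<Longrightarrow> runs d s s' n \<Longrightarrow> runs (Ite r p c d) s s' (Suc n)"
  unfolding runs_def by (meson exec.IteF Suc_le_mono)

lemma runs_Ite_bool: "fst s r = x # xs \<Longrightarrow> runs (if x then c else d) s s' n \<Longrightarrow>
    runs (Ite r (Some True) c d) s s' (Suc n)"
  by (cases x) (simp_all add: runs_IteT runs_IteF)

lemma runs_LoopT: "holds p (fst s r) \<Longrightarrow> runs c s s' m \<Longrightarrow> runs (Loop r p c) s' s'' n \<Longrightarrow>
    runs (Loop r p c) s s'' (Suc (m + n))"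
  unfolding runs_def by (meson exec.LoopT Suc_le_mono add_mono)

lemma runs_LoopF: "\<not> holds p (fst s r) \<Longrightarrow> runs (Loop r p c) s s 1"
  unfolding runs_def using exec.LoopF by blast

lemma runs_Skip: "runs Skip s s 1"
  unfolding runs_def using exec.Skip by blast

definition mst :: "bool list \<Rightarrow> bool list \<Rightarrow> bool list \<Rightarrow> bool list \<Rightarrow> bool list \<Rightarrow> st" where
  "mst a m b n w = ((\<lambda>r. case r of RA \<Rightarrow> a | RM \<Rightarrow> m | RB \<Rightarrow> b | RN \<Rightarrow> n), w)"

lemma mst_sel [simp]:
  "fst (mst a m b n w) RA = a" "fst (mst a m b n w) RM = m"
  "fst (mst a m b n w) RB = b" "fst (mst a m b n w) RN = n" "snd (mst a m b n w) = w"
  by (simp_all add: mst_def)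

lemma exec_mst:
  "exec (Push RA x) (mst a m b n w) 2 (mst (x # a) m b n w)"
  "exec (Push RM x) (mst a m b n w) 2 (mst a (x # m) b n w)"
  "exec (Push RB x) (mst a m b n w) 2 (mst a m (x # b) n w)"
  "exec (Push RN x) (mst a m b n w) 2 (mst a m b (x # n) w)"
  "exec (Pop RA) (mst a m b n w) 1 (mst (tl a) m b n w)"
  "exec (Pop RM) (mst a m b n w) 1 (mst a (tl m) b n w)"
  "exec (Pop RB) (mst a m b n w) 1 (mst a m (tl b) n w)"
  "exec (Pop RN) (mst a m b n w) 1 (mst a m b (tl n) w)"
  "exec (Out x) (mst a m b n w) 1 (mst a m b n (w @ [x]))"
proof -
  have upd: "(case_reg a m b n)(RA := x) = case_reg x m b n"
     "(case_reg a m b n)(RM := x) = case_reg a x b n"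
     "(case_reg a m b n)(RB := x) = case_reg a m x n"
     "(case_reg a m b n)(RN := x) = case_reg a m b x" for x :: "bool list"
    by (auto simp: fun_eq_iff split: reg.splits)
  show "exec (Push RA x) (mst a m b n w) 2 (mst (x # a) m b n w)"
    using exec.Push[of RA x "case_reg a m b n" w] by (simp add: mst_def upd)
  show "exec (Push RM x) (mst a m b n w) 2 (mst a (x # m) b n w)"
    using exec.Push[of RM x "case_reg a m b n" w] by (simp add: mst_def upd)
  show "exec (Push RB x) (mst a m b n w) 2 (mst a m (x # b) n w)"
    using exec.Push[of RB x "case_reg a m b n" w] by (simp add: mst_def upd)
  show "exec (Push RN x) (mst a m b n w) 2 (mst a m b (x # n) w)"
    using exec.Push[of RN x "case_reg a m b n" w] by (simp add: mst_def upd)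
  show "exec (Pop RA) (mst a m b n w) 1 (mst (tl a) m b n w)"
    using exec.Pop[of RA "case_reg a m b n" w] by (simp add: mst_def upd)
  show "exec (Pop RM) (mst a m b n w) 1 (mst a (tl m) b n w)"
    using exec.Pop[of RM "case_reg a m b n" w] by (simp add: mst_def upd)
  show "exec (Pop RB) (mst a m b n w) 1 (mst a m (tl b) n w)"
    using exec.Pop[of RB "case_reg a m b n" w] by (simp add: mst_def upd)
  show "exec (Pop RN) (mst a m b n w) 1 (mst a m b (tl n) w)"
    using exec.Pop[of RN "case_reg a m b n" w] by (simp add: mst_def upd)
  show "exec (Out x) (mst a m b n w) 1 (mst a m b n (w @ [x]))"
    using exec.Out[of x "case_reg a m b n" w] by (simp add: mst_def)
qed

lemma runs_basic:
  "runs (Push RA x) (mst a m b n w) (mst (x # a) m b n w) 2"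
  "runs (Push RM x) (mst a m b n w) (mst a (x # m) b n w) 2"
  "runs (Push RB x) (mst a m b n w) (mst a m (x # b) n w) 2"
  "runs (Push RN x) (mst a m b n w) (mst a m b (x # n) w) 2"
  "runs (Out x) (mst a m b n w) (mst a m b n (w @ [x])) 1"
  "runs (Pop RA) (mst (x # a) m b n w) (mst a m b n w) 1"
  "runs (Pop RM) (mst a (x # m) b n w) (mst a m b n w) 1"
  "runs (Pop RB) (mst a m (x # b) n w) (mst a m b n w) 1"
  "runs (Pop RN) (mst a m b (x # n) w) (mst a m b n w) 1"
  "runs (Pop RB) (mst a m [] n w) (mst a m [] n w) 1"
  using exec_mst[THEN runsI] exec_mst(5)[of "x # a" m b n w, THEN runsI]
    exec_mst(6)[of a "x # m" b n w, THEN runsI] exec_mst(7)[of a m "x # b" n w, THEN runsI]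
    exec_mst(8)[of a m b "x # n" w, THEN runsI] exec_mst(7)[of a m "[]" n w, THEN runsI]
  by simp_all

datatype tree = Lf | Nd tree tree

text \<open>Preorder notation is self-delimiting, so trees can lie on a stack one below the other
  without separators.\<close>

fun code :: "tree \<Rightarrow> bool list" where
  "code Lf = [False]"
| "code (Nd l r) = True # code l @ code r"

definition tsize :: "tree \<Rightarrow> nat" where "tsize t = length (code t)"

lemma tsize_simps [simp]: "tsize Lf = 1" "tsize (Nd l r) = Suc (tsize l + tsize r)"
  by (simp_all add: tsize_def)

lemma tsize_pos [simp]: "0 < tsize t"
  by (cases t) simp_all

lemma code_prefix: "code t @ u = code t' @ u' \<Longrightarrow> t = t' \<and> u = u'"
proof (induction t arbitrary: t' u u')
  case Lf then show ?case by (cases t') auto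
next
  case (Nd l r)
  from Nd.prems obtain l' r' where t': "t' = Nd l' r'" by (cases t') auto
  then have "code l @ (code r @ u) = code l' @ (code r' @ u')" using Nd.prems by simp
  from Nd.IH(1)[OF this] have "l = l'" "code r @ u = code r' @ u'" by auto
  with Nd.IH(2)[OF this(2)] t' show ?case by simp
qed

definition walk_body :: "(bool \<Rightarrow> com) \<Rightarrow> com" where
  "walk_body f = Ite RM (Some True) (Seq (Pop RM) (Seq (f True) (Push RN True)))
     (Seq (Pop RM) (Seq (f False) (Pop RN)))"

definition walk :: "(bool \<Rightarrow> com) \<Rightarrow> com" where
  "walk f = Seq (Push RN True) (Loop RN None (walk_body f))"

text \<open>The stack \<^const>\<open>RN\<close> counts, in unary, the trees that remain to be traversed.\<close>

lemma walk_loop: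
  assumes f: "\<And>x a m b n. runs (f x) (mst a m b n w) (mst (fa x a) m (fb x b) n w) k"
  shows "runs (Loop RN None (walk_body f)) (mst (fold fa (code t) a) m (fold fb (code t) b) n w) s' T \<Longrightarrow>
    runs (Loop RN None (walk_body f)) (mst a (code t @ m) b (True # n) w) s' (T + (k + 10) * tsize t)"
proof (induction t arbitrary: a b m n T)
  case Lf
  have 1: "runs (Seq (Pop RM) (Seq (f False) (Pop RN))) (mst a (code Lf @ m) b (True # n) w)
     (mst (fa False a) m (fb False b) n w) (Suc (1 + Suc (k + 1)))"
    using runs_Seq[OF runs_basic(7) runs_Seq[OF f runs_basic(9)]] by simp
  have "runs (walk_body f) (mst a (code Lf @ m) b (True # n) w)
     (mst (fa False a) m (fb False b) n w) (Suc (Suc (1 + Suc (k + 1))))"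
    unfolding walk_body_def by (rule runs_IteF[OF _ 1]) simp
  from runs_LoopT[OF _ this, of None RN] Lf show ?case
    by (fastforce elim: runs_mono)
next
  case (Nd l r)
  let ?a = "fold fa (code l) (fa True a)" and ?b = "fold fb (code l) (fb True b)"
  have "runs (Loop RN None (walk_body f)) (mst ?a (code r @ m) ?b (True # n) w) s' (T + (k + 10) * tsize r)"
    using Nd.IH(2) Nd.prems by simp
  then have rest: "runs (Loop RN None (walk_body f)) (mst (fa True a) (code l @ code r @ m) (fb True b) (True # True # n) w) s'
      (T + (k + 10) * tsize r + (k + 10) * tsize l)" using Nd.IH(1) by blast
  have 1: "runs (Seq (Pop RM) (Seq (f True) (Push RN True))) (mst a (code (Nd l r) @ m) b (True # n) w)
     (mst (fa True a) (code l @ code r @ m) (fb True b) (True # True # n) w) (Suc (1 + Suc (k + 2)))"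
    using runs_Seq[OF runs_basic(7) runs_Seq[OF f runs_basic(4)]] by simp
  have "runs (walk_body f) (mst a (code (Nd l r) @ m) b (True # n) w)
     (mst (fa True a) (code l @ code r @ m) (fb True b) (True # True # n) w) (Suc (Suc (1 + Suc (k + 2))))"
    unfolding walk_body_def by (rule runs_IteT[OF _ 1]) simp
  from runs_LoopT[OF _ this rest] show ?case
    by (rule runs_mono) (simp_all add: algebra_simps)
qed

lemma walk:
  assumes f: "\<And>x a m b n. runs (f x) (mst a m b n w) (mst (fa x a) m (fb x b) n w) k"
  shows "runs (walk f) (mst a (code t @ m) b [] w) (mst (fold fa (code t) a) m (fold fb (code t) b) [] w)
    ((k + 10) * tsize t + 4)"
proof -
  have "runs (Loop RN None (walk_body f)) (mst (fold fa (code t) a) m (fold fb (code t) b) [] w)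
      (mst (fold fa (code t) a) m (fold fb (code t) b) [] w) 1"
    by (rule runs_LoopF) simp
  from runs_Seq[OF runs_basic(4) walk_loop[of f w fa fb, OF f this]] show ?thesis unfolding walk_def
    by (rule runs_mono) simp
qed

lemma fold_id: "fold (\<lambda>x y. y) xs y = y"
  by (induction xs) auto

definition drop_tree :: com where "drop_tree = walk (\<lambda>_. Skip)"

lemma drop_tree: "runs drop_tree (mst a (code t @ m) b [] w) (mst a m b [] w) (11 * tsize t + 4)"
  using walk[of "\<lambda>_. Skip" w "\<lambda>x y. y" "\<lambda>x y. y" 1, OF runs_Skip]
  by (simp add: drop_tree_def fold_id)

lemma walk_A: "runs (walk (Push RA)) (mst a (code t @ m) b [] w) (mst (rev (code t) @ a) m b [] w) (12 * tsize t + 4)"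
  using walk[of "Push RA" w "(#)" "\<lambda>x y. y" 2, OF runs_basic(1)]
  by (simp add: fold_id fold_Cons_rev)

lemma walk_B: "runs (walk (Push RB)) (mst a (code t @ m) b [] w) (mst a m (rev (code t) @ b) [] w) (12 * tsize t + 4)"
  using walk[of "Push RB" w "\<lambda>x y. y" "(#)" 2, OF runs_basic(3)]
  by (simp add: fold_id fold_Cons_rev)

lemma walk_AB: "runs (walk (\<lambda>x. Seq (Push RA x) (Push RB x))) (mst a (code t @ m) b [] w)
    (mst (rev (code t) @ a) m (rev (code t) @ b) [] w) (15 * tsize t + 4)"
  using walk[of "\<lambda>x. Seq (Push RA x) (Push RB x)" w "(#)" "(#)" 5] runs_Seq[OF runs_basic(1) runs_basic(3)]
  by (simp add: fold_Cons_rev)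

definition restore :: "reg \<Rightarrow> com" where
  "restore r = Loop r None (Ite r (Some True) (Seq (Pop r) (Push RM True)) (Seq (Pop r) (Push RM False)))"

lemma restore_A: "runs (restore RA) (mst a m b n w) (mst [] (rev a @ m) b n w) (6 * length a + 1)"
proof (induction a arbitrary: m)
  case Nil
  show ?case unfolding restore_def using runs_LoopF[of None "mst [] m b n w" RA] by simp
next
  case (Cons x a)
  have "runs (Ite RA (Some True) (Seq (Pop RA) (Push RM True)) (Seq (Pop RA) (Push RM False)))
     (mst (x # a) m b n w) (mst a (x # m) b n w) (Suc (Suc (1 + 2)))"
    using runs_Seq[OF runs_basic(6) runs_basic(2)]
    by (cases x) (auto intro: runs_IteT runs_IteF)
  from runs_LoopT[OF _ this Cons[of "x # m", unfolded restore_def]]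
  show ?case unfolding restore_def by (auto elim: runs_mono)
qed

lemma restore_B: "runs (restore RB) (mst a m b n w) (mst a (rev b @ m) [] n w) (6 * length b + 1)"
proof (induction b arbitrary: m)
  case Nil
  show ?case unfolding restore_def using runs_LoopF[of None "mst a m [] n w" RB] by simp
next
  case (Cons x b)
  have "runs (Ite RB (Some True) (Seq (Pop RB) (Push RM True)) (Seq (Pop RB) (Push RM False)))
     (mst a m (x # b) n w) (mst a (x # m) b n w) (Suc (Suc (1 + 2)))"
    using runs_Seq[OF runs_basic(8) runs_basic(2)]
    by (cases x) (auto intro: runs_IteT runs_IteF)
  from runs_LoopT[OF _ this Cons[of "x # m", unfolded restore_def]]
  show ?case unfolding restore_def by (auto elim: runs_mono)
qed

definition dup_tree :: com where
  "dup_tree = Seq (walk (\<lambda>x. Seq (Push RA x) (Push RB x))) (Seq (restore RA) (restore RB))"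

lemma dup_tree:
  "runs dup_tree (mst [] (code t @ m) [] [] w) (mst [] (code t @ code t @ m) [] [] w) (30 * tsize t + 10)"
  using runs_Seq[OF walk_AB[of "[]" t m "[]" w] runs_Seq[OF restore_A restore_B]]
  by (auto simp: dup_tree_def tsize_def elim!: runs_mono)

text \<open>The upper tree waits on \<open>RA\<close>, the lower one on \<open>RB\<close>; restoring
  \<open>RA\<close> before \<open>RB\<close> exchanges them.\<close>

definition swap_tree :: com where
  "swap_tree = Seq (walk (Push RA)) (Seq (walk (Push RB)) (Seq (restore RA) (restore RB)))"

lemma swap_tree:
  "runs swap_tree (mst [] (code t @ code u @ m) [] [] w) (mst [] (code u @ code t @ m) [] [] w)
     (20 * (tsize t + tsize u) + 20)"
  using runs_Seq[OF walk_A[of "[]" t "code u @ m" "[]" w]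
     runs_Seq[OF walk_B[of _ u m "[]" w] runs_Seq[OF restore_A restore_B]]]
  by (auto simp: swap_tree_def tsize_def elim!: runs_mono)

fun push_code :: "bool list \<Rightarrow> com" where
  "push_code [] = Skip"
| "push_code (x # xs) = Seq (push_code xs) (Push RM x)"

lemma push_code: "runs (push_code xs) (mst a m b n w) (mst a (xs @ m) b n w) (3 * length xs + 1)"
proof (induction xs)
  case Nil show ?case by (simp add: runs_Skip[simplified])
next
  case (Cons x xs)
  have "runs (push_code (x # xs)) (mst a m b n w) (mst a ((x # xs) @ m) b n w) (Suc (3 * length xs + 1 + 2))"
    using runs_Seq[OF Cons runs_basic(2)] by simp
  then show ?case by (rule runs_mono) simp
qed

definition cmp_loop :: com where
  "cmp_loop = Loop RA None (Ite RA (Some True)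
     (Seq (Pop RA) (Ite RB (Some True) (Pop RB) (Seq (Pop RB) (Push RN True))))
     (Seq (Pop RA) (Ite RB (Some False) (Pop RB) (Seq (Pop RB) (Push RN True)))))"

lemma runs_PopB: "runs (Pop RB) (mst a m b n w) (mst a m (tl b) n w) 1"
  unfolding runs_def using exec_mst(7) by blast

text \<open>\<open>RN\<close> collects one mark per mismatch, so it stays empty exactly if
  \<open>a\<close> is a prefix of \<open>b\<close>. All of \<open>a\<close> is consumed even after a
  mismatch; popping an empty \<open>RB\<close> is harmless.\<close>

lemma cmp_loop:
  "\<exists>n'. runs cmp_loop (mst a m b n w) (mst [] m (drop (length a) b) n' w) (9 * length a + 1) \<and>
    (n' = [] \<longleftrightarrow> n = [] \<and> a = take (length a) b)"
proof (induction a arbitrary: b n)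
  case Nil
  show ?case unfolding cmp_loop_def using runs_LoopF[of None "mst [] m b n w" RA] by auto
next
  case (Cons x a)
  let ?ok = "b \<noteq> [] \<and> hd b = x"
  define n1 where "n1 = (if ?ok then n else True # n)"
  obtain n' where IH: "runs cmp_loop (mst a m (tl b) n1 w) (mst [] m (drop (length a) (tl b)) n' w) (9 * length a + 1)"
    "n' = [] \<longleftrightarrow> n1 = [] \<and> a = take (length a) (tl b)"
    using Cons by blast
  have inner: "runs (Ite RB (Some x) (Pop RB) (Seq (Pop RB) (Push RN True))) (mst a m b n w)
      (mst a m (tl b) n1 w) 5"
  proof (cases ?ok)
    case True
    have "runs (Ite RB (Some x) (Pop RB) (Seq (Pop RB) (Push RN True))) (mst a m b n w)
      (mst a m (tl b) n w) (Suc 1)" by (rule runs_IteT[OF _ runs_PopB]) (use True in simp)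
    then show ?thesis unfolding n1_def using True by (auto elim: runs_mono)
  next
    case False
    have "runs (Ite RB (Some x) (Pop RB) (Seq (Pop RB) (Push RN True))) (mst a m b n w)
      (mst a m (tl b) (True # n) w) (Suc (Suc (1 + 2)))"
      by (rule runs_IteF[OF _ runs_Seq[OF runs_PopB runs_basic(4)]]) (use False in simp)
    then show ?thesis unfolding n1_def if_not_P[OF False] by (rule runs_mono) simp
  qed
  have "runs (Ite RA (Some True)
     (Seq (Pop RA) (Ite RB (Some True) (Pop RB) (Seq (Pop RB) (Push RN True))))
     (Seq (Pop RA) (Ite RB (Some False) (Pop RB) (Seq (Pop RB) (Push RN True)))))
     (mst (x # a) m b n w) (mst a m (tl b) n1 w) (Suc (Suc (1 + 5)))"
    by (rule runs_Ite_bool[of _ _ x a])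
      (use runs_Seq[OF runs_basic(6) inner, of x] in \<open>cases x; simp\<close>)+
  from runs_LoopT[OF _ this IH(1)[unfolded cmp_loop_def]]
  have "runs cmp_loop (mst (x # a) m b n w) (mst [] m (drop (length (x # a)) b) n' w) (9 * length (x # a) + 1)"
    unfolding cmp_loop_def by (auto elim: runs_mono simp: drop_Suc)
  moreover have "n' = [] \<longleftrightarrow> n = [] \<and> x # a = take (length (x # a)) b"
    using IH(2) unfolding n1_def by (cases b) auto
  ultimately show ?case by blast
qed

definition clear_B :: com where "clear_B = Loop RB None (Pop RB)"
definition clear_N :: com where "clear_N = Loop RN None (Pop RN)"

lemma clear_B: "runs clear_B (mst a m b n w) (mst a m [] n w) (2 * length b + 1)"
proof (induction b)
  case Nil show ?case unfolding clear_B_def using runs_LoopF[of None "mst a m [] n w" RB] by simp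
next
  case (Cons x b)
  from runs_LoopT[OF _ runs_basic(8) Cons[unfolded clear_B_def]] show ?case
    unfolding clear_B_def by (auto elim: runs_mono)
qed

lemma clear_N: "runs clear_N (mst a m b n w) (mst a m b [] w) (2 * length n + 1)"
proof (induction n)
  case Nil show ?case unfolding clear_N_def using runs_LoopF[of None "mst a m b [] w" RN] by simp
next
  case (Cons x b)
  from runs_LoopT[OF _ runs_basic(9) Cons[unfolded clear_N_def]] show ?case
    unfolding clear_N_def by (auto elim: runs_mono)
qed

definition true_tree :: tree where "true_tree = Nd Lf Lf"

text \<open>No step adds more than one symbol, so the running time of \<open>cmp_loop\<close> bounds
  the number of marks that \<open>clear_N\<close> has to remove.\<close>

lemma exec_len_RN:
  assumes "exec c s t s'"
  shows "length (fst s' RN) \<le> length (fst s RN) + t"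
  using assms by (induction rule: exec.induct) auto

definition eq_tree :: com where
  "eq_tree = Seq (walk (Push RA)) (Seq (walk (Push RB)) (Seq cmp_loop
     (Seq (Ite RB None (Push RN True) Skip) (Seq clear_B
       (Ite RN None (Seq clear_N (push_code (code Lf))) (push_code (code true_tree)))))))"

lemma eq_tree:
  "runs eq_tree (mst [] (code t @ code u @ m) [] [] w)
     (mst [] (code (if t = u then true_tree else Lf) @ m) [] [] w) (50 * (tsize t + tsize u) + 50)"
proof -
  let ?a = "rev (code t)" and ?b = "rev (code u)"
  obtain n' where 1: "runs cmp_loop (mst ?a m ?b [] w) (mst [] m (drop (length ?a) ?b) n' w) (9 * length ?a + 1)"
    "(n' = [] \<longleftrightarrow> ?a = take (length ?a) ?b)"
    using cmp_loop[of ?a m ?b "[]" w] by auto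
  have len: "length n' \<le> 9 * length ?a + 1"
    using 1(1) exec_len_RN unfolding runs_def by fastforce
  \<comment> \<open>What remains on \<open>RB\<close> counts as a further mismatch: the codes are
    compared in reversed form, where one may be a proper prefix of another.\<close>
  define n2 where "n2 = (if drop (length ?a) ?b = [] then n' else True # n')"
  have "n2 = [] \<longleftrightarrow> ?a = ?b" unfolding n2_def using 1(2) by auto
  also have "\<dots> \<longleftrightarrow> t = u" using code_prefix[of t "[]" u "[]"] by auto
  finally have n2: "n2 = [] \<longleftrightarrow> t = u" .
  have 2: "runs (Ite RB None (Push RN True) Skip) (mst [] m (drop (length ?a) ?b) n' w)
      (mst [] m (drop (length ?a) ?b) n2 w) 3"
    by (cases "drop (length ?a) ?b = []")
       (auto simp: n2_def intro!: runs_IteT runs_basic runs_mono[OF runs_IteF[OF _ runs_Skip]]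
         runs_mono[OF runs_IteT[OF _ runs_basic(4)]])
  have 3: "runs (Ite RN None (Seq clear_N (push_code (code Lf))) (push_code (code true_tree)))
     (mst [] m [] n2 w) (mst [] (code (if t = u then true_tree else Lf) @ m) [] [] w) (2 * length n2 + 20)"
  proof (cases "t = u")
    case True
    have "runs (push_code (code true_tree)) (mst [] m [] n2 w) (mst [] (code true_tree @ m) [] n2 w) 10"
      using push_code[of "code true_tree"] by (simp add: true_tree_def)
    then show ?thesis using True n2 by (auto intro!: runs_mono[OF runs_IteF])
  next
    case False
    have "runs (push_code (code Lf)) (mst [] m [] [] w) (mst [] (code Lf @ m) [] [] w) 4"
      using push_code[of "code Lf"] by simp
    from runs_Seq[OF clear_N this] show ?thesis using False n2 by (auto intro!: runs_mono[OF runs_IteT])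
  qed
  have l2: "length n2 \<le> 9 * length ?a + 2" using len by (simp add: n2_def)
  have l3: "length (drop (length ?a) ?b) \<le> tsize u" by (simp add: tsize_def)
  show ?thesis unfolding eq_tree_def
    apply (rule runs_mono)
     apply (rule runs_Seq[OF walk_A[of "[]" t "code u @ m" "[]" w]])
     apply (rule runs_Seq)
      apply (simp only: append_Nil2)
      apply (rule walk_B[of _ u m "[]" w])
     apply (simp only: append_Nil2)
     apply (rule runs_Seq[OF 1(1) runs_Seq[OF 2 runs_Seq[OF clear_B 3]]])
    using l2 l3 by (simp add: tsize_def)
qed

section \<open>Data coded as trees\<close>

class cod =
  fixes tr :: "'a \<Rightarrow> tree"
  assumes tr_inject: "tr x = tr y \<longleftrightarrow> x = y"

instantiation tree :: cod begin
definition "tr_tree (t :: tree) = t"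
instance by standard (simp add: tr_tree_def)
end

instantiation unit :: cod begin
definition "tr_unit (u :: unit) = Lf"
instance by standard simp
end

instantiation bool :: cod begin
definition "tr_bool b = (if b then Nd Lf Lf else Lf)"
instance by standard (simp add: tr_bool_def)
end

text \<open>Unary, so that sizes are linear in values. The code of \<open>n\<close> is also that of
  a list of \<open>n\<close> units, by which numbers can drive iterations.\<close>

instantiation nat :: cod begin
primrec tr_nat where
  "tr_nat 0 = Lf"
| "tr_nat (Suc n) = Nd Lf (tr_nat n)"
instance
proof
  show "tr x = tr y \<longleftrightarrow> x = y" for x y :: nat
  proof (induction x arbitrary: y)
    case 0 show ?case by (cases y) auto
  next
    case (Suc x) then show ?case by (cases y) auto
  qed
qed
end

instantiation prod :: (cod, cod) cod begin
definition "tr_prod p = Nd (tr (fst p)) (tr (snd p))"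
instance by standard (auto simp: tr_prod_def tr_inject prod_eq_iff)
end

instantiation list :: (cod) cod begin
primrec tr_list where
  "tr_list [] = Lf"
| "tr_list (x # xs) = Nd (tr x) (tr_list xs)"
instance
proof
  show "tr x = tr y \<longleftrightarrow> x = y" for x y :: "'a list"
  proof (induction x arbitrary: y)
    case Nil show ?case by (cases y) auto
  next
    case (Cons a x) then show ?case by (cases y) (auto simp: tr_inject)
  qed
qed
end

lemma tr_Pair: "tr (x, y) = Nd (tr x) (tr y)"
  by (simp add: tr_prod_def)

lemma tr_bool_simps: "tr True = Nd Lf Lf" "tr False = Lf"
  by (simp_all add: tr_bool_def)

definition sz :: "'a :: cod \<Rightarrow> nat" where "sz x = tsize (tr x)"

lemma sz_simps [simp]:
  "sz (x, y) = Suc (sz x + sz y)" "sz (0 :: nat) = 1" "sz (Suc n) = sz n + 2"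
  "sz ([] :: 'a :: cod list) = 1" "sz (z # zs :: 'a list) = Suc (sz z + sz zs)" "sz () = 1"
  "sz Lf = 1" "sz (Nd l r) = Suc (sz l + sz r)"
  by (simp_all add: sz_def tr_Pair tr_unit_def tr_tree_def)

lemma sz_nat: "sz (n :: nat) = 2 * n + 1"
  by (induction n) auto

lemma sz_bool: "sz (b :: bool) \<le> 3"
  by (simp add: sz_def tr_bool_def)

lemma sz_pos [simp]: "0 < sz x" "1 \<le> sz x" "Suc 0 \<le> sz x"
  using tsize_pos[of "tr x"] unfolding sz_def by linarith+

lemma sz_fst_snd: "sz (fst p) < sz p" "sz (snd p) < sz p"
  by (cases p; simp)+

lemma length_le_sz: "length xs < sz xs"
  by (induction xs) auto

lemma sz_append: "sz (xs @ ys) + 1 = sz xs + sz ys"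
  by (induction xs) auto

lemma sz_member: "x \<in> set xs \<Longrightarrow> sz x < sz xs"
  by (induction xs) auto

lemma sz_rev [simp]: "sz (rev xs) = sz xs"
proof (induction xs)
  case (Cons x xs)
  then show ?case using sz_append[of "rev xs" "[x]"] by simp
qed simp

lemma sz_list_bound: "(\<And>x. x \<in> set xs \<Longrightarrow> sz x \<le> B) \<Longrightarrow> sz xs \<le> Suc (length xs * Suc B)"
proof (induction xs)
  case (Cons x xs)
  have "sz x \<le> B" "sz xs \<le> Suc (length xs * Suc B)" using Cons by auto
  then show ?case by simp
qed simp

lemma sz_drop: "sz (drop n xs) \<le> sz xs"
proof (induction xs arbitrary: n)
  case (Cons x xs) then show ?case by (cases n) (auto intro: le_SucI trans_le_add2)
qed simp

section \<open>Polynomial bounds\<close>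

text \<open>The base \<open>n + 1\<close> is at least 2 for \<open>n \<ge> 1\<close>, so constants
  and sums are absorbed by a larger exponent; the arguments will be sizes, which are never
  0.\<close>

definition pb :: "(nat \<Rightarrow> nat) \<Rightarrow> bool" where
  "pb p \<longleftrightarrow> (\<exists>k. \<forall>n\<ge>1. p n \<le> (n + 1) ^ k)"

named_theorems pb_intros

lemma pb_mono: "pb q \<Longrightarrow> (\<And>n. n \<ge> 1 \<Longrightarrow> p n \<le> q n) \<Longrightarrow> pb p"
  unfolding pb_def using le_trans by blast

lemma pb_const [pb_intros]: "pb (\<lambda>n. c)"
proof -
  have "c \<le> (n + 1) ^ c" if "n \<ge> 1" for n :: nat
  proof -
    have "c \<le> 2 ^ c" by (simp add: less_imp_le)
    also have "\<dots> \<le> (n + 1) ^ c" using that by (intro power_mono) auto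
    finally show ?thesis .
  qed
  then show ?thesis unfolding pb_def by blast
qed

lemma pb_id [pb_intros]: "pb (\<lambda>n. n)"
  unfolding pb_def by (rule exI[of _ 1]) simp

lemma pb_mult [pb_intros]: "pb p \<Longrightarrow> pb q \<Longrightarrow> pb (\<lambda>n. p n * q n)"
  unfolding pb_def by (metis mult_mono power_add zero_le)

lemma pb_add [pb_intros]:
  assumes "pb p" "pb q"
  shows "pb (\<lambda>n. p n + q n)"
proof -
  obtain k l where k: "\<And>n. n \<ge> 1 \<Longrightarrow> p n \<le> (n + 1) ^ k" and l: "\<And>n. n \<ge> 1 \<Longrightarrow> q n \<le> (n + 1) ^ l"
    using assms unfolding pb_def by metis
  have "p n + q n \<le> (n + 1) ^ (max k l + 1)" if n: "n \<ge> 1" for n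
  proof -
    have "p n \<le> (n + 1) ^ max k l"
      using k[OF n] by (rule order_trans) (auto intro!: power_increasing)
    moreover have "q n \<le> (n + 1) ^ max k l"
      using l[OF n] by (rule order_trans) (auto intro!: power_increasing)
    ultimately have "p n + q n \<le> 2 * (n + 1) ^ max k l" by simp
    also have "\<dots> \<le> (n + 1) * (n + 1) ^ max k l" using n by (intro mult_right_mono) auto
    finally show ?thesis by simp
  qed
  then show ?thesis unfolding pb_def by blast
qed

lemma pb_Suc [pb_intros]: "pb p \<Longrightarrow> pb (\<lambda>n. Suc (p n))"
  using pb_add[OF _ pb_const[of 1], of p] by simp

lemma pb_power [pb_intros]: "pb p \<Longrightarrow> pb (\<lambda>n. p n ^ k)"
proof (induction k)
  case 0 show ?case using pb_const[of 1] by simp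
next
  case (Suc k) then show ?case using pb_mult[OF Suc.prems Suc.IH] by simp
qed

lemma pb_comp: "pb p \<Longrightarrow> pb q \<Longrightarrow> (\<And>n. n \<ge> 1 \<Longrightarrow> q n \<ge> 1) \<Longrightarrow> pb (\<lambda>n. p (q n))"
proof -
  assume p: "pb p" and q: "pb q" and pos: "\<And>n. n \<ge> 1 \<Longrightarrow> q n \<ge> 1"
  obtain k where k: "\<And>n. n \<ge> 1 \<Longrightarrow> p n \<le> (n + 1) ^ k" using p unfolding pb_def by metis
  show ?thesis
    by (rule pb_mono[of "\<lambda>n. Suc (q n) ^ k"]) (use k pos in \<open>auto intro!: pb_intros q\<close>)
qed

section \<open>Functions computable in polynomial time\<close>

text \<open>
  Arguments and results are codes of trees on top of the stack \<^const>\<open>RM\<close>; the other stacks are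
  empty before and after.  Natural numbers are coded in unary.
\<close>

definition calc :: "com \<Rightarrow> tree \<Rightarrow> tree \<Rightarrow> nat \<Rightarrow> bool" where
  "calc c t u n \<longleftrightarrow> (\<forall>m. runs c (mst [] (code t @ m) [] [] []) (mst [] (code u @ m) [] [] []) n)"

lemma calc_mono: "calc c t u m \<Longrightarrow> m \<le> n \<Longrightarrow> calc c t u n"
  unfolding calc_def using runs_mono by blast

lemma calc_Seq: "calc c t u m \<Longrightarrow> calc d u v n \<Longrightarrow> calc (Seq c d) t v (Suc (m + n))"
  unfolding calc_def using runs_Seq by blast

text \<open>The size of the result is bounded along with the time, because the next function in a
  composition is charged for it.\<close>

definition fp :: "('a :: cod \<Rightarrow> 'b :: cod) \<Rightarrow> bool" where
  "fp f \<longleftrightarrow> (\<exists>c k. \<forall>x. calc c (tr x) (tr (f x)) ((sz x + 1) ^ k) \<and> sz (f x) \<le> (sz x + 1) ^ k)"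

lemma fpI:
  assumes "pb p" "\<And>x. calc c (tr x) (tr (f x)) (p (sz x))" "\<And>x. sz (f x) \<le> p (sz x)"
  shows "fp f"
proof -
  obtain k where k: "\<And>n. n \<ge> 1 \<Longrightarrow> p n \<le> (n + 1) ^ k" using assms(1) unfolding pb_def by metis
  show ?thesis unfolding fp_def
    by (intro exI[of _ c] exI[of _ k] allI conjI calc_mono[OF assms(2) k] order_trans[OF assms(3) k]) simp_all
qed

named_theorems fp_intros

lemma fp_id [fp_intros]: "fp (\<lambda>x. x)"
  by (rule fpI[of "\<lambda>n. n" Skip])
     (auto intro: pb_intros simp: calc_def intro!: runs_mono[OF runs_Skip])

lemma fp_comp:
  assumes "fp g" "fp f"
  shows "fp (\<lambda>x. g (f x))"
proof -
  obtain c k where f: "\<And>x. calc c (tr x) (tr (f x)) ((sz x + 1) ^ k)" "\<And>x. sz (f x) \<le> (sz x + 1) ^ k"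
    using assms(2) unfolding fp_def by blast
  obtain d l where g: "\<And>x. calc d (tr x) (tr (g x)) ((sz x + 1) ^ l)" "\<And>x. sz (g x) \<le> (sz x + 1) ^ l"
    using assms(1) unfolding fp_def by blast
  let ?p = "\<lambda>n :: nat. Suc ((n + 1) ^ k + ((n + 1) ^ k + 1) ^ l)"
  have le: "(sz (f x) + 1) ^ l \<le> ((sz x + 1) ^ k + 1) ^ l" for x
    using f(2) by (intro power_mono) auto
  show ?thesis
  proof (rule fpI[of ?p "Seq c d"])
    show "pb ?p" by (intro pb_intros)
    show "calc (Seq c d) (tr x) (tr (g (f x))) (?p (sz x))" for x
      using calc_mono[OF calc_Seq[OF f(1) g(1)]] le by simp
    show "sz (g (f x)) \<le> ?p (sz x)" for x
      using order_trans[OF g(2)[of "f x"] le] by simp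
  qed
qed

text \<open>Programs see only codes, so a program for \<open>f\<close> computes every
  \<open>g\<close> that agrees with \<open>f\<close> on codes. In this way \<open>Cons\<close> and
  \<open>Suc\<close> become pairing.\<close>

lemma fp_rel:
  assumes "fp f" "\<And>y. \<exists>x. tr x = tr y \<and> tr (f x) = tr (g y)"
  shows "fp g"
proof -
  obtain c k where f: "\<And>x. calc c (tr x) (tr (f x)) ((sz x + 1) ^ k)" "\<And>x. sz (f x) \<le> (sz x + 1) ^ k"
    using assms(1) unfolding fp_def by blast
  have "calc c (tr y) (tr (g y)) ((sz y + 1) ^ k) \<and> sz (g y) \<le> (sz y + 1) ^ k" for y
  proof -
    obtain x where x: "tr x = tr y" "tr (f x) = tr (g y)" using assms(2) by blast
    then show ?thesis using f(1)[of x] f(2)[of x] by (simp add: sz_def)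
  qed
  then show ?thesis unfolding fp_def by blast
qed

definition pair_com :: "com \<Rightarrow> com \<Rightarrow> com" where
  "pair_com c d = Seq dup_tree (Seq c (Seq swap_tree (Seq d (Seq swap_tree (Push RM True)))))"

lemma pair_com:
  assumes "calc c t u m" "calc d t v n"
  shows "calc (pair_com c d) t (Nd u v) (m + n + 50 * (tsize t + tsize u + tsize v) + 60)"
  unfolding calc_def
proof
  fix r
  have 1: "runs c (mst [] (code t @ code t @ r) [] [] []) (mst [] (code u @ code t @ r) [] [] []) m"
    using assms(1) unfolding calc_def by blast
  have 2: "runs d (mst [] (code t @ code u @ r) [] [] []) (mst [] (code v @ code u @ r) [] [] []) n"
    using assms(2) unfolding calc_def by blast
  show "runs (pair_com c d) (mst [] (code t @ r) [] [] []) (mst [] (code (Nd u v) @ r) [] [] [])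
      (m + n + 50 * (tsize t + tsize u + tsize v) + 60)"
    unfolding pair_com_def code.simps append.simps append_assoc
    by (rule runs_mono[OF runs_Seq[OF dup_tree runs_Seq[OF 1 runs_Seq[OF swap_tree runs_Seq[OF 2
      runs_Seq[OF swap_tree runs_basic(2)]]]]]]) simp
qed

lemma fp_Pair [fp_intros]:
  assumes "fp f" "fp g"
  shows "fp (\<lambda>x. (f x, g x))"
proof -
  obtain c k where f: "\<And>x. calc c (tr x) (tr (f x)) ((sz x + 1) ^ k)" "\<And>x. sz (f x) \<le> (sz x + 1) ^ k"
    using assms(1) unfolding fp_def by blast
  obtain d l where g: "\<And>x. calc d (tr x) (tr (g x)) ((sz x + 1) ^ l)" "\<And>x. sz (g x) \<le> (sz x + 1) ^ l"
    using assms(2) unfolding fp_def by blast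
  let ?p = "\<lambda>n :: nat. (n + 1) ^ k + (n + 1) ^ l + 50 * (n + (n + 1) ^ k + (n + 1) ^ l) + 60"
  show ?thesis
  proof (rule fpI[of ?p "pair_com c d"])
    show "pb ?p" by (intro pb_intros)
    show "calc (pair_com c d) (tr x) (tr (f x, g x)) (?p (sz x))" for x
      unfolding tr_Pair using f(2)[of x] g(2)[of x]
      by (intro calc_mono[OF pair_com[OF f(1) g(1)]]) (simp add: sz_def)
    show "sz (f x, g x) \<le> ?p (sz x)" for x
      using f(2)[of x] g(2)[of x] by simp
  qed
qed

lemma fp_snd0: "fp snd"
proof (rule fpI[of "\<lambda>n. 11 * n + 20" "Seq (Pop RM) drop_tree"])
  show "pb (\<lambda>n. 11 * n + 20)" by (intro pb_intros)
  fix x :: "'a \<times> 'b"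
  obtain a b where x: "x = (a, b)" by force
  have "runs (Seq (Pop RM) drop_tree) (mst [] (code (tr x) @ m) [] [] []) (mst [] (code (tr b) @ m) [] [] [])
      (11 * sz x + 20)" for m
    unfolding x tr_Pair code.simps append.simps append_assoc
    by (rule runs_mono[OF runs_Seq[OF runs_basic(7) drop_tree]]) (simp add: sz_def tr_Pair)
  then show "calc (Seq (Pop RM) drop_tree) (tr x) (tr (snd x)) (11 * sz x + 20)"
    unfolding calc_def x by simp
  show "sz (snd x) \<le> 11 * sz x + 20" by (simp add: x)
qed

lemma fp_fst0: "fp fst"
proof (rule fpI[of "\<lambda>n. 50 * n + 50" "Seq (Pop RM) (Seq swap_tree drop_tree)"])
  show "pb (\<lambda>n. 50 * n + 50)" by (intro pb_intros)
  fix x :: "'a \<times> 'b"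
  obtain a b where x: "x = (a, b)" by force
  have "runs (Seq (Pop RM) (Seq swap_tree drop_tree)) (mst [] (code (tr x) @ m) [] [] []) (mst [] (code (tr a) @ m) [] [] [])
      (50 * sz x + 50)" for m
    unfolding x tr_Pair code.simps append.simps append_assoc
    by (rule runs_mono[OF runs_Seq[OF runs_basic(7) runs_Seq[OF swap_tree drop_tree]]]) (simp add: sz_def tr_Pair)
  then show "calc (Seq (Pop RM) (Seq swap_tree drop_tree)) (tr x) (tr (fst x)) (50 * sz x + 50)"
    unfolding calc_def x by simp
  show "sz (fst x) \<le> 50 * sz x + 50" by (simp add: x)
qed

lemmas fp_fst [fp_intros] = fp_comp[OF fp_fst0]
lemmas fp_snd [fp_intros] = fp_comp[OF fp_snd0]

lemma fp_const [fp_intros]: "fp (\<lambda>x. c)"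
proof (rule fpI[of "\<lambda>n. 11 * n + 3 * sz c + 20" "Seq drop_tree (push_code (code (tr c)))"])
  show "pb (\<lambda>n. 11 * n + 3 * sz c + 20)" by (intro pb_intros)
  fix x :: 'a
  have "runs (Seq drop_tree (push_code (code (tr c)))) (mst [] (code (tr x) @ m) [] [] []) (mst [] (code (tr c) @ m) [] [] [])
      (11 * sz x + 3 * sz c + 20)" for m
    by (rule runs_mono[OF runs_Seq[OF drop_tree push_code]]) (simp add: sz_def tsize_def)
  then show "calc (Seq drop_tree (push_code (code (tr c)))) (tr x) (tr c) (11 * sz x + 3 * sz c + 20)"
    unfolding calc_def by simp
  show "sz c \<le> 11 * sz x + 3 * sz c + 20" by simp
qed

definition case_com :: "com \<Rightarrow> com \<Rightarrow> com \<Rightarrow> com" where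
  "case_com c d e = Seq dup_tree (Seq c (Ite RM (Some True)
     (Seq swap_tree (Seq (Push RM True) e)) (Seq (Pop RM) d)))"

text \<open>One program serves all case distinctions: for \<open>bool\<close>, \<open>nat\<close>
  and lists alike, one constructor is coded by a leaf and the other by a node, whose two subtrees
  are handed to \<open>g\<close>.\<close>

lemma fp_case_gen:
  fixes T :: "'e :: cod \<Rightarrow> 't :: cod" and a h :: "'e \<Rightarrow> 'b :: cod"
    and g :: "'e \<times> 'l :: cod \<times> 'r :: cod \<Rightarrow> 'b"
  assumes T: "fp T" and a: "fp a" and g: "fp g"
    and h: "\<And>e. (tr (T e) = Lf \<and> h e = a e) \<or> (\<exists>l r. tr (T e) = Nd (tr l) (tr r) \<and> h e = g (e, l, r))"
  shows "fp h"
proof -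
  obtain c k where T: "\<And>x. calc c (tr x) (tr (T x)) ((sz x + 1) ^ k)" "\<And>x. sz (T x) \<le> (sz x + 1) ^ k"
    using T unfolding fp_def by blast
  obtain d l where a: "\<And>x. calc d (tr x) (tr (a x)) ((sz x + 1) ^ l)" "\<And>x. sz (a x) \<le> (sz x + 1) ^ l"
    using a unfolding fp_def by blast
  obtain f j where g: "\<And>x. calc f (tr x) (tr (g x)) ((sz x + 1) ^ j)" "\<And>x. sz (g x) \<le> (sz x + 1) ^ j"
    using g unfolding fp_def by blast
  let ?q = "\<lambda>n :: nat. (n + (n + 1) ^ k + 2) ^ j"
  let ?p = "\<lambda>n :: nat. (n + 1) ^ k + (n + 1) ^ l + ?q n + 50 * (n + (n + 1) ^ k) + 100"
  have "runs (case_com c d f) (mst [] (code (tr e) @ m) [] [] []) (mst [] (code (tr (h e)) @ m) [] [] []) (?p (sz e))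
      \<and> sz (h e) \<le> ?p (sz e)" for e m
  proof -
    have cc: "runs c (mst [] (code (tr e) @ code (tr e) @ m) [] [] []) (mst [] (code (tr (T e)) @ code (tr e) @ m) [] [] []) ((sz e + 1) ^ k)"
      using T(1) unfolding calc_def by blast
    from h[of e] show ?thesis
    proof
      assume l: "tr (T e) = Lf \<and> h e = a e"
      have "runs d (mst [] (code (tr e) @ m) [] [] []) (mst [] (code (tr (a e)) @ m) [] [] []) ((sz e + 1) ^ l)"
        using a(1) unfolding calc_def by blast
      from runs_Seq[OF runs_basic(7) this]
      have "runs (Ite RM (Some True) (Seq swap_tree (Seq (Push RM True) f)) (Seq (Pop RM) d))
         (mst [] (code (tr (T e)) @ code (tr e) @ m) [] [] []) (mst [] (code (tr (h e)) @ m) [] [] []) (Suc (Suc (1 + (sz e + 1) ^ l)))"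
        using l by (intro runs_IteF) auto
      from runs_Seq[OF dup_tree runs_Seq[OF cc this]] show ?thesis
        using l a(2)[of e] unfolding case_com_def by (auto simp: sz_def elim!: runs_mono)
    next
      assume "\<exists>l r. tr (T e) = Nd (tr l) (tr r) \<and> h e = g (e, l, r)"
      then obtain y z where yz: "tr (T e) = Nd (tr y) (tr z)" "h e = g (e, y, z)" by blast
      let ?x = "(e, y, z)"
      have szx: "sz ?x = Suc (sz e + sz (T e))" by (simp add: sz_def yz tr_Pair)
      have q: "(sz ?x + 1) ^ j \<le> ?q (sz e)" unfolding szx using T(2)[of e] by (intro power_mono) auto
      have sw: "runs swap_tree (mst [] (code (tr (T e)) @ code (tr e) @ m) [] [] [])
        (mst [] (code (tr e) @ code (tr (T e)) @ m) [] [] []) (20 * (sz e + (sz e + 1) ^ k) + 20)"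
        using T(2)[of e] by (intro runs_mono[OF swap_tree]) (simp add: sz_def)
      have "runs f (mst [] (code (tr ?x) @ m) [] [] []) (mst [] (code (tr (h e)) @ m) [] [] []) (?q (sz e))"
        using calc_mono[OF g(1)[of ?x] q] yz(2) unfolding calc_def by simp
      moreover have "code (tr ?x) @ m = True # code (tr e) @ code (tr (T e)) @ m" by (simp add: yz tr_Pair)
      ultimately have ff: "runs f (mst [] (True # code (tr e) @ code (tr (T e)) @ m) [] [] []) (mst [] (code (tr (h e)) @ m) [] [] []) (?q (sz e))"
        by simp
      have "runs (Ite RM (Some True) (Seq swap_tree (Seq (Push RM True) f)) (Seq (Pop RM) d))
         (mst [] (code (tr (T e)) @ code (tr e) @ m) [] [] []) (mst [] (code (tr (h e)) @ m) [] [] []) (Suc (Suc ((20 * (sz e + (sz e + 1) ^ k) + 20) + Suc (2 + ?q (sz e)))))"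
        using runs_Seq[OF sw runs_Seq[OF runs_basic(2) ff]]
        by (intro runs_IteT) (auto simp: yz(1))
      from runs_Seq[OF dup_tree runs_Seq[OF cc this]] show ?thesis
        using yz order_trans[OF g(2)[of ?x] q] unfolding case_com_def by (auto simp: sz_def elim!: runs_mono)
    qed
  qed note main = this
  show ?thesis
  proof (rule fpI[of ?p "case_com c d f"])
    show "pb ?p" by (intro pb_intros)
    show "calc (case_com c d f) (tr x) (tr (h x)) (?p (sz x))" for x
      unfolding calc_def using main by blast
    show "sz (h x) \<le> ?p (sz x)" for x using main by blast
  qed
qed

lemma fp_if [fp_intros]:
  assumes "fp b" "fp f" "fp g"
  shows "fp (\<lambda>x. if b x then f x else g x)"
  by (rule fp_case_gen[of b g "\<lambda>p :: 'a \<times> unit \<times> unit. f (fst p)"])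
     (auto simp: tr_bool_def tr_unit_def intro!: assms fp_comp[OF assms(2)] fp_fst0)

lemma fp_case_list [fp_intros]:
  assumes "fp xs" "fp a" "fp (\<lambda>p. g (fst p) (fst (snd p)) (snd (snd p)))"
  shows "fp (\<lambda>e. case xs e of [] \<Rightarrow> a e | y # ys \<Rightarrow> g e y ys)"
  by (rule fp_case_gen[OF assms]) (auto split: list.splits)

lemma fp_case_nat [fp_intros]:
  assumes "fp n" "fp a" "fp (\<lambda>p. g (fst p) (snd p))"
  shows "fp (\<lambda>e. case n e of 0 \<Rightarrow> a e | Suc m \<Rightarrow> g e m)"
proof (rule fp_case_gen[OF assms(1,2), of "\<lambda>p. g (fst p) (snd (snd p))"])
  show "fp (\<lambda>p :: 'a \<times> unit \<times> nat. g (fst p) (snd (snd p)))"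
    using fp_comp[OF assms(3), of "\<lambda>p :: 'a \<times> unit \<times> nat. (fst p, snd (snd p))"]
    by (simp add: fp_intros)
qed (auto split: nat.splits simp: tr_unit_def)

lemma fp_case_prod [fp_intros]:
  assumes "fp (\<lambda>e. g e (fst (p e)) (snd (p e)))"
  shows "fp (\<lambda>e. case p e of (x, y) \<Rightarrow> g e x y)"
  using assms by (simp add: case_prod_beta)

lemma fp_Cons [fp_intros]: "fp f \<Longrightarrow> fp g \<Longrightarrow> fp (\<lambda>x. f x # g x)"
  by (rule fp_rel[OF fp_Pair[of f g]]) (auto simp: tr_Pair)

lemma fp_Suc [fp_intros]: "fp f \<Longrightarrow> fp (\<lambda>x. Suc (f x))"
  by (rule fp_rel[OF fp_Pair[OF fp_const[of "()"], of f]]) (auto simp: tr_Pair tr_unit_def)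

lemma fp_eq [fp_intros]:
  assumes "fp f" "fp g"
  shows "fp (\<lambda>x. f x = g x)"
proof -
  have "fp (\<lambda>p :: 'b \<times> 'b. fst p = snd p)"
  proof (rule fpI[of "\<lambda>n. 50 * n + 60" "Seq (Pop RM) eq_tree"])
    show "pb (\<lambda>n. 50 * n + 60)" by (intro pb_intros)
    fix x :: "'b \<times> 'b"
    obtain a b where x: "x = (a, b)" by force
    have "(if tr a = tr b then true_tree else Lf) = tr (a = b)"
      by (simp add: tr_inject tr_bool_def true_tree_def)
    moreover have "runs (Seq (Pop RM) eq_tree) (mst [] (code (tr x) @ m) [] [] [])
        (mst [] (code (if tr a = tr b then true_tree else Lf) @ m) [] [] []) (50 * sz x + 60)" for m
      unfolding x tr_Pair code.simps append.simps append_assoc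
      by (rule runs_mono[OF runs_Seq[OF runs_basic(7) eq_tree]]) (simp add: sz_def tr_Pair)
    ultimately have "runs (Seq (Pop RM) eq_tree) (mst [] (code (tr x) @ m) [] [] []) (mst [] (code (tr (a = b)) @ m) [] [] [])
        (50 * sz x + 60)" for m
      by simp
    then show "calc (Seq (Pop RM) eq_tree) (tr x) (tr (fst x = snd x)) (50 * sz x + 60)"
      unfolding calc_def x by simp
    show "sz (fst x = snd x) \<le> 50 * sz x + 60" using sz_bool[of "fst x = snd x"] by simp
  qed
  from fp_comp[OF this fp_Pair[OF assms]] show ?thesis by simp
qed

section \<open>Bounded iteration\<close>

definition fold_com :: "com \<Rightarrow> com" where
  "fold_com c = Seq (Pop RM) (Seq (Loop RM (Some True) (Seq (Push RM True) (Seq c (Pop RM)))) (Pop RM))"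

text \<open>The remaining list and the accumulator lie on the stack next to each other; pushing
  \<open>True\<close> makes them a pair for \<open>c\<close>, and popping undoes this. The bound
  \<open>B\<close> is demanded only at states that the fold passes through.\<close>

lemma fold_loop:
  assumes "\<And>y ys zs. xs = ys @ y # zs \<Longrightarrow>
     calc c (Nd (tr (y # zs)) (tr (foldl g s ys))) (Nd (tr zs) (tr (foldl g s (ys @ [y])))) B"
  shows "runs (Loop RM (Some True) (Seq (Push RM True) (Seq c (Pop RM))))
     (mst [] (code (tr xs) @ code (tr s) @ m) [] [] []) (mst [] (False # code (tr (foldl g s xs)) @ m) [] [] [])
     ((B + 6) * length xs + 1)"
  using assms
proof (induction xs arbitrary: s)
  case Nil
  show ?case using runs_LoopF[of "Some True" "mst [] (False # code (tr s) @ m) [] [] []" RM] by simp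
next
  case (Cons x xs)
  let ?m = "code (tr s) @ m"
  have 1: "runs (Push RM True) (mst [] (code (tr (x # xs)) @ ?m) [] [] [])
     (mst [] (code (Nd (tr (x # xs)) (tr s)) @ m) [] [] []) 2"
    using runs_basic(2) by simp
  have 2: "runs c (mst [] (code (Nd (tr (x # xs)) (tr s)) @ m) [] [] [])
     (mst [] (True # code (tr xs) @ code (tr (g s x)) @ m) [] [] []) B"
    using Cons.prems[of "[]" x xs] unfolding calc_def by simp
  have IH: "runs (Loop RM (Some True) (Seq (Push RM True) (Seq c (Pop RM))))
     (mst [] (code (tr xs) @ code (tr (g s x)) @ m) [] [] []) (mst [] (False # code (tr (foldl g (g s x) xs)) @ m) [] [] [])
     ((B + 6) * length xs + 1)"
  proof (rule Cons.IH)
    fix y ys zs assume "xs = ys @ y # zs"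
    then show "calc c (Nd (tr (y # zs)) (tr (foldl g (g s x) ys))) (Nd (tr zs) (tr (foldl g (g s x) (ys @ [y])))) B"
      using Cons.prems[of "x # ys" y zs] by simp
  qed
  from runs_LoopT[OF _ runs_Seq[OF 1 runs_Seq[OF 2 runs_basic(7)]] IH] show ?case
    by (auto elim: runs_mono)
qed

lemma fold_com:
  assumes "\<And>y ys zs. xs = ys @ y # zs \<Longrightarrow>
     calc c (Nd (tr (y # zs)) (tr (foldl g s ys))) (Nd (tr zs) (tr (foldl g s (ys @ [y])))) B"
  shows "calc (fold_com c) (Nd (tr xs) (tr s)) (tr (foldl g s xs)) ((B + 6) * length xs + 6)"
  unfolding calc_def
proof
  fix m
  show "runs (fold_com c) (mst [] (code (Nd (tr xs) (tr s)) @ m) [] [] []) (mst [] (code (tr (foldl g s xs)) @ m) [] [] []) ((B + 6) * length xs + 6)"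
    unfolding fold_com_def code.simps append.simps append_assoc
    by (rule runs_mono[OF runs_Seq[OF runs_basic(7) runs_Seq[OF fold_loop[of xs c g s B m, OF assms] runs_basic(7)]]]) simp_all
qed

definition fold_step :: "('e \<Rightarrow> 'a \<Rightarrow> 'y \<Rightarrow> 'a) \<Rightarrow> 'y list \<times> 'e \<times> 'a \<Rightarrow> 'y list \<times> 'e \<times> 'a" where
  "fold_step f p = (case fst p of [] \<Rightarrow> p
     | y # ys \<Rightarrow> (ys, fst (snd p), f (fst (snd p)) (snd (snd p)) y))"

lemma fp_fold_step:
  assumes "fp (\<lambda>p. f (fst p) (fst (snd p)) (snd (snd p)))"
  shows "fp (fold_step f)"
proof -
  have "fp (\<lambda>q. f (fst (snd (fst q))) (snd (snd (fst q))) (fst (snd q)))" if "True"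
    using fp_comp[OF assms, of "\<lambda>q. (fst (snd (fst q)), snd (snd (fst q)), fst (snd q))"]
    by (simp add: fp_intros)
  then show ?thesis unfolding fold_step_def by (intro fp_intros) simp
qed

text \<open>A polynomial-time step is not enough, since the accumulator could grow exponentially;
  \<open>q\<close> bounds all its intermediate values. The argument \<open>e\<close> travels with
  the accumulator because the step has no other access to it.\<close>

lemma fp_foldl:
  assumes f: "fp (\<lambda>p. f (fst p) (fst (snd p)) (snd (snd p)))" and init: "fp init" and xs: "fp xs"
    and q: "pb q" "\<And>e ys zs. xs e = ys @ zs \<Longrightarrow> sz (foldl (f e) (init e) ys) \<le> q (sz e)"
  shows "fp (\<lambda>e. foldl (f e) (init e) (xs e))"
proof -
  obtain c k where c: "\<And>x. calc c (tr x) (tr (fold_step f x)) ((sz x + 1) ^ k)"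
    using fp_fold_step[OF f] unfolding fp_def by blast
  have "fp (\<lambda>e. (xs e, e, init e))" by (intro fp_intros init xs)
  then obtain d j where d: "\<And>e. calc d (tr e) (tr (xs e, e, init e)) ((sz e + 1) ^ j)"
    "\<And>e. sz (xs e, e, init e) \<le> (sz e + 1) ^ j" unfolding fp_def by blast
  let ?B = "\<lambda>n. ((n + 1) ^ j + n + q n + 3) ^ k"
  let ?p = "\<lambda>n. (n + 1) ^ j + (?B n + 6) * (n + 1) ^ j + n + q n + 20"
  let ?g = "\<lambda>p y. (fst p, f (fst p) (snd p) y)"
  have fl: "foldl ?g (e, a) ys = (e, foldl (f e) a ys)" for e a ys
    by (induction ys arbitrary: a) auto
  have main: "calc (Seq d (fold_com c)) (tr e) (tr (e, foldl (f e) (init e) (xs e))) (?p (sz e))" for e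
  proof -
    have len: "length (xs e) \<le> (sz e + 1) ^ j" using length_le_sz[of "xs e"] d(2)[of e] by simp
    have "calc (fold_com c) (Nd (tr (xs e)) (tr (e, init e))) (tr (foldl ?g (e, init e) (xs e))) ((?B (sz e) + 6) * length (xs e) + 6)"
    proof (rule fold_com)
      fix y ys zs assume xe: "xs e = ys @ y # zs"
      let ?x = "(y # zs, foldl ?g (e, init e) ys)"
      have st: "fold_step f ?x = (zs, foldl ?g (e, init e) (ys @ [y]))"
        by (simp add: fold_step_def fl)
      have "sz (y # zs) \<le> sz (xs e)" using xe sz_append[of ys "y # zs"] sz_pos(2)[of ys] by (simp del: sz_pos)
      moreover have "sz (foldl (f e) (init e) ys) \<le> q (sz e)" using q(2)[OF xe] .
      ultimately have "(sz ?x + 1) ^ k \<le> ?B (sz e)"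
        using d(2)[of e] by (intro power_mono) (auto simp: fl)
      from calc_mono[OF c this] show "calc c (Nd (tr (y # zs)) (tr (foldl ?g (e, init e) ys)))
          (Nd (tr zs) (tr (foldl ?g (e, init e) (ys @ [y])))) (?B (sz e))"
        unfolding st tr_Pair .
    qed
    then have "calc (fold_com c) (tr (xs e, e, init e)) (tr (e, foldl (f e) (init e) (xs e))) ((?B (sz e) + 6) * (sz e + 1) ^ j + 6)"
      unfolding fl tr_Pair[of "xs e"] by (rule calc_mono) (use len in \<open>auto intro: mult_left_mono\<close>)
    from calc_mono[OF calc_Seq[OF d(1) this]] show ?thesis by simp
  qed
  have "fp (\<lambda>e. (e, foldl (f e) (init e) (xs e)))"
  proof (rule fpI[OF _ main])
    show "pb ?p" by (intro pb_intros q)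
    show "sz (e, foldl (f e) (init e) (xs e)) \<le> ?p (sz e)" for e using q(2)[of e "xs e" "[]"] by simp
  qed
  from fp_snd[OF this] show ?thesis by simp
qed

lemma fp_bin:
  assumes "fp (\<lambda>p. h (fst p) (snd p))" "fp f" "fp g"
  shows "fp (\<lambda>x. h (f x) (g x))"
  using fp_comp[OF assms(1) fp_Pair[OF assms(2,3)]] by simp

lemma fp_size:
  assumes "fp f"
  shows "\<exists>q. pb q \<and> (\<forall>x. sz (f x) \<le> q (sz x)) \<and> mono q"
proof -
  obtain k where k: "\<And>x. sz (f x) \<le> (sz x + 1) ^ k" using assms unfolding fp_def by blast
  have "mono (\<lambda>n :: nat. (n + 1) ^ k)" by (intro monoI power_mono) auto
  moreover have "pb (\<lambda>n. (n + 1) ^ k)" by (intro pb_intros)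
  ultimately show ?thesis using k by blast
qed

text \<open>The usual way to meet the size condition: polynomially many steps that each add a
  polynomial amount.\<close>

lemma fp_foldl_add:
  assumes f: "fp (\<lambda>p. f (fst p) (fst (snd p)) (snd (snd p)))" and init: "fp init" and xs: "fp xs"
    and q: "pb q" "\<And>e a y. y \<in> set (xs e) \<Longrightarrow> sz (f e a y) \<le> sz a + q (sz e)"
  shows "fp (\<lambda>e. foldl (f e) (init e) (xs e))"
proof -
  obtain r where r: "pb r" "\<And>e. sz (init e) \<le> r (sz e)" using fp_size[OF init] by blast
  obtain l where l: "pb l" "\<And>e. sz (xs e) \<le> l (sz e)" using fp_size[OF xs] by blast
  show ?thesis
  proof (rule fp_foldl[OF f init xs, of "\<lambda>n. r n + l n * q n"])
    show "pb (\<lambda>n. r n + l n * q n)" by (intro pb_intros q r l)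
    fix e ys zs assume e: "xs e = ys @ zs"
    have "set ys \<subseteq> set (xs e) \<Longrightarrow> sz (foldl (f e) (init e) ys) \<le> sz (init e) + length ys * q (sz e)" for ys
    proof (induction ys rule: rev_induct)
      case (snoc y ys)
      then have "sz (f e (foldl (f e) (init e) ys) y) \<le> sz (foldl (f e) (init e) ys) + q (sz e)"
        using q(2) by auto
      then show ?case using snoc by simp
    qed simp
    from this[of ys] have "sz (foldl (f e) (init e) ys) \<le> sz (init e) + length ys * q (sz e)"
      by (simp add: e)
    moreover have "length ys * q (sz e) \<le> l (sz e) * q (sz e)"
      using length_le_sz[of "xs e"] l(2)[of e] by (intro mult_right_mono) (auto simp: e)
    ultimately show "sz (foldl (f e) (init e) ys) \<le> r (sz e) + l (sz e) * q (sz e)"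
      using r(2)[of e] by linarith
  qed
qed

lemma fp_foldl_const:
  assumes f: "fp (\<lambda>p. f (fst p) (fst (snd p)) (snd (snd p)))" and init: "fp init" and xs: "fp xs"
    and q: "\<And>e a y. sz (f e a y) \<le> c"
  shows "fp (\<lambda>e. foldl (f e) (init e) (xs e))"
proof (rule fp_foldl_add[OF f init xs pb_const[of c]])
  show "sz (f e a y) \<le> sz a + c" for e a y using q[of e a y] by simp
qed

subsection \<open>Lists\<close>

lemma foldl_rev: "foldl (\<lambda>a x. x # a) ys xs = rev xs @ ys"
  by (induction xs arbitrary: ys) auto

lemma fp_revapp: "fp (\<lambda>p. rev (fst p) @ snd p)"
proof -
  have "fp (\<lambda>p. foldl (\<lambda>a x. x # a) (snd p) (fst p))"
    by (rule fp_foldl_add[OF _ _ _ pb_Suc[OF pb_id]])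
      (use sz_member sz_fst_snd(1) less_trans in \<open>fastforce intro!: fp_intros\<close>)+
  then show ?thesis by (simp add: foldl_rev)
qed

lemma fp_rev [fp_intros]: "fp f \<Longrightarrow> fp (\<lambda>x. rev (f x))"
  using fp_bin[of "\<lambda>x y. rev x @ y", OF fp_revapp _ fp_const[of "[]"]] by simp

lemma fp_append [fp_intros]: "fp f \<Longrightarrow> fp g \<Longrightarrow> fp (\<lambda>x. f x @ g x)"
  using fp_bin[of "\<lambda>x y. rev x @ y", OF fp_revapp fp_rev[of f]] by simp

lemma foldl_map: "foldl (\<lambda>a x. f x # a) ys xs = rev (map f xs) @ ys"
  by (induction xs arbitrary: ys) auto

lemma fp_param:
  assumes f: "fp (\<lambda>p. f (fst p) (snd p))" and xs: "fp xs"
  shows "\<exists>q. pb q \<and> (\<forall>e. \<forall>y \<in> set (xs e). sz (f e y) \<le> q (sz e))"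
proof -
  obtain r where r: "pb r" "\<And>p. sz (f (fst p) (snd p)) \<le> r (sz p)" "mono r" using fp_size[OF f] by blast
  obtain l where l: "pb l" "\<And>e. sz (xs e) \<le> l (sz e)" using fp_size[OF xs] by blast
  have "sz (f e y) \<le> r (Suc (sz e + l (sz e)))" if "y \<in> set (xs e)" for e y
  proof -
    have "sz (e, y) \<le> Suc (sz e + l (sz e))" using sz_member[OF that] l(2)[of e] by simp
    from order_trans[OF r(2)[of "(e, y)"] monoD[OF r(3) this]] show ?thesis by simp
  qed
  moreover have "pb (\<lambda>n. r (Suc (n + l n)))"
    by (rule pb_comp[OF r(1)]) (auto intro!: pb_intros l)
  ultimately show ?thesis by blast
qed

lemma fp_arg3: "fp (\<lambda>p. f (fst p) (snd p)) \<Longrightarrow> fp (\<lambda>p. f (fst p) (snd (snd p)))"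
  using fp_comp[of "\<lambda>p. f (fst p) (snd p)" "\<lambda>p. (fst p, snd (snd p))"] by (simp add: fp_intros)

lemma fp_map [fp_intros]:
  assumes f: "fp (\<lambda>p. f (fst p) (snd p))" and xs: "fp xs"
  shows "fp (\<lambda>e. map (f e) (xs e))"
proof -
  obtain q where q: "pb q" "\<And>e y. y \<in> set (xs e) \<Longrightarrow> sz (f e y) \<le> q (sz e)"
    using fp_param[OF f xs] by blast
  have "fp (\<lambda>e. foldl (\<lambda>a x. f e x # a) [] (xs e))"
    by (rule fp_foldl_add[OF _ _ _ pb_Suc[OF q(1)]]) (use q(2) in \<open>auto intro!: fp_intros fp_arg3 f xs\<close>)
  from fp_rev[OF this] show ?thesis by (simp add: foldl_map)
qed

lemma foldl_filter: "foldl (\<lambda>a x. if P x then x # a else a) ys xs = rev (filter P xs) @ ys"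
  by (induction xs arbitrary: ys) auto

lemma fp_filter [fp_intros]:
  assumes f: "fp (\<lambda>p. P (fst p) (snd p))" and xs: "fp xs"
  shows "fp (\<lambda>e. filter (P e) (xs e))"
proof -
  obtain q where q: "pb q" "\<And>e y. y \<in> set (xs e) \<Longrightarrow> sz y \<le> q (sz e)"
    using fp_param[OF fp_snd[OF fp_id] xs] by blast
  have "fp (\<lambda>e. foldl (\<lambda>a x. if P e x then x # a else a) [] (xs e))"
    by (rule fp_foldl_add[OF _ _ _ pb_Suc[OF q(1)]]) (use q(2) in \<open>auto intro!: fp_intros fp_arg3 f xs\<close>)
  from fp_rev[OF this] show ?thesis by (simp add: foldl_filter)
qed

lemma foldl_concat: "foldl (@) ys xss = ys @ concat xss"
  by (induction xss arbitrary: ys) auto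

lemma fp_concat [fp_intros]:
  assumes xs: "fp xs"
  shows "fp (\<lambda>e. concat (xs e))"
proof -
  obtain q where q: "pb q" "\<And>e y. y \<in> set (xs e) \<Longrightarrow> sz y \<le> q (sz e)"
    using fp_param[OF fp_snd[OF fp_id] xs] by blast
  have "fp (\<lambda>e. foldl (@) [] (xs e))"
  proof (rule fp_foldl_add[OF _ _ _ q(1)])
    show "sz (a @ y) \<le> sz a + q (sz e)" if "y \<in> set (xs e)" for e y and a :: "'b list"
      using sz_append[of a y] q(2)[OF that] by simp
  qed (intro fp_intros xs)+
  then show ?thesis by (simp add: foldl_concat)
qed

lemma foldl_length: "foldl (\<lambda>a x. Suc a) n xs = n + length xs"
  by (induction xs arbitrary: n) auto

lemma fp_length [fp_intros]:
  assumes xs: "fp xs"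
  shows "fp (\<lambda>e. length (xs e))"
proof -
  have "fp (\<lambda>e. foldl (\<lambda>a x. Suc a) 0 (xs e))"
    by (rule fp_foldl_add[OF _ _ _ pb_const[of 2]]) (auto intro!: fp_intros xs)
  then show ?thesis by (simp add: foldl_length)
qed

lemma fp_conj [fp_intros]: assumes "fp f" "fp g" shows "fp (\<lambda>x. f x \<and> g x)"
proof -
  have "fp (\<lambda>x. if f x then g x else False)" by (intro fp_intros assms)
  moreover have "(\<lambda>x. if f x then g x else False) = (\<lambda>x. f x \<and> g x)" by auto
  ultimately show ?thesis by simp
qed

lemma fp_not [fp_intros]: assumes "fp f" shows "fp (\<lambda>x. \<not> f x)"
proof -
  have "fp (\<lambda>x. if f x then False else True)" by (intro fp_intros assms)
  moreover have "(\<lambda>x. if f x then False else True) = (\<lambda>x. \<not> f x)" by auto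
  ultimately show ?thesis by simp
qed

lemma fp_disj [fp_intros]: assumes "fp f" "fp g" shows "fp (\<lambda>x. f x \<or> g x)"
  using fp_not[OF fp_conj[OF fp_not[OF assms(1)] fp_not[OF assms(2)]]] by simp

lemma fp_imp [fp_intros]: assumes "fp f" "fp g" shows "fp (\<lambda>x. f x \<longrightarrow> g x)"
  using fp_not[OF fp_conj[OF assms(1) fp_not[OF assms(2)]]] by simp

lemma foldl_Ball: "foldl (\<lambda>a x. a \<and> P x) b xs \<longleftrightarrow> b \<and> (\<forall>x \<in> set xs. P x)"
  by (induction xs arbitrary: b) auto

lemma fp_Ball [fp_intros]:
  assumes P: "fp (\<lambda>p. P (fst p) (snd p))" and xs: "fp xs"
  shows "fp (\<lambda>e. \<forall>x \<in> set (xs e). P e x)"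
proof -
  have "fp (\<lambda>e. foldl (\<lambda>a x. a \<and> P e x) True (xs e))"
    by (rule fp_foldl_const[of _ _ _ 3]) (auto intro!: fp_intros fp_arg3[of P] P xs sz_bool)
  then show ?thesis by (simp add: foldl_Ball)
qed

lemma fp_Bex [fp_intros]:
  assumes P: "fp (\<lambda>p. P (fst p) (snd p))" and xs: "fp xs"
  shows "fp (\<lambda>e. \<exists>x \<in> set (xs e). P e x)"
  using fp_not[OF fp_Ball[OF fp_not[OF P] xs]] by simp

lemma fp_member [fp_intros]:
  assumes x: "fp x" and xs: "fp xs"
  shows "fp (\<lambda>e. x e \<in> set (xs e))"
proof -
  have "fp (\<lambda>e. \<exists>y \<in> set (xs e). y = x e)" by (intro fp_intros fp_comp[OF x] xs)
  then show ?thesis by simp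
qed

lemma fp_tl [fp_intros]: assumes "fp f" shows "fp (\<lambda>x. tl (f x))"
proof -
  have "fp (\<lambda>x. case f x of [] \<Rightarrow> [] | y # ys \<Rightarrow> ys)" by (intro fp_intros assms)
  moreover have "(case l of [] \<Rightarrow> [] | y # ys \<Rightarrow> ys) = tl l" for l :: "'b list" by (cases l) auto
  ultimately show ?thesis by simp
qed

lemma fp_units [fp_intros]: "fp n \<Longrightarrow> fp (\<lambda>e. replicate (n e) ())"
proof (rule fp_rel[of n])
  have "tr (replicate k ()) = tr k" for k by (induction k) (auto simp: tr_unit_def)
  then show "\<exists>x. tr x = tr y \<and> tr (n x) = tr (replicate (n y) ())" for y by auto
qed

lemma fp_funpow:
  fixes f :: "'e :: cod \<Rightarrow> 'b :: cod \<Rightarrow> 'b"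
  assumes f: "fp (\<lambda>p. f (fst p) (snd p))" and init: "fp init" and n: "fp n"
    and q: "pb q" "\<And>e i. i \<le> n e \<Longrightarrow> sz ((f e ^^ i) (init e)) \<le> q (sz e)"
  shows "fp (\<lambda>e. (f e ^^ n e) (init e))"
proof -
  have fl: "foldl (\<lambda>a u. g a) x us = (g ^^ length us) x" for g :: "'b \<Rightarrow> 'b" and x and us :: "unit list"
    by (induction us arbitrary: x) (simp_all add: funpow_swap1)
  have "fp (\<lambda>e. foldl (\<lambda>a u. f e a) (init e) (replicate (n e) ()))"
  proof (rule fp_foldl[OF _ init fp_units[OF n] q(1)])
    show "fp (\<lambda>p. f (fst p) (fst (snd p)))"
      using fp_comp[OF f, of "\<lambda>p. (fst p, fst (snd p))"] by (simp add: fp_intros)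
    fix e and ys zs :: "unit list" assume "replicate (n e) () = ys @ zs"
    then have "length ys \<le> n e" by (metis length_append length_replicate le_add1)
    then show "sz (foldl (\<lambda>a u. f e a) (init e) ys) \<le> q (sz e)" unfolding fl by (rule q(2))
  qed
  then show ?thesis by (simp add: fl)
qed

lemma fp_pred [fp_intros]: assumes "fp f" shows "fp (\<lambda>x. f x - Suc 0)"
proof -
  have "fp (\<lambda>x. case f x of 0 \<Rightarrow> 0 | Suc n \<Rightarrow> n)" by (intro fp_intros assms)
  moreover have "(case l of 0 \<Rightarrow> 0 | Suc n \<Rightarrow> n) = l - Suc 0" for l by (cases l) auto
  ultimately show ?thesis by simp
qed

lemma fp_drop [fp_intros]: assumes "fp n" "fp xs" shows "fp (\<lambda>e. drop (n e) (xs e))"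
proof -
  have pw: "(tl ^^ n) l = drop n l" for n and l :: "'b list"
    by (induction n arbitrary: l) (auto simp: drop_Suc drop_tl)
  obtain q where q: "pb q" "\<And>e. sz (xs e) \<le> q (sz e)" using fp_size[OF assms(2)] by metis
  have "fp (\<lambda>e. (tl ^^ n e) (xs e))"
    by (rule fp_funpow[OF _ assms(2,1) q(1)])
       (auto simp: pw intro!: fp_intros order_trans[OF sz_drop] q(2))
  then show ?thesis by (simp add: pw)
qed

text \<open>\<open>xs ! i\<close> is unspecified beyond the length of the list; the default makes
  the access a computable function.\<close>

definition nthd :: "'a \<Rightarrow> 'a list \<Rightarrow> nat \<Rightarrow> 'a" where
  "nthd d xs i = (case drop i xs of [] \<Rightarrow> d | x # _ \<Rightarrow> x)"

lemma nthd: "nthd d xs i = (if i < length xs then xs ! i else d)"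
  by (simp add: nthd_def Cons_nth_drop_Suc[symmetric])

lemma fp_nthd [fp_intros]: "fp d \<Longrightarrow> fp xs \<Longrightarrow> fp i \<Longrightarrow> fp (\<lambda>e. nthd (d e) (xs e) (i e))"
  unfolding nthd_def by (intro fp_intros)

lemma foldl_take: "foldl (\<lambda>a x. if length a < n then x # a else a) [] xs = rev (take n xs)"
proof (induction xs rule: rev_induct)
  case (snoc x xs)
  then show ?case by (cases "length xs < n") (auto simp: min_def)
qed simp

lemma fp_natsub0: "fp (\<lambda>p. fst p - snd p :: nat)"
proof -
  have pw: "((\<lambda>x. x - Suc 0) ^^ n) l = l - n" for n l :: nat
    by (induction n arbitrary: l) auto
  have "fp (\<lambda>p :: nat \<times> nat. ((\<lambda>x. x - Suc 0) ^^ snd p) (fst p))"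
    by (rule fp_funpow[OF _ _ _ pb_id]) (auto simp: pw sz_nat intro!: fp_intros)
  then show ?thesis by (simp add: pw)
qed

lemma fp_minus [fp_intros]: "fp f \<Longrightarrow> fp g \<Longrightarrow> fp (\<lambda>x. f x - g x :: nat)"
  using fp_bin[of "(-) :: nat \<Rightarrow> nat \<Rightarrow> nat", OF fp_natsub0] .

lemma fp_le [fp_intros]: "fp f \<Longrightarrow> fp g \<Longrightarrow> fp (\<lambda>x. (f x :: nat) \<le> g x)"
  using fp_eq[OF fp_minus[of f g] fp_const[of 0]] by simp

lemma fp_less [fp_intros]: "fp f \<Longrightarrow> fp g \<Longrightarrow> fp (\<lambda>x. (f x :: nat) < g x)"
  using fp_le[OF fp_Suc[of f], of g] by (simp add: Suc_le_eq)

lemma fp_plus0: "fp (\<lambda>p. fst p + snd p :: nat)"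
proof -
  have "fp (\<lambda>p :: nat \<times> nat. (Suc ^^ snd p) (fst p))"
    by (rule fp_funpow[OF _ _ _ pb_id]) (auto simp: sz_nat intro!: fp_intros)
  then show ?thesis by (simp add: add.commute)
qed

lemma fp_plus [fp_intros]: "fp f \<Longrightarrow> fp g \<Longrightarrow> fp (\<lambda>x. f x + g x :: nat)"
  using fp_bin[of "(+) :: nat \<Rightarrow> nat \<Rightarrow> nat", OF fp_plus0] .

lemma fp_times0: "fp (\<lambda>p. fst p * snd p :: nat)"
proof -
  have pw: "((\<lambda>a. a + m) ^^ n) 0 = m * n" for n m :: nat
    by (induction n) auto
  have "fp (\<lambda>p :: nat \<times> nat. ((\<lambda>a. a + fst p) ^^ snd p) 0)"
  proof (rule fp_funpow[of "\<lambda>p a. a + fst p" _ _ "\<lambda>n. 2 * (n * n) + 1"])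
    show "sz (((\<lambda>a. a + fst p) ^^ i) 0) \<le> 2 * (sz p * sz p) + 1" if "i \<le> snd p" for p :: "nat \<times> nat" and i
    proof -
      have "fst p * i \<le> sz p * sz p" using that sz_fst_snd[of p] by (intro mult_mono) (auto simp: sz_nat)
      then show ?thesis unfolding pw sz_nat by simp
    qed
  qed (intro fp_intros pb_intros)+
  then show ?thesis by (simp add: pw)
qed

lemma fp_times [fp_intros]: "fp f \<Longrightarrow> fp g \<Longrightarrow> fp (\<lambda>x. f x * g x :: nat)"
  using fp_bin[of "times :: nat \<Rightarrow> nat \<Rightarrow> nat", OF fp_times0] .

lemma fp_power [fp_intros]: "fp f \<Longrightarrow> fp (\<lambda>x. f x ^ k :: nat)"
  by (induction k) (auto intro!: fp_intros)

lemma fp_take [fp_intros]: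
  assumes n: "fp n" and xs: "fp xs"
  shows "fp (\<lambda>e. take (n e) (xs e))"
proof -
  obtain q where q: "pb q" "\<And>e y. y \<in> set (xs e) \<Longrightarrow> sz y \<le> q (sz e)"
    using fp_param[OF fp_snd[OF fp_id] xs] by blast
  have "fp (\<lambda>e. foldl (\<lambda>a x. if length a < n e then x # a else a) [] (xs e))"
    by (rule fp_foldl_add[OF _ _ _ pb_Suc[OF q(1)]])
      (use q(2) in \<open>auto intro!: fp_intros fp_comp[OF n] xs\<close>)
  from fp_rev[OF this] show ?thesis by (simp add: foldl_take)
qed

lemma fp_upt [fp_intros]:
  assumes n: "fp n"
  shows "fp (\<lambda>e. [0..<n e])"
proof -
  have pw: "((\<lambda>l. l @ [length l]) ^^ i) [] = [0..<i]" for i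
    by (induction i) auto
  have szu: "sz [0..<i] \<le> 1 + i * (2 * i + 2)" for i
    using sz_list_bound[of "[0..<i]" "2 * i + 1"] by (auto simp: sz_nat)
  obtain q where q: "pb q" "\<And>e. sz (n e) \<le> q (sz e)" using fp_size[OF n] by metis
  have "fp (\<lambda>e. ((\<lambda>l. l @ [length l]) ^^ n e) [])"
  proof (rule fp_funpow[of "\<lambda>e l. l @ [length l]" _ _ "\<lambda>m. 1 + q m * (2 * q m + 2)"])
    fix e i assume "i \<le> n e"
    then have i: "i \<le> q (sz e)" using q(2)[of e] by (simp add: sz_nat)
    then have "i * (2 * i + 2) \<le> q (sz e) * (2 * q (sz e) + 2)" by (intro mult_mono) auto
    then show "sz (((\<lambda>l. l @ [length l]) ^^ i) []) \<le> 1 + q (sz e) * (2 * q (sz e) + 2)"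
      unfolding pw using szu[of i] by simp
  qed (intro fp_intros pb_intros q n)+
  then show ?thesis by (simp add: pw)
qed

lemma fp_replicate [fp_intros]: "fp n \<Longrightarrow> fp x \<Longrightarrow> fp (\<lambda>e. replicate (n e) (x e))"
proof -
  assume n: "fp n" and x: "fp x"
  have "fp (\<lambda>e. map (\<lambda>u. x e) (replicate (n e) ()))" by (intro fp_intros n fp_comp[OF x])
  then show ?thesis by (simp add: map_replicate)
qed

lemma fp_all_less [fp_intros]:
  assumes "fp (\<lambda>p. P (fst p) (snd p :: nat))" "fp n"
  shows "fp (\<lambda>e. \<forall>i < n e. P e i)"
proof -
  have "fp (\<lambda>e. \<forall>i \<in> set [0..<n e]. P e i)" by (intro fp_intros assms)
  then show ?thesis by (simp add: Ball_def)
qed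

lemma fp_ex_less [fp_intros]:
  assumes "fp (\<lambda>p. P (fst p) (snd p :: nat))" "fp n"
  shows "fp (\<lambda>e. \<exists>i < n e. P e i)"
  using fp_not[OF fp_all_less[OF fp_not[OF assms(1)] assms(2)]] by simp

section \<open>Reading the input and writing the output\<close>

definition in_com :: com where
  "in_com = Seq (Loop RA None (Ite RA (Some True) (Seq (Pop RA) (Push RB True)) (Seq (Pop RA) (Push RB False))))
     (Seq (Push RM False) (Loop RB None (Ite RB (Some True)
        (Seq (Pop RB) (push_code (True # code (tr True)))) (Seq (Pop RB) (push_code (True # code (tr False)))))))"

lemma inp_mst: "inp x = mst x [] [] [] []"
  by (auto simp: inp_def mst_def fun_eq_iff split: reg.splits)

lemma in_com1: "runs (Loop RA None (Ite RA (Some True) (Seq (Pop RA) (Push RB True)) (Seq (Pop RA) (Push RB False))))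
    (mst a m b n w) (mst [] m (rev a @ b) n w) (6 * length a + 1)"
proof (induction a arbitrary: b)
  case Nil show ?case using runs_LoopF[of None "mst [] m b n w" RA] by simp
next
  case (Cons x a)
  have "runs (Ite RA (Some True) (Seq (Pop RA) (Push RB True)) (Seq (Pop RA) (Push RB False)))
     (mst (x # a) m b n w) (mst a m (x # b) n w) (Suc (Suc (1 + 2)))"
    using runs_Seq[OF runs_basic(6) runs_basic(3)]
    by (cases x) (auto intro: runs_IteT runs_IteF)
  from runs_LoopT[OF _ this Cons[of "x # b"]] show ?case by (auto elim: runs_mono)
qed

text \<open>The code of a list is built from its end towards its beginning, hence the preceding
  reversal of the input onto \<open>RB\<close>.\<close>

lemma in_com2: "runs (Loop RB None (Ite RB (Some True)
        (Seq (Pop RB) (push_code (True # code (tr True)))) (Seq (Pop RB) (push_code (True # code (tr False))))))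
    (mst a (code (tr y) @ m) b n w) (mst a (code (tr (rev b @ y)) @ m) [] n w) (20 * length b + 1)"
proof (induction b arbitrary: y)
  case Nil show ?case using runs_LoopF[of None "mst a (code (tr y) @ m) [] n w" RB] by simp
next
  case (Cons x b)
  have 1: "runs (push_code (True # code (tr x))) (mst a (code (tr y) @ m) b n w) (mst a (code (tr (x # y)) @ m) b n w) 15"
    using runs_mono[OF push_code[of "True # code (tr x)" a "code (tr y) @ m" b n w], of 15]
    by (cases x) (simp_all add: tr_bool_simps)
  have "runs (Ite RB (Some True) (Seq (Pop RB) (push_code (True # code (tr True)))) (Seq (Pop RB) (push_code (True # code (tr False)))))
     (mst a (code (tr y) @ m) (x # b) n w) (mst a (code (tr (x # y)) @ m) b n w) (Suc (Suc (1 + 15)))"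
    by (rule runs_Ite_bool[of _ _ x b]) (use runs_Seq[OF runs_basic(8) 1, of x] in \<open>cases x; simp\<close>)+
  from runs_LoopT[OF _ this Cons[of "x # y"]] show ?case by (auto elim: runs_mono)
qed

lemma in_com: "runs in_com (inp x) (mst [] (code (tr x) @ []) [] [] []) (26 * length x + 10)"
proof -
  have 2: "runs (Push RM False) (mst [] [] (rev x @ []) [] []) (mst [] (code (tr ([] :: bool list)) @ []) (rev x) [] []) 2"
    using runs_basic(2) by simp
  have 3: "runs (Loop RB None (Ite RB (Some True)
        (Seq (Pop RB) (push_code (True # code (tr True)))) (Seq (Pop RB) (push_code (True # code (tr False))))))
    (mst [] (code (tr ([] :: bool list)) @ []) (rev x) [] []) (mst [] (code (tr x) @ []) [] [] []) (20 * length x + 1)"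
    using in_com2[of "[]" "[]" "[]" "rev x" "[]" "[]"] by simp
  show ?thesis unfolding in_com_def inp_mst
    by (rule runs_mono[OF runs_Seq[OF in_com1 runs_Seq[OF 2 3]]]) simp
qed

definition out_com :: com where
  "out_com = Loop RM (Some True) (Seq (Pop RM) (Ite RM (Some True)
     (Seq (Pop RM) (Seq (Pop RM) (Seq (Pop RM) (Out True)))) (Seq (Pop RM) (Out False))))"

lemma out_com: "runs out_com (mst [] (code (tr y) @ []) [] [] w) (mst [] [False] [] [] (w @ y)) (12 * length y + 1)"
proof (induction y arbitrary: w)
  case Nil show ?case unfolding out_com_def using runs_LoopF[of "Some True" "mst [] [False] [] [] w" RM] by simp
next
  case (Cons x y)
  have 1: "runs (Ite RM (Some True)
     (Seq (Pop RM) (Seq (Pop RM) (Seq (Pop RM) (Out True)))) (Seq (Pop RM) (Out False)))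
     (mst [] (code (tr x) @ code (tr y)) [] [] w) (mst [] (code (tr y) @ []) [] [] (w @ [x])) 9"
  proof (cases x)
    case True
    have "runs (Seq (Pop RM) (Seq (Pop RM) (Seq (Pop RM) (Out True))))
      (mst [] (True # False # False # code (tr y)) [] [] w) (mst [] (code (tr y) @ []) [] [] (w @ [True])) 8"
      unfolding append_Nil2
      by (rule runs_mono[OF runs_Seq[OF runs_basic(7) runs_Seq[OF runs_basic(7)
        runs_Seq[OF runs_basic(7) runs_basic(5)]]]]) simp
    from runs_IteT[OF _ this] show ?thesis using True by (simp add: tr_bool_simps)
  next
    case False
    have "runs (Seq (Pop RM) (Out False))
      (mst [] (False # code (tr y)) [] [] w) (mst [] (code (tr y) @ []) [] [] (w @ [False])) 8"
      unfolding append_Nil2 by (rule runs_mono[OF runs_Seq[OF runs_basic(7) runs_basic(5)]]) simp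
    from runs_IteF[OF _ this] show ?thesis using False by (simp add: tr_bool_simps)
  qed
  have "runs (Pop RM) (mst [] (code (tr (x # y)) @ []) [] [] w) (mst [] (code (tr x) @ code (tr y)) [] [] w) 1"
    using runs_basic(7) by simp
  from runs_LoopT[OF _ runs_Seq[OF this 1] Cons[of "w @ [x]", unfolded out_com_def]] show ?case
    unfolding out_com_def by (auto elim: runs_mono)
qed

section \<open>From computable functions to complexity classes\<close>

lemma sz_string: "sz (x :: bool list) \<le> 4 * length x + 1"
  using sz_list_bound[of x 3] sz_bool by simp

lemma pb_bigo:
  assumes "pb p"
  shows "\<exists>k. (\<lambda>n. real (p n)) \<in> O(\<lambda>n. real n ^ k)"
proof -
  obtain k where k: "\<And>n. n \<ge> 1 \<Longrightarrow> p n \<le> (n + 1) ^ k" using assms unfolding pb_def by metis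
  have "norm (real (p n)) \<le> 2 ^ k * norm (real n ^ k)" if "n \<ge> 1" for n
  proof -
    have "p n \<le> (2 * n) ^ k" using k[OF that] power_mono[of "n + 1" "2 * n" k] that by linarith
    then have "real (p n) \<le> real ((2 * n) ^ k)" by (rule of_nat_mono)
    also have "\<dots> = 2 ^ k * real n ^ k" by (simp add: power_mult_distrib)
    finally show ?thesis by simp
  qed
  then have "(\<lambda>n. real (p n)) \<in> O(\<lambda>n. real n ^ k)"
    by (intro bigoI[of _ "2 ^ k"] eventually_sequentiallyI[of 1])
  then show ?thesis by blast
qed

theorem polytime_if_fp:
  assumes "fp f"
  shows "polytime_computable f"
proof -
  obtain c k where c: "\<And>x. calc c (tr x) (tr (f x)) ((sz x + 1) ^ k)" "\<And>x. sz (f x) \<le> (sz x + 1) ^ k"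
    using assms unfolding fp_def by blast
  let ?T = "\<lambda>n. 26 * n + 20 + 13 * (4 * n + 2) ^ k"
  have "\<exists>t \<le> ?T (length x). \<exists>s. exec (Seq in_com (Seq c out_com)) (inp x) t (s, f x)" for x
  proof -
    have sx: "(sz x + 1) ^ k \<le> (4 * length x + 2) ^ k" using sz_string[of x] by (intro power_mono) auto
    have "length (f x) \<le> (4 * length x + 2) ^ k"
      using length_le_sz[of "f x"] c(2)[of x] sx by linarith
    moreover have "runs c (mst [] (code (tr x) @ []) [] [] []) (mst [] (code (tr (f x)) @ []) [] [] []) ((4 * length x + 2) ^ k)"
      using calc_mono[OF c(1) sx] unfolding calc_def by blast
    ultimately have "runs (Seq in_com (Seq c out_com)) (inp x) (mst [] [False] [] [] ([] @ f x)) (?T (length x))"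
      by (intro runs_mono[OF runs_Seq[OF in_com runs_Seq[OF _ out_com]]]) auto
    then show ?thesis unfolding runs_def mst_def by auto
  qed
  from machine_computes[OF this] have "computes_within (machine (Seq in_com (Seq c out_com))) f ?T" by simp
  moreover have "pb ?T" by (intro pb_intros)
  ultimately show ?thesis unfolding polytime_computable_def using machine_wf pb_bigo by metis
qed

text \<open>With exponent \<open>Suc k\<close> the pad exceeds the length of the input even for
  \<open>k = 0\<close>.\<close>

definition pad :: "nat \<Rightarrow> bool list \<Rightarrow> nat" where
  "pad k x = 2 ^ ((length x + 1) ^ Suc k)"

text \<open>With \<open>E = 2 ^ ((n + 1) ^ k)\<close>, a polynomial of degree \<open>l\<close> is at
  most \<open>E ^ (2 * l)\<close>, which only multiplies the exponent by a constant. From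
  \<open>2 * l * 2 ^ k + 1\<close> on, one more factor \<open>n\<close> in the exponent pays for
  this and for replacing \<open>n + 1\<close> by \<open>2 * n\<close>.\<close>

lemma expo_bigo:
  assumes "pb p"
  shows "\<exists>j. (\<lambda>n. real (p (2 ^ ((n + 1) ^ k)))) \<in> O(\<lambda>n. 2 ^ (n ^ j))"
proof -
  obtain l where l: "\<And>n. n \<ge> 1 \<Longrightarrow> p n \<le> (n + 1) ^ l" using assms unfolding pb_def by metis
  have "norm (real (p (2 ^ ((n + 1) ^ k)))) \<le> 1 * norm (2 ^ (n ^ (k + 1)) :: real)" if n: "n \<ge> 2 * l * 2 ^ k + 1" for n
  proof -
    let ?E = "2 ^ ((n + 1) ^ k) :: nat"
    have "p ?E \<le> (?E + 1) ^ l" by (rule l) simp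
    also have "\<dots> \<le> (?E * ?E) ^ l"
    proof (rule power_mono)
      have E2: "2 \<le> ?E" by (metis one_le_numeral one_le_power power_increasing power_one_right le_add2)
      have "?E + 1 \<le> 2 * ?E" using E2 by linarith
      also have "\<dots> \<le> ?E * ?E" using E2 by (intro mult_right_mono) auto
      finally show "?E + 1 \<le> ?E * ?E" .
    qed simp
    also have "\<dots> = 2 ^ (2 * l * (n + 1) ^ k)"
      by (simp add: power_mult[symmetric] power_add[symmetric] algebra_simps flip: mult_2)
    also have "\<dots> \<le> 2 ^ (n ^ (k + 1))"
    proof (rule power_increasing)
      have "(n + 1) ^ k \<le> (2 * n) ^ k" using n by (intro power_mono) auto
      then have "2 * l * (n + 1) ^ k \<le> 2 * l * (2 ^ k * n ^ k)" by (simp add: power_mult_distrib)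
      also have "\<dots> \<le> n * n ^ k" using n by (simp add: mult.assoc[symmetric] mult_right_mono)
      finally show "2 * l * (n + 1) ^ k \<le> n ^ (k + 1)" by simp
    qed simp
    finally have "real (p ?E) \<le> real (2 ^ (n ^ (k + 1)))" by (rule of_nat_mono)
    then show ?thesis by simp
  qed
  then have "(\<lambda>n. real (p (2 ^ ((n + 1) ^ k)))) \<in> O(\<lambda>n. 2 ^ (n ^ (k + 1)))"
    by (intro bigoI[of _ 1] eventually_sequentiallyI[of "2 * l * 2 ^ k + 1"])
  then show ?thesis by blast
qed

text \<open>The padding is computed by repeated doubling, so only its result has exponential size.\<close>

lemma calc_pad:
  obtains c p where "pb p"
    "\<And>x :: bool list. calc c (tr x) (tr (pad k x)) (p (pad k x))"
proof -
  let ?f = "\<lambda>(e :: unit) (a :: nat) (y :: unit). a + a"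
  have ff: "fp (\<lambda>p :: unit \<times> nat \<times> unit. ?f (fst p) (fst (snd p)) (snd (snd p)))" by (intro fp_intros)
  obtain b j where b: "\<And>x. calc b (tr x) (tr (fold_step ?f x)) ((sz x + 1) ^ j)"
    using fp_fold_step[of ?f, OF ff] unfolding fp_def by blast
  have "fp (\<lambda>x :: bool list. (replicate ((length x + 1) ^ Suc k) (), (), Suc 0))"
    by (intro fp_intros)
  then obtain d l where d: "\<And>x :: bool list. calc d (tr x) (tr (replicate ((length x + 1) ^ Suc k) (), (), Suc 0)) ((sz x + 1) ^ l)"
    unfolding fp_def by blast
  obtain e i where e: "\<And>x :: unit \<times> nat. calc e (tr x) (tr (snd x)) ((sz x + 1) ^ i)"
    using fp_snd0 unfolding fp_def by blast
  let ?g = "\<lambda>(p :: unit \<times> nat) (y :: unit). (fst p, snd p + snd p)"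
  have fl: "foldl ?g ((), a) ys = ((), a * 2 ^ length ys)" for a ys
    by (induction ys arbitrary: a) auto
  let ?B = "\<lambda>n. (4 * n + 10) ^ j"
  let ?p = "\<lambda>n. (4 * n + 2) ^ l + (?B n + 6) * n + 10 + (2 * n + 10) ^ i"
  have "calc (Seq d (Seq (fold_com b) e)) (tr x) (tr (pad k x)) (?p (pad k x))" for x :: "bool list"
  proof -
    let ?m = "(length x + 1) ^ Suc k" and ?n = "pad k x"
    have mn: "?m < ?n" unfolding pad_def by (rule less_exp)
    have lm: "length x < ?m"
      using self_le_power[of "length x + 1" "Suc k"] by (simp del: power_Suc)
    have lx: "(sz x + 1) ^ l \<le> (4 * ?n + 2) ^ l" using mn lm sz_string[of x] by (intro power_mono) auto
    have 1: "calc (fold_com b) (Nd (tr (replicate ?m ())) (tr ((), Suc 0))) (tr (foldl ?g ((), Suc 0) (replicate ?m ()))) ((?B ?n + 6) * length (replicate ?m ()) + 6)"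
    proof (rule fold_com)
      fix y :: unit and ys zs assume xe: "replicate ?m () = ys @ y # zs"
      let ?x = "(y # zs, foldl ?g ((), Suc 0) ys)"
      have st: "fold_step ?f ?x = (zs, foldl ?g ((), Suc 0) (ys @ [y]))"
        by (simp add: fold_step_def fl)
      have len: "?m = length ys + Suc (length zs)" using arg_cong[OF xe, of length] by simp
      have "sz zs \<le> 2 * length zs + 1" using sz_list_bound[of zs 1] by simp
      then have szy: "sz (y # zs) \<le> 2 * ?m + 1" using len by simp
      have "(2 :: nat) ^ length ys \<le> 2 ^ ?m" using len by (intro power_increasing) auto
      then have pw: "2 ^ length ys \<le> ?n" by (simp add: pad_def)
      have "sz ?x = sz (y # zs) + 2 * 2 ^ length ys + 4"
        unfolding fl by (simp add: sz_nat)
      then have "sz ?x + 1 \<le> 4 * ?n + 10" using szy mn pw by linarith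
      then have "(sz ?x + 1) ^ j \<le> ?B ?n" by (intro power_mono) auto
      from calc_mono[OF b this] show "calc b (Nd (tr (y # zs)) (tr (foldl ?g ((), Suc 0) ys)))
          (Nd (tr zs) (tr (foldl ?g ((), Suc 0) (ys @ [y])))) (?B ?n)"
        unfolding st tr_Pair .
    qed
    have fin: "foldl ?g ((), Suc 0) (replicate ?m ()) = ((), ?n)"
      using fl[of "Suc 0" "replicate ?m ()"] by (simp add: pad_def del: power_Suc)
    have "calc (fold_com b) (tr (replicate ?m (), (), Suc 0)) (tr ((), ?n)) ((?B ?n + 6) * ?n + 6)"
      using calc_mono[OF 1, of "(?B ?n + 6) * ?n + 6"] mn unfolding fin tr_Pair[of "replicate ?m ()"] by simp
    moreover have "calc e (tr ((), ?n)) (tr ?n) ((2 * ?n + 10) ^ i)"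
      by (rule calc_mono[OF e[of "((), ?n)", simplified snd_conv]]) (auto simp: sz_nat intro!: power_mono)
    ultimately have 2: "calc (Seq (fold_com b) e) (tr (replicate ?m (), (), Suc 0)) (tr ?n) (Suc ((?B ?n + 6) * ?n + 6 + (2 * ?n + 10) ^ i))"
      by (rule calc_Seq)
    show ?thesis
      by (rule calc_mono[OF calc_Seq[OF calc_mono[OF d lx] 2]]) simp
  qed
  moreover have "pb ?p" by (intro pb_intros)
  ultimately show ?thesis using that by blast
qed

text \<open>Padding: time polynomial in the unary number \<open>pad k x\<close> is exponential in
  the length of \<open>x\<close>. The algorithm receives the pad as a second argument and may use it
  as fuel and as a cap on sizes.\<close>

theorem EXPTIME_if_fp:
  assumes P: "fp P" and L: "\<And>x. x \<in> L \<longleftrightarrow> P (x, pad k x)"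
  shows "L \<in> EXPTIME"
proof -
  obtain c q where c: "pb q" "\<And>x :: bool list. calc c (tr x) (tr (pad k x)) (q (pad k x))"
    using calc_pad by blast
  obtain d l where d: "\<And>x. calc d (tr x) (tr (P x)) ((sz x + 1) ^ l)"
    using P unfolding fp_def by blast
  let ?p = "\<lambda>n. 600 * n + 400 + q n + (6 * n + 6) ^ l"
  let ?c = "Seq in_com (Seq (pair_com Skip c) d)"
  have "\<exists>t s. Suc (Suc (Suc t)) \<le> ?p (pad k x) \<and> exec ?c (inp x) t s \<and> holds (Some True) (fst s RM) = (x \<in> L)" for x
  proof -
    let ?n = "pad k x"
    have "length x < (length x + 1) ^ Suc k"
      using self_le_power[of "length x + 1" "Suc k"] by (simp del: power_Suc)
    then have ln: "length x < ?n" unfolding pad_def using less_exp less_trans by blast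
    then have szx: "sz x \<le> 4 * ?n + 1" using sz_string[of x] by linarith
    have sk: "calc Skip (tr x) (tr x) 1" unfolding calc_def using runs_Skip by blast
    have 1: "calc (pair_com Skip c) (tr x) (tr (x, ?n)) (1 + q ?n + 50 * (sz x + sz x + sz ?n) + 60)"
      using pair_com[OF sk c(2)] by (simp add: sz_def tr_Pair)
    have "(sz (x, ?n) + 1) ^ l \<le> (6 * ?n + 6) ^ l"
      using szx by (intro power_mono) (auto simp: sz_nat)
    then have 2: "calc d (tr (x, ?n)) (tr (P (x, ?n))) ((6 * ?n + 6) ^ l)" using calc_mono[OF d] by blast
    have 3: "runs (Seq (pair_com Skip c) d) (mst [] (code (tr x) @ []) [] [] []) (mst [] (code (tr (P (x, ?n))) @ []) [] [] [])
        (Suc (1 + q ?n + 50 * (sz x + sz x + sz ?n) + 60 + (6 * ?n + 6) ^ l))"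
      using calc_Seq[OF 1 2] unfolding calc_def by blast
    have "runs ?c (inp x) (mst [] (code (tr (P (x, ?n))) @ []) [] [] []) (?p ?n - 3)"
      by (rule runs_mono[OF runs_Seq[OF in_com 3]]) (use ln szx in \<open>simp add: sz_nat\<close>)
    then obtain t where t: "t \<le> ?p ?n - 3" "exec ?c (inp x) t (mst [] (code (tr (P (x, ?n))) @ []) [] [] [])"
      unfolding runs_def by blast
    have "holds (Some True) (code (tr (P (x, ?n))) @ []) = (x \<in> L)"
      unfolding L by (cases "P (x, ?n)") (simp_all add: tr_bool_simps)
    then show ?thesis using t by (intro exI[of _ t] exI conjI) auto
  qed
  then have dec: "decides_within (machine (Seq ?c answer)) L (\<lambda>n. ?p (2 ^ ((n + 1) ^ Suc k)))"
    by (intro machine_decides) (simp add: pad_def)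
  have pb: "pb ?p" by (intro pb_intros c(1))
  obtain j where j: "(\<lambda>n. real (?p (2 ^ ((n + 1) ^ Suc k)))) \<in> O(\<lambda>n. 2 ^ (n ^ j))"
    using expo_bigo[OF pb, of "Suc k"] by blast
  have "L \<in> DTIME (\<lambda>n. 2 ^ (n ^ j))"
    unfolding DTIME_def by (intro CollectI exI conjI) (rule machine_wf, rule dec, rule j)
  then show ?thesis unfolding EXPTIME_def by blast
qed

section \<open>Muller games\<close>

lemma funpow_stable:
  fixes F :: "'v set \<Rightarrow> 'v set"
  assumes mono: "mono F" and V: "finite V" "\<And>Z. F Z \<subseteq> V" and N: "card V \<le> N"
  shows "F ((F ^^ N) {}) = (F ^^ N) {}"
proof (rule ccontr)
  let ?Z = "\<lambda>i. (F ^^ i) {}"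
  assume ne: "F (?Z N) \<noteq> ?Z N"
  have sub: "?Z i \<subseteq> V" for i using V(2) by (cases i) auto
  have inc: "?Z i \<subseteq> ?Z (Suc i)" for i
  proof (induction i)
    case (Suc i) show ?case using monoD[OF mono Suc.IH] by (simp only: funpow.simps o_apply)
  qed simp
  have strict: "?Z i \<noteq> ?Z (Suc i)" if "i \<le> N" for i
  proof
    assume "?Z i = ?Z (Suc i)"
    then have fx: "F (?Z i) = ?Z i" by (simp only: funpow.simps o_apply)
    have "?Z (i + d) = ?Z i" for d by (induction d) (simp_all add: fx)
    from this[of "N - i"] this[of "Suc (N - i)"] that ne show False by simp
  qed
  have "i \<le> Suc N \<Longrightarrow> i \<le> card (?Z i)" for i
  proof (induction i)
    case (Suc i)
    then have "?Z i \<subset> ?Z (Suc i)" using inc[of i] strict[of i] by auto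
    then have "card (?Z i) < card (?Z (Suc i))"
      by (rule psubset_card_mono[OF finite_subset[OF sub V(1)]])
    then show ?case using Suc by simp
  qed simp
  from this[of "Suc N"] card_mono[OF V(1) sub, of "Suc N"] N show False by simp
qed

text \<open>\<open>own\<close> marks the positions of the player whose winning region is computed,
  and \<open>win\<close> the colour sets this player wants to see infinitely often. \<open>N\<close>
  is only an upper bound, since the algorithm knows the length of a list of positions. As every
  position has a colour, no play stays within \<open>D = {}\<close>.\<close>

locale muller =
  fixes V :: "'v set" and own :: "'v \<Rightarrow> bool" and E :: "'v \<Rightarrow> 'v set"
    and col :: "'v \<Rightarrow> 'c set" and win :: "'c set \<Rightarrow> bool" and N :: nat
  assumes fin: "finite V" and card_V: "card V \<le> N" and EV: "v \<in> V \<Longrightarrow> E v \<subseteq> V"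
    and col_ne: "v \<in> V \<Longrightarrow> col v \<noteq> {}"
begin

definition cpre :: "'v set \<Rightarrow> 'v set" where
  "cpre Z = {v \<in> V. if own v then \<exists>u \<in> E v. u \<in> Z else \<forall>u \<in> E v. u \<in> Z}"

text \<open>Leaving the sub-game for \<open>D - {c}\<close> at a position with colours in
  \<open>D\<close> means that \<open>c\<close> was seen; then one controlled step into
  \<open>Z\<close> restarts the recursion. If the colours leave \<open>D\<close> altogether, the old
  target counts.\<close>

definition tgt :: "'c set \<Rightarrow> 'v set \<Rightarrow> 'v set \<Rightarrow> 'v set" where
  "tgt D T Z = {v \<in> V. if col v \<subseteq> D then v \<in> cpre Z else v \<in> T}"

text \<open>If \<open>D\<close> is winning, the player must be able, for every \<open>c\<close> in
  \<open>D\<close>, to win without \<open>c\<close> or to see \<open>c\<close> and return to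
  \<open>Z\<close>; this calls for a greatest fixpoint. If \<open>D\<close> is losing, some colour
  has to be avoided from some time on, and each stage of a least fixpoint chooses which one.\<close>

definition F :: "('c set \<Rightarrow> 'v set \<Rightarrow> 'v set) \<Rightarrow> 'c set \<Rightarrow> 'v set \<Rightarrow> 'v set \<Rightarrow> 'v set" where
  "F w D T Z = {v \<in> V. if col v \<subseteq> D
     then (if win D then \<forall>c \<in> D. v \<in> w (D - {c}) (tgt D T Z) else \<exists>c \<in> D. v \<in> w (D - {c}) (tgt D T Z))
     else v \<in> T}"

definition start :: "'c set \<Rightarrow> 'v set" where "start D = (if win D then V else {})"

text \<open>
  \<open>W n D T\<close> is the set of positions from which the owner of the \<open>own\<close>-positions can either
  reach a position of \<open>T\<close> through positions all of whose colours are in \<open>D\<close>, or stay forever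
  in such positions and win, provided that \<open>D\<close> has at most \<open>n\<close> elements.
\<close>

primrec W :: "nat \<Rightarrow> 'c set \<Rightarrow> 'v set \<Rightarrow> 'v set" where
  "W 0 D T = T"
| "W (Suc n) D T = (F (W n) D T ^^ N) (start D)"

lemma cpre_mono: "Z \<subseteq> Z' \<Longrightarrow> cpre Z \<subseteq> cpre Z'"
  by (auto simp: cpre_def split: if_splits)

lemma tgt_mono: "T \<subseteq> T' \<Longrightarrow> Z \<subseteq> Z' \<Longrightarrow> tgt D T Z \<subseteq> tgt D T' Z'"
  using cpre_mono[of Z Z'] by (auto simp: tgt_def split: if_splits)

lemma tgt_V: "tgt D T Z \<subseteq> V"
  by (auto simp: tgt_def)

lemma F_V: "F w D T Z \<subseteq> V"
  by (auto simp: F_def)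

lemma F_mono:
  assumes w: "\<And>D T T'. T \<subseteq> T' \<Longrightarrow> w D T \<subseteq> w D T'" and "T \<subseteq> T'" "Z \<subseteq> Z'"
  shows "F w D T Z \<subseteq> F w D T' Z'"
  using w[OF tgt_mono[OF assms(2,3)]] assms(2) by (fastforce simp: F_def split: if_splits)

lemma W_mono: "T \<subseteq> T' \<Longrightarrow> W n D T \<subseteq> W n D T'"
proof (induction n arbitrary: D T T')
  case (Suc n)
  note IH = Suc
  have "(F (W n) D T ^^ i) (start D) \<subseteq> (F (W n) D T' ^^ i) (start D)" for i
  proof (induction i)
    case (Suc i)
    from F_mono[OF IH(1) IH(2) this] show ?case by simp
  qed simp
  then show ?case by simp
qed simp

lemma iter_V: "(F w D T ^^ i) (start D) \<subseteq> V"
  using F_V by (cases i) (auto simp: start_def)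

definition dual_own :: "'v \<Rightarrow> bool" where "dual_own v = (\<not> own v)"
definition dual_win :: "'c set \<Rightarrow> bool" where "dual_win D = (\<not> win D)"

end

context muller begin

interpretation dual: muller V dual_own E col dual_win N
  using muller_axioms by (simp add: muller_def)

lemma dual_cpre: "dual.cpre (V - Z) = V - cpre Z"
  using EV by (auto simp: cpre_def dual.cpre_def dual_own_def split: if_splits)

lemma dual_tgt: "dual.tgt D (V - T) (V - Z) = V - tgt D T Z"
  by (auto simp: dual.tgt_def tgt_def dual_cpre)

lemma dual_F:
  assumes "\<And>D T. w' D (V - T) = V - w D T"
  shows "dual.F w' D (V - T) (V - Z) = V - F w D T Z"
  unfolding F_def dual.F_def dual_tgt assms by (auto simp: dual_win_def)

lemma dual_start: "dual.start D = V - start D"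
  by (auto simp: dual.start_def start_def dual_win_def)

text \<open>Complementing exchanges the quantifiers in \<open>F\<close>, the start sets and the
  owners in \<open>cpre\<close>, so the iterates for the two players are complements of each other
  at every stage. This is determinacy on the level of regions.\<close>

lemma dual_W: "dual.W n D (V - T) = V - W n D T"
proof (induction n arbitrary: D T)
  case (Suc n)
  have "(dual.F (dual.W n) D (V - T) ^^ i) (dual.start D) = V - (F (W n) D T ^^ i) (start D)" for i
    by (induction i) (simp_all add: dual_start dual_F[of "dual.W n" "W n", OF Suc.IH])
  then show ?case by simp
qed simp

text \<open>For losing \<open>D\<close> the iteration ascends from the empty set and is stable after
  \<open>N\<close> steps. For winning \<open>D\<close> it descends from \<open>V\<close>, and its
  complement is an ascending iteration of the dual game.\<close>

lemma W_fixpoint: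
  "F (W n) D T (W (Suc n) D T) = W (Suc n) D T"
proof (cases "win D")
  case False
  have "mono (F (W n) D T)" by (intro monoI F_mono W_mono) auto
  from funpow_stable[OF this fin F_V card_V] show ?thesis using False by (simp add: start_def)
next
  case True
  have "mono (dual.F (dual.W n) D (V - T))" by (intro monoI dual.F_mono dual.W_mono) auto
  from funpow_stable[OF this fin dual.F_V card_V]
  have "dual.F (dual.W n) D (V - T) (dual.W (Suc n) D (V - T)) = dual.W (Suc n) D (V - T)"
    using True by (simp add: dual.start_def dual_win_def)
  then have "V - F (W n) D T (W (Suc n) D T) = V - W (Suc n) D T"
    unfolding dual_W dual_F[of "dual.W n" "W n", OF dual_W] .
  then show ?thesis using F_V iter_V by (metis W.simps(2) double_diff order_refl)
qed

subsection \<open>Winning strategies as graphs\<close>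

definition inf_cols :: "(nat \<Rightarrow> nat list \<times> 'v) \<Rightarrow> 'c set" where
  "inf_cols p = {c. \<exists>\<^sub>\<infinity>i. c \<in> col (snd (p i))}"

text \<open>A strategy with memory, as a graph on pairs of a memory and a position: it offers a move
  at own positions and covers every move of the opponent. Memories are lists, so that graphs can be
  combined by prepending an index; there may be infinitely many of them. Obligations end where the
  colours leave \<open>D\<close>.\<close>

definition sgraph :: "'c set \<Rightarrow> 'v set \<Rightarrow> (nat list \<times> 'v) set \<Rightarrow> (nat list \<times> 'v) rel \<Rightarrow> bool" where
  "sgraph D T I R \<longleftrightarrow> R \<subseteq> I \<times> I \<and> I \<subseteq> UNIV \<times> V \<and>
     (\<forall>x y. (x, y) \<in> R \<longrightarrow> snd y \<in> E (snd x)) \<and>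
     (\<forall>x \<in> I. \<not> col (snd x) \<subseteq> D \<longrightarrow> snd x \<in> T) \<and>
     (\<forall>x \<in> I. col (snd x) \<subseteq> D \<longrightarrow>
        (if own (snd x) then \<exists>y. (x, y) \<in> R else \<forall>u \<in> E (snd x). \<exists>m. (x, (m, u)) \<in> R)) \<and>
     (\<forall>p. (\<forall>i. (p i, p (Suc i)) \<in> R \<and> col (snd (p i)) \<subseteq> D) \<longrightarrow> win (inf_cols p))"

text \<open>
  The graphs \<open>I k\<close>, \<open>R k\<close> for the colour sets \<open>D - {c k}\<close> are combined: whenever a position with
  colour \<open>c k\<close> is reached, play moves into \<open>X k\<close> and continues in some graph \<open>k'\<close> with
  \<open>(k, k') \<in> nx\<close>.
\<close>

lemma glue:
  fixes K :: "nat set" and c :: "nat \<Rightarrow> 'c" and X :: "nat \<Rightarrow> 'v set" and nx :: "nat rel"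
  assumes sub: "\<And>k. k \<in> K \<Longrightarrow> sgraph (D - {c k}) (tgt D T (X k)) (I k) (R k)"
    and T: "T \<subseteq> V"
    and XT: "\<And>k u. k \<in> K \<Longrightarrow> u \<in> X k \<Longrightarrow> \<not> col u \<subseteq> D \<Longrightarrow> u \<in> T"
    and XI: "\<And>k u. k \<in> K \<Longrightarrow> u \<in> X k \<Longrightarrow> col u \<subseteq> D \<Longrightarrow> \<exists>k' \<in> K. (k, k') \<in> nx \<and> (\<exists>m. (m, u) \<in> I k')"
    and lim: "\<And>f S. (\<And>i. (f i, f (Suc i)) \<in> nx) \<Longrightarrow> S \<subseteq> D \<Longrightarrow> (\<And>a. \<exists>\<^sub>\<infinity>i. c (f i) = a \<Longrightarrow> a \<in> S) \<Longrightarrow> win S"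
  shows "\<exists>I' R'. sgraph D T I' R' \<and> (\<forall>k \<in> K. \<forall>m v. (m, v) \<in> I k \<longrightarrow> (k # m, v) \<in> I') \<and>
    (\<forall>v \<in> T. \<not> col v \<subseteq> D \<longrightarrow> ([], v) \<in> I')"
proof -
  define I' where "I' = {(k # m, v) | k m v. k \<in> K \<and> (m, v) \<in> I k} \<union> {([], v) | v. v \<in> T \<and> \<not> col v \<subseteq> D}"
  define Rin where "Rin = {((k # m, v), (k # m', u)) | k m v m' u. k \<in> K \<and> ((m, v), (m', u)) \<in> R k \<and> col v \<subseteq> D - {c k}}"
  define Rsw where "Rsw = {((k # m, v), (k' # m', u)) | k m v k' m' u. k \<in> K \<and> (m, v) \<in> I k \<and> col v \<subseteq> D \<and>
     \<not> col v \<subseteq> D - {c k} \<and> u \<in> E v \<and> k' \<in> K \<and> (k, k') \<in> nx \<and> (m', u) \<in> I k'}"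
  define Rend where "Rend = {((k # m, v), ([] :: nat list, u)) | k m v u. k \<in> K \<and> (m, v) \<in> I k \<and> col v \<subseteq> D \<and>
     \<not> col v \<subseteq> D - {c k} \<and> u \<in> E v \<and> u \<in> T \<and> \<not> col u \<subseteq> D}"
  define R' where "R' = Rin \<union> Rsw \<union> Rend"
  have sg1: "x \<in> I k \<and> y \<in> I k" if "k \<in> K" "(x, y) \<in> R k" for k x y
    using sub[OF that(1)] that(2) unfolding sgraph_def by blast
  have sg2: "v \<in> V" if "k \<in> K" "(m, v) \<in> I k" for k m v
    using sub[OF that(1)] that(2) unfolding sgraph_def by blast
  have sg3: "snd y \<in> E (snd x)" if "k \<in> K" "(x, y) \<in> R k" for k x y
    using sub[OF that(1)] that(2) unfolding sgraph_def by blast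
  have sg4: "v \<in> tgt D T (X k)" if "k \<in> K" "(m, v) \<in> I k" "\<not> col v \<subseteq> D - {c k}" for k m v
    using sub[OF that(1)] that(2,3) unfolding sgraph_def by (metis snd_conv)
  have sg5: "if own v then \<exists>y. ((m, v), y) \<in> R k else \<forall>u \<in> E v. \<exists>m'. ((m, v), (m', u)) \<in> R k"
    if "k \<in> K" "(m, v) \<in> I k" "col v \<subseteq> D - {c k}" for k m v
    using sub[OF that(1)] that(2,3) unfolding sgraph_def by (metis snd_conv)
  have sg6: "win (inf_cols p)" if "k \<in> K" "\<And>i. (p i, p (Suc i)) \<in> R k \<and> col (snd (p i)) \<subseteq> D - {c k}" for k p
    using sub[OF that(1)] that(2) unfolding sgraph_def by blast
  have "Rin \<subseteq> I' \<times> I'" using sg1 unfolding I'_def Rin_def by auto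
  moreover have "Rsw \<subseteq> I' \<times> I'" unfolding I'_def Rsw_def by auto
  moreover have "Rend \<subseteq> I' \<times> I'" unfolding I'_def Rend_def by auto
  ultimately have "R' \<subseteq> I' \<times> I'" unfolding R'_def by blast
  moreover have "I' \<subseteq> UNIV \<times> V" using sg2 T unfolding I'_def by auto
  moreover have "snd y \<in> E (snd x)" if "(x, y) \<in> R'" for x y
  proof -
    from that consider "(x, y) \<in> Rin" | "(x, y) \<in> Rsw" | "(x, y) \<in> Rend" unfolding R'_def by blast
    then show ?thesis
    proof cases
      case 1
      then show ?thesis using sg3 unfolding Rin_def by fastforce
    qed (auto simp: Rsw_def Rend_def)
  qed
  moreover have "snd x \<in> T" if x: "x \<in> I'" and nt: "\<not> col (snd x) \<subseteq> D" for x
  proof -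
    from x consider (a) k m v where "x = (k # m, v)" "k \<in> K" "(m, v) \<in> I k" | (b) v where "x = ([], v)" "v \<in> T"
      unfolding I'_def by blast
    then show ?thesis
    proof cases
      case a
      then have "v \<in> tgt D T (X k)" using sg4[OF a(2,3)] nt by auto
      then show ?thesis using a nt by (auto simp: tgt_def)
    qed auto
  qed
  moreover have "if own (snd x) then \<exists>y. (x, y) \<in> R' else \<forall>u \<in> E (snd x). \<exists>m. (x, (m, u)) \<in> R'"
    if x: "x \<in> I'" and nt: "col (snd x) \<subseteq> D" for x
  proof -
    obtain k m v where k: "x = (k # m, v)" "k \<in> K" "(m, v) \<in> I k"
      using x nt unfolding I'_def by auto
    show ?thesis
    proof (cases "col v \<subseteq> D - {c k}")
      case True
      note sg5[OF k(2,3) True]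
      moreover have "((k # m, v), (k # m', u)) \<in> R'" if "((m, v), (m', u)) \<in> R k" for m' u
        using that k True unfolding R'_def Rin_def by blast
      ultimately show ?thesis unfolding k(1) by (auto split: if_splits) blast+
    next
      case False
      then have "v \<in> tgt D T (X k)" using sg4[OF k(2,3)] by blast
      then have cp: "v \<in> cpre (X k)" using nt k(1) by (auto simp: tgt_def)
      have ex: "\<exists>m'. ((k # m, v), (m', u)) \<in> R'" if u: "u \<in> X k" "u \<in> E v" for u
      proof (cases "col u \<subseteq> D")
        case True
        then obtain k' m' where "k' \<in> K" "(k, k') \<in> nx" "(m', u) \<in> I k'" using XI[OF k(2) u(1)] by blast
        then show ?thesis using k False nt u(2) unfolding R'_def Rsw_def by fastforce
      next
        case nt2: False
        then show ?thesis using k False nt u(2) XT[OF k(2) u(1)] unfolding R'_def Rend_def by fastforce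
      qed
      show ?thesis
      proof (cases "own v")
        case True
        then obtain u where "u \<in> E v" "u \<in> X k" using cp unfolding cpre_def by auto
        then show ?thesis using ex[of u] True unfolding k(1) by auto
      next
        case False
        then show ?thesis using cp ex unfolding k(1) cpre_def by auto
      qed
    qed
  qed
  moreover have "win (inf_cols p)" if p: "\<And>i. (p i, p (Suc i)) \<in> R'" and nt: "\<And>i. col (snd (p i)) \<subseteq> D" for p
  proof -
    define ix where "ix i = hd (fst (p i))" for i
    define sw where "sw = {i. \<not> col (snd (p i)) \<subseteq> D - {c (ix i)}}"
    have step: "(i \<notin> sw \<and> (p i, p (Suc i)) \<in> Rin \<and> ix (Suc i) = ix i) \<or>
        (i \<in> sw \<and> (ix i, ix (Suc i)) \<in> nx)" for i
    proof -
      have "(p i, p (Suc i)) \<notin> Rend" using nt[of "Suc i"] unfolding Rend_def by force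
      then have "(p i, p (Suc i)) \<in> Rin \<or> (p i, p (Suc i)) \<in> Rsw" using p[of i] unfolding R'_def by blast
      then show ?thesis
      proof
        assume a: "(p i, p (Suc i)) \<in> Rin"
        then show ?thesis unfolding Rin_def sw_def ix_def by force
      next
        assume "(p i, p (Suc i)) \<in> Rsw"
        then show ?thesis unfolding Rsw_def sw_def ix_def by force
      qed
    qed
    have swc: "c (ix i) \<in> col (snd (p i))" if "i \<in> sw" for i
      using that nt[of i] unfolding sw_def by blast
    show ?thesis
    \<comment> \<open>With finitely many switches the play finally stays in one graph, whose winning
      condition applies to a suffix, and a suffix has the same colours infinitely often. Otherwise
      the successive indices form an infinite chain in \<open>nx\<close>, and each switch sees the
      colour \<open>c\<close> of its index.\<close>
    proof (cases "finite sw")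
      case True
      then obtain n where n: "\<And>i. i \<ge> n \<Longrightarrow> i \<notin> sw"
        using finite_nat_bounded[OF True] by (auto simp: not_less[symmetric])
      have ixn: "ix (n + i) = ix n" for i
        by (induction i) (use step n in \<open>auto simp: le_add1\<close>, metis le_add1 n step)
      define q where "q i = (tl (fst (p (n + i))), snd (p (n + i)))" for i
      have q: "ix n \<in> K \<and> (q i, q (Suc i)) \<in> R (ix n) \<and> col (snd (q i)) \<subseteq> D - {c (ix n)}" for i
      proof -
        have "(p (n + i), p (Suc (n + i))) \<in> Rin" using step[of "n + i"] n[of "n + i"] by auto
        then show ?thesis using ixn[of i] unfolding Rin_def q_def ix_def by force
      qed
      then have "win (inf_cols q)" using sg6[of "ix n" q] by blast
      moreover have "inf_cols q = inf_cols p"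
      proof -
        have "(\<exists>\<^sub>\<infinity>i. a \<in> col (snd (p (i + n)))) \<longleftrightarrow> (\<exists>\<^sub>\<infinity>i. a \<in> col (snd (p i)))" for a
        proof -
          have "(\<forall>\<^sub>\<infinity>i. \<not> a \<in> col (snd (p (i + n)))) \<longleftrightarrow> (\<forall>\<^sub>\<infinity>i. \<not> a \<in> col (snd (p i)))"
            unfolding cofinite_eq_sequentially
            by (rule eventually_sequentially_seg[of "\<lambda>i. \<not> a \<in> col (snd (p i))"])
          then show ?thesis unfolding not_INFM[symmetric] by argo
        qed
        then show ?thesis unfolding inf_cols_def q_def by (simp add: add.commute)
      qed
      ultimately show ?thesis by simp
    next
      case False
      define e where "e = enumerate sw"
      have e: "e j \<in> sw" "e j < e (Suc j)" for j
        unfolding e_def using enumerate_in_set[OF False] enumerate_step[OF False] by auto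
      have gap: "ix (Suc (e j)) = ix (e (Suc j))" for j
      proof -
        have no: "i \<notin> sw" if "e j < i" "i < e (Suc j)" for i
        proof
          assume "i \<in> sw"
          from enumerate_Ex[OF False this] obtain l where "i = e l" unfolding e_def by blast
          then have "e j < e l" "e l < e (Suc j)" using that by auto
          then have "j < l" "l < Suc j" by (simp_all only: e_def enumerate_mono_iff[OF False])
          then show False by simp
        qed
        have "Suc (e j) + d \<le> e (Suc j) \<Longrightarrow> ix (Suc (e j) + d) = ix (Suc (e j))" for d
        proof (induction d)
          case (Suc d)
          then have "Suc (e j) + d \<notin> sw" by (intro no) auto
          then show ?case using step[of "Suc (e j) + d"] Suc by auto
        qed simp
        from this[of "e (Suc j) - Suc (e j)"] show ?thesis using e(2)[of j] by simp
      qed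
      show ?thesis
      proof (rule lim[of "\<lambda>j. ix (e j)"])
        show "(ix (e j), ix (e (Suc j))) \<in> nx" for j using step[of "e j"] e(1)[of j] gap[of j] by auto
        show "inf_cols p \<subseteq> D"
        proof
          fix a assume "a \<in> inf_cols p"
          then obtain i where "a \<in> col (snd (p i))" unfolding inf_cols_def by (auto dest: INFM_EX)
          then show "a \<in> D" using nt by blast
        qed
        show "a \<in> inf_cols p" if a: "\<exists>\<^sub>\<infinity>j. c (ix (e j)) = a" for a
          unfolding inf_cols_def INFM_nat_le mem_Collect_eq
        proof
          fix m
          obtain j where j: "j \<ge> m" "c (ix (e j)) = a" using a unfolding INFM_nat_le by blast
          have "m \<le> e j" using le_enumerate[OF False, of j] j(1) unfolding e_def by simp
          then show "\<exists>n\<ge>m. a \<in> col (snd (p n))" using swc[OF e(1)[of j]] j(2) by blast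
        qed
      qed
    qed
  qed
  ultimately have "sgraph D T I' R'" unfolding sgraph_def by blast
  then show ?thesis unfolding I'_def by blast
qed

theorem W_sgraph:
  assumes "finite D" "card D \<le> n" "T \<subseteq> V"
  shows "\<exists>I R. sgraph D T I R \<and> (\<forall>v \<in> W n D T. \<exists>m. (m, v) \<in> I)"
  using assms
proof (induction n arbitrary: D T)
  case 0
  then have "D = {}" by simp
  then have "sgraph D T ({[]} \<times> T) {}" using 0 col_ne unfolding sgraph_def by auto
  then show ?case by fastforce
next
  case (Suc n)
  let ?F = "F (W n) D T"
  show ?case
  proof (cases "D = {}")
    case True
    have "v \<in> T" if "v \<in> W (Suc n) D T" for v
    proof -
      have "v \<in> F (W n) D T (W (Suc n) D T)" using that W_fixpoint[of n D T] by blast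
      then show ?thesis using col_ne[of v] True unfolding F_def by auto
    qed
    moreover have "sgraph D T ({[]} \<times> T) {}" using Suc.prems True col_ne unfolding sgraph_def by auto
    ultimately show ?thesis by (intro exI[of _ "{[]} \<times> T"] exI[of _ "{}"]) blast
  next
    case ne: False
    obtain cs where cs: "set cs = D" using finite_list[OF Suc.prems(1)] by blast
    have lcs: "cs \<noteq> []" using ne cs by auto
    have IH: "\<exists>I R. sgraph (D - {c}) (tgt D T X) I R \<and> (\<forall>v \<in> W n (D - {c}) (tgt D T X). \<exists>m. (m, v) \<in> I)"
      if "c \<in> D" for c X
      by (rule Suc.IH) (use Suc.prems that tgt_V in auto)
    show ?thesis
    proof (cases "win D")
      case True
      define Z where "Z = W (Suc n) D T"
      have Z: "Z = ?F Z" unfolding Z_def W_fixpoint ..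
      \<comment> \<open>Round robin: infinitely many switches see every colour of \<open>D\<close>
        infinitely often, and \<open>D\<close> is winning.\<close>
      define c where "c k = cs ! (k mod length cs)" for k
      have cD: "c k \<in> D" for k unfolding c_def using lcs cs by (metis length_greater_0_conv mod_less_divisor nth_mem)
      have "\<exists>P. sgraph (D - {c k}) (tgt D T Z) (fst P) (snd P) \<and> (\<forall>v \<in> W n (D - {c k}) (tgt D T Z). \<exists>m. (m, v) \<in> fst P)" for k
        using IH[OF cD[of k], of Z] by force
      then obtain P where P: "\<And>k. sgraph (D - {c k}) (tgt D T Z) (fst (P k)) (snd (P k))"
        "\<And>k v. v \<in> W n (D - {c k}) (tgt D T Z) \<Longrightarrow> \<exists>m. (m, v) \<in> fst (P k)" by metis
      have ent: "\<exists>m. (m, u) \<in> fst (P k)" if "u \<in> Z" "col u \<subseteq> D" for u k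
      proof -
        have "u \<in> ?F Z" using Z that(1) by simp
        then have "u \<in> W n (D - {c k}) (tgt D T Z)" using that(2) True cD[of k] by (auto simp: F_def)
        then show ?thesis by (rule P(2))
      qed
      have entT: "u \<in> T" if "u \<in> Z" "\<not> col u \<subseteq> D" for u
      proof -
        have "u \<in> ?F Z" using Z that(1) by simp
        then show ?thesis using that(2) by (auto simp: F_def)
      qed
      have "\<exists>I' R'. sgraph D T I' R' \<and> (\<forall>k \<in> UNIV. \<forall>m v. (m, v) \<in> fst (P k) \<longrightarrow> (k # m, v) \<in> I') \<and>
          (\<forall>v \<in> T. \<not> col v \<subseteq> D \<longrightarrow> ([], v) \<in> I')"
      proof (rule glue[of UNIV D c T "\<lambda>_. Z" _ "\<lambda>k. snd (P k)" "{(k, Suc k) | k. True}"])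
        fix f :: "nat \<Rightarrow> nat" and S
        assume f: "\<And>i. (f i, f (Suc i)) \<in> {(k, Suc k) | k. True}" and S: "S \<subseteq> D"
          and inf: "\<And>a. \<exists>\<^sub>\<infinity>i. c (f i) = a \<Longrightarrow> a \<in> S"
        have f: "f i = f 0 + i" for i by (induction i) (use f in auto)
        have "D \<subseteq> S"
        proof
          fix a assume "a \<in> D"
          then obtain l where l: "l < length cs" "cs ! l = a" using cs by (metis in_set_conv_nth)
          have "\<exists>\<^sub>\<infinity>i. c (f i) = a" unfolding INFM_nat_le
          proof
            fix m
            \<comment> \<open>Congruent to \<open>l\<close> modulo \<open>length cs\<close>, and so
              large that subtracting \<open>f 0\<close> still leaves at least
              \<open>m\<close>.\<close>
            let ?i = "(m + f 0) * length cs + l"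
            have "1 \<le> length cs" using lcs by (simp add: Suc_le_eq)
            then have "(m + f 0) * 1 \<le> (m + f 0) * length cs" by (rule mult_left_mono) simp
            then have "m + f 0 \<le> ?i" by (rule order_trans[rotated, OF trans_le_add1]) simp
            then have "f 0 + m \<le> ?i" by (simp only: add.commute[of m])
            moreover have "c ?i = a" unfolding c_def using l by simp
            ultimately have "?i - f 0 \<ge> m" "c (f (?i - f 0)) = a" using f[of "?i - f 0"] by auto
            then show "\<exists>n\<ge>m. c (f n) = a" by blast
          qed
          then show "a \<in> S" by (rule inf)
        qed
        then show "win S" using S True by (metis subset_antisym)
      qed (use P(1) Suc.prems(3) ent entT in auto)
      then obtain I' R' where I': "sgraph D T I' R'" "\<And>k m v. (m, v) \<in> fst (P k) \<Longrightarrow> (k # m, v) \<in> I'"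
          "\<And>v. v \<in> T \<Longrightarrow> \<not> col v \<subseteq> D \<Longrightarrow> ([], v) \<in> I'" by blast
      moreover have "\<exists>m. (m, v) \<in> I'" if "v \<in> W (Suc n) D T" for v
        using that ent[of v 0] entT[of v] I'(2,3) unfolding Z_def by blast
      ultimately show ?thesis by blast
    next
      case False
      define Z where "Z i = (?F ^^ i) {}" for i
      \<comment> \<open>An index \<open>k\<close> codes a stage of the least fixpoint together with
        the place of a colour in \<open>cs\<close>. Switches lead to smaller stages, so there are
        only finitely many, and the play ends up within one sub-game.\<close>
      define c where "c k = cs ! (snd (prod_decode k))" for k
      define X where "X k = Z (fst (prod_decode k))" for k
      define K where "K = {k. snd (prod_decode k) < length cs}"
      have cD: "c k \<in> D" if "k \<in> K" for k using that cs unfolding c_def K_def by auto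
      have "\<exists>P. k \<in> K \<longrightarrow> sgraph (D - {c k}) (tgt D T (X k)) (fst P) (snd P) \<and> (\<forall>v \<in> W n (D - {c k}) (tgt D T (X k)). \<exists>m. (m, v) \<in> fst P)" for k
        using IH[OF cD[of k], of "X k"] by force
      then obtain P where P: "\<And>k. k \<in> K \<Longrightarrow> sgraph (D - {c k}) (tgt D T (X k)) (fst (P k)) (snd (P k))"
        "\<And>k v. k \<in> K \<Longrightarrow> v \<in> W n (D - {c k}) (tgt D T (X k)) \<Longrightarrow> \<exists>m. (m, v) \<in> fst (P k)" by metis
      have ent: "\<exists>k \<in> K. fst (prod_decode k) < i \<and> (\<exists>m. (m, u) \<in> fst (P k))" if u: "u \<in> Z i" "col u \<subseteq> D" for u i
      proof -
        have "i \<noteq> 0" using u(1) unfolding Z_def by (cases "i = 0") simp_all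
        then obtain i' where i': "i = Suc i'" by (cases i) auto
        have "u \<in> ?F (Z i')" using u(1) unfolding i' Z_def by simp
        then obtain a where a: "a \<in> D" "u \<in> W n (D - {a}) (tgt D T (Z i'))"
          using u(2) False by (auto simp: F_def)
        obtain l where l: "l < length cs" "cs ! l = a" using a(1) cs by (metis in_set_conv_nth)
        let ?k = "prod_encode (i', l)"
        have "?k \<in> K" "c ?k = a" "X ?k = Z i'" using l by (auto simp: K_def c_def X_def)
        then show ?thesis using P(2)[of ?k u] a(2) i' by (intro bexI[of _ ?k]) auto
      qed
      have entT: "u \<in> T" if "u \<in> Z i" "\<not> col u \<subseteq> D" for u i
        using that unfolding Z_def by (cases i) (auto simp: F_def)
      let ?nx = "{(k, k'). fst (prod_decode k') < fst (prod_decode k)}"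
      have "\<exists>I' R'. sgraph D T I' R' \<and> (\<forall>k \<in> K. \<forall>m v. (m, v) \<in> fst (P k) \<longrightarrow> (k # m, v) \<in> I') \<and>
          (\<forall>v \<in> T. \<not> col v \<subseteq> D \<longrightarrow> ([], v) \<in> I')"
      proof (rule glue[of K D c T X _ "\<lambda>k. snd (P k)" ?nx])
        fix f :: "nat \<Rightarrow> nat" and S
        assume f: "\<And>i. (f i, f (Suc i)) \<in> ?nx"
        have "wf (measure (\<lambda>k. fst (prod_decode k)))" by simp
        then show "win S" using f unfolding wf_iff_no_infinite_down_chain by fastforce
      next
        fix k u assume "k \<in> K" "u \<in> X k" "col u \<subseteq> D"
        then show "\<exists>k' \<in> K. (k, k') \<in> ?nx \<and> (\<exists>m. (m, u) \<in> fst (P k'))"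
          using ent[of u "fst (prod_decode k)"] unfolding X_def by auto
      qed (use P(1) Suc.prems(3) entT X_def in auto)
      then obtain I' R' where I': "sgraph D T I' R'" "\<And>k m v. k \<in> K \<Longrightarrow> (m, v) \<in> fst (P k) \<Longrightarrow> (k # m, v) \<in> I'"
          "\<And>v. v \<in> T \<Longrightarrow> \<not> col v \<subseteq> D \<Longrightarrow> ([], v) \<in> I'" by blast
      have WZ: "W (Suc n) D T = Z N" using False unfolding Z_def by (simp add: start_def)
      have "\<exists>m. (m, v) \<in> I'" if v: "v \<in> W (Suc n) D T" for v
      proof (cases "col v \<subseteq> D")
        case True
        then show ?thesis using ent[of v N] v I'(2) unfolding WZ by blast
      next
        case False
        then show ?thesis using entT[of v N] v I'(3) unfolding WZ by blast
      qed
      then show ?thesis using I'(1) by blast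
    qed
  qed
qed

subsection \<open>Determinacy\<close>

text \<open>All colours lie in \<open>C\<close>, so a play never leaves \<open>C\<close>, and every
  infinite play of the graph is won.\<close>

lemma W_win:
  assumes "finite C" "\<And>v. v \<in> V \<Longrightarrow> col v \<subseteq> C" "card C \<le> n"
  shows "\<exists>I R. sgraph C {} I R \<and> (\<forall>v \<in> W n C {}. \<exists>m. (m, v) \<in> I)"
  using W_sgraph[of C n "{}"] assms by auto

end

context muller begin

interpretation dual: muller V dual_own E col dual_win N
  using muller_axioms by (simp add: muller_def)

lemma W_lose:
  assumes "finite C" "\<And>v. v \<in> V \<Longrightarrow> col v \<subseteq> C" "card C \<le> n"
  shows "\<exists>I R. dual.sgraph C V I R \<and> (\<forall>v \<in> V - W n C {}. \<exists>m. (m, v) \<in> I)"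
  using dual.W_sgraph[of C n V] dual_W[of n C "{}"] assms by auto

end

subsection \<open>A table for the iterates\<close>

text \<open>
  A path lists, innermost first, the colours removed so far together with the indices of the
  iterates from which the targets were formed.  The membership of a position in an iterate is
  then determined by the membership of positions in iterates at lexicographically smaller places.
\<close>

context muller begin

definition rest :: "'c set \<Rightarrow> ('c \<times> nat) list \<Rightarrow> 'c set" where
  "rest C p = C - fst ` set p"

definition iter :: "nat \<Rightarrow> 'c set \<Rightarrow> 'v set \<Rightarrow> nat \<Rightarrow> 'v set" where
  "iter n D T i = (F (W n) D T ^^ i) (start D)"

primrec tg :: "'c set \<Rightarrow> ('c \<times> nat) list \<Rightarrow> 'v set" where
  "tg C [] = {}"
| "tg C (x # p) = tgt (rest C p) (tg C p) (iter (card C - length p) (rest C p) (tg C p) (snd x))"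

definition table :: "'c set \<Rightarrow> ('c \<times> nat) list \<Rightarrow> nat \<Rightarrow> 'v set" where
  "table C p i = iter (card C - length p) (rest C p) (tg C p) i"

lemma table_0: "table C p 0 = (if win (rest C p) then V else {})"
  by (simp add: table_def iter_def start_def)

lemma tg_Cons: "v \<in> tg C (x # p) \<longleftrightarrow> v \<in> V \<and> (if col v \<subseteq> rest C p
    then if own v then \<exists>u \<in> E v. u \<in> table C p (snd x) else \<forall>u \<in> E v. u \<in> table C p (snd x)
    else v \<in> tg C p)"
  by (auto simp: table_def tgt_def cpre_def)

lemma table_Suc:
  assumes C: "finite C" and p: "distinct (map fst p)" "fst ` set p \<subseteq> C"
  shows "v \<in> table C p (Suc i) \<longleftrightarrow> v \<in> V \<and> (if col v \<subseteq> rest C p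
    then (if win (rest C p) then \<forall>c \<in> rest C p. v \<in> table C ((c, i) # p) N
      else \<exists>c \<in> rest C p. v \<in> table C ((c, i) # p) N)
    else v \<in> tg C p)"
proof -
  have eq: "W (card C - length p) (rest C p - {c}) (tgt (rest C p) (tg C p) (table C p i)) = table C ((c, i) # p) N"
    if c: "c \<in> rest C p" for c
  proof -
    have "distinct (map fst ((c, i) # p))" "fst ` set ((c, i) # p) \<subseteq> C"
      using p c by (auto simp: rest_def)
    \<comment> \<open>Hence the level \<open>card C - length p\<close> is a successor, and the inner
      \<open>W\<close> unfolds to the \<open>N\<close>-th iterate at the level of the longer
      path.\<close>
    then have "length ((c, i) # p) \<le> card C"
      by (metis C card_mono distinct_card length_map list.set_map)
    then obtain n where n: "card C - length p = Suc n" "card C - length ((c, i) # p) = n"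
      by (metis Suc_diff_Suc length_Cons less_eq_Suc_le)
    have "rest C ((c, i) # p) = rest C p - {c}" by (auto simp: rest_def)
    then show ?thesis unfolding table_def n by (simp add: n iter_def table_def)
  qed
  show ?thesis
    unfolding table_def[of C p] iter_def funpow.simps o_apply
    unfolding F_def iter_def[symmetric] table_def[of C p, symmetric] mem_Collect_eq
    using eq by auto
qed

text \<open>One level more than there are colours: \<open>iter n\<close> iterates the operator built
  from \<open>W n\<close>, so its result is \<open>W (Suc n)\<close>.\<close>

lemma table_N: "W (Suc (card C)) C {} = table C [] N"
  by (simp add: table_def iter_def rest_def)

end

section \<open>Instances as tuples\<close>

text \<open>Tuples and lists have codes by the class \<open>cod\<close>; \<open>inst\<close> turns
  them into the records of the problem statement.\<close>

type_synonym tab = "nat \<times> (nat \<times> nat list) list"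
type_synonym tinst = "nat list \<times> (nat \<times> nat) list \<times> (tab list \<times> (nat \<times> nat) list) list \<times> nat \<times> nat list"
type_synonym pos = "nat \<times> nat \<times> nat \<times> nat list"

definition tab_of :: "tab \<Rightarrow> dpa_table" where
  "tab_of t = \<lparr> table_initial = fst t, table_rows = snd t \<rparr>"

definition player_of :: "tab list \<times> (nat \<times> nat) list \<Rightarrow> player_data" where
  "player_of d = \<lparr> pay_automata = map tab_of (fst d), pref_list = snd d \<rparr>"

definition inst :: "tinst \<Rightarrow> cne_instance" where
  "inst T = \<lparr> owner_list = fst T, edge_list = fst (snd T),
     player_list = map player_of (fst (snd (snd T))),
     start_vertex = fst (snd (snd (snd T))), thresholds = snd (snd (snd (snd T))) \<rparr>"

lemma inst_surj: "\<exists>T. inst T = X"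
proof -
  have t: "tab_of (table_initial t, table_rows t) = t" for t by (simp add: tab_of_def)
  have p: "player_of (map (\<lambda>t. (table_initial t, table_rows t)) (pay_automata d), pref_list d) = d" for d
    by (simp add: player_of_def t comp_def)
  have "inst (owner_list X, edge_list X,
      map (\<lambda>d. (map (\<lambda>t. (table_initial t, table_rows t)) (pay_automata d), pref_list d)) (player_list X),
      start_vertex X, thresholds X) = X"
    by (simp add: inst_def p comp_def)
  then show ?thesis by blast
qed

definition nv :: "tinst \<Rightarrow> nat" where "nv T = length (fst T)"
definition np :: "tinst \<Rightarrow> nat" where "np T = length (fst (snd (snd T)))"
definition owner :: "tinst \<Rightarrow> nat \<Rightarrow> nat" where "owner T v = nthd 0 (fst T) v"
definition outs :: "tinst \<Rightarrow> nat \<Rightarrow> nat list" where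
  "outs T v = map snd (filter (\<lambda>e. fst e = v) (fst (snd T)))"
definition tabs :: "tinst \<Rightarrow> nat \<Rightarrow> tab list" where "tabs T i = fst (nthd ([], []) (fst (snd (snd T))) i)"
definition prefs :: "tinst \<Rightarrow> nat \<Rightarrow> (nat \<times> nat) list" where "prefs T i = snd (nthd ([], []) (fst (snd (snd T))) i)"
definition sv :: "tinst \<Rightarrow> nat" where "sv T = fst (snd (snd (snd T)))"
definition th :: "tinst \<Rightarrow> nat list" where "th T = snd (snd (snd (snd T)))"

definition autos :: "tinst \<Rightarrow> (nat \<times> nat \<times> tab) list" where
  "autos T = concat (map (\<lambda>i. map (\<lambda>p. (i, p, nthd (0, []) (tabs T i) p)) [0..<length (tabs T i)]) [0..<np T])"

definition naut :: "tinst \<Rightarrow> nat" where "naut T = length (autos T)"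
definition aut :: "tinst \<Rightarrow> nat \<Rightarrow> nat \<times> nat \<times> tab" where "aut T a = nthd (0, 0, 0, []) (autos T) a"
definition atab :: "tinst \<Rightarrow> nat \<Rightarrow> tab" where "atab T a = snd (snd (aut T a))"
definition row :: "tab \<Rightarrow> nat \<Rightarrow> nat \<times> nat list" where "row t q = nthd (0, []) (snd t) q"

definition stepq :: "tinst \<Rightarrow> nat list \<Rightarrow> nat \<Rightarrow> nat list" where
  "stepq T qs v = map (\<lambda>a. nthd 0 (snd (row (atab T a) (nthd 0 qs a))) v) [0..<naut T]"

definition initq :: "tinst \<Rightarrow> nat list" where "initq T = map (\<lambda>a. fst (atab T a)) [0..<naut T]"

text \<open>Well-formedness apart from the condition that the automata of a player partition the words.\<close>

definition synt :: "tinst \<Rightarrow> bool" where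
  "synt T \<longleftrightarrow> (\<forall>i \<in> set (fst T). i < np T) \<and>
     (\<forall>e \<in> set (fst (snd T)). fst e < nv T \<and> snd e < nv T) \<and>
     (\<forall>v < nv T. outs T v \<noteq> []) \<and>
     (\<forall>i < np T. (\<forall>e \<in> set (prefs T i). fst e < length (tabs T i) \<and> snd e < length (tabs T i)) \<and>
        (\<forall>t \<in> set (tabs T i). fst t < length (snd t) \<and>
           (\<forall>r \<in> set (snd t). length (snd r) = nv T \<and> (\<forall>q \<in> set (snd r). q < length (snd t))))) \<and>
     sv T < nv T \<and> length (th T) = np T \<and> (\<forall>i < np T. nthd 0 (th T) i < length (tabs T i))"

lemma inst_sel [simp]:
  "num_verts (inst T) = nv T" "num_players (inst T) = np T" "owner_list (inst T) = fst T"
  "edge_list (inst T) = fst (snd T)" "start_vertex (inst T) = sv T" "thresholds (inst T) = th T"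
  by (simp_all add: inst_def num_verts_def num_players_def nv_def np_def sv_def th_def)

lemma inst_player:
  assumes "i < np T"
  shows "pay_automata (player_list (inst T) ! i) = map tab_of (tabs T i)"
    "pref_list (player_list (inst T) ! i) = prefs T i" "num_payoffs (inst T) i = length (tabs T i)"
  using assms by (simp_all add: inst_def np_def tabs_def prefs_def nthd player_of_def num_payoffs_def)

definition words :: "tinst \<Rightarrow> nat word set" where "words T = omega_words {..<nv T}"

definition lang :: "tinst \<Rightarrow> nat \<Rightarrow> nat \<Rightarrow> nat word set" where
  "lang T i p = dpa_language {..<nv T} (dpa_of (tab_of (tabs T i ! p)))"

definition exact :: "tinst \<Rightarrow> nat \<Rightarrow> bool" where
  "exact T i \<longleftrightarrow> (\<forall>w \<in> words T. \<exists>!p. p < length (tabs T i) \<and> w \<in> lang T i p)"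

lemma lang_pay:
  assumes "i < np T" "p < length (tabs T i)"
  shows "dpa_language {..<num_verts (inst T)} (pay_dpa (inst T) i p) = lang T i p"
  using assms by (simp add: lang_def pay_dpa_def inst_player)

lemma game_sel [simp]:
  "verts (game_of (inst T)) = {..<nv T}" "edges (game_of (inst T)) = set (fst (snd T))"
  "players (game_of (inst T)) = {..<np T}"
  by (simp_all add: game_of_def)

lemma game_sel2:
  assumes "i < np T"
  shows "payoffs (game_of (inst T)) i = {..<length (tabs T i)}" "pref (game_of (inst T)) i = set (prefs T i)"
    "pay (game_of (inst T)) i w = (THE p. p < length (tabs T i) \<and> w \<in> lang T i p)"
proof -
  show "payoffs (game_of (inst T)) i = {..<length (tabs T i)}" "pref (game_of (inst T)) i = set (prefs T i)"
    using assms by (simp_all add: game_of_def inst_player)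
  have "p < num_payoffs (inst T) i \<and> w \<in> dpa_language {..<num_verts (inst T)} (pay_dpa (inst T) i p) \<longleftrightarrow>
      p < length (tabs T i) \<and> w \<in> lang T i p" for p
    using lang_pay[OF assms] inst_player(3)[OF assms] by auto
  then show "pay (game_of (inst T)) i w = (THE p. p < length (tabs T i) \<and> w \<in> lang T i p)"
    by (simp add: game_of_def)
qed

lemma owned_game: "u < nv T \<Longrightarrow> u \<in> owned (game_of (inst T)) i \<longleftrightarrow> owner T u = i"
  by (simp add: game_of_def owner_def nthd nv_def)

lemma owned_sub: "owned (game_of (inst T)) i \<subseteq> {..<nv T}"
  by (auto simp: game_of_def)

lemma outs_edges: "u \<in> set (outs T v) \<longleftrightarrow> (v, u) \<in> edges (game_of (inst T))"
  by (force simp: outs_def)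

lemma pay_exact:
  assumes "i < np T" "exact T i" "w \<in> words T"
  shows "p < length (tabs T i) \<Longrightarrow> w \<in> lang T i p \<longleftrightarrow> pay (game_of (inst T)) i w = p"
    "pay (game_of (inst T)) i w < length (tabs T i)"
proof -
  have ex: "\<exists>!p. p < length (tabs T i) \<and> w \<in> lang T i p" using assms(2,3) unfolding exact_def by blast
  from theI'[OF ex] show "pay (game_of (inst T)) i w < length (tabs T i)"
    unfolding game_sel2[OF assms(1)] by blast
  show "w \<in> lang T i p \<longleftrightarrow> pay (game_of (inst T)) i w = p" if "p < length (tabs T i)"
    using theI'[OF ex] ex that unfolding game_sel2[OF assms(1)] by blast
qed

lemma wf_dpa_tab: "wf_dpa {..<n} (dpa_of (tab_of t)) \<longleftrightarrow>
    fst t < length (snd t) \<and> (\<forall>q < length (snd t). \<forall>a < n. snd (snd t ! q) ! a < length (snd t))"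
  by (auto simp: wf_dpa_def dpa_of_def tab_of_def)

lemma synt_wf_arena: "synt T \<Longrightarrow> wf_arena (game_of (inst T))"
proof -
  assume s: "synt T"
  have o: "owner T u < np T" if "u < nv T" for u
    using s that nth_mem[of u "fst T"] unfolding synt_def owner_def nthd nv_def by auto
  have "disjoint_family_on (owned (game_of (inst T))) {..<np T}"
    by (auto simp: disjoint_family_on_def game_of_def)
  moreover have "(\<Union>i \<in> {..<np T}. owned (game_of (inst T)) i) = {..<nv T}"
    using o owned_game[of _ T] owned_sub[of T] by blast
  moreover have "\<exists>w. (u, w) \<in> edges (game_of (inst T))" if "u < nv T" for u
    using s that outs_edges[of _ T u] unfolding synt_def by (metis list.set_intros(1) neq_Nil_conv)
  moreover have "edges (game_of (inst T)) \<subseteq> {..<nv T} \<times> {..<nv T}"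
    using s unfolding synt_def by fastforce
  ultimately show ?thesis unfolding wf_arena_def by auto
qed

text \<open>Regularity needs no test of its own: once every word is accepted by exactly one table of
  a player, the preimages of the payoffs are the languages of the tables.\<close>

lemma valid_inst: "valid_instance (inst T) \<longleftrightarrow> synt T \<and> (\<forall>i < np T. exact T i)"
proof
  let ?G = "game_of (inst T)"
  assume v: "valid_instance (inst T)"
  then have rp: "rp_game ?G" and
    tb: "\<And>i t. i < np T \<Longrightarrow> t \<in> set (tabs T i) \<Longrightarrow> wf_dpa {..<nv T} (dpa_of (tab_of t)) \<and>
        (\<forall>r \<in> set (snd t). length (snd r) = nv T)" and
    lg: "\<And>i p. i < np T \<Longrightarrow> p < length (tabs T i) \<Longrightarrow> lang T i p = pay_preimage ?G i p" and
    sv: "sv T < nv T" "length (th T) = np T" "\<And>i. i < np T \<Longrightarrow> th T ! i < length (tabs T i)"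
    unfolding valid_instance_def
    by (auto simp: inst_player game_sel2 tab_of_def lang_pay[symmetric] split: prod.splits)
  from rp have wa: "wf_arena ?G" and
    pr: "\<And>i. i < np T \<Longrightarrow> set (prefs T i) \<subseteq> {..<length (tabs T i)} \<times> {..<length (tabs T i)}" and
    pa: "\<And>i w. i < np T \<Longrightarrow> w \<in> words T \<Longrightarrow> pay ?G i w < length (tabs T i)"
    unfolding rp_game_def wf_game_def words_def by (auto simp: game_sel2)
  have ex: "exact T i" if i: "i < np T" for i
    unfolding exact_def
  proof
    fix w assume w: "w \<in> words T"
    have "w \<in> lang T i p \<longleftrightarrow> pay ?G i w = p" if "p < length (tabs T i)" for p
      using lg[OF i that] w unfolding pay_preimage_def words_def by simp
    then show "\<exists>!p. p < length (tabs T i) \<and> w \<in> lang T i p" using pa[OF i w] by blast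
  qed
  have ow: "owner T u < np T" if "u < nv T" for u
  proof -
    have "u \<in> (\<Union>i \<in> {..<np T}. owned ?G i)" using wa that unfolding wf_arena_def by simp
    then show ?thesis using owned_game[OF that] by auto
  qed
  have "i < np T" if "i \<in> set (fst T)" for i
    using that ow unfolding in_set_conv_nth owner_def nthd nv_def by auto
  moreover have "fst e < nv T \<and> snd e < nv T" if "e \<in> set (fst (snd T))" for e
  proof -
    have "set (fst (snd T)) \<subseteq> {..<nv T} \<times> {..<nv T}" using wa unfolding wf_arena_def game_sel by blast
    from subsetD[OF this that] show ?thesis by (simp add: mem_Times_iff)
  qed
  moreover have "outs T u \<noteq> []" if u: "u < nv T" for u
  proof -
    from wa have "\<forall>u \<in> verts ?G. \<exists>w. (u, w) \<in> edges ?G" unfolding wf_arena_def by (elim conjE)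
    from bspec[OF this, of u] obtain w where "(u, w) \<in> edges ?G" using u by auto
    then have "w \<in> set (outs T u)" by (simp only: outs_edges)
    then show ?thesis by auto
  qed
  moreover have "fst e < length (tabs T i) \<and> snd e < length (tabs T i)" if "i < np T" "e \<in> set (prefs T i)" for i e
    using pr that by fastforce
  moreover have "q < length (snd t)" if h: "i < np T" "t \<in> set (tabs T i)" "r \<in> set (snd t)" "q \<in> set (snd r)" for i t r q
  proof -
    have "length (snd r) = nv T" using tb[OF h(1,2)] h(3) by blast
    then obtain a where "a < nv T" "snd r ! a = q" using h(4) by (metis in_set_conv_nth)
    moreover obtain j where "j < length (snd t)" "snd t ! j = r" using h(3) by (metis in_set_conv_nth)
    ultimately show ?thesis using tb[OF h(1,2)] unfolding wf_dpa_tab by auto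
  qed
  moreover have "fst t < length (snd t)" if "i < np T" "t \<in> set (tabs T i)" for i t
    using tb[OF that] unfolding wf_dpa_tab by blast
  moreover have "nthd 0 (th T) i < length (tabs T i)" if "i < np T" for i
    using sv that by (simp add: nthd)
  ultimately have "synt T" unfolding synt_def using tb sv(1,2) by blast
  then show "synt T \<and> (\<forall>i < np T. exact T i)" using ex by blast
next
  let ?G = "game_of (inst T)"
  assume se: "synt T \<and> (\<forall>i < np T. exact T i)"
  then have s: "synt T" and ex: "\<And>i. i < np T \<Longrightarrow> exact T i" by blast+
  have tb: "wf_dpa {..<nv T} (dpa_of (tab_of t)) \<and> (\<forall>r \<in> set (snd t). length (snd r) = nv T)"
    if "i < np T" "t \<in> set (tabs T i)" for i t
    using s that unfolding synt_def wf_dpa_tab by (metis nth_mem)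
  have lg: "lang T i p = pay_preimage ?G i p" if i: "i < np T" "p < length (tabs T i)" for i p
  proof -
    have "lang T i p \<subseteq> words T" unfolding lang_def words_def dpa_language_def by blast
    then show ?thesis using pay_exact(1)[OF i(1) ex[OF i(1)] _ i(2)] unfolding pay_preimage_def words_def by auto
  qed
  have reg: "omega_regular {..<nv T} (pay_preimage ?G i p)" if i: "i < np T" "p < length (tabs T i)" for i p
    unfolding lg[OF i, symmetric] lang_def
    by (rule omega_regular_dpa_language) (use tb[OF i(1) nth_mem[OF i(2)]] in blast)
  have "wf_game ?G" unfolding wf_game_def
    using synt_wf_arena[OF s] s pay_exact(2)[OF _ ex] unfolding synt_def words_def by (fastforce simp: game_sel2)
  then have "rp_game ?G" unfolding rp_game_def using reg by (auto simp: game_sel2)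
  moreover have "th T ! i < length (tabs T i)" if "i < np T" for i
    using s that unfolding synt_def by (auto simp: nthd)
  moreover have "\<forall>i < np T. \<forall>t \<in> set (pay_automata (player_list (inst T) ! i)).
        wf_dpa {..<nv T} (dpa_of t) \<and> (\<forall>(c, row) \<in> set (table_rows t). length row = nv T)"
  proof (intro allI impI ballI)
    fix i t assume i: "i < np T" "t \<in> set (pay_automata (player_list (inst T) ! i))"
    then obtain t' where "t' \<in> set (tabs T i)" "t = tab_of t'" by (auto simp: inst_player)
    then show "wf_dpa {..<nv T} (dpa_of t) \<and> (\<forall>(c, row) \<in> set (table_rows t). length row = nv T)"
      using tb[OF i(1), of t'] by (fastforce simp: tab_of_def)
  qed
  moreover have "\<forall>i < np T. \<forall>p < num_payoffs (inst T) i.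
      dpa_language {..<num_verts (inst T)} (pay_dpa (inst T) i p) = pay_preimage ?G i p"
    using lg lang_pay by (simp add: inst_player)
  ultimately show "valid_instance (inst T)"
    unfolding valid_instance_def using s by (simp add: synt_def game_sel2)
qed

section \<open>The prover-challenger game\<close>

text \<open>
  A position \<open>(m, v, u, qs)\<close> consists of a mode, the current vertex, the stage and the states of all
  payoff automata.  In mode \<open>0\<close> nobody has deviated, in mode \<open>Suc i\<close> player \<open>i\<close> has deviated, and
  in mode \<open>Suc (np T + i)\<close> the challenger spells out a word in order to refute that the automata of
  player \<open>i\<close> partition the words.  In stage \<open>0\<close> the prover proposes a successor \<open>u\<close>, which leads
  to stage \<open>Suc u\<close>, where it is the challenger's turn.
\<close>

definition succs :: "tinst \<Rightarrow> pos \<Rightarrow> pos list" where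
  "succs T x = (case x of (m, v, s, qs) \<Rightarrow> (case s of
      0 \<Rightarrow> if m = 0 \<or> m \<le> np T \<and> Suc (owner T v) \<noteq> m
           then map (\<lambda>u. (m, v, Suc u, qs)) (outs T v) else [(m, v, Suc 0, qs)]
    | Suc u \<Rightarrow>
        if m = 0 then (0, u, 0, stepq T qs v) # map (\<lambda>u'. (Suc (owner T v), u', 0, stepq T qs v)) (outs T v)
        else if m \<le> np T
          then if Suc (owner T v) = m then map (\<lambda>u'. (m, u', 0, stepq T qs v)) (outs T v)
               else [(m, u, 0, stepq T qs v)]
          else map (\<lambda>u'. (m, u', 0, stepq T qs v)) [0..<nv T]))"

text \<open>\<open>naut T\<close> is one past the indices of the automata; it tags the colour that
  records the mode, so that the winning condition can tell which mode lasts.\<close>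

definition cols :: "tinst \<Rightarrow> pos \<Rightarrow> (nat \<times> nat) list" where
  "cols T x = (case x of (m, v, s, qs) \<Rightarrow> (naut T, m) # map (\<lambda>a. (a, nthd 0 qs a)) [0..<naut T])"

definition stA :: "pos \<Rightarrow> bool" where "stA x = (fst (snd (snd x)) = 0)"

definition prio :: "tinst \<Rightarrow> nat \<Rightarrow> nat \<Rightarrow> nat" where "prio T a q = fst (row (atab T a) q)"

definition accS :: "tinst \<Rightarrow> (nat \<times> nat) set \<Rightarrow> nat \<Rightarrow> bool" where
  "accS T S a \<longleftrightarrow> (\<exists>x \<in> S. fst x = a \<and> even (prio T a (snd x)) \<and>
     (\<forall>y \<in> S. fst y = a \<longrightarrow> prio T a (snd y) \<le> prio T a (snd x)))"

lemma accS_iff: "accS T S a \<longleftrightarrow>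
    (\<exists>q. (a, q) \<in> S \<and> even (prio T a q) \<and> (\<forall>q'. (a, q') \<in> S \<longrightarrow> prio T a q' \<le> prio T a q))"
  by (auto simp: accS_def Bex_def Ball_def split_paired_Ex split_paired_All)

text \<open>After a deviation of player \<open>i\<close>, the automata of all payoffs preferred to
  the claimed one must reject. In a validation mode, some automaton of the player must accept and
  all accepting ones must stand for the same payoff.\<close>

definition winp :: "tinst \<Rightarrow> nat list \<Rightarrow> (nat \<times> nat) set \<Rightarrow> bool" where
  "winp T pv S \<longleftrightarrow>
     ((naut T, 0) \<in> S \<longrightarrow> (\<forall>a < naut T. fst (snd (aut T a)) = nthd 0 pv (fst (aut T a)) \<longrightarrow> accS T S a)) \<and>
     (\<forall>i < np T.
       ((naut T, Suc i) \<in> S \<longrightarrow> (\<forall>a < naut T. fst (aut T a) = i \<and>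
          (nthd 0 pv i, fst (snd (aut T a))) \<in> set (prefs T i) \<longrightarrow> \<not> accS T S a)) \<and>
       ((naut T, Suc (np T + i)) \<in> S \<longrightarrow>
          (\<exists>a < naut T. fst (aut T a) = i \<and> accS T S a) \<and>
          (\<forall>a < naut T. \<forall>b < naut T. fst (aut T a) = i \<and> fst (aut T b) = i \<and> accS T S a \<and> accS T S b \<longrightarrow>
             fst (snd (aut T a)) = fst (snd (aut T b)))))"

definition VV :: "tinst \<Rightarrow> pos set" where
  "VV T = {(m, v, s, qs). m < Suc (2 * np T) \<and> v < nv T \<and> s < Suc (nv T) \<and>
     length qs = naut T \<and> (\<forall>a < naut T. qs ! a < length (snd (atab T a)))}"

definition CC :: "tinst \<Rightarrow> (nat \<times> nat) set" where
  "CC T = {(a, q). a < naut T \<and> q < length (snd (atab T a))} \<union> {naut T} \<times> {..<Suc (2 * np T)}"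

lemma finite_VV: "finite (VV T)"
proof -
  let ?B = "\<Union>a < naut T. {..<length (snd (atab T a))}"
  have "VV T \<subseteq> {..<Suc (2 * np T)} \<times> {..<nv T} \<times> {..<Suc (nv T)} \<times> {qs. set qs \<subseteq> ?B \<and> length qs = naut T}"
    by (fastforce simp: VV_def in_set_conv_nth)
  moreover have "finite {qs. set qs \<subseteq> ?B \<and> length qs = naut T}"
    by (intro finite_lists_length_eq) auto
  ultimately show ?thesis by (auto intro: finite_subset)
qed

lemma finite_CC: "finite (CC T)"
proof -
  have "{(a, q). a < naut T \<and> q < length (snd (atab T a))} = (SIGMA a : {..<naut T}. {..<length (snd (atab T a))})"
    by auto
  then show ?thesis unfolding CC_def by auto
qed

lemma autos_iff: "(i, p, t) \<in> set (autos T) \<longleftrightarrow> i < np T \<and> p < length (tabs T i) \<and> t = tabs T i ! p"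
  by (force simp: autos_def nthd image_iff)

lemma aut_mem: "a < naut T \<Longrightarrow> aut T a \<in> set (autos T)"
  by (simp add: aut_def nthd naut_def)

lemma aut_props:
  assumes "a < naut T"
  shows "fst (aut T a) < np T" "fst (snd (aut T a)) < length (tabs T (fst (aut T a)))"
    "atab T a = tabs T (fst (aut T a)) ! fst (snd (aut T a))"
  using aut_mem[OF assms] autos_iff[of "fst (aut T a)" "fst (snd (aut T a))" "snd (snd (aut T a))" T]
  by (simp_all add: atab_def)

lemma aut_ex:
  assumes "i < np T" "p < length (tabs T i)"
  obtains a where "a < naut T" "fst (aut T a) = i" "fst (snd (aut T a)) = p"
proof -
  have "(i, p, tabs T i ! p) \<in> set (autos T)" using assms by (simp add: autos_iff)
  then obtain a where "a < naut T" "autos T ! a = (i, p, tabs T i ! p)" by (auto simp: in_set_conv_nth naut_def)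
  then show ?thesis using that[of a] by (simp add: aut_def nthd naut_def)
qed

lemma atab_wf:
  assumes s: "synt T" and a: "a < naut T"
  shows "fst (atab T a) < length (snd (atab T a))"
    "q < length (snd (atab T a)) \<Longrightarrow> length (snd (snd (atab T a) ! q)) = nv T"
    "q < length (snd (atab T a)) \<Longrightarrow> v < nv T \<Longrightarrow> snd (snd (atab T a) ! q) ! v < length (snd (atab T a))"
proof -
  have m: "atab T a \<in> set (tabs T (fst (aut T a)))" "fst (aut T a) < np T" using aut_props[OF a] by simp_all
  then have t: "fst (atab T a) < length (snd (atab T a))"
    "\<And>r. r \<in> set (snd (atab T a)) \<Longrightarrow> length (snd r) = nv T \<and> (\<forall>q \<in> set (snd r). q < length (snd (atab T a)))"
    using s unfolding synt_def by blast+
  show "fst (atab T a) < length (snd (atab T a))" by (rule t(1))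
  show "q < length (snd (atab T a)) \<Longrightarrow> length (snd (snd (atab T a) ! q)) = nv T"
    "q < length (snd (atab T a)) \<Longrightarrow> v < nv T \<Longrightarrow> snd (snd (atab T a) ! q) ! v < length (snd (atab T a))"
    using t(2)[of "snd (atab T a) ! q"] by auto
qed

abbreviation adpa :: "tinst \<Rightarrow> nat \<Rightarrow> (nat, nat) dpa" where
  "adpa T a \<equiv> dpa_of (tab_of (atab T a))"

lemma adpa_sel:
  "states (adpa T a) = {..<length (snd (atab T a))}" "initial (adpa T a) = fst (atab T a)"
  "q < length (snd (atab T a)) \<Longrightarrow> priority (adpa T a) q = prio T a q"
  by (simp_all add: dpa_of_def tab_of_def prio_def row_def nthd)

lemma adpa_delta:
  assumes "synt T" "a < naut T" "q < length (snd (atab T a))" "v < nv T"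
  shows "nthd 0 (snd (row (atab T a) q)) v = delta (adpa T a) q v" "delta (adpa T a) q v < length (snd (atab T a))"
  using atab_wf[OF assms(1,2)] assms by (simp_all add: dpa_of_def tab_of_def row_def nthd)

lemma adpa_wf: "synt T \<Longrightarrow> a < naut T \<Longrightarrow> wf_dpa {..<nv T} (adpa T a)"
  unfolding wf_dpa_tab using atab_wf by blast

lemma lang_adpa: "a < naut T \<Longrightarrow> dpa_language {..<nv T} (adpa T a) = lang T (fst (aut T a)) (fst (snd (aut T a)))"
  by (simp add: lang_def aut_props(3))

lemma outs_lt: "synt T \<Longrightarrow> u \<in> set (outs T v) \<Longrightarrow> u < nv T \<and> v < nv T"
  by (auto simp: synt_def outs_def)

lemma owner_lt: "synt T \<Longrightarrow> v < nv T \<Longrightarrow> owner T v < np T"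
  using nth_mem[of v "fst T"] by (auto simp: synt_def owner_def nthd nv_def)

lemma stepq_VV:
  assumes s: "synt T" and x: "(m, v, u, qs) \<in> VV T" and y: "m' < Suc (2 * np T)" "v' < nv T"
  shows "(m', v', 0, stepq T qs v) \<in> VV T"
  using x y atab_wf[OF s] by (auto simp: VV_def stepq_def row_def nthd)

lemma succs_VV:
  assumes s: "synt T" and x: "x \<in> VV T"
  shows "set (succs T x) \<subseteq> VV T"
proof -
  obtain m v u qs where xx: "x = (m, v, u, qs)" by (cases x) auto
  have v: "v < nv T" "m < Suc (2 * np T)" using x by (auto simp: xx VV_def)
  note st = stepq_VV[OF s x[unfolded xx]]
  have A: "(m, v, Suc u', qs) \<in> VV T" if "u' < nv T" for u' using x that by (auto simp: xx VV_def)
  show ?thesis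
  proof (cases u)
    case 0
    then show ?thesis using A outs_lt[OF s] v by (auto simp: xx succs_def)
  next
    case (Suc u')
    then have "u' < nv T" using x by (auto simp: xx VV_def)
    then show ?thesis using Suc st outs_lt[OF s] v owner_lt[OF s v(1)] by (auto simp: xx succs_def)
  qed
qed

lemma muller_T:
  assumes "synt T" "card (VV T) \<le> N"
  shows "muller (VV T) (\<lambda>x. set (succs T x)) (\<lambda>x. set (cols T x)) N"
proof unfold_locales
  show "set (cols T v) \<noteq> {}" for v by (cases v) (simp add: cols_def)
qed (use assms finite_VV succs_VV in auto)

lemma cols_CC: "x \<in> VV T \<Longrightarrow> set (cols T x) \<subseteq> CC T"
  by (auto simp: VV_def CC_def cols_def nthd)

section \<open>Plays of the prover-challenger game\<close>

text \<open>Only the positions in stage \<open>0\<close> of a play are considered; the others have the same colours.\<close>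

definition ic :: "tinst \<Rightarrow> (nat \<Rightarrow> pos) \<Rightarrow> (nat \<times> nat) set" where
  "ic T x = {c. \<exists>\<^sub>\<infinity>k. c \<in> set (cols T (x k))}"

definition qrun :: "tinst \<Rightarrow> nat word \<Rightarrow> nat \<Rightarrow> nat list" where
  "qrun T w k = map (\<lambda>a. dpa_run (adpa T a) w k) [0..<naut T]"

lemma run_lt: "synt T \<Longrightarrow> w \<in> words T \<Longrightarrow> a < naut T \<Longrightarrow> dpa_run (adpa T a) w k < length (snd (atab T a))"
  using dpa_run_in_states[OF adpa_wf, of T a w k] unfolding words_def adpa_sel by simp

lemma qrun_0: "qrun T w 0 = initq T"
  by (simp add: qrun_def initq_def adpa_sel)

lemma qrun_Suc:
  assumes "synt T" "w \<in> words T"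
  shows "qrun T w (Suc k) = stepq T (qrun T w k) (w k)"
proof -
  have "w k < nv T" using assms(2) by (auto simp: words_def omega_words_def)
  moreover have "nthd 0 (qrun T w k) a = dpa_run (adpa T a) w k" if "a < naut T" for a
    using that by (simp add: qrun_def nthd)
  ultimately show ?thesis
    using adpa_delta(1)[OF assms(1) _ run_lt[OF assms]] by (simp add: stepq_def qrun_def[of _ _ "Suc k"])
qed

lemma ic_mode: "(naut T, m) \<in> ic T x \<longleftrightarrow> (\<exists>\<^sub>\<infinity>k. fst (x k) = m)"
proof -
  have "(naut T, m) \<in> set (cols T y) \<longleftrightarrow> fst y = m" for y
    by (cases y) (auto simp: cols_def)
  then show ?thesis by (simp add: ic_def)
qed

lemma limit_comp_image:
  assumes "finite (range r)"
  shows "limit (f \<circ> r) = f ` limit r"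
proof (intro equalityI subsetI)
  fix x assume "x \<in> limit (f \<circ> r)"
  then have "\<exists>\<^sub>\<infinity>n. f (r n) = x" by (simp add: limit_def)
  then have "\<exists>\<^sub>\<infinity>n. \<exists>q \<in> range r. r n = q \<and> f q = x" by (rule INFM_mono) auto
  then obtain q where "\<exists>\<^sub>\<infinity>n. r n = q \<and> f q = x" unfolding INFM_finite_Bex_distrib[OF assms] by blast
  then have "q \<in> limit r" "f q = x" by (auto simp: limit_def dest: INFM_EX elim: INFM_mono)
  then show "x \<in> f ` limit r" by blast
next
  fix x assume "x \<in> f ` limit r"
  then obtain q where "\<exists>\<^sub>\<infinity>n. r n = q" "x = f q" by (auto simp: limit_def)
  then show "x \<in> limit (f \<circ> r)" by (auto simp: limit_def elim: INFM_mono)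
qed

text \<open>The states of automaton \<open>a\<close> seen infinitely often form the limit of its
  run, a finite nonempty set. So the largest priority is attained and \<open>accS\<close> is
  max-even acceptance.\<close>

lemma acc_ic:
  assumes s: "synt T" and w: "w \<in> words T" and a: "a < naut T"
    and x: "\<And>k. snd (snd (snd (x k))) = qrun T w k"
  shows "accS T (ic T x) a \<longleftrightarrow> w \<in> lang T (fst (aut T a)) (fst (snd (aut T a)))"
proof -
  let ?r = "dpa_run (adpa T a) w"
  have mem: "(a, q) \<in> ic T x \<longleftrightarrow> q \<in> limit ?r" for q
  proof -
    have "(a, q) \<in> set (cols T (x k)) \<longleftrightarrow> ?r k = q" for k
      using a x[of k] by (cases "x k") (auto simp: cols_def qrun_def nthd)
    then show ?thesis by (simp add: ic_def limit_def)
  qed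
  have rlt: "?r k < length (snd (atab T a))" for k by (rule run_lt[OF s w a])
  have fr: "finite (range ?r)" by (rule finite_subset[of _ "{..<length (snd (atab T a))}"]) (use rlt in auto)
  have lsub: "limit ?r \<subseteq> {..<length (snd (atab T a))}" using limit_in_range[of ?r] rlt by blast
  have fl: "finite (limit ?r)" using finite_subset[OF lsub] by simp
  have ne: "limit ?r \<noteq> {}" using limit_nonempty[OF fr] by blast
  have "limit (priority (adpa T a) \<circ> ?r) = priority (adpa T a) ` limit ?r"
    by (rule limit_comp_image[OF fr])
  also have "\<dots> = prio T a ` limit ?r" using lsub by (intro image_cong) (auto simp: adpa_sel)
  finally have lim: "limit (priority (adpa T a) \<circ> ?r) = prio T a ` limit ?r" .
  have "accS T (ic T x) a \<longleftrightarrow> (\<exists>q \<in> limit ?r. even (prio T a q) \<and> (\<forall>q' \<in> limit ?r. prio T a q' \<le> prio T a q))"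
    unfolding accS_iff mem by blast
  also have "\<dots> \<longleftrightarrow> even (Max (prio T a ` limit ?r))"
  proof -
    have "Max (prio T a ` limit ?r) \<in> prio T a ` limit ?r" using fl ne by (intro Max_in) auto
    then obtain q where q: "q \<in> limit ?r" "Max (prio T a ` limit ?r) = prio T a q" by (elim imageE)
    have "prio T a q' \<le> prio T a q" if "q' \<in> limit ?r" for q'
      unfolding q(2)[symmetric] using fl that by simp
    then show ?thesis using q by (metis order_antisym)
  qed
  also have "\<dots> \<longleftrightarrow> w \<in> dpa_language {..<nv T} (adpa T a)"
    using w unfolding dpa_language_def words_def by (simp add: lim)
  finally show ?thesis unfolding lang_adpa[OF a] .
qed

lemma inf_cols_ic:
  assumes "\<And>k. cols T (snd (p (2 * k))) = cols T (x k)" "\<And>k. cols T (snd (p (Suc (2 * k)))) = cols T (x k)"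
  shows "{c. \<exists>\<^sub>\<infinity>i. c \<in> set (cols T (snd (p i)))} = ic T x"
proof -
  have c: "cols T (snd (p i)) = cols T (x (i div 2))" for i
    using assms(1)[of "i div 2"] assms(2)[of "i div 2"] by (cases "even i") (auto elim!: evenE oddE)
  have "(\<exists>\<^sub>\<infinity>i. c \<in> set (cols T (x (i div 2)))) \<longleftrightarrow> (\<exists>\<^sub>\<infinity>k. c \<in> set (cols T (x k)))" for c
    unfolding INFM_nat_le
  proof (intro iffI allI)
    fix m assume "\<forall>m. \<exists>n\<ge>m. c \<in> set (cols T (x (n div 2)))"
    then obtain n where "n \<ge> 2 * m" "c \<in> set (cols T (x (n div 2)))" by blast
    then show "\<exists>n\<ge>m. c \<in> set (cols T (x n))" by (intro exI[of _ "n div 2"]) auto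
  next
    fix m assume "\<forall>m. \<exists>n\<ge>m. c \<in> set (cols T (x n))"
    then obtain n where "n \<ge> m" "c \<in> set (cols T (x n))" by blast
    then show "\<exists>n\<ge>m. c \<in> set (cols T (x (n div 2)))" by (intro exI[of _ "2 * n"]) auto
  qed
  then show ?thesis unfolding ic_def c by simp
qed

text \<open>\<open>WT T pv N\<close> is the winning region of the prover.\<close>

definition WT :: "tinst \<Rightarrow> nat list \<Rightarrow> nat \<Rightarrow> pos set" where
  "WT T pv N = muller.W (VV T) stA (\<lambda>x. set (succs T x)) (\<lambda>x. set (cols T x)) (winp T pv) N (Suc (card (CC T))) (CC T) {}"

lemma succs_stage:
  "stA x \<Longrightarrow> y \<in> set (succs T x) \<Longrightarrow> \<not> stA y \<and> cols T y = cols T x"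
  "\<not> stA x \<Longrightarrow> y \<in> set (succs T x) \<Longrightarrow> stA y"
  by (cases x; auto simp: succs_def stA_def cols_def split: nat.splits if_splits)+

text \<open>A path of a strategy graph, split into its nodes \<open>x k\<close> in stage 0 and the
  nodes \<open>y k\<close> between them.\<close>

definition alternating :: "tinst \<Rightarrow> (nat list \<times> pos) rel \<Rightarrow> (nat \<Rightarrow> nat list \<times> pos) \<Rightarrow> (nat \<Rightarrow> nat list \<times> pos) \<Rightarrow> bool" where
  "alternating T R x y \<longleftrightarrow> (\<forall>k. stA (snd (x k)) \<and> (x k, y k) \<in> R \<and> (y k, x (Suc k)) \<in> R)"

lemma prover_graph:
  assumes s: "synt T" and N: "card (VV T) \<le> N" and v: "v \<in> WT T pv N"
  obtains I R m where "(m, v) \<in> I" "\<And>x. x \<in> I \<Longrightarrow> snd x \<in> VV T"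
    "\<And>x. x \<in> I \<Longrightarrow> stA (snd x) \<Longrightarrow> \<exists>y \<in> I. (x, y) \<in> R \<and> snd y \<in> set (succs T (snd x))"
    "\<And>x u. x \<in> I \<Longrightarrow> \<not> stA (snd x) \<Longrightarrow> u \<in> set (succs T (snd x)) \<Longrightarrow> \<exists>y \<in> I. (x, y) \<in> R \<and> snd y = u"
    "\<And>x y. alternating T R x y \<Longrightarrow> winp T pv (ic T (\<lambda>k. snd (x k)))"
proof -
  interpret muller "VV T" stA "\<lambda>x. set (succs T x)" "\<lambda>x. set (cols T x)" "winp T pv" N
    by (rule muller_T[OF s N])
  obtain I R where g: "sgraph (CC T) {} I R" "\<forall>v \<in> W (Suc (card (CC T))) (CC T) {}. \<exists>m. (m, v) \<in> I"
    using W_win[of "CC T" "Suc (card (CC T))"] finite_CC cols_CC by auto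
  obtain m where m: "(m, v) \<in> I" using g(2) v unfolding WT_def by blast
  have "I \<subseteq> UNIV \<times> VV T" using g(1) unfolding sgraph_def by blast
  then have IV: "snd x \<in> VV T" if "x \<in> I" for x using that by auto
  have RI: "x \<in> I \<and> y \<in> I \<and> snd y \<in> set (succs T (snd x))" if "(x, y) \<in> R" for x y
    using g(1) that unfolding sgraph_def by blast
  have st: "if stA (snd x) then \<exists>y. (x, y) \<in> R else \<forall>u \<in> set (succs T (snd x)). \<exists>m. (x, (m, u)) \<in> R" if "x \<in> I" for x
    using g(1) that cols_CC[OF IV[OF that]] unfolding sgraph_def by blast
  have win: "winp T pv (inf_cols p)" if "\<And>i. (p i, p (Suc i)) \<in> R" for p
    using g(1) that cols_CC IV RI unfolding sgraph_def by meson
  show ?thesis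
  proof (rule that[OF m IV])
    show "\<exists>y \<in> I. (x, y) \<in> R \<and> snd y \<in> set (succs T (snd x))" if "x \<in> I" "stA (snd x)" for x
      using st[OF that(1)] that(2) RI by metis
    show "\<exists>y \<in> I. (x, y) \<in> R \<and> snd y = u" if "x \<in> I" "\<not> stA (snd x)" "u \<in> set (succs T (snd x))" for x u
      using st[OF that(1)] that(2,3) RI by (metis snd_conv)
    show "winp T pv (ic T (\<lambda>k. snd (x k)))" if alt: "alternating T R x y" for x y
    proof -
      let ?p = "\<lambda>i. if even i then x (i div 2) else y (i div 2)"
      have R: "(?p i, ?p (Suc i)) \<in> R" for i
        using alt unfolding alternating_def by (cases "even i") (auto elim!: evenE oddE)
      have "inf_cols ?p = ic T (\<lambda>k. snd (x k))" unfolding inf_cols_def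
      proof (rule inf_cols_ic)
        show "cols T (snd (?p (Suc (2 * k)))) = cols T (snd (x k))" for k
          using alt RI succs_stage(1) unfolding alternating_def by simp
      qed simp
      then show ?thesis using win[of ?p, OF R] by simp
    qed
  qed
qed

text \<open>Determinacy enters here: outside the winning region of the prover, the strategy graph of
  the dual game is available.\<close>

lemma challenger_graph:
  assumes s: "synt T" and N: "card (VV T) \<le> N" and v: "v \<in> VV T - WT T pv N"
  obtains I R m where "(m, v) \<in> I" "\<And>x. x \<in> I \<Longrightarrow> snd x \<in> VV T"
    "\<And>x u. x \<in> I \<Longrightarrow> stA (snd x) \<Longrightarrow> u \<in> set (succs T (snd x)) \<Longrightarrow> \<exists>y \<in> I. (x, y) \<in> R \<and> snd y = u"
    "\<And>x. x \<in> I \<Longrightarrow> \<not> stA (snd x) \<Longrightarrow> \<exists>y \<in> I. (x, y) \<in> R \<and> snd y \<in> set (succs T (snd x))"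
    "\<And>x y. alternating T R x y \<Longrightarrow> \<not> winp T pv (ic T (\<lambda>k. snd (x k)))"
proof -
  interpret muller "VV T" stA "\<lambda>x. set (succs T x)" "\<lambda>x. set (cols T x)" "winp T pv" N
    by (rule muller_T[OF s N])
  interpret d: muller "VV T" dual_own "\<lambda>x. set (succs T x)" "\<lambda>x. set (cols T x)" dual_win N
    by (rule muller_T[OF s N])
  obtain I R where g: "d.sgraph (CC T) (VV T) I R" "\<forall>v \<in> VV T - W (Suc (card (CC T))) (CC T) {}. \<exists>m. (m, v) \<in> I"
    using W_lose[of "CC T" "Suc (card (CC T))"] finite_CC cols_CC by auto
  obtain m where m: "(m, v) \<in> I" using g(2) v unfolding WT_def by blast
  have "I \<subseteq> UNIV \<times> VV T" using g(1) unfolding d.sgraph_def by blast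
  then have IV: "snd x \<in> VV T" if "x \<in> I" for x using that by auto
  have RI: "x \<in> I \<and> y \<in> I \<and> snd y \<in> set (succs T (snd x))" if "(x, y) \<in> R" for x y
    using g(1) that unfolding d.sgraph_def by blast
  have st: "if \<not> stA (snd x) then \<exists>y. (x, y) \<in> R else \<forall>u \<in> set (succs T (snd x)). \<exists>m. (x, (m, u)) \<in> R" if "x \<in> I" for x
    using g(1) that cols_CC[OF IV[OF that]] unfolding d.sgraph_def dual_own_def by blast
  have win: "\<not> winp T pv (d.inf_cols p)" if "\<And>i. (p i, p (Suc i)) \<in> R" for p
    using g(1) that cols_CC IV RI unfolding d.sgraph_def dual_win_def by meson
  show ?thesis
  proof (rule that[OF m IV])
    show "\<exists>y \<in> I. (x, y) \<in> R \<and> snd y \<in> set (succs T (snd x))" if "x \<in> I" "\<not> stA (snd x)" for x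
      using st[OF that(1)] that(2) RI by metis
    show "\<exists>y \<in> I. (x, y) \<in> R \<and> snd y = u" if "x \<in> I" "stA (snd x)" "u \<in> set (succs T (snd x))" for x u
      using st[OF that(1)] that(2,3) RI by (metis snd_conv)
    show "\<not> winp T pv (ic T (\<lambda>k. snd (x k)))" if alt: "alternating T R x y" for x y
    proof -
      let ?p = "\<lambda>i. if even i then x (i div 2) else y (i div 2)"
      have R: "(?p i, ?p (Suc i)) \<in> R" for i
        using alt unfolding alternating_def by (cases "even i") (auto elim!: evenE oddE)
      have "d.inf_cols ?p = ic T (\<lambda>k. snd (x k))" unfolding d.inf_cols_def
      proof (rule inf_cols_ic)
        show "cols T (snd (?p (Suc (2 * k)))) = cols T (snd (x k))" for k
          using alt RI succs_stage(1) unfolding alternating_def by simp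
      qed simp
      then show ?thesis using win[of ?p, OF R] by simp
    qed
  qed
qed

lemma ic_mode_const:
  assumes "\<forall>\<^sub>\<infinity>k. fst (x k) = m"
  shows "(naut T, m') \<in> ic T x \<longleftrightarrow> m' = m"
proof
  assume "(naut T, m') \<in> ic T x"
  then have "\<exists>\<^sub>\<infinity>k. fst (x k) = m'" by (simp add: ic_mode)
  from INFM_EX[OF INFM_conjI[OF this assms]] show "m' = m" by auto
next
  assume "m' = m"
  then have "\<exists>\<^sub>\<infinity>k. fst (x k) = m'"
    using assms eventually_frequently[OF sequentially_bot] by (simp add: cofinite_eq_sequentially)
  then show "(naut T, m') \<in> ic T x" by (simp add: ic_mode)
qed

context
  fixes T :: tinst and pv :: "nat list" and x :: "nat \<Rightarrow> pos" and w :: "nat word"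
  assumes s: "synt T" and w: "w \<in> words T" and x: "\<And>k. snd (snd (snd (x k))) = qrun T w k"
begin

lemma acc_lang: "a < naut T \<Longrightarrow> accS T (ic T x) a \<longleftrightarrow> w \<in> lang T (fst (aut T a)) (fst (snd (aut T a)))"
  by (rule acc_ic[OF s w _ x])

lemma winp_main:
  assumes "\<forall>\<^sub>\<infinity>k. fst (x k) = 0" and pv: "\<And>i. i < np T \<Longrightarrow> nthd 0 pv i < length (tabs T i)"
  shows "winp T pv (ic T x) \<longleftrightarrow> (\<forall>i < np T. w \<in> lang T i (nthd 0 pv i))"
proof -
  have "winp T pv (ic T x) \<longleftrightarrow> (\<forall>a < naut T. fst (snd (aut T a)) = nthd 0 pv (fst (aut T a)) \<longrightarrow> accS T (ic T x) a)"
    unfolding winp_def ic_mode_const[OF assms(1)] by simp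
  also have "\<dots> \<longleftrightarrow> (\<forall>i < np T. w \<in> lang T i (nthd 0 pv i))"
  proof (intro iffI allI impI)
    fix i assume a: "\<forall>a < naut T. fst (snd (aut T a)) = nthd 0 pv (fst (aut T a)) \<longrightarrow> accS T (ic T x) a" "i < np T"
    obtain a where "a < naut T" "fst (aut T a) = i" "fst (snd (aut T a)) = nthd 0 pv i"
      using aut_ex[OF a(2) pv[OF a(2)]] .
    then show "w \<in> lang T i (nthd 0 pv i)" using a(1) acc_lang[of a] by auto
  next
    fix a assume "\<forall>i < np T. w \<in> lang T i (nthd 0 pv i)" "a < naut T" "fst (snd (aut T a)) = nthd 0 pv (fst (aut T a))"
    then show "accS T (ic T x) a" using acc_lang[of a] aut_props(1)[of a T] by auto
  qed
  finally show ?thesis .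
qed

lemma winp_dev:
  assumes "\<forall>\<^sub>\<infinity>k. fst (x k) = Suc i" and i: "i < np T"
  shows "winp T pv (ic T x) \<longleftrightarrow> (\<forall>p < length (tabs T i). (nthd 0 pv i, p) \<in> set (prefs T i) \<longrightarrow> w \<notin> lang T i p)"
proof -
  have "winp T pv (ic T x) \<longleftrightarrow> (\<forall>a < naut T. fst (aut T a) = i \<and>
          (nthd 0 pv i, fst (snd (aut T a))) \<in> set (prefs T i) \<longrightarrow> \<not> accS T (ic T x) a)"
    unfolding winp_def ic_mode_const[OF assms(1)] using i by auto
  also have "\<dots> \<longleftrightarrow> (\<forall>p < length (tabs T i). (nthd 0 pv i, p) \<in> set (prefs T i) \<longrightarrow> w \<notin> lang T i p)"
  proof (intro iffI allI impI)
    fix p assume a: "\<forall>a < naut T. fst (aut T a) = i \<and>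
          (nthd 0 pv i, fst (snd (aut T a))) \<in> set (prefs T i) \<longrightarrow> \<not> accS T (ic T x) a"
      "p < length (tabs T i)" "(nthd 0 pv i, p) \<in> set (prefs T i)"
    obtain a where "a < naut T" "fst (aut T a) = i" "fst (snd (aut T a)) = p"
      using aut_ex[OF i a(2)] .
    then show "w \<notin> lang T i p" using a(1,3) acc_lang[of a] by auto
  next
    fix a assume "\<forall>p < length (tabs T i). (nthd 0 pv i, p) \<in> set (prefs T i) \<longrightarrow> w \<notin> lang T i p" "a < naut T"
      "fst (aut T a) = i \<and> (nthd 0 pv i, fst (snd (aut T a))) \<in> set (prefs T i)"
    then show "\<not> accS T (ic T x) a" using acc_lang[of a] aut_props(2)[of a T] by auto
  qed
  finally show ?thesis .
qed

lemma winp_val: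
  assumes "\<forall>\<^sub>\<infinity>k. fst (x k) = Suc (np T + i)" and i: "i < np T"
  shows "winp T pv (ic T x) \<longleftrightarrow> (\<exists>!p. p < length (tabs T i) \<and> w \<in> lang T i p)"
proof -
  have *: "winp T pv (ic T x) \<longleftrightarrow> (\<exists>a < naut T. fst (aut T a) = i \<and> accS T (ic T x) a) \<and>
          (\<forall>a < naut T. \<forall>b < naut T. fst (aut T a) = i \<and> fst (aut T b) = i \<and> accS T (ic T x) a \<and> accS T (ic T x) b \<longrightarrow>
             fst (snd (aut T a)) = fst (snd (aut T b)))"
    unfolding winp_def ic_mode_const[OF assms(1)] using i by auto
  show ?thesis
  proof
    assume "winp T pv (ic T x)"
    then obtain a where a: "a < naut T" "fst (aut T a) = i" "accS T (ic T x) a" and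
      u: "\<And>b. b < naut T \<Longrightarrow> fst (aut T b) = i \<Longrightarrow> accS T (ic T x) b \<Longrightarrow> fst (snd (aut T a)) = fst (snd (aut T b))"
      unfolding * by blast
    show "\<exists>!p. p < length (tabs T i) \<and> w \<in> lang T i p"
    proof (rule ex1I[of _ "fst (snd (aut T a))"])
      show "fst (snd (aut T a)) < length (tabs T i) \<and> w \<in> lang T i (fst (snd (aut T a)))"
        using acc_lang[OF a(1)] a aut_props(2)[OF a(1)] by auto
      fix p assume p: "p < length (tabs T i) \<and> w \<in> lang T i p"
      then obtain b where "b < naut T" "fst (aut T b) = i" "fst (snd (aut T b)) = p" using aut_ex[OF i, of p] by blast
      then show "p = fst (snd (aut T a))" using u[of b] acc_lang[of b] p by auto
    qed
  next
    assume ex: "\<exists>!p. p < length (tabs T i) \<and> w \<in> lang T i p"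
    then obtain p where p: "p < length (tabs T i)" "w \<in> lang T i p" by blast
    obtain a where "a < naut T" "fst (aut T a) = i" "fst (snd (aut T a)) = p"
      using aut_ex[OF i p(1)] .
    then have "\<exists>a < naut T. fst (aut T a) = i \<and> accS T (ic T x) a" using p(2) acc_lang[of a] by auto
    moreover have "fst (snd (aut T a)) = fst (snd (aut T b))" if ab: "a < naut T" "b < naut T"
      "fst (aut T a) = i \<and> fst (aut T b) = i \<and> accS T (ic T x) a \<and> accS T (ic T x) b" for a b
    proof -
      have "fst (snd (aut T c)) < length (tabs T i) \<and> w \<in> lang T i (fst (snd (aut T c)))" if "c = a \<or> c = b" for c
        using that ab acc_lang[of c] aut_props(2)[of c T] by auto
      then show ?thesis using ex by blast
    qed
    ultimately show "winp T pv (ic T x)" unfolding * by blast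
  qed
qed

end

lemma qrun_seq:
  assumes "synt T" "w \<in> words T" "q 0 = initq T" "\<And>k. q (Suc k) = stepq T (q k) (w k)"
  shows "q k = qrun T w k"
  by (induction k) (simp_all add: assms qrun_0 qrun_Suc[OF assms(1,2)])

lemma start_VV:
  assumes "synt T" "m < Suc (2 * np T)" "v < nv T"
  shows "(m, v, 0, initq T) \<in> VV T"
  using assms atab_wf(1)[OF assms(1)] by (auto simp: VV_def initq_def)

definition qs_of :: "pos \<Rightarrow> nat list" where "qs_of x = snd (snd (snd x))"
definition vx :: "pos \<Rightarrow> nat" where "vx x = fst (snd x)"

text \<open>In this mode the prover has a single move and the challenger can spell any word, so the
  prover wins from all first letters if and only if every word has exactly one payoff.\<close>

lemma exact_iff:
  assumes s: "synt T" and N: "card (VV T) \<le> N" and i: "i < np T"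
  shows "exact T i \<longleftrightarrow> (\<forall>u < nv T. (Suc (np T + i), u, 0, initq T) \<in> WT T pv N)"
proof
  let ?M = "Suc (np T + i)"
  have M: "?M \<noteq> 0" "\<not> ?M \<le> np T" by auto
  assume all: "\<forall>u < nv T. (?M, u, 0, initq T) \<in> WT T pv N"
  show "exact T i" unfolding exact_def
  proof
    fix w assume w: "w \<in> words T"
    then have wl: "w k < nv T" for k by (auto simp: words_def omega_words_def)
    then have "(?M, w 0, 0, initq T) \<in> WT T pv N" using all by blast
    obtain I R m where g: "(m, (?M, w 0, 0, initq T)) \<in> I" and "\<And>x. x \<in> I \<Longrightarrow> snd x \<in> VV T"
      and g': "\<And>x. x \<in> I \<Longrightarrow> stA (snd x) \<Longrightarrow> \<exists>y \<in> I. (x, y) \<in> R \<and> snd y \<in> set (succs T (snd x))"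
      "\<And>x u. x \<in> I \<Longrightarrow> \<not> stA (snd x) \<Longrightarrow> u \<in> set (succs T (snd x)) \<Longrightarrow> \<exists>y \<in> I. (x, y) \<in> R \<and> snd y = u"
      "\<And>x y. alternating T R x y \<Longrightarrow> winp T pv (ic T (\<lambda>k. snd (x k)))"
      by (rule prover_graph[OF s N \<open>_ \<in> WT T pv N\<close>], rule that)
    have "\<exists>f. \<forall>k. (f k \<in> I \<and> snd (f k) = (?M, w k, 0, qrun T w k)) \<and> (\<exists>y. (f k, y) \<in> R \<and> (y, f (Suc k)) \<in> R)"
    proof (rule dependent_nat_choice)
      show "\<exists>x. x \<in> I \<and> snd x = (?M, w 0, 0, qrun T w 0)" using g by (auto simp: qrun_0)
      fix x k assume x: "x \<in> I \<and> snd x = (?M, w k, 0, qrun T w k)"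
      then obtain y where y: "y \<in> I" "(x, y) \<in> R" "snd y \<in> set (succs T (snd x))"
        using g'(1)[of x] by (auto simp: stA_def)
      have "snd y = (?M, w k, Suc 0, qrun T w k)" using y(3) x M by (simp add: succs_def)
      then have "\<not> stA (snd y)" "(?M, w (Suc k), 0, qrun T w (Suc k)) \<in> set (succs T (snd y))"
        using wl[of "Suc k"] qrun_Suc[OF s w] M by (auto simp: stA_def succs_def)
      from g'(2)[OF y(1) this] y(2) show "\<exists>z. (z \<in> I \<and> snd z = (?M, w (Suc k), 0, qrun T w (Suc k))) \<and> (\<exists>y. (x, y) \<in> R \<and> (y, z) \<in> R)"
        by blast
    qed
    then obtain f where f: "\<And>k. snd (f k) = (?M, w k, 0, qrun T w k)"
      "\<And>k. \<exists>y. (f k, y) \<in> R \<and> (y, f (Suc k)) \<in> R" by blast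
    then obtain y where "\<And>k. (f k, y k) \<in> R \<and> (y k, f (Suc k)) \<in> R" by metis
    then have "alternating T R f y" unfolding alternating_def by (simp add: f stA_def)
    from g'(3)[OF this] show "\<exists>!p. p < length (tabs T i) \<and> w \<in> lang T i p"
      by (subst (asm) winp_val[OF s w _ _ i]) (simp_all add: f)
  qed
next
  let ?M = "Suc (np T + i)"
  have M: "?M \<noteq> 0" "\<not> ?M \<le> np T" by auto
  assume ex: "exact T i"
  show "\<forall>u < nv T. (?M, u, 0, initq T) \<in> WT T pv N"
  proof (intro allI impI, rule ccontr)
    fix u assume u: "u < nv T" "(?M, u, 0, initq T) \<notin> WT T pv N"
    then have "(?M, u, 0, initq T) \<in> VV T - WT T pv N" using start_VV[OF s, of ?M u] i by auto
    obtain I R m where g: "(m, (?M, u, 0, initq T)) \<in> I"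
      "\<And>x. x \<in> I \<Longrightarrow> snd x \<in> VV T"
      "\<And>x u. x \<in> I \<Longrightarrow> stA (snd x) \<Longrightarrow> u \<in> set (succs T (snd x)) \<Longrightarrow> \<exists>y \<in> I. (x, y) \<in> R \<and> snd y = u"
      "\<And>x. x \<in> I \<Longrightarrow> \<not> stA (snd x) \<Longrightarrow> \<exists>y \<in> I. (x, y) \<in> R \<and> snd y \<in> set (succs T (snd x))"
      "\<And>x y. alternating T R x y \<Longrightarrow> \<not> winp T pv (ic T (\<lambda>k. snd (x k)))"
      by (rule challenger_graph[OF s N \<open>_ \<in> VV T - WT T pv N\<close>], rule that)
    let ?Q = "\<lambda>x z. (\<exists>y. (x, y) \<in> R \<and> (y, z) \<in> R) \<and> qs_of (snd z) = stepq T (qs_of (snd x)) (vx (snd x))"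
    have "\<exists>f. \<forall>k. (f k \<in> I \<and> (\<exists>v qs. snd (f k) = (?M, v, 0, qs)) \<and> (k = 0 \<longrightarrow> qs_of (snd (f k)) = initq T)) \<and> ?Q (f k) (f (Suc k))"
    proof (rule dependent_nat_choice)
      show "\<exists>x. x \<in> I \<and> (\<exists>v qs. snd x = (?M, v, 0, qs)) \<and> (0 = 0 \<longrightarrow> qs_of (snd x) = initq T)"
        using g(1) by (force simp: qs_of_def)
      fix x and k :: nat assume "x \<in> I \<and> (\<exists>v qs. snd x = (?M, v, 0, qs)) \<and> (k = 0 \<longrightarrow> qs_of (snd x) = initq T)"
      then obtain v qs where x: "x \<in> I" "snd x = (?M, v, 0, qs)" by blast
      have "stA (snd x)" "(?M, v, Suc 0, qs) \<in> set (succs T (snd x))" using M by (simp_all add: x(2) succs_def stA_def)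
      from g(3)[OF x(1) this] obtain y where y: "y \<in> I" "(x, y) \<in> R" "snd y = (?M, v, Suc 0, qs)" by blast
      have "\<not> stA (snd y)" by (simp add: y(3) stA_def)
      from g(4)[OF y(1) this] obtain z where z: "z \<in> I" "(y, z) \<in> R" "snd z \<in> set (succs T (snd y))" by blast
      have "\<exists>y. (x, y) \<in> R \<and> (y, z) \<in> R" using y z by blast
      moreover obtain v' where "snd z = (?M, v', 0, stepq T qs v)" using z(3) M by (auto simp: y(3) succs_def)
      ultimately show "\<exists>z. (z \<in> I \<and> (\<exists>v qs. snd z = (?M, v, 0, qs)) \<and> (Suc k = 0 \<longrightarrow> qs_of (snd z) = initq T)) \<and> ?Q x z"
        using z(1) x(2) by (intro exI[of _ z]) (simp add: qs_of_def vx_def)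
    qed
    then obtain f where f: "\<And>k. f k \<in> I" "\<And>k. \<exists>v qs. snd (f k) = (?M, v, 0, qs)" "qs_of (snd (f 0)) = initq T"
      "\<And>k. \<exists>y. (f k, y) \<in> R \<and> (y, f (Suc k)) \<in> R"
      "\<And>k. qs_of (snd (f (Suc k))) = stepq T (qs_of (snd (f k))) (vx (snd (f k)))" by blast
    define w where "w k = vx (snd (f k))" for k
    have "vx y < nv T" if "y \<in> VV T" for y using that by (auto simp: VV_def vx_def)
    then have "w k < nv T" for k using g(2)[OF f(1)] unfolding w_def by blast
    then have w: "w \<in> words T" unfolding words_def omega_words_def by auto
    have q: "snd (snd (snd (snd (f k)))) = qrun T w k" for k
    proof -
      have "qs_of (snd (f k)) = qrun T w k"
        by (rule qrun_seq[OF s w, of "\<lambda>k. qs_of (snd (f k))"], rule f(3), simp only: f(5) w_def)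
      then show ?thesis by (simp only: qs_of_def)
    qed
    have st: "stA (snd (f k))" for k using f(2)[of k] by (auto simp: stA_def)
    obtain y where "\<And>k. (f k, y k) \<in> R \<and> (y k, f (Suc k)) \<in> R" using f(4) by metis
    then have "alternating T R f y" unfolding alternating_def using st by blast
    from g(5)[OF this] have "\<not> winp T pv (ic T (\<lambda>k. snd (f k)))" .
    moreover have "fst (snd (f k)) = ?M" for k using f(2)[of k] by auto
    ultimately have "\<not> (\<exists>!p. p < length (tabs T i) \<and> w \<in> lang T i p)"
      using winp_val[OF s w q _ i] by simp
    then show False using ex w unfolding exact_def by blast
  qed
qed

subsection \<open>From a winning strategy of the prover to an equilibrium\<close>

lemma outcome_props:
  assumes "synt T" "strategy_profile (game_of (inst T)) \<sigma>" "v < nv T"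
  defines "G \<equiv> game_of (inst T)"
  shows "play G (outcome G \<sigma> v)" "outcome G \<sigma> v 0 = v" "i < np T \<Longrightarrow> consistent G i (\<sigma> i) (outcome G \<sigma> v)"
    "play G w \<Longrightarrow> w 0 = v \<Longrightarrow> (\<And>i. i < np T \<Longrightarrow> consistent G i (\<sigma> i) w) \<Longrightarrow> outcome G \<sigma> v = w"
proof -
  have ex: "\<exists>!w. play G w \<and> w 0 = v \<and> (\<forall>i \<in> players G. consistent G i (\<sigma> i) w)"
    unfolding G_def by (rule outcome_unique[OF synt_wf_arena[OF assms(1)] assms(2)]) (use assms(3) in simp)
  note o = theI'[OF ex, folded outcome_def]
  show "play G (outcome G \<sigma> v)" "outcome G \<sigma> v 0 = v" using o by blast+
  show "consistent G i (\<sigma> i) (outcome G \<sigma> v)" if "i < np T" using o that by (simp add: G_def)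
  show "outcome G \<sigma> v = w" if "play G w" "w 0 = v" "\<And>i. i < np T \<Longrightarrow> consistent G i (\<sigma> i) w"
    using ex o that by (metis G_def game_sel(3) lessThan_iff)
qed

lemma play_words: "play (game_of (inst T)) w \<Longrightarrow> w \<in> words T"
  by (simp add: play_def words_def)

lemma play_outs: "play (game_of (inst T)) w \<Longrightarrow> w (Suc k) \<in> set (outs T (w k))"
  by (simp only: play_def outs_edges)

lemma play_lt: "play (game_of (inst T)) w \<Longrightarrow> w k < nv T"
  by (auto simp: play_def omega_words_def)

lemma consistent_step:
  assumes "consistent (game_of (inst T)) (owner T (w k)) s w" "w k < nv T"
  shows "w (Suc k) = s (map w [0..<Suc k])"
  using assms owned_game[of "w k" T] unfolding consistent_def by blast

text \<open>All players read their moves off one graph of the prover. They follow the proposals; the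
  first departure from a proposal reveals the deviating player as the owner of the vertex, and from
  then on the graph is followed in the mode of this player. \<open>irr\<close> deals with deviations
  that end in the claimed payoff.\<close>

theorem NE_if_WT:
  assumes s: "synt T" and ex: "\<And>i. i < np T \<Longrightarrow> exact T i" and N: "card (VV T) \<le> N"
    and pv: "\<And>i. i < np T \<Longrightarrow> nthd 0 pv i < length (tabs T i)"
    and irr: "\<And>i. i < np T \<Longrightarrow> (nthd 0 pv i, nthd 0 pv i) \<notin> set (prefs T i)"
    and W: "(0, sv T, 0, initq T) \<in> WT T pv N"
  defines "G \<equiv> game_of (inst T)"
  shows "\<exists>\<sigma>. nash_equilibrium G (sv T) \<sigma> \<and> (\<forall>i < np T. pay G i (outcome G \<sigma> (sv T)) = nthd 0 pv i)"
proof -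
  have sv: "sv T < nv T" using s by (simp add: synt_def)
  obtain I R m0 where g: "(m0, (0, sv T, 0, initq T)) \<in> I" "\<And>x. x \<in> I \<Longrightarrow> snd x \<in> VV T"
      "\<And>x. x \<in> I \<Longrightarrow> stA (snd x) \<Longrightarrow> \<exists>y \<in> I. (x, y) \<in> R \<and> snd y \<in> set (succs T (snd x))"
      "\<And>x u. x \<in> I \<Longrightarrow> \<not> stA (snd x) \<Longrightarrow> u \<in> set (succs T (snd x)) \<Longrightarrow> \<exists>y \<in> I. (x, y) \<in> R \<and> snd y = u"
      "\<And>x y. alternating T R x y \<Longrightarrow> winp T pv (ic T (\<lambda>k. snd (x k)))"
    by (rule prover_graph[OF s N W], rule that)
  define yy where "yy x = (SOME y. y \<in> I \<and> (x, y) \<in> R \<and> snd y \<in> set (succs T (snd x)))" for x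
  define zz where "zz y u = (SOME z. z \<in> I \<and> (y, z) \<in> R \<and> snd z = u)" for y u
  \<comment> \<open>A proposal \<open>u\<close> appears as the stage \<open>Suc u\<close>, hence the
    \<open>- 1\<close>.\<close>
  define prp where "prp x = fst (snd (snd (snd (yy x)))) - 1" for x
  define tp :: "nat list \<times> pos \<Rightarrow> nat \<Rightarrow> pos" where "tp x u = (case snd x of (m, v, t, qs) \<Rightarrow>
      if m = 0 then (if u = prp x then (0, u, 0, stepq T qs v) else (Suc (owner T v), u, 0, stepq T qs v))
      else (m, u, 0, stepq T qs v))" for x u
  define nx where "nx x u = zz (yy x) (tp x u)" for x u
  define node where "node h = foldl nx (m0, (0, sv T, 0, initq T)) (tl h)" for h
  \<comment> \<open>The second case is for histories off the graph, where the proposal need not be a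
    successor.\<close>
  define \<sigma> where "\<sigma> i h = (if (last h, prp (node h)) \<in> edges G then prp (node h) else SOME u. (last h, u) \<in> edges G)"
    for i :: nat and h
  have yy: "yy x \<in> I" "(x, yy x) \<in> R" "snd (yy x) \<in> set (succs T (snd x))" if "x \<in> I" "stA (snd x)" for x
  proof -
    have "\<exists>y. y \<in> I \<and> (x, y) \<in> R \<and> snd y \<in> set (succs T (snd x))" using g(3)[OF that] by blast
    from someI_ex[OF this] show "yy x \<in> I" "(x, yy x) \<in> R" "snd (yy x) \<in> set (succs T (snd x))"
      unfolding yy_def by blast+
  qed
  have zz: "zz y u \<in> I" "(y, zz y u) \<in> R" "snd (zz y u) = u" if "y \<in> I" "\<not> stA (snd y)" "u \<in> set (succs T (snd y))" for y u
  proof -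
    have "\<exists>z. z \<in> I \<and> (y, z) \<in> R \<and> snd z = u" using g(4)[OF that] by blast
    from someI_ex[OF this] show "zz y u \<in> I" "(y, zz y u) \<in> R" "snd (zz y u) = u" unfolding zz_def by blast+
  qed
  have prof: "strategy_profile G \<sigma>"
    unfolding strategy_profile_def strategy_def
  proof (intro ballI allI impI)
    fix i h assume h: "history G h \<and> last h \<in> owned G i"
    then have "last h < nv T" using owned_sub[of T i] by (auto simp: G_def)
    then have "\<exists>u. (last h, u) \<in> edges G"
      using s outs_edges[of _ T "last h"] unfolding synt_def G_def by (metis list.set_intros(1) neq_Nil_conv)
    from someI_ex[OF this] show "(last h, \<sigma> i h) \<in> edges G" unfolding \<sigma>_def by simp
  qed
  \<comment> \<open>A play in which everybody but \<open>j\<close> obeys either stays in mode 0 and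
    has the claimed payoffs, or enters the mode of \<open>j\<close> for good, where no preferred
    payoff is possible.\<close>
  have main: "(\<forall>i < np T. pay G i w = nthd 0 pv i) \<or> (j < np T \<and> (nthd 0 pv j, pay G j w) \<notin> set (prefs T j))"
    if w: "play G w" "w 0 = sv T" and con: "\<And>i. i < np T \<Longrightarrow> i \<noteq> j \<Longrightarrow> consistent G i (\<sigma> i) w" for w j
  proof -
    note w' = w(1)[unfolded G_def]
    have wl: "w k < nv T" for k by (rule play_lt[OF w'])
    have ww: "w \<in> words T" by (rule play_words[OF w'])
    define xk where "xk k = node (map w [0..<Suc k])" for k
    have x0: "xk 0 = (m0, (0, sv T, 0, initq T))" by (simp add: xk_def node_def)
    have xS: "xk (Suc k) = nx (xk k) (w (Suc k))" for k
    proof -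
      have e: "map w [0..<Suc (Suc k)] = map w [0..<Suc k] @ [w (Suc k)]" by simp
      have ne: "map w [0..<Suc k] \<noteq> []" by simp
      show ?thesis unfolding xk_def node_def e tl_append2[OF ne] by (simp only: foldl_append foldl.simps)
    qed
    have follow: "w (Suc k) = prp (xk k)" if "owner T (w k) \<noteq> j" "prp (xk k) \<in> set (outs T (w k))" for k
    proof -
      have "w (Suc k) = \<sigma> (owner T (w k)) (map w [0..<Suc k])"
        by (rule consistent_step[OF con[unfolded G_def] wl]) (use that owner_lt[OF s wl] in auto)
      then show ?thesis using that(2) unfolding \<sigma>_def outs_edges xk_def[symmetric] by (simp add: G_def)
    qed
    have invstp: "(xk k \<in> I \<and> (\<exists>md. snd (xk k) = (md, w k, 0, qrun T w k) \<and> (md = 0 \<or> md = Suc j \<and> j < np T))) \<and>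
        (yy (xk k) \<in> I \<and> (xk k, yy (xk k)) \<in> R \<and> (yy (xk k), xk (Suc k)) \<in> R \<and> stA (snd (xk k)) \<and>
        (fst (snd (xk k)) = Suc j \<longrightarrow> fst (snd (xk (Suc k))) = Suc j))" for k
    proof -
      have step: "yy (xk k) \<in> I \<and> (xk k, yy (xk k)) \<in> R \<and> (yy (xk k), xk (Suc k)) \<in> R \<and> stA (snd (xk k)) \<and>
        xk (Suc k) \<in> I \<and> (\<exists>md'. snd (xk (Suc k)) = (md', w (Suc k), 0, qrun T w (Suc k)) \<and> (md' = 0 \<or> md' = Suc j \<and> j < np T) \<and>
          (md = Suc j \<longrightarrow> md' = Suc j))"
        if x: "xk k \<in> I" "snd (xk k) = (md, w k, 0, qrun T w k)" "md = 0 \<or> md = Suc j \<and> j < np T" for k md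
      proof -
        let ?u = "w (Suc k)" and ?v = "w k" and ?q = "qrun T w k"
        have st: "stA (snd (xk k))" by (simp add: x(2) stA_def)
        have q: "stepq T ?q ?v = qrun T w (Suc k)" using qrun_Suc[OF s ww] by simp
        have u: "?u \<in> set (outs T ?v)" by (rule play_outs[OF w'])
        note y = yy[OF x(1) st]
        have t: "tp (xk k) ?u \<in> set (succs T (snd (yy (xk k)))) \<and> (\<exists>md'. tp (xk k) ?u = (md', ?u, 0, stepq T ?q ?v) \<and>
            (md' = 0 \<or> md' = Suc j \<and> j < np T) \<and> (md = Suc j \<longrightarrow> md' = Suc j))"
        proof (cases "md = 0")
          case True
          then obtain p where p: "p \<in> set (outs T ?v)" "snd (yy (xk k)) = (0, ?v, Suc p, ?q)"
            using y(3) by (auto simp: x(2) succs_def)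
          then have pr: "prp (xk k) = p" by (simp add: prp_def)
          show ?thesis
          proof (cases "?u = p")
            case True
            then show ?thesis using p \<open>md = 0\<close> by (simp add: tp_def x(2) pr succs_def)
          next
            case False
            then have "owner T ?v = j" using follow[of k] p(1) pr by auto
            then show ?thesis using p u \<open>md = 0\<close> False owner_lt[OF s wl[of k]] by (simp add: tp_def x(2) pr succs_def)
          qed
        next
          case False
          then have md: "md = Suc j" "j < np T" using x(3) by auto
          show ?thesis
          proof (cases "owner T ?v = j")
            case True
            then have "snd (yy (xk k)) = (md, ?v, Suc 0, ?q)" using y(3) md by (simp add: x(2) succs_def)
            then show ?thesis using md True u by (simp add: tp_def x(2) succs_def)
          next
            case o: False
            then obtain p where p: "p \<in> set (outs T ?v)" "snd (yy (xk k)) = (md, ?v, Suc p, ?q)"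
              using y(3) md by (auto simp: x(2) succs_def)
            then have "?u = p" using follow[OF o] by (simp add: prp_def)
            then show ?thesis using md o p by (simp add: tp_def x(2) succs_def)
          qed
        qed
        have "\<not> stA (snd (yy (xk k)))" using succs_stage(1)[OF st y(3)] by blast
        note z = zz[OF y(1) this conjunct1[OF t], folded nx_def xS]
        show ?thesis using y z st t unfolding q by auto
      qed
      have inv: "xk k \<in> I \<and> (\<exists>md. snd (xk k) = (md, w k, 0, qrun T w k) \<and> (md = 0 \<or> md = Suc j \<and> j < np T))" for k
      proof (induction k)
        case 0 then show ?case using g(1) w(2) by (simp add: x0 qrun_0)
      next
        case (Suc k) then show ?case using step[of k] by blast
      qed
      have stp: "yy (xk k) \<in> I \<and> (xk k, yy (xk k)) \<in> R \<and> (yy (xk k), xk (Suc k)) \<in> R \<and> stA (snd (xk k)) \<and>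
        (fst (snd (xk k)) = Suc j \<longrightarrow> fst (snd (xk (Suc k))) = Suc j)" for k
        using inv[of k] step[of k] by (metis fst_conv)
      show "(xk k \<in> I \<and> (\<exists>md. snd (xk k) = (md, w k, 0, qrun T w k) \<and> (md = 0 \<or> md = Suc j \<and> j < np T))) \<and>
        (yy (xk k) \<in> I \<and> (xk k, yy (xk k)) \<in> R \<and> (yy (xk k), xk (Suc k)) \<in> R \<and> stA (snd (xk k)) \<and>
        (fst (snd (xk k)) = Suc j \<longrightarrow> fst (snd (xk (Suc k))) = Suc j))" using inv stp by blast
    qed
    note inv = conjunct1[OF invstp] and stp = conjunct2[OF invstp]
    have "alternating T R xk (\<lambda>k. yy (xk k))" unfolding alternating_def using stp by blast
    from g(5)[OF this] have win: "winp T pv (ic T (\<lambda>k. snd (xk k)))" .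
    have q: "snd (snd (snd (snd (xk k)))) = qrun T w k" for k using inv[of k] by auto
    show ?thesis
    proof (cases "\<exists>K. fst (snd (xk K)) = Suc j")
      case True
      then obtain K where K: "fst (snd (xk K)) = Suc j" by blast
      then have j: "j < np T" using inv[of K] by auto
      have "fst (snd (xk k)) = Suc j" if "k \<ge> K" for k
        using that by (induction k rule: dec_induct) (use K stp in auto)
      then have ev: "\<forall>\<^sub>\<infinity>k. fst (snd (xk k)) = Suc j" unfolding MOST_nat_le by blast
      have "w \<notin> lang T j p" if "p < length (tabs T j)" "(nthd 0 pv j, p) \<in> set (prefs T j)" for p
        using winp_dev[OF s ww q ev j] win that by blast
      moreover have "w \<in> lang T j (pay G j w)" "pay G j w < length (tabs T j)"
        using pay_exact[OF j ex[OF j] ww] unfolding G_def by blast+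
      ultimately show ?thesis using j by blast
    next
      case False
      have "fst (snd (xk k)) = 0" for k
      proof -
        obtain md where md: "snd (xk k) = (md, w k, 0, qrun T w k)" "md = 0 \<or> md = Suc j \<and> j < np T"
          using inv[of k] by blast
        have "md \<noteq> Suc j" using False md(1) by (metis fst_conv)
        then show ?thesis using md by simp
      qed
      then have ev: "\<forall>\<^sub>\<infinity>k. fst (snd (xk k)) = 0" by simp
      have "pay G i w = nthd 0 pv i" if i: "i < np T" for i
        using winp_main[OF s ww q ev pv] win i pay_exact(1)[OF i ex[OF i] ww pv[OF i]] unfolding G_def by blast
      then show ?thesis by blast
    qed
  qed
  note op = outcome_props[OF s prof[unfolded G_def] sv, folded G_def]
  \<comment> \<open>No player has the index \<open>np T\<close>, so nobody is exempt from
    obeying.\<close>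
  have pay: "pay G i (outcome G \<sigma> (sv T)) = nthd 0 pv i" if "i < np T" for i
    using main[OF op(1,2,3), of "np T"] that by blast
  have "(pay G i (outcome G \<sigma> (sv T)), pay G i (outcome G (\<sigma>(i := \<tau>)) (sv T))) \<notin> pref G i"
    if i: "i < np T" and \<tau>: "strategy G i \<tau>" for i \<tau>
  proof -
    have "strategy_profile G (\<sigma>(i := \<tau>))" using prof \<tau> by (auto simp: strategy_profile_def)
    note ot = outcome_props[OF s this[unfolded G_def] sv, folded G_def]
    have con: "consistent G k (\<sigma> k) (outcome G (\<sigma>(i := \<tau>)) (sv T))" if "k < np T" "k \<noteq> i" for k
      using ot(3)[OF that(1)] that(2) by simp
    from main[of "outcome G (\<sigma>(i := \<tau>)) (sv T)" i, OF ot(1,2) con] have "(nthd 0 pv i, pay G i (outcome G (\<sigma>(i := \<tau>)) (sv T))) \<notin> set (prefs T i)"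
      using irr[OF i] i by auto
    then show ?thesis using pay[OF i] i by (simp add: G_def game_sel2)
  qed
  then have "nash_equilibrium G (sv T) \<sigma>"
    unfolding nash_equilibrium_def using prof by (simp add: G_def)
  then show ?thesis using pay by blast
qed

subsection \<open>From an equilibrium to a winning strategy of the prover\<close>

text \<open>If the challenger won, his graph could be played against a prover who proposes the moves
  of the equilibrium. Without an announced deviation this produces the outcome itself, with a payoff
  other than the claimed one; otherwise it produces a profitable deviation of one player.\<close>

theorem WT_if_NE:
  assumes s: "synt T" and ex: "\<And>i. i < np T \<Longrightarrow> exact T i" and N: "card (VV T) \<le> N"
    and pv: "\<And>i. i < np T \<Longrightarrow> nthd 0 pv i < length (tabs T i)"
  defines "G \<equiv> game_of (inst T)"
  assumes ne: "nash_equilibrium G (sv T) \<sigma>"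
    and pay: "\<And>i. i < np T \<Longrightarrow> pay G i (outcome G \<sigma> (sv T)) = nthd 0 pv i"
  shows "(0, sv T, 0, initq T) \<in> WT T pv N"
proof (rule ccontr)
  have sv: "sv T < nv T" using s by (simp add: synt_def)
  assume "(0, sv T, 0, initq T) \<notin> WT T pv N"
  then have nW: "(0, sv T, 0, initq T) \<in> VV T - WT T pv N" using start_VV[OF s _ sv, of 0] by auto
  have prof: "strategy_profile G \<sigma>" using ne unfolding nash_equilibrium_def by blast
  obtain I R m0 where g: "(m0, (0, sv T, 0, initq T)) \<in> I"
      "\<And>x. x \<in> I \<Longrightarrow> snd x \<in> VV T"
      "\<And>x u. x \<in> I \<Longrightarrow> stA (snd x) \<Longrightarrow> u \<in> set (succs T (snd x)) \<Longrightarrow> \<exists>y \<in> I. (x, y) \<in> R \<and> snd y = u"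
      "\<And>x. x \<in> I \<Longrightarrow> \<not> stA (snd x) \<Longrightarrow> \<exists>y \<in> I. (x, y) \<in> R \<and> snd y \<in> set (succs T (snd x))"
      "\<And>x y. alternating T R x y \<Longrightarrow> \<not> winp T pv (ic T (\<lambda>k. snd (x k)))"
    by (rule challenger_graph[OF s N nW], rule that)
  \<comment> \<open>The vertex history is carried along because the proposals depend on it through
    \<open>\<sigma>\<close>.\<close>
  define P where "P = (\<lambda>(k :: nat) (x, h). x \<in> I \<and> stA (snd x) \<and> history G h \<and> last h = vx (snd x) \<and>
      fst (snd x) \<le> np T \<and> (k = 0 \<longrightarrow> x = (m0, (0, sv T, 0, initq T)) \<and> h = [sv T]))"
  define Q where "Q = (\<lambda>(x, h) (z, h'). (\<exists>y. (x, y) \<in> R \<and> (y, z) \<in> R) \<and> h' = h @ [vx (snd z)] \<and>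
      qs_of (snd z) = stepq T (qs_of (snd x)) (vx (snd x)) \<and>
      (fst (snd x) = 0 \<longrightarrow> fst (snd z) = 0 \<or> fst (snd z) = Suc (owner T (vx (snd x)))) \<and>
      (fst (snd x) \<noteq> 0 \<longrightarrow> fst (snd z) = fst (snd x)) \<and>
      (fst (snd z) \<noteq> Suc (owner T (vx (snd x))) \<longrightarrow> vx (snd z) = \<sigma> (owner T (vx (snd x))) h))"
  have "\<exists>f. \<forall>k. P k (f k) \<and> Q (f k) (f (Suc k))"
  proof (rule dependent_nat_choice)
    show "\<exists>x. P 0 x"
      using g(1) sv by (intro exI[of _ "((m0, (0, sv T, 0, initq T)), [sv T])"])
        (simp add: P_def stA_def vx_def history_def G_def)
    fix xh k assume Pk: "P k xh"
    obtain x h where xh: "xh = (x, h)" by (cases xh)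
    then have x: "x \<in> I" "stA (snd x)" "history G h" "last h = vx (snd x)" "fst (snd x) \<le> np T"
      using Pk by (auto simp: P_def)
    obtain m v qs where mv: "snd x = (m, v, 0, qs)" using x(2) by (cases "snd x") (auto simp: stA_def)
    have v: "v < nv T" using g(2)[OF x(1)] by (auto simp: mv VV_def)
    have o: "owner T v < np T" by (rule owner_lt[OF s v])
    define u where "u = \<sigma> (owner T v) h"
    have "last h \<in> owned G (owner T v)" using owned_game[OF v] by (simp add: x(4) mv vx_def G_def)
    moreover have "strategy G (owner T v) (\<sigma> (owner T v))"
      using prof o by (simp add: strategy_profile_def G_def)
    ultimately have "(last h, u) \<in> edges G" using x(3) unfolding strategy_def u_def by blast
    then have u: "u \<in> set (outs T v)" unfolding G_def outs_edges by (simp add: x(4) mv vx_def)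
    obtain z where z: "z \<in> I" "\<exists>y. (x, y) \<in> R \<and> (y, z) \<in> R" "stA (snd z)" "vx (snd z) \<in> set (outs T v)"
       "qs_of (snd z) = stepq T qs v" "fst (snd z) \<le> np T" "m = 0 \<longrightarrow> fst (snd z) = 0 \<or> fst (snd z) = Suc (owner T v)"
       "m \<noteq> 0 \<longrightarrow> fst (snd z) = m" "fst (snd z) \<noteq> Suc (owner T v) \<longrightarrow> vx (snd z) = u"
    proof -
      \<comment> \<open>At a vertex of the deviating player the prover has only the dummy move to
        stage \<open>Suc 0\<close>; elsewhere the move of \<open>\<sigma>\<close> is
        proposed.\<close>
      let ?t = "if m = 0 \<or> Suc (owner T v) \<noteq> m then (m, v, Suc u, qs) else (m, v, Suc 0, qs)"
      have m: "m \<le> np T" using x(5) by (simp add: mv)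
      have "?t \<in> set (succs T (snd x))" using u m by (auto simp: mv succs_def)
      from g(3)[OF x(1,2) this] obtain y where y: "y \<in> I" "(x, y) \<in> R" "snd y = ?t" by blast
      have "\<not> stA (snd y)" by (simp add: y(3) stA_def)
      from g(4)[OF y(1) this] obtain z where z: "z \<in> I" "(y, z) \<in> R" "snd z \<in> set (succs T (snd y))" by blast
      have "stA (snd z) \<and> vx (snd z) \<in> set (outs T v) \<and> qs_of (snd z) = stepq T qs v \<and> fst (snd z) \<le> np T \<and>
        (m = 0 \<longrightarrow> fst (snd z) = 0 \<or> fst (snd z) = Suc (owner T v)) \<and> (m \<noteq> 0 \<longrightarrow> fst (snd z) = m) \<and>
        (fst (snd z) \<noteq> Suc (owner T v) \<longrightarrow> vx (snd z) = u)"
        using z(3) u m o unfolding y(3) by (auto simp: succs_def stA_def vx_def qs_of_def split: if_splits)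
      then show thesis using that z(1,2) y(2) by blast
    qed
    have "history G (h @ [vx (snd z)])"
    proof -
      have "(last h, vx (snd z)) \<in> edges G" using z(4) unfolding G_def outs_edges by (simp add: x(4) mv vx_def)
      moreover have "vx (snd z) < nv T" using outs_lt[OF s z(4)] by blast
      ultimately show ?thesis using x(3) unfolding history_def G_def by (auto simp: successively_append_iff)
    qed
    then have "P (Suc k) (z, h @ [vx (snd z)]) \<and> Q xh (z, h @ [vx (snd z)])"
      using z unfolding P_def Q_def xh by (simp add: mv vx_def qs_of_def u_def)
    then show "\<exists>y. P (Suc k) y \<and> Q xh y" by blast
  qed
  then obtain f where f: "\<And>k. P k (f k)" "\<And>k. Q (f k) (f (Suc k))" by blast
  define x where "x k = snd (fst (f k))" for k
  define w where "w k = vx (x k)" for k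
  have P: "fst (f k) \<in> I" "stA (x k)" "history G (snd (f k))" "fst (x k) \<le> np T" for k
    using f(1)[of k] by (auto simp: P_def x_def split: prod.splits)
  have P0: "x 0 = (0, sv T, 0, initq T)" "snd (f 0) = [sv T]"
    using f(1)[of 0] by (auto simp: P_def x_def split: prod.splits)
  have Q: "\<exists>y. (fst (f k), y) \<in> R \<and> (y, fst (f (Suc k))) \<in> R" "snd (f (Suc k)) = snd (f k) @ [w (Suc k)]"
     "qs_of (x (Suc k)) = stepq T (qs_of (x k)) (w k)"
     "fst (x k) = 0 \<Longrightarrow> fst (x (Suc k)) = 0 \<or> fst (x (Suc k)) = Suc (owner T (w k))"
     "fst (x k) \<noteq> 0 \<Longrightarrow> fst (x (Suc k)) = fst (x k)"
     "fst (x (Suc k)) \<noteq> Suc (owner T (w k)) \<Longrightarrow> w (Suc k) = \<sigma> (owner T (w k)) (snd (f k))" for k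
    using f(2)[of k] by (auto simp: Q_def x_def w_def split: prod.splits)
  have w0: "w 0 = sv T" by (simp add: w_def P0 vx_def)
  have h: "snd (f k) = map w [0..<Suc k]" for k
    by (induction k) (simp_all add: P0 w0 Q(2))
  have "(w k, w (Suc k)) \<in> edges G" "w k < nv T" for k
    using P(3)[of "Suc k"] unfolding h by (auto simp: history_def successively_append_iff G_def)
  then have play: "play G w" unfolding play_def omega_words_def by (auto simp: G_def)
  have ww: "w \<in> words T" using play_words play unfolding G_def by blast
  have wl: "w k < nv T" for k using play_lt play unfolding G_def by blast
  have q: "snd (snd (snd (x k))) = qrun T w k" for k
  proof -
    have "qs_of (x k) = qrun T w k"
      by (rule qrun_seq[OF s ww, of "\<lambda>k. qs_of (x k)"]) (simp_all add: P0 Q(3) qs_of_def[of "(_, _)"])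
    then show ?thesis by (simp only: qs_of_def)
  qed
  obtain y where "\<And>k. (fst (f k), y k) \<in> R \<and> (y k, fst (f (Suc k))) \<in> R" using Q(1) by metis
  then have "alternating T R (\<lambda>k. fst (f k)) y" unfolding alternating_def using P(2) unfolding x_def by blast
  from g(5)[OF this] have nwin: "\<not> winp T pv (ic T x)" unfolding x_def .
  note op = outcome_props[OF s prof[unfolded G_def] sv, folded G_def]
  show False
  proof (cases "\<forall>k. fst (x k) = 0")
    case True
    then have con: "consistent G i (\<sigma> i) w" if "i < np T" for i
      unfolding consistent_def using owned_game[OF wl, of _ i] Q(6) h by (auto simp: G_def)
    have "outcome G \<sigma> (sv T) = w" by (rule op(4)[OF play w0 con])
    then have "w \<in> lang T i (nthd 0 pv i)" if "i < np T" for i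
      using pay[OF that] pay_exact(1)[OF that ex[OF that] ww pv[OF that]] unfolding G_def by simp
    then show False using nwin winp_main[OF s ww q _ pv] True by simp
  next
    case False
    then obtain K where K: "fst (x K) \<noteq> 0" by blast
    then obtain i where i: "fst (x K) = Suc i" by (cases "fst (x K)") auto
    have iK: "fst (x k) = Suc i" if "k \<ge> K" for k
      using that by (induction k rule: dec_induct) (use i Q(5) in auto)
    have i01: "fst (x k) = 0 \<or> fst (x k) = Suc i" for k
    proof (cases "k \<ge> K")
      case False
      have "fst (x k) \<noteq> 0 \<Longrightarrow> fst (x (k + d)) = fst (x k)" for d by (induction d) (use Q(5) in auto)
      from this[of "K - k"] show ?thesis using False i by (cases "fst (x k) = 0") auto
    qed (use iK in auto)
    have inp: "i < np T" using P(4)[of K] i by simp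
    have con: "consistent G j (\<sigma> j) w" if "j < np T" "j \<noteq> i" for j
      unfolding consistent_def
    proof (intro allI impI)
      fix n assume "w n \<in> owned G j"
      then have "owner T (w n) = j" using owned_game[OF wl] unfolding G_def by blast
      then show "w (Suc n) = \<sigma> j (map w [0..<Suc n])"
        using Q(6)[of n] i01[of "Suc n"] that(2) unfolding h by auto
    qed
    \<comment> \<open>The deviation reproduces \<open>w\<close> along the prefixes of
      \<open>w\<close>; off them it falls back on \<open>\<sigma>\<close>.\<close>
    define \<tau> where "\<tau> h = (if h = map w [0..<length h] then w (length h) else \<sigma> i h)" for h
    have "strategy G i \<tau>"
      unfolding strategy_def
    proof (intro allI impI)
      fix h assume h: "history G h \<and> last h \<in> owned G i"
      show "(last h, \<tau> h) \<in> edges G"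
      proof (cases "h = map w [0..<length h]")
        case True
        have "h \<noteq> []" using h by (auto simp: history_def)
        then obtain l where l: "length h = Suc l" by (cases h) auto
        have "last h = w l" using True unfolding l by (metis l last_map last_upt length_Cons list.size(3) map_is_Nil_conv nat.simps(3) upt_Suc diff_Suc_1 zero_less_Suc \<open>h \<noteq> []\<close>)
        then show ?thesis using True play unfolding \<tau>_def play_def by (simp add: l)
      next
        case False
        then show ?thesis using h prof inp unfolding \<tau>_def strategy_profile_def strategy_def by (auto simp: G_def)
      qed
    qed
    note \<tau> = this
    have prof': "strategy_profile G (\<sigma>(i := \<tau>))" using prof \<tau> by (auto simp: strategy_profile_def)
    note ot = outcome_props[OF s prof'[unfolded G_def] sv, folded G_def]
    have con\<tau>: "consistent G i \<tau> w" unfolding consistent_def \<tau>_def by simp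
    have ow: "outcome G (\<sigma>(i := \<tau>)) (sv T) = w"
      by (rule ot(4)[OF play w0]) (use con con\<tau> in \<open>auto simp: fun_upd_def\<close>)
    have "i \<in> players G" using inp by (simp add: G_def)
    then have "(pay G i (outcome G \<sigma> (sv T)), pay G i (outcome G (\<sigma>(i := \<tau>)) (sv T))) \<notin> pref G i"
      using ne \<tau> unfolding nash_equilibrium_def by blast
    then have "(nthd 0 pv i, pay G i w) \<notin> set (prefs T i)"
      unfolding pay[OF inp] ow using game_sel2(2)[OF inp] by (simp add: G_def)
    then have "w \<notin> lang T i p" if "p < length (tabs T i)" "(nthd 0 pv i, p) \<in> set (prefs T i)" for p
      using that pay_exact(1)[OF inp ex[OF inp] ww that(1)] unfolding G_def by auto
    moreover have "\<forall>\<^sub>\<infinity>k. fst (x k) = Suc i" unfolding MOST_nat_le using iK by blast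
    ultimately show False using nwin winp_dev[OF s ww q _ inp] by blast
  qed
qed

section \<open>Encoding and parsing instances\<close>

lemma fp_min [fp_intros]: "fp f \<Longrightarrow> fp g \<Longrightarrow> fp (\<lambda>x. min (f x) (g x) :: nat)"
  unfolding min_def by (intro fp_intros)

definition half :: "nat \<Rightarrow> nat \<times> bool" where
  "half n = ((\<lambda>p. if snd p then (Suc (fst p), False) else (fst p, True)) ^^ n) (0, False)"

lemma half: "half n = (n div 2, odd n)"
  by (induction n) (auto simp: half_def)

lemma fp_half0: "fp half"
proof -
  have "fp (\<lambda>n :: nat. ((\<lambda>p. if snd p then (Suc (fst p), False) else (fst p, True)) ^^ n) (0, False))"
  proof (rule fp_funpow[of "\<lambda>_ p. if snd p then (Suc (fst p), False) else (fst p, True)" _ _ "\<lambda>n. n + 10"])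
    fix n i :: nat assume "i \<le> n"
    then show "sz (((\<lambda>p. if snd p then (Suc (fst p), False) else (fst p, True)) ^^ i) (0, False)) \<le> sz n + 10"
      unfolding half_def[symmetric] half using sz_bool[of "odd i"] by (simp add: sz_nat)
  qed (intro fp_intros pb_intros)+
  then show ?thesis unfolding half_def .
qed

lemma fp_div2 [fp_intros]: "fp f \<Longrightarrow> fp (\<lambda>e. f e div 2 :: nat)"
  using fp_fst[OF fp_comp[OF fp_half0]] by (simp add: half)

lemma fp_odd [fp_intros]: "fp f \<Longrightarrow> fp (\<lambda>e. odd (f e :: nat))"
  using fp_snd[OF fp_comp[OF fp_half0]] by (simp add: half)

lemma fp_even [fp_intros]: "fp f \<Longrightarrow> fp (\<lambda>e. even (f e :: nat))"
  using fp_not[OF fp_odd] by simp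

definition bit_step :: "nat \<times> bool list \<Rightarrow> nat \<times> bool list" where
  "bit_step s = (if fst s = 0 then s else (fst s div 2, odd (fst s) # snd s))"

lemma bit_step_iter: "n \<le> k \<Longrightarrow> (bit_step ^^ k) (n, bs) = (0, rev (bits n) @ bs)"
proof (induction k arbitrary: n bs)
  case 0
  then show ?case by (simp add: bits.simps[of 0])
next
  case (Suc k)
  show ?case
  proof (cases "n = 0")
    case True
    then show ?thesis using Suc.IH[of 0 bs] by (simp add: funpow_swap1 bit_step_def)
  next
    case False
    then have "n div 2 \<le> k" using Suc.prems by linarith
    from Suc.IH[OF this, of "odd n # bs"] False show ?thesis
      by (simp add: funpow_swap1 bit_step_def[of "(n, bs)"] bits.simps[of n])
  qed
qed

lemma fp_bits [fp_intros]:
  assumes "fp f"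
  shows "fp (\<lambda>e. bits (f e))"
proof -
  have "fp (\<lambda>n. (bit_step ^^ n) (n, []))"
  proof (rule fp_funpow[of "\<lambda>_. bit_step" _ _ "\<lambda>n. n + 1 + 5 * n + 5"])
    show "fp (\<lambda>p. bit_step (snd p))" unfolding bit_step_def by (intro fp_intros)
    fix n i :: nat assume i: "i \<le> n"
    have "fst ((bit_step ^^ i) (n, [])) \<le> n \<and> sz (snd ((bit_step ^^ i) (n, []))) \<le> 4 * i + 1"
    proof (induction i)
      case (Suc i)
      obtain a bs where it: "(bit_step ^^ i) (n, []) = (a, bs)" by (cases "(bit_step ^^ i) (n, [])")
      have S: "(bit_step ^^ Suc i) (n, []) = bit_step (a, bs)" by (simp add: it)
      have "a \<le> n" "sz bs \<le> 4 * i + 1" using Suc by (simp_all add: it)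
      then show ?case unfolding S using sz_bool[of "odd a"] by (auto simp: bit_step_def)
    qed simp
    then have "sz (fst ((bit_step ^^ i) (n, [])), snd ((bit_step ^^ i) (n, []))) \<le> sz n + 1 + 5 * sz n + 5"
      unfolding sz_simps sz_nat using i by auto
    then show "sz ((bit_step ^^ i) (n, [])) \<le> sz n + 1 + 5 * sz n + 5" by simp
  qed (intro fp_intros pb_intros)+
  then have "fp (\<lambda>n. rev (snd ((bit_step ^^ n) (n, []))))" by (intro fp_intros)
  then have "fp (\<lambda>n. bits n)" by (simp add: bit_step_iter)
  from fp_comp[OF this assms] show ?thesis .
qed

lemma fp_enc_list [fp_intros]:
  assumes "fp (\<lambda>p. g (fst p) (snd p))" "fp xs"
  shows "fp (\<lambda>e. enc_list (g e) (xs e))"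
  unfolding enc_list_def by (intro fp_intros assms)

lemma fp_enc_nat [fp_intros]: "fp f \<Longrightarrow> fp (\<lambda>e. enc_nat (f e))"
  unfolding enc_nat_def by (intro fp_intros)

lemma fp_enc_pair [fp_intros]:
  assumes "fp (\<lambda>p. g (fst p) (snd p))" "fp (\<lambda>p. h (fst p) (snd p))" "fp f"
  shows "fp (\<lambda>e. enc_pair (g e) (h e) (f e))"
proof -
  have "fp (\<lambda>e. g e (fst (f e)))" "fp (\<lambda>e. h e (snd (f e)))"
    using fp_comp[OF assms(1), of "\<lambda>e. (e, fst (f e))"] fp_comp[OF assms(2), of "\<lambda>e. (e, snd (f e))"] assms(3)
    by (simp_all add: fp_intros)
  then show ?thesis unfolding enc_pair_def by (intro fp_intros)
qed

definition enc_tab :: "tab \<Rightarrow> bool list" where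
  "enc_tab t = enc_nat (fst t) @ enc_list (enc_pair enc_nat (enc_list enc_nat)) (snd t)"

definition enc_pl :: "tab list \<times> (nat \<times> nat) list \<Rightarrow> bool list" where
  "enc_pl d = enc_list enc_tab (fst d) @ enc_list (enc_pair enc_nat enc_nat) (snd d)"

definition encT :: "tinst \<Rightarrow> bool list" where
  "encT T = enc_list enc_nat (fst T) @ enc_list (enc_pair enc_nat enc_nat) (fst (snd T)) @
     enc_list enc_pl (fst (snd (snd T))) @ enc_nat (fst (snd (snd (snd T)))) @
     enc_list enc_nat (snd (snd (snd (snd T))))"

lemma enc_list_map: "enc_list e (map f xs) = enc_list (\<lambda>x. e (f x)) xs"
  by (simp add: enc_list_def comp_def)

lemma encode_inst: "encode (inst T) = encT T"
proof -
  have "enc_dpa (tab_of t) = enc_tab t" for t by (simp add: enc_dpa_def tab_of_def enc_tab_def)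
  then have "enc_player (player_of d) = enc_pl d" for d
    by (simp add: enc_player_def player_of_def enc_pl_def enc_list_map)
  then show ?thesis by (simp add: encode_def inst_def encT_def enc_list_map)
qed

lemma fp_encT: "fp encT"
  unfolding encT_def enc_pl_def enc_tab_def by (intro fp_intros)

definition pbit :: "bool list \<Rightarrow> bool \<times> bool list" where
  "pbit r = (case r of [] \<Rightarrow> (False, []) | b # r' \<Rightarrow> (b, r'))"

text \<open>The last component records that the end marker was read. As many rounds as there are
  input symbols suffice, since every element costs at least its marker.\<close>

definition plist_step :: "(bool list \<Rightarrow> 'a \<times> bool list) \<Rightarrow> 'a list \<times> bool list \<times> bool \<Rightarrow> 'a list \<times> bool list \<times> bool" where
  "plist_step p s = (if snd (snd s) then s else case fst (snd s) of [] \<Rightarrow> (fst s, [], True)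
     | b # r \<Rightarrow> if b then (fst (p r) # fst s, snd (p r), False) else (fst s, r, True))"

definition plist :: "(bool list \<Rightarrow> 'a \<times> bool list) \<Rightarrow> bool list \<Rightarrow> 'a list \<times> bool list" where
  "plist p r = (case (plist_step p ^^ length r) ([], r, False) of (xs, r', _) \<Rightarrow> (rev xs, r'))"

lemma plist_done: "(plist_step p ^^ k) (xs, r, True) = (xs, r, True)"
  by (induction k) (simp_all add: plist_step_def)

lemma plist_iter:
  assumes "\<And>x r. x \<in> set xs \<Longrightarrow> p (e x @ r) = (x, r)"
  shows "length xs < k \<Longrightarrow> (plist_step p ^^ k) (ys, enc_list e xs @ r, False) = (rev xs @ ys, r, True)"
  using assms
proof (induction xs arbitrary: ys k)
  case Nil
  then obtain k' where k: "k = Suc k'" by (cases k) auto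
  have "plist_step p (ys, enc_list e [] @ r, False) = (ys, r, True)" by (simp add: plist_step_def enc_list_def)
  then show ?case by (simp add: k funpow_swap1 plist_done del: funpow.simps add: funpow_Suc_right)
next
  case (Cons x xs)
  then obtain k' where k: "k = Suc k'" "length xs < k'" by (cases k) auto
  have "plist_step p (ys, enc_list e (x # xs) @ r, False) = (x # ys, enc_list e xs @ r, False)"
    using Cons.prems(2)[of x] by (simp add: plist_step_def enc_list_def)
  then show ?case using Cons.IH[OF k(2), of "x # ys"] Cons.prems(2)
    by (simp add: k(1) del: funpow.simps add: funpow_Suc_right)
qed

lemma enc_list_length: "x \<in> set xs \<Longrightarrow> length (e x) < length (enc_list e xs)" "length xs < length (enc_list e xs)"
proof -
  show "length xs < length (enc_list e xs)" by (induction xs) (auto simp: enc_list_def)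
  show "length (e x) < length (enc_list e xs)" if "x \<in> set xs"
    using that by (induction xs) (auto simp: enc_list_def)
qed

lemma plist:
  assumes "\<And>x r. x \<in> set xs \<Longrightarrow> p (e x @ r) = (x, r)"
  shows "plist p (enc_list e xs @ r) = (xs, r)"
  using plist_iter[of xs p e "length (enc_list e xs @ r)" "[]" r, OF assms] enc_list_length(2)[of xs e]
  by (simp add: plist_def)

text \<open>Input numbers are binary but values are held in unary, so a number may be exponentially
  large. The cap \<open>c\<close> bounds all intermediate values.\<close>

definition bval :: "nat \<Rightarrow> bool list \<Rightarrow> nat" where
  "bval c bs = foldl (\<lambda>n b. min c (n + n + (if b then 1 else 0))) 0 (rev bs)"

lemma bval_Cons: "bval c (b # bs) = min c (bval c bs + bval c bs + (if b then 1 else 0))"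
  by (simp add: bval_def)

lemma bval_bits: "n \<le> c \<Longrightarrow> bval c (bits n) = n"
proof (induction n rule: less_induct)
  case (less n)
  show ?case
  proof (cases "n = 0")
    case False
    then have "bval c (bits (n div 2)) = n div 2" using less by simp
    moreover have "n div 2 + n div 2 + (if odd n then 1 else 0) = n" by presburger
    ultimately show ?thesis using False less.prems by (simp add: bits.simps[of n] bval_Cons del: One_nat_def)
  qed (simp add: bits.simps[of 0] bval_def)
qed

definition pnat :: "nat \<Rightarrow> bool list \<Rightarrow> nat \<times> bool list" where
  "pnat c r = (case plist pbit r of (bs, r') \<Rightarrow> (bval c bs, r'))"

definition ppair :: "(bool list \<Rightarrow> 'a \<times> bool list) \<Rightarrow> (bool list \<Rightarrow> 'b \<times> bool list) \<Rightarrow>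
    bool list \<Rightarrow> ('a \<times> 'b) \<times> bool list" where
  "ppair p q r = (case p r of (x, r') \<Rightarrow> case q r' of (y, r'') \<Rightarrow> ((x, y), r''))"

lemma pnat: "n \<le> c \<Longrightarrow> pnat c (enc_nat n @ r) = (n, r)"
  unfolding pnat_def enc_nat_def by (subst plist) (auto simp: pbit_def bval_bits)

lemma ppair: "p (e (fst z) @ f (snd z) @ r) = (fst z, f (snd z) @ r) \<Longrightarrow> q (f (snd z) @ r) = (snd z, r) \<Longrightarrow>
    ppair p q (enc_pair e f z @ r) = (z, r)"
  by (simp add: ppair_def enc_pair_def)

definition ptab :: "nat \<Rightarrow> bool list \<Rightarrow> tab \<times> bool list" where
  "ptab c = ppair (pnat c) (plist (ppair (pnat c) (plist (pnat c))))"

definition ppl :: "nat \<Rightarrow> bool list \<Rightarrow> (tab list \<times> (nat \<times> nat) list) \<times> bool list" where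
  "ppl c = ppair (plist (ptab c)) (plist (ppair (pnat c) (pnat c)))"

definition pinst :: "nat \<Rightarrow> bool list \<Rightarrow> tinst \<times> bool list" where
  "pinst c = ppair (plist (pnat c)) (ppair (plist (ppair (pnat c) (pnat c)))
     (ppair (plist (ppl c)) (ppair (pnat c) (plist (pnat c)))))"

lemma length_enc_pair: "length (enc_pair e f z) = length (e (fst z)) + length (f (snd z))"
  by (simp add: enc_pair_def)

lemma bits_length: "n < 2 ^ length (bits n)"
proof (induction n rule: less_induct)
  case (less n)
  show ?case
  proof (cases "n = 0")
    case False
    then have "n div 2 < 2 ^ length (bits (n div 2))" using less by simp
    then show ?thesis using False by (simp add: bits.simps[of n])
  qed simp
qed

lemma enc_nat_length: "n < 2 ^ length (enc_nat n)"
proof -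
  have "(2 :: nat) ^ length (bits n) \<le> 2 ^ length (enc_nat n)"
    unfolding enc_nat_def using enc_list_length(2)[of "bits n" "\<lambda>b. [b]"] by (intro power_increasing) auto
  then show ?thesis using bits_length[of n] by linarith
qed

lemma pnat2: "length (enc_nat n) \<le> l \<Longrightarrow> 2 ^ l \<le> c \<Longrightarrow> pnat c (enc_nat n @ r) = (n, r)"
proof (rule pnat)
  assume "length (enc_nat n) \<le> l" "2 ^ l \<le> c"
  then have "(2 :: nat) ^ length (enc_nat n) \<le> c" using power_increasing[of "length (enc_nat n)" l "2 :: nat"] by linarith
  then show "n \<le> c" using enc_nat_length[of n] by linarith
qed

text \<open>\<open>l\<close> bounds the length of the parsed text; a number whose code has at most
  \<open>l\<close> symbols is below \<open>2 ^ l\<close> and so is not cut by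
  \<open>c\<close>.\<close>

context
  fixes c l :: nat
  assumes c: "2 ^ l \<le> c"
begin

lemma plist2:
  assumes "\<And>x r. length (e x) \<le> l \<Longrightarrow> p (e x @ r) = (x, r)" and len: "length (enc_list e xs) \<le> l"
  shows "plist p (enc_list e xs @ r) = (xs, r)"
proof (rule plist)
  fix x r assume "x \<in> set xs"
  then have "length (e x) \<le> l" using enc_list_length(1)[of x xs e] len by simp
  then show "p (e x @ r) = (x, r)" by (rule assms(1))
qed

lemma ppair2:
  assumes "\<And>x r. length (e x) \<le> l \<Longrightarrow> p (e x @ r) = (x, r)" "\<And>x r. length (f x) \<le> l \<Longrightarrow> q (f x @ r) = (x, r)"
    "length (enc_pair e f z) \<le> l"
  shows "ppair p q (enc_pair e f z @ r) = (z, r)"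
  using assms by (intro ppair) (auto simp: length_enc_pair)

lemma pnat3: "length (enc_nat n) \<le> l \<Longrightarrow> pnat c (enc_nat n @ r) = (n, r)"
  using pnat2 c by blast

lemma ptab: "length (enc_tab t) \<le> l \<Longrightarrow> ptab c (enc_tab t @ r) = (t, r)"
proof -
  have "enc_tab t = enc_pair enc_nat (enc_list (enc_pair enc_nat (enc_list enc_nat))) t" for t
    by (simp add: enc_tab_def enc_pair_def)
  then show "length (enc_tab t) \<le> l \<Longrightarrow> ptab c (enc_tab t @ r) = (t, r)"
    unfolding ptab_def by (simp only:) (intro ppair2 plist2 pnat3, assumption+)
qed

lemma ppl: "length (enc_pl t) \<le> l \<Longrightarrow> ppl c (enc_pl t @ r) = (t, r)"
proof -
  have "enc_pl t = enc_pair (enc_list enc_tab) (enc_list (enc_pair enc_nat enc_nat)) t" for t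
    by (simp add: enc_pl_def enc_pair_def)
  then show "length (enc_pl t) \<le> l \<Longrightarrow> ppl c (enc_pl t @ r) = (t, r)"
    unfolding ppl_def by (simp only:) (intro ppair2 plist2 pnat3 ptab, assumption+)
qed

lemma pinst: "length (encT t) \<le> l \<Longrightarrow> pinst c (encT t @ r) = (t, r)"
proof -
  have "encT t = enc_pair (enc_list enc_nat) (enc_pair (enc_list (enc_pair enc_nat enc_nat))
      (enc_pair (enc_list enc_pl) (enc_pair enc_nat (enc_list enc_nat)))) t" for t
    by (simp add: encT_def enc_pair_def)
  then show "length (encT t) \<le> l \<Longrightarrow> pinst c (encT t @ r) = (t, r)"
    unfolding pinst_def by (simp only:) (intro ppair2 plist2 pnat3 ppl, assumption+)
qed

end

text \<open>The bound on the remaining input bounds the results of iterated parsing.\<close>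

definition fparse :: "('e :: cod \<Rightarrow> bool list \<Rightarrow> 'a :: cod \<times> bool list) \<Rightarrow> bool" where
  "fparse p \<longleftrightarrow> fp (\<lambda>z. p (fst z) (snd z)) \<and> (\<forall>e r. sz (snd (p e r)) \<le> sz r)"

lemma fparse_pbit: "fparse (\<lambda>e. pbit)"
proof -
  have "fp (\<lambda>z :: 'a \<times> bool list. pbit (snd z))" unfolding pbit_def by (intro fp_intros)
  then show ?thesis unfolding fparse_def by (auto simp: pbit_def split: list.splits)
qed

lemma fparse_ppair:
  assumes "fparse p" "fparse q"
  shows "fparse (\<lambda>e. ppair (p e) (q e))"
proof -
  have p: "fp (\<lambda>z. p (fst z) (snd z))" and q: "fp (\<lambda>z. q (fst z) (snd z))"
    using assms unfolding fparse_def by blast+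
  have "fp (\<lambda>z. q (fst z) (snd (p (fst z) (snd z))))"
    using fp_comp[OF q, of "\<lambda>z. (fst z, snd (p (fst z) (snd z)))"] p by (simp add: fp_intros)
  then have "fp (\<lambda>z. ppair (p (fst z)) (q (fst z)) (snd z))"
    unfolding ppair_def case_prod_beta by (intro fp_intros p)
  moreover have "sz (snd (ppair (p e) (q e) r)) \<le> sz r" for e r
  proof -
    have "sz (snd (q e (snd (p e r)))) \<le> sz (snd (p e r))" "sz (snd (p e r)) \<le> sz r"
      using assms unfolding fparse_def by blast+
    then show ?thesis unfolding ppair_def case_prod_beta by simp
  qed
  ultimately show ?thesis unfolding fparse_def by blast
qed

lemma fparse_plist:
  fixes p :: "'e :: cod \<Rightarrow> bool list \<Rightarrow> 'a :: cod \<times> bool list"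
  assumes "fparse p"
  shows "fparse (\<lambda>e. plist (p e))"
proof -
  have p: "fp (\<lambda>z. p (fst z) (snd z))" and le: "\<And>e r. sz (snd (p e r)) \<le> sz r"
    using assms unfolding fparse_def by blast+
  let ?it = "\<lambda>z i. (plist_step (p (fst z)) ^^ i) ([], snd z, False)"
  obtain q where q: "pb q" "\<And>z. sz (p (fst z) (snd z)) \<le> q (sz z)" "mono q" using fp_size[OF p] by blast
  have inv: "sz (fst (snd (?it z i))) \<le> sz (snd z) \<and> sz (fst (?it z i)) \<le> 1 + i * Suc (q (sz z))" for z i
  proof (induction i)
    case (Suc i)
    obtain xs r d where it: "?it z i = (xs, r, d)" by (cases "?it z i")
    have r: "sz r \<le> sz (snd z)" "sz xs \<le> 1 + i * Suc (q (sz z))" using Suc by (simp_all add: it)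
    have S: "?it z (Suc i) = plist_step (p (fst z)) (xs, r, d)" by (simp add: it)
    show ?case unfolding S
    proof (cases "d \<or> r = [] \<or> \<not> hd r")
      case True
      then show "sz (fst (snd (plist_step (p (fst z)) (xs, r, d)))) \<le> sz (snd z) \<and>
          sz (fst (plist_step (p (fst z)) (xs, r, d))) \<le> 1 + Suc i * Suc (q (sz z))"
        using r by (cases r) (auto simp: plist_step_def)
    next
      case False
      then obtain r' where r': "r = True # r'" "\<not> d" by (cases r) auto
      have "sz (fst z, r') \<le> sz z" using r(1) by (cases z) (simp add: r')
      then have "sz (p (fst z) r') \<le> q (sz z)" using q(2)[of "(fst z, r')"] monoD[OF q(3)] by fastforce
      then have "sz (fst (p (fst z) r')) \<le> q (sz z)" using sz_fst_snd(1)[of "p (fst z) r'"] by linarith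
      then show "sz (fst (snd (plist_step (p (fst z)) (xs, r, d)))) \<le> sz (snd z) \<and>
          sz (fst (plist_step (p (fst z)) (xs, r, d))) \<le> 1 + Suc i * Suc (q (sz z))"
        using r le[of "fst z" r'] by (simp add: plist_step_def r')
    qed
  qed simp
  have "fp (\<lambda>z. ?it z (length (snd z)))"
  proof (rule fp_funpow[of "\<lambda>z. plist_step (p (fst z))" _ _ "\<lambda>n. n + 1 + n * Suc (q n) + 10"])
    have "fp (\<lambda>w. p (fst (fst (fst w))) (snd (snd w)))"
      using fp_comp[OF p, of "\<lambda>w. (fst (fst (fst w)), snd (snd w))"] by (simp add: fp_intros)
    then show "fp (\<lambda>y. plist_step (p (fst (fst y))) (snd y))"
      unfolding plist_step_def by (intro fp_intros)
    fix z :: "'e \<times> bool list" and i assume i: "i \<le> length (snd z)"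
    obtain xs r d where it: "?it z i = (xs, r, d)" by (cases "?it z i")
    have "length (snd z) \<le> sz z" "sz (snd z) \<le> sz z"
      using length_le_sz[of "snd z"] sz_fst_snd(2)[of z] by linarith+
    then have "i * Suc (q (sz z)) \<le> sz z * Suc (q (sz z))" using i by (intro mult_right_mono) auto
    then show "sz (?it z i) \<le> sz z + 1 + sz z * Suc (q (sz z)) + 10"
      using inv[where z = z and i = i] sz_bool[of d] \<open>sz (snd z) \<le> sz z\<close> by (simp add: it)
  qed (intro fp_intros pb_intros q)+
  then have "fp (\<lambda>z. plist (p (fst z)) (snd z))"
    unfolding plist_def case_prod_beta by (intro fp_intros)
  moreover have "sz (snd (plist (p e) r)) \<le> sz r" for e r
    using inv[where z = "(e, r)" and i = "length r"] by (simp add: plist_def case_prod_beta)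
  ultimately show ?thesis unfolding fparse_def by blast
qed

lemma fp_bval [fp_intros]:
  assumes "fp c" "fp bs"
  shows "fp (\<lambda>e. bval (c e) (bs e))"
proof -
  obtain q where q: "pb q" "\<And>e. sz (c e) \<le> q (sz e)" using fp_size[OF assms(1)] by blast
  show ?thesis unfolding bval_def
  proof (rule fp_foldl_add[OF _ _ _ q(1)])
    show "fp (\<lambda>p. min (c (fst p)) (fst (snd p) + fst (snd p) + (if snd (snd p) then 1 else 0)))"
      by (intro fp_intros fp_comp[OF assms(1)])
    show "sz (min (c e) (a + a + (if y then 1 else 0))) \<le> sz a + q (sz e)" for e a y
      using q(2)[of e] by (simp add: sz_nat min_def)
  qed (intro fp_intros assms)+
qed

lemma fparse_pnat: "fparse pnat"
proof -
  have b: "fp (\<lambda>z :: nat \<times> bool list. plist pbit (snd z))" "\<And>r. sz (snd (plist pbit r)) \<le> sz r"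
    using fparse_plist[OF fparse_pbit[where 'a = nat]] unfolding fparse_def by auto
  then have "fp (\<lambda>z. pnat (fst z) (snd z))" unfolding pnat_def case_prod_beta by (intro fp_intros b)
  then show ?thesis using b(2) unfolding fparse_def by (simp add: pnat_def case_prod_beta)
qed

lemma fparse_pinst: "fparse pinst"
  unfolding pinst_def ppl_def ptab_def
  by (intro fparse_ppair fparse_plist fparse_pnat)

lemma fp_pinst [fp_intros]: "fp c \<Longrightarrow> fp r \<Longrightarrow> fp (\<lambda>e. pinst (c e) (r e))"
  by (rule fp_bin) (use fparse_pinst in \<open>simp_all add: fparse_def\<close>)

section \<open>Deciding the problem\<close>

text \<open>
  Products are cut off at \<open>cap\<close> elements, which keeps the function polynomial in \<open>cap\<close>; the
  cut is never reached when \<open>cap\<close> is large enough.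
\<close>

definition cprod :: "nat \<Rightarrow> 'a list list \<Rightarrow> 'a list list" where
  "cprod cap xss = foldl (\<lambda>acc xs. take cap (concat (map (\<lambda>x. map (\<lambda>l. x # l) acc) xs))) [[]] (rev xss)"

lemma cprod_Cons: "cprod cap (xs # xss) = take cap (concat (map (\<lambda>x. map (\<lambda>l. x # l) (cprod cap xss)) xs))"
  by (simp add: cprod_def)

text \<open>The factors are nonempty, so each partial product is at most the whole product; bounding
  the whole therefore prevents a cut at every stage.\<close>

lemma cprod_eq:
  assumes "\<And>xs. xs \<in> set xss \<Longrightarrow> xs \<noteq> []" "prod_list (map length xss) \<le> cap"
  shows "cprod cap xss = product_lists xss \<and> length (product_lists xss) = prod_list (map length xss)"
  using assms
proof (induction xss)
  case (Cons xs xss)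
  have "1 \<le> length xs" using Cons.prems(1)[of xs] by (simp add: Suc_le_eq)
  then have "1 * prod_list (map length xss) \<le> length xs * prod_list (map length xss)" by (rule mult_right_mono) simp
  also have "\<dots> \<le> cap" using Cons.prems(2) by simp
  finally have le: "prod_list (map length xss) \<le> cap" by simp
  have IH: "cprod cap xss = product_lists xss" "length (product_lists xss) = prod_list (map length xss)"
    using Cons.IH[OF _ le] Cons.prems(1) by auto
  have "length (concat (map (\<lambda>x. map (\<lambda>l. x # l) (product_lists xss)) xs)) = prod_list (map length (xs # xss))"
    by (simp add: length_concat comp_def IH(2) sum_list_triv)
  then show ?case using Cons.prems(2) by (simp add: cprod_Cons IH(1))
qed (simp add: cprod_def)

lemma cprod_mem:
  assumes "\<And>xs. xs \<in> set xss \<Longrightarrow> xs \<noteq> []" "prod_list (map length xss) \<le> cap"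
  shows "l \<in> set (cprod cap xss) \<longleftrightarrow> length l = length xss \<and> (\<forall>i < length xss. l ! i \<in> set (xss ! i))"
  using cprod_eq[OF assms] by (auto simp: product_lists_set list_all2_conv_all_nth)

lemma fp_cprod [fp_intros]:
  fixes xss :: "'e :: cod \<Rightarrow> 'a :: cod list list"
  assumes "fp cap" "fp xss"
  shows "fp (\<lambda>e. cprod (cap e) (xss e))"
proof -
  obtain q where q: "pb q" "\<And>e. sz (cap e) \<le> q (sz e)" using fp_size[OF assms(1)] by blast
  obtain r where r: "pb r" "\<And>e. sz (xss e) \<le> r (sz e)" using fp_size[OF assms(2)] by blast
  let ?g = "\<lambda>cap acc xs. take cap (concat (map (\<lambda>x. map (\<lambda>l. x # l) acc) xs))"
  have elem: "l \<in> set (foldl (?g c) [[]] ys) \<Longrightarrow> sz l \<le> sz ys" for l c and ys :: "'a list list"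
  proof (induction ys arbitrary: l rule: rev_induct)
    case (snoc xs ys)
    then have "l \<in> set (concat (map (\<lambda>x. map (\<lambda>l. x # l) (foldl (?g c) [[]] ys)) xs))"
      by (auto dest: in_set_takeD)
    then obtain x l' where l: "l = x # l'" "x \<in> set xs" "l' \<in> set (foldl (?g c) [[]] ys)" by auto
    then show ?case using snoc.IH[OF l(3)] sz_member[OF l(2)] sz_append[of ys "[xs]"] by simp
  qed simp
  have len: "length (foldl (?g c) [[]] ys) \<le> Suc c" for c and ys :: "'a list list"
    by (induction ys rule: rev_induct) auto
  show ?thesis unfolding cprod_def
  proof (rule fp_foldl[where q = "\<lambda>n. Suc (Suc (q n) * Suc (r n))"])
    show "fp (\<lambda>p. ?g (cap (fst p)) (fst (snd p)) (snd (snd p)))"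
      by (intro fp_intros fp_comp[OF assms(1)])
    show "pb (\<lambda>n. Suc (Suc (q n) * Suc (r n)))" by (intro pb_intros q r)
    fix e ys zs assume "rev (xss e) = ys @ zs"
    then have "sz (xss e) + 1 = sz ys + sz zs" using sz_append[of ys zs] by (metis sz_rev)
    then have ys: "sz ys \<le> r (sz e)" using r(2)[of e] sz_pos(2)[of zs] by linarith
    have "sz (foldl (?g (cap e)) [[]] ys) \<le> Suc (length (foldl (?g (cap e)) [[]] ys) * Suc (r (sz e)))"
      by (rule sz_list_bound) (use elem[of _ "cap e" ys] ys in \<open>force intro: order_trans\<close>)
    also have "\<dots> \<le> Suc (Suc (q (sz e)) * Suc (r (sz e)))"
    proof -
      have "length (foldl (?g (cap e)) [[]] ys) \<le> Suc (q (sz e))"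
        using len[of "cap e" ys] q(2)[of e] by (simp add: sz_nat)
      then show ?thesis by (intro Suc_leI le_imp_less_Suc mult_right_mono) auto
    qed
    finally show "sz (foldl (?g (cap e)) [[]] ys) \<le> Suc (Suc (q (sz e)) * Suc (r (sz e)))" .
  qed (intro fp_intros assms)+
qed

type_synonym path = "((nat \<times> nat) \<times> nat) list"

definition Vl :: "nat \<Rightarrow> tinst \<Rightarrow> pos list" where
  "Vl cap T = concat (map (\<lambda>m. concat (map (\<lambda>v. concat (map (\<lambda>s. map (\<lambda>qs. (m, v, s, qs))
     (cprod cap (map (\<lambda>a. [0..<length (snd (atab T a))]) [0..<naut T]))) [0..<Suc (nv T)])) [0..<nv T]))
     [0..<Suc (2 * np T)])"

definition Cl :: "tinst \<Rightarrow> (nat \<times> nat) list" where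
  "Cl T = concat (map (\<lambda>a. map (\<lambda>q. (a, q)) [0..<length (snd (atab T a))]) [0..<naut T]) @
     map (\<lambda>m. (naut T, m)) [0..<Suc (2 * np T)]"

definition paths :: "nat \<Rightarrow> nat \<Rightarrow> (nat \<times> nat) list \<Rightarrow> path list" where
  "paths cap N cs = concat (map (\<lambda>j. cprod cap (replicate j (concat (map (\<lambda>c. map (\<lambda>i. (c, i)) [0..<Suc N]) cs))))
     [0..<Suc (length cs)])"

definition places :: "nat \<Rightarrow> nat \<Rightarrow> (nat \<times> nat) list \<Rightarrow> pos list \<Rightarrow> (path \<times> nat \<times> pos) list" where
  "places cap N cs vs = concat (map (\<lambda>p. concat (map (\<lambda>i. map (\<lambda>v. (p, i, v)) vs) [0..<Suc N])) (paths cap N cs))"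

definition restl :: "(nat \<times> nat) list \<Rightarrow> path \<Rightarrow> (nat \<times> nat) list" where
  "restl cs p = filter (\<lambda>c. \<not> c \<in> set (map fst p)) cs"

text \<open>Evaluates \<open>tg\<close> against a table \<open>S\<close>, starting from the outer
  end of the path. The first component of the accumulator is the suffix reached so far, the second
  one tells whether \<open>v\<close> is in its target.\<close>

definition tgl :: "tinst \<Rightarrow> (nat \<times> nat) list \<Rightarrow> (path \<times> nat \<times> pos) list \<Rightarrow> path \<Rightarrow> pos \<Rightarrow> path \<times> bool" where
  "tgl T cs S p v = foldl (\<lambda>a x. (x # fst a,
      if \<forall>c \<in> set (cols T v). c \<in> set (restl cs (fst a))
      then if stA v then \<exists>u \<in> set (succs T v). (fst a, snd x, u) \<in> set S
           else \<forall>u \<in> set (succs T v). (fst a, snd x, u) \<in> set S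
      else snd a)) ([], False) (rev p)"

definition evl :: "tinst \<Rightarrow> nat list \<Rightarrow> (nat \<times> nat) list \<Rightarrow> nat \<Rightarrow> (path \<times> nat \<times> pos) list \<Rightarrow> path \<times> nat \<times> pos \<Rightarrow> bool" where
  "evl T pv cs N S x = (case fst (snd x) of
      0 \<Rightarrow> winp T pv (set (restl cs (fst x)))
    | Suc i \<Rightarrow>
        if \<forall>c \<in> set (cols T (snd (snd x))). c \<in> set (restl cs (fst x))
        then if winp T pv (set (restl cs (fst x)))
             then \<forall>c \<in> set (restl cs (fst x)). ((c, i) # fst x, N, snd (snd x)) \<in> set S
             else \<exists>c \<in> set (restl cs (fst x)). ((c, i) # fst x, N, snd (snd x)) \<in> set S
        else snd (tgl T cs S (fst x) (snd (snd x))))"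

text \<open>All places are re-evaluated in every round, which avoids fixing an order of evaluation:
  a place is right as soon as the places it consults are right.\<close>

definition tab_run :: "tinst \<Rightarrow> nat list \<Rightarrow> (nat \<times> nat) list \<Rightarrow> nat \<Rightarrow> (path \<times> nat \<times> pos) list \<Rightarrow> nat \<Rightarrow> (path \<times> nat \<times> pos) list" where
  "tab_run T pv cs N al k = ((\<lambda>S. filter (evl T pv cs N S) al) ^^ k) []"

definition starts :: "tinst \<Rightarrow> pos list" where
  "starts T = (0, sv T, 0, initq T) #
     concat (map (\<lambda>i. map (\<lambda>u. (Suc (np T + i), u, 0, initq T)) [0..<nv T]) [0..<np T])"

text \<open>The last conjunct is there because a strategy is among its own deviations, so a payoff
  preferred to itself never occurs in an equilibrium.\<close>

definition okpv :: "tinst \<Rightarrow> nat list \<Rightarrow> bool" where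
  "okpv T pv \<longleftrightarrow> (\<forall>i < np T.
     (nthd 0 (th T) i = nthd 0 pv i \<or> (nthd 0 (th T) i, nthd 0 pv i) \<in> set (prefs T i)) \<and>
     \<not> (nthd 0 pv i, nthd 0 pv i) \<in> set (prefs T i))"

definition solve :: "nat \<Rightarrow> tinst \<Rightarrow> bool" where
  "solve cap T = (let vs = Vl cap T; cs = Cl T; al = places cap (length vs) cs vs in
     \<exists>pv \<in> set (cprod cap (map (\<lambda>i. [0..<length (tabs T i)]) [0..<np T])). okpv T pv \<and>
       (\<forall>s \<in> set (starts T). ([], length vs, s) \<in> set (tab_run T pv cs (length vs) al cap)))"

text \<open>The parser reports no errors. Encoding its result again and comparing with the input
  rejects every string that is not an encoding.\<close>

definition decide :: "bool list \<times> nat \<Rightarrow> bool" where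
  "decide xk = (let T = fst (pinst (snd xk) (fst xk)) in encT T = fst xk \<and> synt T \<and> solve (snd xk) T)"

subsection \<open>Complexity\<close>

lemma fp_tri:
  assumes "fp (\<lambda>p. h (fst p) (fst (snd p)) (snd (snd p)))" "fp f" "fp g" "fp k"
  shows "fp (\<lambda>x. h (f x) (g x) (k x))"
  using fp_comp[OF assms(1) fp_Pair[OF assms(2) fp_Pair[OF assms(3,4)]]] by simp

lemma fp_quad:
  assumes "fp (\<lambda>p. h (fst p) (fst (snd p)) (fst (snd (snd p))) (snd (snd (snd p))))" "fp f" "fp g" "fp k" "fp l"
  shows "fp (\<lambda>x. h (f x) (g x) (k x) (l x))"
  using fp_comp[OF assms(1) fp_Pair[OF assms(2) fp_Pair[OF assms(3) fp_Pair[OF assms(4,5)]]]] by simp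

lemma fp_nv0: "fp nv" unfolding nv_def by (intro fp_intros)
lemma fp_np0: "fp np" unfolding np_def by (intro fp_intros)
lemma fp_sv0: "fp sv" unfolding sv_def by (intro fp_intros)
lemma fp_th0: "fp th" unfolding th_def by (intro fp_intros)
lemmas fp_sel [fp_intros] = fp_comp[OF fp_nv0] fp_comp[OF fp_np0] fp_comp[OF fp_sv0] fp_comp[OF fp_th0]

lemma fp_owner0: "fp (\<lambda>p. owner (fst p) (snd p))" unfolding owner_def by (intro fp_intros)
lemma fp_outs0: "fp (\<lambda>p. outs (fst p) (snd p))" unfolding outs_def by (intro fp_intros)
lemma fp_tabs0: "fp (\<lambda>p. tabs (fst p) (snd p))" unfolding tabs_def by (intro fp_intros)
lemma fp_prefs0: "fp (\<lambda>p. prefs (fst p) (snd p))" unfolding prefs_def by (intro fp_intros)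
lemmas fp_sel2 [fp_intros] = fp_bin[of owner, OF fp_owner0] fp_bin[of outs, OF fp_outs0]
  fp_bin[of tabs, OF fp_tabs0] fp_bin[of prefs, OF fp_prefs0]

lemma fp_autos0: "fp autos" unfolding autos_def by (intro fp_intros)
lemmas fp_autos [fp_intros] = fp_comp[OF fp_autos0]
lemma fp_naut [fp_intros]: "fp T \<Longrightarrow> fp (\<lambda>e. naut (T e))" unfolding naut_def by (intro fp_intros)
lemma fp_aut0: "fp (\<lambda>p. aut (fst p) (snd p))" unfolding aut_def by (intro fp_intros)
lemmas fp_aut [fp_intros] = fp_bin[of aut, OF fp_aut0]
lemma fp_atab0: "fp (\<lambda>p. atab (fst p) (snd p))" unfolding atab_def by (intro fp_intros)
lemmas fp_atab [fp_intros] = fp_bin[of atab, OF fp_atab0]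
lemma fp_row0: "fp (\<lambda>p. row (fst p) (snd p))" unfolding row_def by (intro fp_intros)
lemmas fp_row [fp_intros] = fp_bin[of row, OF fp_row0]
lemma fp_prio0: "fp (\<lambda>p. prio (fst p) (fst (snd p)) (snd (snd p)))" unfolding prio_def by (intro fp_intros)
lemmas fp_prio [fp_intros] = fp_tri[of prio, OF fp_prio0]
lemma fp_stepq0: "fp (\<lambda>p. stepq (fst p) (fst (snd p)) (snd (snd p)))" unfolding stepq_def by (intro fp_intros)
lemmas fp_stepq [fp_intros] = fp_tri[of stepq, OF fp_stepq0]
lemma fp_initq0: "fp initq" unfolding initq_def by (intro fp_intros)
lemmas fp_initq [fp_intros] = fp_comp[OF fp_initq0]

lemma fp_synt0: "fp synt"
  unfolding synt_def by (intro fp_intros)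
lemmas fp_synt [fp_intros] = fp_comp[OF fp_synt0]

lemma fp_cols0: "fp (\<lambda>p. cols (fst p) (snd p))"
  unfolding cols_def by (intro fp_intros)
lemmas fp_cols [fp_intros] = fp_bin[of cols, OF fp_cols0]

lemma fp_stA [fp_intros]: "fp x \<Longrightarrow> fp (\<lambda>e. stA (x e))"
  unfolding stA_def by (intro fp_intros)

lemma fp_succs0: "fp (\<lambda>p. succs (fst p) (snd p))"
  unfolding succs_def by (intro fp_intros)
lemmas fp_succs [fp_intros] = fp_bin[of succs, OF fp_succs0]

lemma fp_winp0: "fp (\<lambda>p. winp (fst p) (fst (snd p)) (set (snd (snd p))))"
  unfolding winp_def accS_def by (intro fp_intros)
lemmas fp_winp [fp_intros] = fp_tri[of "\<lambda>T pv D. winp T pv (set D)", OF fp_winp0]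

lemma fp_restl0: "fp (\<lambda>p. restl (fst p) (snd p))"
  unfolding restl_def by (intro fp_intros)
lemmas fp_restl [fp_intros] = fp_bin[of restl, OF fp_restl0]

lemma fp_Vl0: "fp (\<lambda>p. Vl (fst p) (snd p))"
  unfolding Vl_def by (intro fp_intros)
lemmas fp_Vl [fp_intros] = fp_bin[of Vl, OF fp_Vl0]

lemma fp_Cl0: "fp Cl"
  unfolding Cl_def by (intro fp_intros)
lemmas fp_Cl [fp_intros] = fp_comp[OF fp_Cl0]

lemma fp_paths0: "fp (\<lambda>p. paths (fst p) (fst (snd p)) (snd (snd p)))"
  unfolding paths_def by (intro fp_intros)
lemmas fp_paths [fp_intros] = fp_tri[of paths, OF fp_paths0]

lemma fp_places0: "fp (\<lambda>p. places (fst p) (fst (snd p)) (fst (snd (snd p))) (snd (snd (snd p))))"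
  unfolding places_def by (intro fp_intros)
lemmas fp_places [fp_intros] = fp_quad[of places, OF fp_places0]

lemma fp_starts0: "fp starts"
  unfolding starts_def by (intro fp_intros)
lemmas fp_starts [fp_intros] = fp_comp[OF fp_starts0]

lemma fp_okpv0: "fp (\<lambda>p. okpv (fst p) (snd p))"
  unfolding okpv_def by (intro fp_intros)
lemmas fp_okpv [fp_intros] = fp_bin[of okpv, OF fp_okpv0]

lemma fp_tgl0: "fp (\<lambda>q. tgl (fst q) (fst (snd q)) (fst (snd (snd q))) (fst (snd (snd (snd q)))) (snd (snd (snd (snd q)))))"
proof -
  have gen: "sz (y # fst a, b) \<le> sz a + (sz e + 10)" if y: "y \<in> set (rev (fst (snd (snd (snd e)))))"
    for e :: "tinst \<times> (nat \<times> nat) list \<times> (path \<times> nat \<times> pos) list \<times> path \<times> pos" and a :: "path \<times> bool" and y and b :: bool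
  proof -
    have "y \<in> set (fst (snd (snd (snd e))))" using y by simp
    from sz_member[OF this] have "sz y < sz e"
      using sz_fst_snd(1)[of "snd (snd (snd e))"] sz_fst_snd(2)[of "snd (snd e)"]
        sz_fst_snd(2)[of "snd e"] sz_fst_snd(2)[of e] by linarith
    moreover have "sz (y # fst a, b) = Suc (Suc (sz y + sz (fst a)) + sz b)" by simp
    moreover have "sz (fst a) \<le> sz a" using sz_fst_snd(1)[of a] by simp
    ultimately show ?thesis using sz_bool[of b] by linarith
  qed
  show ?thesis unfolding tgl_def
  proof (rule fp_foldl_add[where q = "\<lambda>n. n + 10"], goal_cases)
    case (5 e a y)
    then show ?case by (rule gen)
  qed (intro fp_intros pb_intros)+
qed

lemma fp_tgl [fp_intros]:
  assumes "fp f" "fp g" "fp k" "fp l" "fp m"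
  shows "fp (\<lambda>x. tgl (f x) (g x) (k x) (l x) (m x))"
  using fp_comp[OF fp_tgl0 fp_Pair[OF assms(1) fp_Pair[OF assms(2) fp_Pair[OF assms(3) fp_Pair[OF assms(4,5)]]]]] by simp

lemma fp_evl0: "fp (\<lambda>q. evl (fst q) (fst (snd q)) (fst (snd (snd q))) (fst (snd (snd (snd q))))
    (fst (snd (snd (snd (snd q))))) (snd (snd (snd (snd (snd q))))))"
  unfolding evl_def by (intro fp_intros)

lemma fp_evl [fp_intros]:
  assumes "fp f" "fp g" "fp k" "fp l" "fp m" "fp n"
  shows "fp (\<lambda>x. evl (f x) (g x) (k x) (l x) (m x) (n x))"
  using fp_comp[OF fp_evl0 fp_Pair[OF assms(1) fp_Pair[OF assms(2) fp_Pair[OF assms(3) fp_Pair[OF assms(4)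
    fp_Pair[OF assms(5,6)]]]]]] by simp

lemma sz_filter: "sz (filter P xs) \<le> sz xs"
  by (induction xs) auto

text \<open>Every round yields a sublist of \<open>al\<close>, so the size stays bounded whatever
  the number of rounds.\<close>

lemma fp_tab_run0: "fp (\<lambda>q. tab_run (fst q) (fst (snd q)) (fst (snd (snd q))) (fst (snd (snd (snd q))))
    (fst (snd (snd (snd (snd q))))) (snd (snd (snd (snd (snd q))))))"
  unfolding tab_run_def
proof (rule fp_funpow[where q = "\<lambda>n. n"], goal_cases)
  case (5 e i)
  have "sz (((\<lambda>S. filter (P S) al) ^^ i) []) \<le> sz al" for P :: "(path \<times> nat \<times> pos) list \<Rightarrow> path \<times> nat \<times> pos \<Rightarrow> bool" and al
    by (cases i) (simp_all add: sz_filter)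
  moreover have "sz (fst (snd (snd (snd (snd e))))) \<le> sz e"
    using sz_fst_snd(1)[of "snd (snd (snd (snd e)))"] sz_fst_snd(2)[of "snd (snd (snd e))"]
      sz_fst_snd(2)[of "snd (snd e)"] sz_fst_snd(2)[of "snd e"] sz_fst_snd(2)[of e] by linarith
  ultimately show ?case using le_trans by blast
qed (intro fp_intros pb_intros)+

lemma fp_tab_run [fp_intros]:
  assumes "fp f" "fp g" "fp k" "fp l" "fp m" "fp n"
  shows "fp (\<lambda>x. tab_run (f x) (g x) (k x) (l x) (m x) (n x))"
  using fp_comp[OF fp_tab_run0 fp_Pair[OF assms(1) fp_Pair[OF assms(2) fp_Pair[OF assms(3) fp_Pair[OF assms(4)
    fp_Pair[OF assms(5,6)]]]]]] by simp

lemma fp_solve0: "fp (\<lambda>p. solve (fst p) (snd p))"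
  unfolding solve_def Let_def by (intro fp_intros)
lemmas fp_solve [fp_intros] = fp_bin[of solve, OF fp_solve0]

lemmas fp_encT' [fp_intros] = fp_comp[OF fp_encT]

lemma fp_decide: "fp decide"
  unfolding decide_def Let_def by (intro fp_intros)

subsection \<open>The table computes the winning region\<close>

lemma set_Cl: "set (Cl T) = CC T"
  unfolding Cl_def CC_def by (auto simp: atLeast0LessThan image_iff)

lemma tgl_Cons: "tgl T cs S (x # p) v = (x # fst (tgl T cs S p v),
      if \<forall>c \<in> set (cols T v). c \<in> set (restl cs (fst (tgl T cs S p v)))
      then if stA v then \<exists>u \<in> set (succs T v). (fst (tgl T cs S p v), snd x, u) \<in> set S
           else \<forall>u \<in> set (succs T v). (fst (tgl T cs S p v), snd x, u) \<in> set S
      else snd (tgl T cs S p v))"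
  by (simp add: tgl_def)

lemma fst_tgl [simp]: "fst (tgl T cs S p v) = p"
  by (induction p) (simp_all add: tgl_Cons, simp add: tgl_def)

text \<open>A path with an index is read as a number in base \<open>B = Suc N\<close>, outermost
  index first, which turns the lexicographic order of places into the order of numbers. As
  \<open>e\<close> exceeds all path lengths, each further index has a weight smaller by the factor
  \<open>B\<close>.\<close>

primrec base :: "nat \<Rightarrow> nat \<Rightarrow> path \<Rightarrow> nat" where
  "base B e [] = 0"
| "base B e (x # p) = base B e p + snd x * B ^ (e - length p)"

definition rank :: "nat \<Rightarrow> nat \<Rightarrow> path \<Rightarrow> nat \<Rightarrow> nat" where
  "rank B e p i = base B e p + i * B ^ (e - length p)"

text \<open>\<open>al\<close> also contains paths that repeat a colour. Correctness is claimed for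
  the \<open>valid\<close> ones, and the value of a valid place depends only on valid
  places.\<close>

locale table_run =
  fixes T :: tinst and pv :: "nat list" and cap :: nat and vs cs N al e
  assumes s: "synt T" and vs: "set vs = VV T" and cs: "cs = Cl T" and N: "N = length vs"
    and al: "\<And>p i v. (p, i, v) \<in> set al \<longleftrightarrow>
      length p \<le> length cs \<and> (\<forall>x \<in> set p. fst x \<in> CC T \<and> snd x < Suc N) \<and> i < Suc N \<and> v \<in> VV T"
    and e: "e = Suc (length cs)"
begin

lemma card_VV: "card (VV T) \<le> N"
  unfolding N vs[symmetric] by (rule card_length)

sublocale muller "VV T" stA "\<lambda>x. set (succs T x)" "\<lambda>x. set (cols T x)" "winp T pv" N
  by (rule muller_T[OF s card_VV])

definition valid :: "path \<Rightarrow> bool" where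
  "valid p \<longleftrightarrow> distinct (map fst p) \<and> (\<forall>x \<in> set p. fst x \<in> CC T \<and> snd x < Suc N)"

lemma valid_length: "valid p \<Longrightarrow> length p \<le> length cs"
proof -
  assume v: "valid p"
  have "card (set (map fst p)) = length p" using v distinct_card[of "map fst p"] unfolding valid_def by simp
  moreover have "set (map fst p) \<subseteq> CC T" using v unfolding valid_def by auto
  ultimately have "length p \<le> card (CC T)" using card_mono[OF finite_CC] by metis
  also have "\<dots> \<le> length cs" unfolding cs set_Cl[symmetric] by (rule card_length)
  finally show ?thesis .
qed

lemma valid_al: "valid p \<Longrightarrow> i < Suc N \<Longrightarrow> v \<in> VV T \<Longrightarrow> (p, i, v) \<in> set al"
  using valid_length[of p] unfolding al valid_def by blast

lemma set_restl: "set (restl cs p) = rest (CC T) p"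
  by (auto simp: restl_def cs set_Cl rest_def)

lemma tgl_correct:
  assumes "v \<in> VV T"
    and S: "\<And>x p'. x # p' \<in> set (suffixes p) \<Longrightarrow> \<forall>u \<in> VV T. (p', snd x, u) \<in> set S \<longleftrightarrow> u \<in> table (CC T) p' (snd x)"
  shows "snd (tgl T cs S p v) \<longleftrightarrow> v \<in> tg (CC T) p"
  using S
proof (induction p)
  case Nil then show ?case by (simp add: tgl_def)
next
  case (Cons x p)
  have IH: "snd (tgl T cs S p v) \<longleftrightarrow> v \<in> tg (CC T) p" by (rule Cons.IH) (use Cons.prems in auto)
  have St: "\<forall>u \<in> VV T. (p, snd x, u) \<in> set S \<longleftrightarrow> u \<in> table (CC T) p (snd x)"
    by (rule Cons.prems) simp
  have sub: "set (succs T v) \<subseteq> VV T" by (rule EV[OF assms(1)])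
  have ex: "(\<exists>u \<in> set (succs T v). (p, snd x, u) \<in> set S) \<longleftrightarrow> (\<exists>u \<in> set (succs T v). u \<in> table (CC T) p (snd x))"
    and all: "(\<forall>u \<in> set (succs T v). (p, snd x, u) \<in> set S) \<longleftrightarrow> (\<forall>u \<in> set (succs T v). u \<in> table (CC T) p (snd x))"
    using St sub by blast+
  show ?case unfolding tgl_Cons tg_Cons fst_tgl snd_conv IH set_restl ex all subset_eq
    using assms(1) by simp
qed

lemma suffix_rank:
  assumes "x # p' \<in> set (suffixes p)"
  shows "rank (Suc N) e p' (snd x) \<le> base (Suc N) e p"
  using assms by (induction p) (auto simp: rank_def)

lemma suffix_valid: "x # p' \<in> set (suffixes p) \<Longrightarrow> valid p \<Longrightarrow> valid p' \<and> snd x < Suc N"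
  by (induction p) (auto simp: valid_def)

text \<open>The places consulted have smaller rank. For a child, the index lowered by one outweighs
  the digit \<open>N\<close> appended below it; targets refer to suffixes, whose ranks are at most
  the \<open>base\<close> of the path.\<close>

lemma tab_run_correct:
  assumes "valid p" "i < Suc N" "v \<in> VV T" "rank (Suc N) e p i < k"
  shows "(p, i, v) \<in> set (tab_run T pv cs N al k) \<longleftrightarrow> v \<in> table (CC T) p i"
  using assms
proof (induction k arbitrary: p i v)
  case (Suc k)
  let ?S = "tab_run T pv cs N al k" and ?D = "rest (CC T) p"
  have S: "tab_run T pv cs N al (Suc k) = filter (evl T pv cs N ?S) al"
    by (simp add: tab_run_def)
  have mem: "(p, i, v) \<in> set (tab_run T pv cs N al (Suc k)) \<longleftrightarrow> evl T pv cs N ?S (p, i, v)"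
    unfolding S using valid_al[OF Suc.prems(1-3)] by simp
  show ?case
  proof (cases i)
    case 0
    then show ?thesis unfolding mem using Suc.prems(3) by (simp add: evl_def table_0 set_restl)
  next
    case (Suc j)
    have rk: "rank (Suc N) e p (Suc j) \<le> k" using Suc.prems(4) Suc by simp
    have le: "length p \<le> length cs" by (rule valid_length[OF Suc.prems(1)])
    have pw: "Suc N ^ (e - length p) = Suc N * Suc N ^ (e - Suc (length p))"
      using le unfolding e by (simp add: Suc_diff_le)
    have child: "((c, j) # p, N, v) \<in> set ?S \<longleftrightarrow> v \<in> table (CC T) ((c, j) # p) N" if c: "c \<in> ?D" for c
    proof (rule Suc.IH)
      show "valid ((c, j) # p)" using Suc.prems(1,2) c Suc unfolding valid_def rest_def by auto
      have "rank (Suc N) e ((c, j) # p) N < rank (Suc N) e p (Suc j)"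
        unfolding rank_def using pw by simp
      then show "rank (Suc N) e ((c, j) # p) N < k" using rk by linarith
    qed (use Suc.prems(3) in auto)
    have tg: "snd (tgl T cs ?S p v) \<longleftrightarrow> v \<in> tg (CC T) p"
    proof (rule tgl_correct[OF Suc.prems(3)], intro ballI)
      fix x p' u assume x: "x # p' \<in> set (suffixes p)" and u: "u \<in> VV T"
      have "base (Suc N) e p < rank (Suc N) e p (Suc j)" unfolding rank_def by simp
      then show "(p', snd x, u) \<in> set ?S \<longleftrightarrow> u \<in> table (CC T) p' (snd x)"
        using suffix_valid[OF x Suc.prems(1)] suffix_rank[OF x] rk u by (intro Suc.IH) auto
    qed
    have D: "distinct (map fst p)" "fst ` set p \<subseteq> CC T" using Suc.prems(1) by (auto simp: valid_def)
    have ch: "(\<forall>c \<in> ?D. ((c, j) # p, N, v) \<in> set ?S) \<longleftrightarrow> (\<forall>c \<in> ?D. v \<in> table (CC T) ((c, j) # p) N)"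
      "(\<exists>c \<in> ?D. ((c, j) # p, N, v) \<in> set ?S) \<longleftrightarrow> (\<exists>c \<in> ?D. v \<in> table (CC T) ((c, j) # p) N)"
      using child by blast+
    show ?thesis unfolding mem unfolding Suc table_Suc[OF finite_CC D] subset_eq
      using Suc.prems(3) by (simp add: evl_def set_restl ch tg)
  qed
qed simp

lemma tab_run_WT:
  assumes "v \<in> VV T" "Suc N ^ Suc e \<le> k"
  shows "([], N, v) \<in> set (tab_run T pv cs N al k) \<longleftrightarrow> v \<in> WT T pv N"
proof -
  have "rank (Suc N) e [] N < Suc N ^ Suc e" by (simp add: rank_def)
  then show ?thesis
    unfolding WT_def table_N using assms by (intro tab_run_correct) (auto simp: valid_def)
qed

end

section \<open>Exponential bounds\<close>

lemma encT_sizes: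
  defines "n \<equiv> \<lambda>T. length (encT T)"
  shows "nv T < n T" "np T < n T" "1 \<le> n T"
    "i < np T \<Longrightarrow> length (tabs T i) \<le> n T" "i < np T \<Longrightarrow> t \<in> set (tabs T i) \<Longrightarrow> length (snd t) \<le> n T"
proof -
  have E: "n T = length (enc_list enc_nat (fst T)) + length (enc_list (enc_pair enc_nat enc_nat) (fst (snd T))) +
     length (enc_list enc_pl (fst (snd (snd T)))) + length (enc_nat (fst (snd (snd (snd T))))) +
     length (enc_list enc_nat (snd (snd (snd (snd T)))))" by (simp add: n_def encT_def)
  show 1: "nv T < n T" unfolding E nv_def using enc_list_length(2)[of "fst T" enc_nat] by linarith
  show "np T < n T" unfolding E np_def using enc_list_length(2)[of "fst (snd (snd T))" enc_pl] by linarith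
  show "1 \<le> n T" using 1 by linarith
  assume i: "i < np T"
  let ?d = "fst (snd (snd T)) ! i"
  have d: "?d \<in> set (fst (snd (snd T)))" "tabs T i = fst ?d" using i by (simp_all add: np_def tabs_def nthd)
  have le: "length (enc_pl ?d) \<le> n T" using enc_list_length(1)[OF d(1), of enc_pl] unfolding E by linarith
  have pl: "length (enc_list enc_tab (fst ?d)) \<le> length (enc_pl ?d)" by (simp add: enc_pl_def)
  show "length (tabs T i) \<le> n T" unfolding d(2) using enc_list_length(2)[of "fst ?d" enc_tab] le pl by linarith
  assume "t \<in> set (tabs T i)"
  then have "length (enc_tab t) \<le> n T" using enc_list_length(1)[of t "fst ?d" enc_tab] le pl unfolding d(2) by linarith
  moreover have "length (snd t) \<le> length (enc_tab t)"
    using enc_list_length(2)[of "snd t" "enc_pair enc_nat (enc_list enc_nat)"] by (simp add: enc_tab_def)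
  ultimately show "length (snd t) \<le> n T" by linarith
qed

lemma prod_list_bound: "(\<And>x. x \<in> set xs \<Longrightarrow> x \<le> (b :: nat)) \<Longrightarrow> prod_list xs \<le> b ^ length xs"
  by (induction xs) (auto intro: mult_mono)

lemma sum_list_bound: "(\<And>x. x \<in> set xs \<Longrightarrow> x \<le> (b :: nat)) \<Longrightarrow> sum_list xs \<le> length xs * b"
  by (induction xs) (auto intro: add_mono)

lemma length_concat_const: "(\<And>x. x \<in> set xs \<Longrightarrow> length (f x) = b) \<Longrightarrow> length (concat (map f xs)) = length xs * b"
  by (induction xs) auto

text \<open>Origin of the exponent 7: there are at most \<open>m ^ 3\<close> colours and
  \<open>2 ^ (m ^ 3)\<close> positions, hence \<open>2 ^ (2 * m ^ 3)\<close> letters of a path and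
  \<open>2 ^ (2 * m ^ 6)\<close> paths of any given length. As \<open>m \<ge> 3\<close>, the factor
  2 is absorbed by one more \<open>m\<close>.\<close>

context
  fixes T :: tinst and n m cap :: nat
  assumes s: "synt T" and n: "length (encT T) = n" and m: "m = n + 2" and cap: "2 ^ (m ^ 7) \<le> cap"
begin

lemma rows: "a < naut T \<Longrightarrow> length (snd (atab T a)) \<le> n"
  using encT_sizes(5)[of "fst (aut T a)" T "atab T a"] aut_props[of a T] n by simp

lemma naut: "naut T \<le> n * n"
proof -
  have "naut T \<le> length [0..<np T] * n" unfolding naut_def autos_def length_concat map_map
    by (rule order_trans[OF sum_list_bound[of _ n]]) (use encT_sizes(4)[of _ T] n in auto)
  also have "\<dots> \<le> n * n" using encT_sizes(2)[of T] n by (intro mult_right_mono) auto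
  finally show ?thesis .
qed

text \<open>The \<open>+ 2\<close> anticipates the exponent \<open>Suc (Suc (length (Cl T)))\<close>
  in the number of rounds.\<close>

lemma length_Cl: "length (Cl T) + 2 \<le> m ^ 3"
proof -
  have "length (concat (map (\<lambda>a. map (\<lambda>q. (a, q)) [0..<length (snd (atab T a))]) [0..<naut T])) \<le> length [0..<naut T] * n"
    unfolding length_concat map_map by (rule order_trans[OF sum_list_bound[of _ n]]) (use rows in auto)
  also have "\<dots> \<le> n * n * n" using naut by (intro mult_right_mono) auto
  finally have "length (Cl T) \<le> n * n * n + (2 * n + 1)"
    using encT_sizes(2)[of T] n by (simp add: Cl_def)
  then show ?thesis by (simp add: m power3_eq_cube algebra_simps)
qed

lemma m_pow: "m ^ k \<le> 2 ^ (m * k)"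
proof -
  have "m ^ k \<le> (2 ^ m) ^ k" by (intro power_mono) (auto simp: less_imp_le)
  then show ?thesis by (simp add: power_mult)
qed

lemma m3: "3 \<le> m"
  using encT_sizes(3)[of T] n m by simp

lemma le_cap: "x \<le> 2 ^ k \<Longrightarrow> k \<le> m ^ 7 \<Longrightarrow> x \<le> cap"
proof -
  assume "x \<le> 2 ^ k" "k \<le> m ^ 7"
  then have "x \<le> 2 ^ (m ^ 7)" using power_increasing[of k "m ^ 7" "2 :: nat"] by linarith
  then show "x \<le> cap" using cap by linarith
qed

lemma mpow_le: "i \<le> j \<Longrightarrow> m ^ i \<le> m ^ j"
  using m3 by (intro power_increasing) auto

lemma states_prod: "prod_list (map length (map (\<lambda>a. [0..<length (snd (atab T a))]) [0..<naut T])) \<le> m ^ (n * n)"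
proof -
  have "prod_list (map length (map (\<lambda>a. [0..<length (snd (atab T a))]) [0..<naut T])) \<le> m ^ length (map length (map (\<lambda>a. [0..<length (snd (atab T a))]) [0..<naut T]))"
    by (rule prod_list_bound) (use rows m in force)
  also have "\<dots> \<le> m ^ (n * n)" using naut m3 by (intro power_increasing) auto
  finally show ?thesis .
qed

lemma states_cap: "prod_list (map length (map (\<lambda>a. [0..<length (snd (atab T a))]) [0..<naut T])) \<le> cap"
proof (rule le_cap)
  show "prod_list (map length (map (\<lambda>a. [0..<length (snd (atab T a))]) [0..<naut T])) \<le> 2 ^ (m * (n * n))"
    by (rule order_trans[OF states_prod m_pow])
  have "m * (n * n) \<le> m * (m * m)" by (intro mult_left_mono mult_mono) (auto simp: m)
  also have "\<dots> = m ^ 3" by (simp add: power3_eq_cube)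
  also have "\<dots> \<le> m ^ 7" by (rule mpow_le) simp
  finally show "m * (n * n) \<le> m ^ 7" .
qed

lemma states_ne: "xs \<in> set (map (\<lambda>a. [0..<length (snd (atab T a))]) [0..<naut T]) \<Longrightarrow> xs \<noteq> []"
proof -
  assume "xs \<in> set (map (\<lambda>a. [0..<length (snd (atab T a))]) [0..<naut T])"
  then obtain a where a: "a < naut T" "xs = [0..<length (snd (atab T a))]" by auto
  then show "xs \<noteq> []" using atab_wf(1)[OF s a(1)] by (cases "snd (atab T a)") (auto simp del: upt_Suc)
qed

lemma set_Vl: "set (Vl cap T) = VV T"
proof -
  have "qs \<in> set (cprod cap (map (\<lambda>a. [0..<length (snd (atab T a))]) [0..<naut T])) \<longleftrightarrow>
      length qs = naut T \<and> (\<forall>a < naut T. qs ! a < length (snd (atab T a)))" for qs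
    using cprod_mem[OF states_ne states_cap] by auto
  then show ?thesis unfolding Vl_def VV_def by (auto simp: image_iff less_Suc_eq_le simp del: upt_Suc)
qed

lemma length_Vl: "Suc (length (Vl cap T)) \<le> 2 ^ (m ^ 3)"
proof -
  let ?P = "length (cprod cap (map (\<lambda>a. [0..<length (snd (atab T a))]) [0..<naut T]))"
  have P: "?P \<le> m ^ (n * n)" using cprod_eq[OF states_ne states_cap] states_prod by simp
  have "length (Vl cap T) = Suc (2 * np T) * (nv T * (Suc (nv T) * ?P))"
    unfolding Vl_def by (subst length_concat_const[where b = "nv T * (Suc (nv T) * ?P)"],
      subst length_concat_const[where b = "Suc (nv T) * ?P"],
      subst length_concat_const[where b = ?P]) simp_all
  also have "\<dots> \<le> Suc (2 * np T) * (m * (m * m ^ (n * n)))"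
    using encT_sizes(1)[of T] n P by (intro mult_left_mono mult_mono) (auto simp: m)
  also have "\<dots> = Suc (2 * np T) * m ^ (n * n + 2)" by (simp add: power_add power2_eq_square mult.assoc)
  finally have "Suc (length (Vl cap T)) \<le> Suc (2 * np T) * m ^ (n * n + 2) + m ^ (n * n + 2)"
    using m3 one_le_power[of m "n * n + 2"] by linarith
  also have "\<dots> = (2 * np T + 2) * m ^ (n * n + 2)" by simp
  also have "\<dots> \<le> m ^ 2 * m ^ (n * n + 2)"
    using encT_sizes(2)[of T] n by (intro mult_right_mono) (auto simp: m power2_eq_square)
  also have "\<dots> = m ^ (n * n + 4)"
    by (subst power_add[symmetric]) (rule arg_cong[of _ _ "\<lambda>k. m ^ k"], simp)
  also have "\<dots> \<le> 2 ^ (m * (n * n + 4))" by (rule m_pow)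
  also have "\<dots> \<le> 2 ^ (m ^ 3)"
    by (intro power_increasing) (simp_all add: m power3_eq_cube algebra_simps)
  finally show ?thesis .
qed

lemma alph_length: "length (concat (map (\<lambda>c. map (\<lambda>i. (c, i)) [0..<Suc (length (Vl cap T))]) (Cl T))) \<le> 2 ^ (m ^ 3 + m ^ 3)"
proof -
  have C: "length (Cl T) \<le> 2 ^ (m ^ 3)" using length_Cl less_exp[of "m ^ 3"] by linarith
  have "length (concat (map (\<lambda>c. map (\<lambda>i. (c, i)) [0..<Suc (length (Vl cap T))]) (Cl T))) = length (Cl T) * Suc (length (Vl cap T))"
    by (rule length_concat_const) simp
  also have "\<dots> \<le> 2 ^ (m ^ 3) * 2 ^ (m ^ 3)"
    using C by (intro mult_mono length_Vl) auto
  finally show ?thesis by (simp add: power_add)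
qed

lemma set_places: "(p, i, v) \<in> set (places cap (length (Vl cap T)) (Cl T) (Vl cap T)) \<longleftrightarrow>
    length p \<le> length (Cl T) \<and> (\<forall>x \<in> set p. fst x \<in> CC T \<and> snd x < Suc (length (Vl cap T))) \<and>
    i < Suc (length (Vl cap T)) \<and> v \<in> VV T"
proof -
  let ?N = "length (Vl cap T)" and ?A = "concat (map (\<lambda>c. map (\<lambda>i. (c, i)) [0..<Suc (length (Vl cap T))]) (Cl T))"
  have A: "x \<in> set ?A \<longleftrightarrow> fst x \<in> CC T \<and> snd x < Suc ?N" for x
    by (cases x) (auto simp: set_Cl[symmetric] image_iff simp del: upt_Suc)
  have "(naut T, 0) \<in> CC T" by (simp add: CC_def)
  then have ne: "?A \<noteq> []" using A[of "((naut T, 0), 0)"] by (metis empty_iff empty_set fst_conv snd_conv zero_less_Suc)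
  have P: "p \<in> set (cprod cap (replicate j ?A)) \<longleftrightarrow> length p = j \<and> (\<forall>x \<in> set p. fst x \<in> CC T \<and> snd x < Suc ?N)"
    if j: "j \<le> length (Cl T)" for p :: path and j
  proof -
    have "prod_list (map length (replicate j ?A)) = length ?A ^ j"
      unfolding map_replicate by (induction j) simp_all
    also have "\<dots> \<le> (2 ^ (m ^ 3 + m ^ 3)) ^ j" by (rule power_mono[OF alph_length]) simp
    also have "\<dots> = 2 ^ ((m ^ 3 + m ^ 3) * j)" by (simp add: power_mult)
    finally have le: "prod_list (map length (replicate j ?A)) \<le> cap"
    proof (rule le_cap)
      have "(m ^ 3 + m ^ 3) * j \<le> (2 * m ^ 3) * m ^ 3" using length_Cl j by (intro mult_mono) auto
      also have "\<dots> = 2 * m ^ 6" by (simp add: power_add[symmetric])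
      also have "\<dots> \<le> m * m ^ 6" using m3 by (intro mult_right_mono) auto
      finally show "(m ^ 3 + m ^ 3) * j \<le> m ^ 7" by (simp add: power_Suc[symmetric] del: power_Suc)
    qed
    have "xs \<in> set (replicate j ?A) \<Longrightarrow> xs \<noteq> []" for xs using ne by (metis in_set_replicate)
    from cprod_mem[OF this le, of p] show ?thesis
      using A by (auto simp: all_set_conv_all_nth)
  qed
  have "p \<in> set (paths cap ?N (Cl T)) \<longleftrightarrow> length p \<le> length (Cl T) \<and> (\<forall>x \<in> set p. fst x \<in> CC T \<and> snd x < Suc ?N)" for p
    unfolding paths_def using P by (auto simp: image_iff less_Suc_eq_le simp del: upt_Suc)
  then show ?thesis unfolding places_def by (auto simp: image_iff set_Vl simp del: upt_Suc)
qed

lemma rank_cap: "Suc (length (Vl cap T)) ^ Suc (Suc (length (Cl T))) \<le> cap"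
proof (rule le_cap)
  have "Suc (length (Vl cap T)) ^ Suc (Suc (length (Cl T))) \<le> (2 ^ (m ^ 3)) ^ Suc (Suc (length (Cl T)))"
    by (intro power_mono length_Vl) simp
  also have "\<dots> = 2 ^ (m ^ 3 * (length (Cl T) + 2))" by (simp add: power_mult[symmetric] power_add[symmetric] algebra_simps)
  finally show "Suc (length (Vl cap T)) ^ Suc (Suc (length (Cl T))) \<le> 2 ^ (m ^ 3 * (length (Cl T) + 2))" .
  have "m ^ 3 * (length (Cl T) + 2) \<le> m ^ 3 * m ^ 3" using length_Cl by (intro mult_left_mono) auto
  also have "\<dots> = m ^ 6" by (simp add: power_add[symmetric])
  also have "\<dots> \<le> m ^ 7" by (rule mpow_le) simp
  finally show "m ^ 3 * (length (Cl T) + 2) \<le> m ^ 7" .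
qed

lemma tabs_ne: "i < np T \<Longrightarrow> tabs T i \<noteq> []"
  using s unfolding synt_def by fastforce

lemma vectors: "pv \<in> set (cprod cap (map (\<lambda>i. [0..<length (tabs T i)]) [0..<np T])) \<longleftrightarrow>
    length pv = np T \<and> (\<forall>i < np T. nthd 0 pv i < length (tabs T i))"
proof -
  have "prod_list (map length (map (\<lambda>i. [0..<length (tabs T i)]) [0..<np T])) \<le> m ^ length (map length (map (\<lambda>i. [0..<length (tabs T i)]) [0..<np T]))"
    by (rule prod_list_bound) (use encT_sizes(4)[of _ T] n m in force)
  also have "\<dots> \<le> 2 ^ (m * length (map length (map (\<lambda>i. [0..<length (tabs T i)]) [0..<np T])))" by (rule m_pow)
  finally have le: "prod_list (map length (map (\<lambda>i. [0..<length (tabs T i)]) [0..<np T])) \<le> cap"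
  proof (rule le_cap)
    have "m * np T \<le> m * m" using encT_sizes(2)[of T] n m by (intro mult_left_mono) auto
    also have "\<dots> \<le> m ^ 7" using mpow_le[of 2 7] by (simp add: power2_eq_square)
    finally show "m * length (map length (map (\<lambda>i. [0..<length (tabs T i)]) [0..<np T])) \<le> m ^ 7" by simp
  qed
  have "xs \<in> set (map (\<lambda>i. [0..<length (tabs T i)]) [0..<np T]) \<Longrightarrow> xs \<noteq> []" for xs using tabs_ne by auto
  from cprod_mem[OF this le] show ?thesis by (auto simp: nthd)
qed

lemma set_starts: "(\<forall>x \<in> set (starts T). P x) \<longleftrightarrow> P (0, sv T, 0, initq T) \<and>
    (\<forall>i < np T. \<forall>u < nv T. P (Suc (np T + i), u, 0, initq T))"
  unfolding starts_def by (auto simp: image_iff)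

lemma card_VV_le: "card (VV T) \<le> length (Vl cap T)"
  unfolding set_Vl[symmetric] by (rule card_length)

lemma starts_VV: "x \<in> set (starts T) \<Longrightarrow> x \<in> VV T"
proof -
  have "\<forall>x \<in> set (starts T). x \<in> VV T" unfolding set_starts
    using s by (auto intro!: start_VV simp: synt_def)
  then show "x \<in> set (starts T) \<Longrightarrow> x \<in> VV T" by blast
qed

theorem solve_correct: "solve cap T \<longleftrightarrow> (\<exists>pv. length pv = np T \<and> (\<forall>i < np T. nthd 0 pv i < length (tabs T i)) \<and>
    okpv T pv \<and> (\<forall>x \<in> set (starts T). x \<in> WT T pv (length (Vl cap T))))"
proof -
  have "x \<in> set (starts T) \<Longrightarrow> ([], length (Vl cap T), x) \<in> set (tab_run T pv (Cl T) (length (Vl cap T))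
      (places cap (length (Vl cap T)) (Cl T) (Vl cap T)) cap) \<longleftrightarrow> x \<in> WT T pv (length (Vl cap T))" for x pv
  proof -
    assume x: "x \<in> set (starts T)"
    interpret table_run T pv cap "Vl cap T" "Cl T" "length (Vl cap T)"
        "places cap (length (Vl cap T)) (Cl T) (Vl cap T)" "Suc (length (Cl T))"
      by unfold_locales (use s set_Vl set_places in auto)
    show ?thesis by (rule tab_run_WT[OF starts_VV[OF x] rank_cap])
  qed
  then show ?thesis unfolding solve_def Let_def Bex_def vectors by auto
qed

text \<open>The vector of payoffs is found by exhaustive search. One winning region answers two
  questions: the validation positions decide \<open>exact\<close>, and given this, payoffs and
  automata agree and the position of mode 0 decides the existence of an equilibrium.\<close>

theorem solve_iff: "solve cap T \<longleftrightarrow> valid_instance (inst T) \<and>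
    constrained_NE_exists (game_of (inst T)) (start_vertex (inst T)) (\<lambda>i. thresholds (inst T) ! i)"
proof -
  let ?G = "game_of (inst T)" and ?N = "length (Vl cap T)"
  have lt: "length (th T) = np T" and sv: "sv T < nv T" using s by (simp_all add: synt_def)
  have ex: "(\<forall>i < np T. exact T i) \<longleftrightarrow> (\<forall>i < np T. \<forall>u < nv T. (Suc (np T + i), u, 0, initq T) \<in> WT T pv ?N)" for pv
    using exact_iff[OF s card_VV_le] by blast
  have cne: "constrained_NE_exists ?G (sv T) (\<lambda>i. th T ! i) \<longleftrightarrow> (\<exists>pv. length pv = np T \<and>
      (\<forall>i < np T. nthd 0 pv i < length (tabs T i)) \<and> okpv T pv \<and> (0, sv T, 0, initq T) \<in> WT T pv ?N)"
    if e: "\<forall>i < np T. exact T i"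
  proof
    assume "constrained_NE_exists ?G (sv T) (\<lambda>i. th T ! i)"
    then obtain \<sigma> where ne: "nash_equilibrium ?G (sv T) \<sigma>" and
      t: "\<And>i. i < np T \<Longrightarrow> th T ! i = pay ?G i (outcome ?G \<sigma> (sv T)) \<or> (th T ! i, pay ?G i (outcome ?G \<sigma> (sv T))) \<in> pref ?G i"
      unfolding constrained_NE_exists_def by auto
    define pv where "pv = map (\<lambda>i. pay ?G i (outcome ?G \<sigma> (sv T))) [0..<np T]"
    have pv: "nthd 0 pv i = pay ?G i (outcome ?G \<sigma> (sv T))" if "i < np T" for i using that by (simp add: pv_def nthd)
    have prof: "strategy_profile ?G \<sigma>" using ne by (simp add: nash_equilibrium_def)
    have ww: "outcome ?G \<sigma> (sv T) \<in> words T" using play_words outcome_props(1)[OF s prof sv] by blast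
    have lt': "nthd 0 pv i < length (tabs T i)" if "i < np T" for i
      unfolding pv[OF that] by (rule pay_exact(2)[OF that _ ww]) (use e that in blast)
    have "(nthd 0 pv i, nthd 0 pv i) \<notin> set (prefs T i)" if i: "i < np T" for i
    proof -
      have "i \<in> players ?G" "strategy ?G i (\<sigma> i)" using i prof by (auto simp: strategy_profile_def)
      \<comment> \<open>The deviation to the player's own strategy, which changes nothing.\<close>
      then have "(pay ?G i (outcome ?G \<sigma> (sv T)), pay ?G i (outcome ?G (\<sigma>(i := \<sigma> i)) (sv T))) \<notin> pref ?G i"
        using ne unfolding nash_equilibrium_def by blast
      then show ?thesis unfolding pv[OF i] using game_sel2(2)[OF i] by simp
    qed
    moreover have "nthd 0 (th T) i = nthd 0 pv i \<or> (nthd 0 (th T) i, nthd 0 pv i) \<in> set (prefs T i)" if i: "i < np T" for i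
    proof -
      have "nthd 0 (th T) i = th T ! i" using i lt by (simp add: nthd)
      then show ?thesis using t[OF i] unfolding pv[OF i] game_sel2(2)[OF i] by metis
    qed
    ultimately have "okpv T pv" unfolding okpv_def by blast
    moreover have "(0, sv T, 0, initq T) \<in> WT T pv ?N"
      by (rule WT_if_NE[OF s _ card_VV_le lt' ne]) (use e pv in auto)
    moreover have "length pv = np T" by (simp add: pv_def)
    ultimately show "\<exists>pv. length pv = np T \<and> (\<forall>i < np T. nthd 0 pv i < length (tabs T i)) \<and> okpv T pv \<and>
        (0, sv T, 0, initq T) \<in> WT T pv ?N" using lt' by blast
  next
    assume "\<exists>pv. length pv = np T \<and> (\<forall>i < np T. nthd 0 pv i < length (tabs T i)) \<and> okpv T pv \<and>
        (0, sv T, 0, initq T) \<in> WT T pv ?N"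
    then obtain pv where pv: "\<And>i. i < np T \<Longrightarrow> nthd 0 pv i < length (tabs T i)" "okpv T pv" "(0, sv T, 0, initq T) \<in> WT T pv ?N"
      by blast
    obtain \<sigma> where \<sigma>: "nash_equilibrium ?G (sv T) \<sigma>" "\<forall>i < np T. pay ?G i (outcome ?G \<sigma> (sv T)) = nthd 0 pv i"
      using NE_if_WT[OF s _ card_VV_le pv(1) _ pv(3)] e pv(2) unfolding okpv_def by blast
    have "th T ! i = pay ?G i (outcome ?G \<sigma> (sv T)) \<or> (th T ! i, pay ?G i (outcome ?G \<sigma> (sv T))) \<in> pref ?G i"
      if i: "i < np T" for i
    proof -
      have "nthd 0 (th T) i = th T ! i" using i lt by (simp add: nthd)
      then show ?thesis using pv(2) \<sigma>(2) i game_sel2(2)[OF i] unfolding okpv_def by metis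
    qed
    then show "constrained_NE_exists ?G (sv T) (\<lambda>i. th T ! i)"
      unfolding constrained_NE_exists_def using \<sigma>(1) by auto
  qed
  have "solve cap T \<longleftrightarrow> (\<exists>pv. (\<forall>i < np T. exact T i) \<and> length pv = np T \<and> (\<forall>i < np T. nthd 0 pv i < length (tabs T i)) \<and>
    okpv T pv \<and> (0, sv T, 0, initq T) \<in> WT T pv ?N)"
    unfolding solve_correct set_starts using ex by blast
  also have "\<dots> \<longleftrightarrow> (\<forall>i < np T. exact T i) \<and> constrained_NE_exists ?G (sv T) (\<lambda>i. th T ! i)"
    using cne by blast
  finally show ?thesis unfolding valid_inst using s by simp
qed

end

text \<open>Origin of 13: the pad is 2 to the power \<open>(n + 1) ^ 14\<close>, and
  \<open>(n + 2) ^ 7 \<le> ((n + 1) ^ 2) ^ 7\<close> for \<open>n \<ge> 1\<close>.\<close>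

theorem NE_problem_in_EXPTIME: "constrained_NE_problem \<in> EXPTIME"
proof (rule EXPTIME_if_fp[OF fp_decide, of _ 13])
  fix x
  show "x \<in> constrained_NE_problem \<longleftrightarrow> decide (x, pad 13 x)"
  proof (cases "\<exists>T. encT T = x")
    case False
    have "x \<notin> constrained_NE_problem"
    proof
      assume "x \<in> constrained_NE_problem"
      then obtain X where X: "x = encode X" unfolding constrained_NE_problem_def by blast
      obtain T where "inst T = X" using inst_surj[of X] by blast
      then have "encT T = x" using encode_inst[of T] X by simp
      then show False using False by blast
    qed
    moreover have "\<not> decide (x, pad 13 x)"
    proof
      assume "decide (x, pad 13 x)"
      then have "encT (fst (pinst (pad 13 x) x)) = x" unfolding decide_def Let_def fst_conv snd_conv by (rule conjunct1)
      then show False using False by blast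
    qed
    ultimately show ?thesis by blast
  next
    case True
    then obtain T where T: "encT T = x" by blast
    let ?n = "length x" and ?cap = "pad 13 x"
    have n1: "1 \<le> ?n" using encT_sizes(3)[of T] T by simp
    have pn: "2 ^ ?n \<le> ?cap" unfolding pad_def
      by (intro power_increasing order_trans[OF _ self_le_power]) auto
    have "?n + 2 \<le> (?n + 1) ^ 2" using n1 by (simp add: power2_eq_square)
    then have "(?n + 2) ^ 7 \<le> ((?n + 1) ^ 2) ^ 7" by (intro power_mono) auto
    then have "(?n + 2) ^ 7 \<le> (?n + 1) ^ Suc 13" by (simp add: power_mult[symmetric])
    then have cap: "2 ^ ((?n + 2) ^ 7) \<le> ?cap" unfolding pad_def by (intro power_increasing) auto
    have parse: "fst (pinst ?cap x) = T" using pinst[OF pn, of T "[]"] T by simp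
    have "x \<in> constrained_NE_problem \<longleftrightarrow> valid_instance (inst T) \<and>
        constrained_NE_exists (game_of (inst T)) (start_vertex (inst T)) (\<lambda>i. thresholds (inst T) ! i)"
    proof
      assume "x \<in> constrained_NE_problem"
      then obtain X where "x = encode X" "valid_instance X"
          "constrained_NE_exists (game_of X) (start_vertex X) (\<lambda>i. thresholds X ! i)"
        unfolding constrained_NE_problem_def by blast
      moreover have "X = inst T" using \<open>x = encode X\<close> T encode_inst[of T] inj_encode by (metis injD)
      ultimately show "valid_instance (inst T) \<and>
        constrained_NE_exists (game_of (inst T)) (start_vertex (inst T)) (\<lambda>i. thresholds (inst T) ! i)" by blast
    next
      assume "valid_instance (inst T) \<and>
        constrained_NE_exists (game_of (inst T)) (start_vertex (inst T)) (\<lambda>i. thresholds (inst T) ! i)"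
      then show "x \<in> constrained_NE_problem"
        unfolding constrained_NE_problem_def using T encode_inst[of T] by (intro CollectI exI[of _ "inst T"]) simp
    qed
    also have "\<dots> \<longleftrightarrow> synt T \<and> solve ?cap T"
      using solve_iff[OF _ _ refl cap] T valid_inst by blast
    also have "\<dots> \<longleftrightarrow> decide (x, ?cap)" unfolding decide_def Let_def using parse T by simp
    finally show ?thesis .
  qed
qed

section \<open>Games with Boolean registers\<close>

text \<open>
  On a visit of a vertex \<open>x\<close> with \<open>ck x = Suc r\<close>, it is claimed that register \<open>r\<close> has the value
  \<open>cb x\<close>, and then it is set to \<open>cn x\<close>.  A vertex \<open>x\<close> with \<open>sk x = Suc r\<close> is a sink, in which
  player 1 bets that some claim about register \<open>r\<close> was wrong.  For player 1, the payoff \<open>0\<close> is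
  never attained, \<open>1\<close> is that of the plays without a sink, \<open>2 + 2 * r\<close> and \<open>3 + 2 * r\<close> are those
  of a bet on \<open>r\<close> that is won or lost.
\<close>

definition pay_reg :: "nat \<Rightarrow> nat" where "pay_reg p = (p - 2) div 2"

text \<open>In the states 0 to 3 the low bit is the current value of the register of
  \<open>p\<close>, and the high bit tells whether a claim about it was wrong. States 4 and 5 are
  absorbing verdicts, accept and reject, reached at the first sink.\<close>

definition pay_step :: "('n \<Rightarrow> nat) \<Rightarrow> ('n \<Rightarrow> bool) \<Rightarrow> ('n \<Rightarrow> bool) \<Rightarrow> ('n \<Rightarrow> nat) \<Rightarrow> nat \<Rightarrow> nat \<Rightarrow> 'n \<Rightarrow> nat" where
  "pay_step ck cb cn sk p q x =
     (if 4 \<le> q then q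
      else if sk x \<noteq> 0 then (if 2 \<le> p \<and> sk x = Suc (pay_reg p) \<and> (2 \<le> q) = even p then 4 else 5)
      else if ck x = Suc (pay_reg p)
        then (if cn x then 1 else 0) + (if 2 \<le> q \<or> (q = 1) \<noteq> cb x then 2 else 0)
      else q)"

text \<open>A play without a sink stays in the states below 4, where only the automaton of payoff 1
  has an even priority.\<close>

definition pay_prio :: "nat \<Rightarrow> nat \<Rightarrow> nat" where
  "pay_prio p q = (if q = 4 \<or> q \<noteq> 5 \<and> p = 1 then 2 else 1)"

definition pay_tab :: "('n \<Rightarrow> nat) \<Rightarrow> ('n \<Rightarrow> bool) \<Rightarrow> ('n \<Rightarrow> bool) \<Rightarrow> ('n \<Rightarrow> nat) \<Rightarrow> (nat \<Rightarrow> bool) \<Rightarrow> 'n list \<Rightarrow> nat \<Rightarrow> tab" where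
  "pay_tab ck cb cn sk r0 V p = (if r0 (pay_reg p) then 1 else 0,
     map (\<lambda>q. (pay_prio p q, map (pay_step ck cb cn sk p q) V)) [0..<6])"

text \<open>Player 0 is the prover and has a single payoff. For player 1 the threshold 0 is never
  attained and lies below exactly the odd payoffs, so the outcome must have an odd payoff; every
  nonzero even payoff, a won bet, is preferred to each odd one.\<close>

definition mkT :: "'n \<Rightarrow> 'n list \<Rightarrow> ('n \<Rightarrow> 'n list) \<Rightarrow> ('n \<Rightarrow> bool) \<Rightarrow> ('n \<Rightarrow> nat) \<Rightarrow> ('n \<Rightarrow> bool) \<Rightarrow> ('n \<Rightarrow> bool) \<Rightarrow>
    ('n \<Rightarrow> nat) \<Rightarrow> nat \<Rightarrow> (nat \<Rightarrow> bool) \<Rightarrow> tinst" where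
  "mkT d V sc pro ck cb cn sk R r0 =
     (map (\<lambda>x. if pro x then 0 else 1) V,
      concat (map (\<lambda>i. map (\<lambda>j. (i, j)) (filter (\<lambda>j. nthd d V j \<in> set (sc (nthd d V i))) [0..<length V])) [0..<length V]),
      [([(0, [(2, replicate (length V) 0)])], []),
       (map (pay_tab ck cb cn sk r0 V) [0..<2 + 2 * R],
        concat (map (\<lambda>p. map (\<lambda>q. (p, q)) (filter (\<lambda>q. p = 0 \<and> odd q \<or> odd p \<and> even q \<and> q \<noteq> 0) [0..<2 + 2 * R])) [0..<2 + 2 * R]))],
      0, [0, 0])"

lemma limit_eventually_const:
  assumes "\<And>n. k \<le> n \<Longrightarrow> f n = c"
  shows "limit f = {c}"
proof -
  have "(\<exists>\<^sub>\<infinity>n. f n = x) \<longleftrightarrow> c = x" for x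
    unfolding INFM_nat_le using assms by (metis le_cases order_refl order_trans)
  then show ?thesis by (auto simp: limit_def)
qed

text \<open>A claim is followed by a move of the challenger with a sink for the same register among
  the choices, so that a wrong claim can be punished at once.\<close>

locale reggame =
  fixes d :: 'n and V :: "'n list" and sc :: "'n \<Rightarrow> 'n list" and pro :: "'n \<Rightarrow> bool" and ck :: "'n \<Rightarrow> nat"
    and cb cn :: "'n \<Rightarrow> bool" and sk :: "'n \<Rightarrow> nat" and R :: nat and r0 :: "nat \<Rightarrow> bool"
  assumes V: "V \<noteq> []"
    and sc: "\<And>x. x \<in> set V \<Longrightarrow> sc x \<noteq> [] \<and> set (sc x) \<subseteq> set V"
    and ck: "\<And>x r. x \<in> set V \<Longrightarrow> ck x = Suc r \<Longrightarrow> \<not> pro x \<and> (\<exists>y \<in> set (sc x). sk y = Suc r)"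
    and sk: "\<And>x r. x \<in> set V \<Longrightarrow> sk x = Suc r \<Longrightarrow> r < R"
begin

definition nxt :: "'n \<Rightarrow> (nat \<Rightarrow> bool) \<Rightarrow> nat \<Rightarrow> bool" where
  "nxt x \<rho> = (\<lambda>r. if ck x = Suc r then cn x else \<rho> r)"

text \<open>The attractor is taken over pairs of a vertex and the true contents of the registers.
  These pairs are exponentially many, while the arena has only the vertices.\<close>

inductive Att :: "'n \<Rightarrow> (nat \<Rightarrow> bool) \<Rightarrow> bool" where
  caught: "sk x = 0 \<Longrightarrow> ck x = Suc r \<Longrightarrow> \<rho> r \<noteq> cb x \<Longrightarrow> Att x \<rho>"
| prover: "sk x = 0 \<Longrightarrow> pro x \<Longrightarrow> (\<And>y. y \<in> set (sc x) \<Longrightarrow> Att y (nxt x \<rho>)) \<Longrightarrow> Att x \<rho>"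
| challenger: "sk x = 0 \<Longrightarrow> \<not> pro x \<Longrightarrow> y \<in> set (sc x) \<Longrightarrow> Att y (nxt x \<rho>) \<Longrightarrow> Att x \<rho>"

definition T :: tinst where "T = mkT d V sc pro ck cb cn sk R r0"
abbreviation G where "G \<equiv> game_of (inst T)"
definition nm :: "nat \<Rightarrow> 'n" where "nm v = V ! v"

lemma T_simps:
  "np T = 2" "nv T = length V" "v < length V \<Longrightarrow> owner T v = (if pro (nm v) then 0 else 1)"
  "sv T = 0" "th T = [0, 0]"
  "tabs T 0 = [(0, [(2, replicate (length V) 0)])]" "tabs T (Suc 0) = map (pay_tab ck cb cn sk r0 V) [0..<2 + 2 * R]"
  "prefs T 0 = []"
  by (simp_all add: T_def mkT_def np_def nv_def owner_def nm_def sv_def th_def tabs_def prefs_def nthd del: upt_Suc)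

lemma prefs_T: "(p, q) \<in> set (prefs T (Suc 0)) \<longleftrightarrow> p < 2 + 2 * R \<and> q < 2 + 2 * R \<and>
    (p = 0 \<and> odd q \<or> odd p \<and> even q \<and> q \<noteq> 0)"
  by (auto simp: T_def mkT_def prefs_def nthd image_iff simp del: upt_Suc)

lemma edge_T: "(i, j) \<in> edges G \<longleftrightarrow> i < length V \<and> j < length V \<and> nm j \<in> set (sc (nm i))"
  by (auto simp: T_def mkT_def nthd image_iff nm_def simp del: upt_Suc)

lemma nm_in: "v < length V \<Longrightarrow> nm v \<in> set V"
  by (simp add: nm_def)

lemma pick: "v < length V \<Longrightarrow> y \<in> set (sc (nm v)) \<Longrightarrow> \<exists>u. (v, u) \<in> edges G \<and> nm u = y"
  using sc[OF nm_in, of v] unfolding edge_T by (metis in_set_conv_nth nm_def subsetD)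

lemma pay_step_bound: "q < 6 \<Longrightarrow> pay_step ck cb cn sk p q x < 6"
  by (auto simp: pay_step_def)

lemma synt_T: "synt T"
proof -
  have o: "\<forall>i \<in> set (fst T). i < np T" by (auto simp: T_def mkT_def np_def)
  have e: "\<forall>e \<in> set (fst (snd T)). fst e < nv T \<and> snd e < nv T"
    using edge_T by (auto simp: T_simps)
  have out: "outs T v \<noteq> []" if "v < nv T" for v
  proof -
    have v: "v < length V" using that by (simp add: T_simps)
    have "sc (nm v) \<noteq> []" using sc[OF nm_in[OF v]] by blast
    then obtain y where "y \<in> set (sc (nm v))" by (cases "sc (nm v)") auto
    from pick[OF v this] obtain u where "(v, u) \<in> edges G" by blast
    then have "u \<in> set (outs T v)" by (simp only: outs_edges)
    then show ?thesis by auto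
  qed
  have t: "(\<forall>e \<in> set (prefs T i). fst e < length (tabs T i) \<and> snd e < length (tabs T i)) \<and>
        (\<forall>t \<in> set (tabs T i). fst t < length (snd t) \<and>
           (\<forall>r \<in> set (snd t). length (snd r) = nv T \<and> (\<forall>q \<in> set (snd r). q < length (snd t))))" if "i < np T" for i
  proof -
    have "i = 0 \<or> i = Suc 0" using that by (auto simp: T_simps)
    then show ?thesis
    proof
      assume "i = 0" then show ?thesis by (auto simp: T_simps)
    next
      assume i: "i = Suc 0"
      have "\<forall>e \<in> set (prefs T i). fst e < length (tabs T i) \<and> snd e < length (tabs T i)"
      proof
        fix e assume "e \<in> set (prefs T i)"
        then have "(fst e, snd e) \<in> set (prefs T (Suc 0))" unfolding i by simp
        then have "fst e < 2 + 2 * R \<and> snd e < 2 + 2 * R" unfolding prefs_T by blast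
        then show "fst e < length (tabs T i) \<and> snd e < length (tabs T i)" unfolding i T_simps by simp
      qed
      moreover have "fst t < length (snd t) \<and>
           (\<forall>r \<in> set (snd t). length (snd r) = nv T \<and> (\<forall>q \<in> set (snd r). q < length (snd t)))" if t: "t \<in> set (tabs T i)" for t
      proof -
        obtain p where "t = pay_tab ck cb cn sk r0 V p" using t unfolding i by (auto simp: T_simps simp del: upt_Suc)
        then show ?thesis using pay_step_bound by (auto simp: pay_tab_def T_simps simp del: upt_Suc)
      qed
      ultimately show ?thesis by blast
    qed
  qed
  have th: "\<forall>i < np T. nthd 0 (th T) i < length (tabs T i)"
  proof (intro allI impI)
    fix i assume "i < np T"
    then have "i = 0 \<or> i = Suc 0" by (auto simp: T_simps)
    then show "nthd 0 (th T) i < length (tabs T i)" by (auto simp: T_simps nthd)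
  qed
  show ?thesis unfolding synt_def using o e out t th V by (simp add: T_simps(1,2,4,5))
qed

section \<open>What the payoff automata compute\<close>

definition track :: "nat \<Rightarrow> 'n list \<Rightarrow> bool \<times> bool" where
  "track r l = foldl (\<lambda>(v, b) x. if ck x = Suc r then (cn x, b \<or> v \<noteq> cb x) else (v, b)) (r0 r, False) l"

definition regs :: "'n list \<Rightarrow> nat \<Rightarrow> bool" where "regs l r = fst (track r l)"
definition brk :: "'n list \<Rightarrow> nat \<Rightarrow> bool" where "brk l r = snd (track r l)"

lemma track_simps:
  "regs [] = r0" "brk [] r = False" "regs (l @ [x]) = nxt x (regs l)"
  "brk (l @ [x]) r = (brk l r \<or> ck x = Suc r \<and> regs l r \<noteq> cb x)"
  by (auto simp: regs_def brk_def track_def nxt_def fun_eq_iff split: prod.splits)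

definition run :: "nat \<Rightarrow> nat word \<Rightarrow> nat \<Rightarrow> nat" where
  "run p w = rec_nat (if r0 (pay_reg p) then 1 else 0) (\<lambda>n q. pay_step ck cb cn sk p q (nm (w n)))"

lemma run_simps: "run p w 0 = (if r0 (pay_reg p) then 1 else 0)" "run p w (Suc n) = pay_step ck cb cn sk p (run p w n) (nm (w n))"
  by (simp_all add: run_def)

lemma run_track:
  "(\<And>k. k < n \<Longrightarrow> sk (nm (w k)) = 0) \<Longrightarrow> run p w n = (if regs (map (\<lambda>k. nm (w k)) [0..<n]) (pay_reg p) then 1 else 0) +
     (if brk (map (\<lambda>k. nm (w k)) [0..<n]) (pay_reg p) then 2 else 0)"
proof (induction n)
  case 0 then show ?case by (simp add: run_simps track_simps)
next
  case (Suc n)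
  have "sk (nm (w n)) = 0" "run p w n = (if regs (map (\<lambda>k. nm (w k)) [0..<n]) (pay_reg p) then 1 else 0) +
     (if brk (map (\<lambda>k. nm (w k)) [0..<n]) (pay_reg p) then 2 else 0)" using Suc by auto
  then show ?case by (auto simp: run_simps track_simps pay_step_def nxt_def)
qed

lemma run_lt: "run p w n < 6"
  by (induction n) (auto simp: run_simps pay_step_bound)

text \<open>The priorities are eventually constant, so their limit is a singleton.\<close>

lemma lang_run:
  assumes w: "w \<in> words T" and p: "p < 2 + 2 * R" and c: "\<And>n. k \<le> n \<Longrightarrow> pay_prio p (run p w n) = c"
  shows "w \<in> lang T (Suc 0) p \<longleftrightarrow> even c"
proof -
  let ?A = "dpa_of (tab_of (tabs T (Suc 0) ! p))"
  have wl: "w n < length V" for n using w by (auto simp: words_def omega_words_def T_simps)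
  have t: "tabs T (Suc 0) ! p = pay_tab ck cb cn sk r0 V p" using p by (simp add: T_simps del: upt_Suc)
  have r: "dpa_run ?A w n = run p w n" for n
  proof (induction n)
    case 0 show ?case unfolding t by (simp add: dpa_of_def tab_of_def pay_tab_def run_simps)
  next
    case (Suc n)
    have "snd (snd (pay_tab ck cb cn sk r0 V p) ! run p w n) ! w n = pay_step ck cb cn sk p (run p w n) (nm (w n))"
      using run_lt wl by (simp add: pay_tab_def nm_def del: upt_Suc)
    then show ?case using Suc unfolding t by (simp add: dpa_of_def tab_of_def run_simps)
  qed
  have "(priority ?A \<circ> dpa_run ?A w) n = pay_prio p (run p w n)" for n
    unfolding comp_def r unfolding t using run_lt[of p w n] by (simp add: dpa_of_def tab_of_def pay_tab_def del: upt_Suc)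
  then have "limit (priority ?A \<circ> dpa_run ?A w) = {c}"
    using c by (intro limit_eventually_const[of k]) auto
  then show ?thesis using w unfolding lang_def dpa_language_def words_def by (simp add: T_simps)
qed

lemma lang_no_sink:
  assumes "w \<in> words T" "p < 2 + 2 * R" "\<And>n. sk (nm (w n)) = 0"
  shows "w \<in> lang T (Suc 0) p \<longleftrightarrow> p = 1"
proof -
  have "run p w n < 4" for n using run_track[of n w p] assms(3) by auto
  then have "run p w n \<noteq> 4 \<and> run p w n \<noteq> 5" for n
  proof -
    assume *: "\<And>n. run p w n < 4"
    show ?thesis using *[of n] by linarith
  qed
  then have "pay_prio p (run p w n) = (if p = 1 then 2 else 1)" for n by (simp add: pay_prio_def)
  from lang_run[OF assms(1,2), of 0, OF this] show ?thesis by simp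
qed

lemma lang_sink:
  assumes w: "w \<in> words T" and p: "p < 2 + 2 * R" and sk: "sk (nm (w n)) = Suc r" "\<And>k. k < n \<Longrightarrow> sk (nm (w k)) = 0"
  shows "w \<in> lang T (Suc 0) p \<longleftrightarrow> p = (if brk (map (\<lambda>k. nm (w k)) [0..<n]) r then 2 + 2 * r else 3 + 2 * r)"
proof -
  define q :: nat where "q = (if p = (if brk (map (\<lambda>k. nm (w k)) [0..<n]) r then 2 + 2 * r else 3 + 2 * r) then 4 else 5)"
  have "2 \<le> run p w n \<longleftrightarrow> brk (map (\<lambda>k. nm (w k)) [0..<n]) (pay_reg p)" "run p w n < 4"
    using run_track[of n w p] sk(2) by auto
  moreover have "2 \<le> p \<and> r = pay_reg p \<and> brk (map (\<lambda>k. nm (w k)) [0..<n]) (pay_reg p) = even p \<longleftrightarrow>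
      p = (if brk (map (\<lambda>k. nm (w k)) [0..<n]) r then 2 + 2 * r else 3 + 2 * r)"
  proof -
    have "2 \<le> p \<and> r = pay_reg p \<longleftrightarrow> p = 2 + 2 * r \<or> p = 3 + 2 * r" unfolding pay_reg_def by presburger
    moreover have "even (2 + 2 * r)" "odd (3 + 2 * r)" by simp_all
    ultimately show ?thesis by (metis (no_types) numeral_eq_iff add_right_cancel even_numeral)
  qed
  ultimately have "run p w (Suc n) = q" using sk(1) unfolding run_simps pay_step_def q_def by auto
  then have q: "run p w (Suc n + k) = q" for k
    by (induction k) (auto simp: run_simps pay_step_def q_def)
  have "pay_prio p (run p w k) = (if q = 4 then 2 else 1)" if "Suc n \<le> k" for k
    using q[of "k - Suc n"] that by (auto simp: pay_prio_def q_def)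
  from lang_run[OF w p this, of "Suc n"] show ?thesis unfolding q_def by auto
qed

lemma exact_T: "i < np T \<Longrightarrow> exact T i"
proof -
  assume "i < np T"
  then consider "i = 0" | "i = Suc 0" by (fastforce simp: T_simps)
  then show "exact T i"
  proof cases
    case 1
    have "w \<in> lang T 0 0" if w: "w \<in> words T" for w
    proof -
      let ?A = "dpa_of (tab_of (tabs T 0 ! 0))"
      have wl: "w n < length V" for n using w by (auto simp: words_def omega_words_def T_simps)
      have "dpa_run ?A w n = 0" for n
        by (induction n) (use wl in \<open>auto simp: T_simps dpa_of_def tab_of_def\<close>)
      then have "limit (priority ?A \<circ> dpa_run ?A w) = {2}"
        by (intro limit_eventually_const[of 0]) (simp add: T_simps dpa_of_def tab_of_def)
      then show ?thesis using w unfolding lang_def dpa_language_def words_def by simp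
    qed
    then show ?thesis unfolding exact_def 1 by (auto simp: T_simps)
  next
    case 2
    have "\<exists>!p. p < 2 + 2 * R \<and> w \<in> lang T (Suc 0) p" if w: "w \<in> words T" for w
    proof (cases "\<exists>n. sk (nm (w n)) \<noteq> 0")
      case False
      then show ?thesis using lang_no_sink[OF w] by auto
    next
      case True
      define n where "n = (LEAST n. sk (nm (w n)) \<noteq> 0)"
      have n: "sk (nm (w n)) \<noteq> 0" unfolding n_def by (rule LeastI_ex[OF True])
      then obtain r where r: "sk (nm (w n)) = Suc r" by (cases "sk (nm (w n))") auto
      have lt: "sk (nm (w k)) = 0" if "k < n" for k using not_less_Least that unfolding n_def by blast
      have "nm (w n) \<in> set V" using w by (intro nm_in) (auto simp: words_def omega_words_def T_simps)
      from sk[OF this r] have "r < R" .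
      then have "(if brk (map (\<lambda>k. nm (w k)) [0..<n]) r then 2 + 2 * r else 3 + 2 * r) < 2 + 2 * R" by simp
      then show ?thesis using lang_sink[OF w _ r lt] by blast
    qed
    then show ?thesis unfolding exact_def 2 by (simp add: T_simps del: upt_Suc)
  qed
qed

lemma two_players: "encode (inst T) \<in> two_player_instances"
proof -
  have "valid_instance (inst T)" unfolding valid_inst using synt_T exact_T by blast
  moreover have "card (players G) = 2" by (simp add: T_simps)
  ultimately show ?thesis unfolding two_player_instances_def by blast
qed

lemma pay_T:
  assumes "w \<in> words T"
  shows "(\<And>n. sk (nm (w n)) = 0) \<Longrightarrow> pay G (Suc 0) w = 1"
    and "sk (nm (w n)) = Suc r \<Longrightarrow> (\<And>k. k < n \<Longrightarrow> sk (nm (w k)) = 0) \<Longrightarrow>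
      pay G (Suc 0) w = (if brk (map (\<lambda>k. nm (w k)) [0..<n]) r then 2 + 2 * r else 3 + 2 * r)"
proof -
  have e: "Suc 0 < np T" "exact T (Suc 0)" using exact_T by (simp_all add: T_simps)
  have l: "length (tabs T (Suc 0)) = 2 + 2 * R" by (simp add: T_simps del: upt_Suc)
  note p = pay_exact[OF e assms, unfolded l]
  { assume "\<And>n. sk (nm (w n)) = 0"
    then show "pay G (Suc 0) w = 1" using lang_no_sink[OF assms, of 1] p(1)[of 1] by simp }
  { assume h: "sk (nm (w n)) = Suc r" "\<And>k. k < n \<Longrightarrow> sk (nm (w k)) = 0"
    have "nm (w n) \<in> set V" using assms by (intro nm_in) (auto simp: words_def omega_words_def T_simps)
    from sk[OF this h(1)] have "(if brk (map (\<lambda>k. nm (w k)) [0..<n]) r then 2 + 2 * r else 3 + 2 * r) < 2 + 2 * R" by simp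
    then show "pay G (Suc 0) w = (if brk (map (\<lambda>k. nm (w k)) [0..<n]) r then 2 + 2 * r else 3 + 2 * r)"
      using lang_sink[OF assms _ h] p(1) by blast }
qed

lemma own0: "v < length V \<Longrightarrow> v \<in> owned G i \<longleftrightarrow> i = (if pro (nm v) then 0 else 1)"
proof -
  assume v: "v < length V"
  have "v \<in> owned G i \<longleftrightarrow> owner T v = i" by (rule owned_game) (simp add: T_simps v)
  then show ?thesis unfolding T_simps(3)[OF v] by (simp only: eq_commute)
qed

lemma pref_T: "pref G 0 = {}" "pref G (Suc 0) = set (prefs T (Suc 0))"
proof -
  have "0 < np T" "Suc 0 < np T" unfolding T_simps by simp_all
  from game_sel2(2)[OF this(1)] game_sel2(2)[OF this(2)]
  show "pref G 0 = {}" "pref G (Suc 0) = set (prefs T (Suc 0))" unfolding T_simps(8) by (simp_all only: list.set)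
qed

lemma strategy_exists: "\<exists>s. strategy G i s \<and> (\<forall>h. history G h \<longrightarrow> (\<exists>u. (last h, u) \<in> edges G \<and> P h u) \<longrightarrow> P h (s h))"
proof -
  define s where "s = (\<lambda>h. if \<exists>u. (last h, u) \<in> edges G \<and> P h u then SOME u. (last h, u) \<in> edges G \<and> P h u
     else SOME u. (last h, u) \<in> edges G)"
  have "(last h, s h) \<in> edges G" if "history G h" for h
  proof -
    have "h \<noteq> []" "set h \<subseteq> {..<length V}" using that by (auto simp: history_def T_simps)
    then have "last h < length V" using last_in_set by blast
    then have "hd (sc (nm (last h))) \<in> set (sc (nm (last h)))" using sc[OF nm_in] by simp
    from pick[OF \<open>last h < length V\<close> this] have e: "\<exists>u. (last h, u) \<in> edges G" by blast
    show ?thesis unfolding s_def using someI_ex[of "\<lambda>u. (last h, u) \<in> edges G \<and> P h u"] someI_ex[OF e] by auto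
  qed
  moreover have "P h (s h)" if "\<exists>u. (last h, u) \<in> edges G \<and> P h u" for h
    unfolding s_def using someI_ex[OF that] that by auto
  ultimately show ?thesis unfolding strategy_def by blast
qed

lemma play_history: "play G w \<Longrightarrow> history G (map w [0..<Suc n])"
proof (induction n)
  case 0 then show ?case by (auto simp: history_def play_def omega_words_def)
next
  case (Suc n)
  have "history G (map w [0..<Suc n])" "(w n, w (Suc n)) \<in> edges G" "w (Suc n) \<in> verts G"
    using Suc by (auto simp: play_def omega_words_def)
  then show ?case by (auto simp: history_def successively_append_iff)
qed

text \<open>Outside the attractor, the prover can keep every claim true.\<close>

lemma NE_if_not_Att:
  assumes "\<not> Att (nm 0) r0"
  shows "constrained_NE_exists G (sv T) (\<lambda>i. th T ! i)"
proof -
  let ?\<rho> = "\<lambda>h. regs (map nm h)"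
  obtain s0 where s0: "strategy G 0 s0" and
    keep: "\<And>h. history G h \<Longrightarrow> \<exists>u. (last h, u) \<in> edges G \<and> \<not> Att (nm u) (?\<rho> h) \<Longrightarrow> \<not> Att (nm (s0 h)) (?\<rho> h)"
    using strategy_exists[of 0 "\<lambda>h u. \<not> Att (nm u) (?\<rho> h)"] by blast
  obtain s1 where s1: "strategy G (Suc 0) s1" using strategy_exists[of "Suc 0" "\<lambda>h u. True"] by blast
  define \<sigma> where "\<sigma> = (\<lambda>i :: nat. if i = 0 then s0 else s1)"
  have pl: "players G = {0, Suc 0}" by (auto simp: T_simps)
  have prof: "strategy_profile G \<sigma>" unfolding strategy_profile_def pl using s0 s1 by (simp add: \<sigma>_def)
  have sv: "sv T < nv T" using V by (simp add: T_simps)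
  have bad: "odd (pay G (Suc 0) w) \<and> pay G (Suc 0) w < 2 + 2 * R"
    if play: "play G w" and w0: "w 0 = 0" and con: "consistent G 0 s0 w" for w
  proof -
    have ww: "w \<in> words T" by (rule play_words[OF play])
    have wl: "w n < length V" for n using ww by (auto simp: words_def omega_words_def T_simps)
    \<comment> \<open>Before the first sink the play stays outside the attractor, so no claim made
      so far was wrong.\<close>
    have inv: "(\<forall>k < n. sk (nm (w k)) = 0) \<Longrightarrow> \<not> Att (nm (w n)) (?\<rho> (map w [0..<n])) \<and> (\<forall>r. \<not> brk (map nm (map w [0..<n])) r)" for n
    proof (induction n)
      case 0 then show ?case using assms w0 by (simp add: track_simps)
    next
      case (Suc n)
      let ?x = "nm (w n)" and ?h = "map w [0..<Suc n]"
      have IH: "\<not> Att ?x (?\<rho> (map w [0..<n]))" "\<And>r. \<not> brk (map nm (map w [0..<n])) r"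
        using Suc by auto
      have x0: "sk ?x = 0" using Suc.prems by blast
      have \<rho>: "?\<rho> ?h = nxt ?x (?\<rho> (map w [0..<n]))" by (simp add: track_simps)
      have nb: "\<not> brk (map nm ?h) r" for r
        using IH caught[OF x0, of r] by (auto simp: track_simps)
      have e: "(w n, w (Suc n)) \<in> edges G" using play by (simp add: play_def)
      have "\<not> Att (nm (w (Suc n))) (?\<rho> ?h)"
      proof (cases "pro ?x")
        case True
        then obtain y where y: "y \<in> set (sc ?x)" "\<not> Att y (?\<rho> ?h)"
          using prover[OF x0 True] IH(1) unfolding \<rho> by blast
        from pick[OF wl y(1)] obtain u where u: "(w n, u) \<in> edges G" "nm u = y" by blast
        have la: "last ?h = w n" by simp
        have "\<not> Att (nm (s0 ?h)) (?\<rho> ?h)"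
        proof (rule keep[OF play_history[OF play]])
          show "\<exists>u. (last ?h, u) \<in> edges G \<and> \<not> Att (nm u) (?\<rho> ?h)"
            unfolding la by (rule exI[of _ u]) (use u y in simp)
        qed
        moreover have "w (Suc n) = s0 ?h" using con True own0[OF wl[of n], of 0] unfolding consistent_def by simp
        ultimately show ?thesis by simp
      next
        case False
        then show ?thesis using challenger[OF x0 False] IH(1) e unfolding \<rho> edge_T by blast
      qed
      then show ?case using nb by blast
    qed
    show ?thesis
    proof (cases "\<exists>n. sk (nm (w n)) \<noteq> 0")
      case False
      then have "pay G (Suc 0) w = 1" by (intro pay_T(1)[OF ww]) blast
      then show ?thesis by simp
    next
      case True
      define n where "n = (LEAST n. sk (nm (w n)) \<noteq> 0)"
      have n: "sk (nm (w n)) \<noteq> 0" unfolding n_def by (rule LeastI_ex[OF True])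
      then obtain r where r: "sk (nm (w n)) = Suc r" by (cases "sk (nm (w n))") auto
      have lt: "sk (nm (w k)) = 0" if "k < n" for k using not_less_Least that unfolding n_def by blast
      have "\<not> brk (map (\<lambda>k. nm (w k)) [0..<n]) r" using inv[of n] lt by (simp add: comp_def)
      then have "pay G (Suc 0) w = 3 + 2 * r" using pay_T(2)[OF ww r lt] by simp
      then show ?thesis using sk[OF nm_in[OF wl] r] by simp
    qed
  qed
  note op = outcome_props[OF synt_T prof sv]
  have out: "odd (pay G (Suc 0) (outcome G \<sigma> (sv T))) \<and> pay G (Suc 0) (outcome G \<sigma> (sv T)) < 2 + 2 * R"
    using op(1,2) op(3)[of 0] by (intro bad) (simp_all add: T_simps \<sigma>_def)
  have "(pay G i (outcome G \<sigma> (sv T)), pay G i (outcome G (\<sigma>(i := \<tau>)) (sv T))) \<notin> pref G i"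
    if i: "i \<in> players G" and \<tau>: "strategy G i \<tau>" for i \<tau>
  proof (cases "i = 0")
    case True then show ?thesis by (simp only: pref_T empty_iff not_False_eq_True)
  next
    case False
    then have i1: "i = Suc 0" using i unfolding pl by simp
    have "strategy_profile G (\<sigma>(i := \<tau>))" using prof \<tau> unfolding strategy_profile_def by auto
    note ot = outcome_props[OF synt_T this sv]
    have "odd (pay G (Suc 0) (outcome G (\<sigma>(i := \<tau>)) (sv T)))"
      using ot(1,2) ot(3)[of 0] bad by (simp add: T_simps \<sigma>_def i1)
    then show ?thesis unfolding i1 pref_T prefs_T using out by (auto elim: oddE)
  qed
  then have "nash_equilibrium G (sv T) \<sigma>" unfolding nash_equilibrium_def using prof by blast
  moreover have "th T ! i = pay G i (outcome G \<sigma> (sv T)) \<or> (th T ! i, pay G i (outcome G \<sigma> (sv T))) \<in> pref G i"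
    if "i \<in> players G" for i
  proof (cases "i = 0")
    case True
    have "pay G 0 (outcome G \<sigma> (sv T)) < 1"
      using pay_exact(2)[of 0 T, OF _ exact_T play_words[OF op(1)]] by (simp add: T_simps)
    then show ?thesis using True by (simp add: T_simps)
  next
    case False
    then have i1: "i = Suc 0" using that unfolding pl by simp
    have "th T ! Suc 0 = 0" unfolding T_simps by simp
    then show ?thesis unfolding i1 pref_T prefs_T using out by simp
  qed
  ultimately show ?thesis unfolding constrained_NE_exists_def by blast
qed

text \<open>Induction along the attractor, against a fixed strategy \<open>s\<close> of player 0.
  \<open>h\<close> is the history before the current vertex, and the final sink is the bet that
  follows a wrong claim.\<close>

lemma Att_path:
  assumes "Att x \<rho>" "history G (h @ [v])" "nm v = x" "regs (map nm h) = \<rho>" "\<And>u. u \<in> set h \<Longrightarrow> sk (nm u) = 0"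
    "\<And>k. Suc k < length (h @ [v]) \<Longrightarrow> pro (nm ((h @ [v]) ! k)) \<Longrightarrow> (h @ [v]) ! Suc k = s (take (Suc k) (h @ [v]))"
    "strategy G 0 s"
  shows "\<exists>g u r. history G (g @ [u]) \<and> hd (g @ [u]) = hd (h @ [v]) \<and> (\<forall>u \<in> set g. sk (nm u) = 0) \<and> sk (nm u) = Suc r \<and> brk (map nm g) r \<and>
     (\<forall>k. Suc k < length (g @ [u]) \<longrightarrow> pro (nm ((g @ [u]) ! k)) \<longrightarrow> (g @ [u]) ! Suc k = s (take (Suc k) (g @ [u])))"
  using assms
proof (induction arbitrary: h v)
  case (caught x r \<rho>)
  have v: "v < length V" using caught.prems(1) by (auto simp: history_def T_simps)
  obtain y where y: "y \<in> set (sc x)" "sk y = Suc r" and np: "\<not> pro x"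
    using ck[OF nm_in[OF v], of r] caught by auto
  obtain u where u: "(v, u) \<in> edges G" "nm u = y" using pick[OF v, of y] y caught.prems(2) by blast
  have hist: "history G ((h @ [v]) @ [u])"
    using caught.prems(1) u(1) unfolding history_def edge_T by (auto simp: successively_append_iff T_simps)
  have "brk (map nm (h @ [v])) r"
    using caught.hyps caught.prems(2,3) by (simp add: track_simps)
  moreover have "((h @ [v]) @ [u]) ! Suc k = s (take (Suc k) ((h @ [v]) @ [u]))"
    if "Suc k < length ((h @ [v]) @ [u])" "pro (nm (((h @ [v]) @ [u]) ! k))" for k
  proof (cases "k = length h")
    case True then show ?thesis using that np caught.prems(2) by (simp add: nth_append)
  next
    case False
    then have k: "Suc k < length (h @ [v])" using that by simp
    then have "((h @ [v]) @ [u]) ! k = (h @ [v]) ! k" "((h @ [v]) @ [u]) ! Suc k = (h @ [v]) ! Suc k"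
      "take (Suc k) ((h @ [v]) @ [u]) = take (Suc k) (h @ [v])" by (simp_all add: nth_append)
    then show ?thesis using caught.prems(5)[OF k] that(2) by metis
  qed
  ultimately show ?case using hist u(2) y(2) caught.prems(2,4) caught.hyps(1)
    by - (rule exI[of _ "h @ [v]"], rule exI[of _ u], rule exI[of _ r], auto simp: hd_append)
next
  case (prover x \<rho>)
  have v: "v < length V" using prover.prems(1) by (auto simp: history_def T_simps)
  define u where "u = s (h @ [v])"
  have own: "v \<in> owned G 0" using own0[OF v, of 0] prover by simp
  have "(last (h @ [v]), u) \<in> edges G" using prover.prems(6,1) own unfolding strategy_def u_def by auto
  then have e: "(v, u) \<in> edges G" by simp
  have hist: "history G ((h @ [v]) @ [u])"
    using prover.prems(1) e unfolding history_def edge_T by (auto simp: successively_append_iff T_simps)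
  have "\<exists>g u' r. history G (g @ [u']) \<and> hd (g @ [u']) = hd ((h @ [v]) @ [u]) \<and> (\<forall>u \<in> set g. sk (nm u) = 0) \<and> sk (nm u') = Suc r \<and> brk (map nm g) r \<and>
     (\<forall>k. Suc k < length (g @ [u']) \<longrightarrow> pro (nm ((g @ [u']) ! k)) \<longrightarrow> (g @ [u']) ! Suc k = s (take (Suc k) (g @ [u'])))"
  proof (rule prover.IH[of "nm u"])
    show "nm u \<in> set (sc x)" using e prover.prems(2) unfolding edge_T by simp
    show "regs (map nm (h @ [v])) = nxt x \<rho>" using prover.prems by (simp add: track_simps)
    show "sk (nm u) = 0" if "u \<in> set (h @ [v])" for u using that prover.prems(2,4) prover.hyps by auto
    show "((h @ [v]) @ [u]) ! Suc k = s (take (Suc k) ((h @ [v]) @ [u]))"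
      if "Suc k < length ((h @ [v]) @ [u])" "pro (nm (((h @ [v]) @ [u]) ! k))" for k
    proof (cases "k = length h")
      case True then show ?thesis by (simp add: nth_append u_def)
    next
      case False
      then have k: "Suc k < length (h @ [v])" using that by simp
      then have "((h @ [v]) @ [u]) ! k = (h @ [v]) ! k" "((h @ [v]) @ [u]) ! Suc k = (h @ [v]) ! Suc k"
        "take (Suc k) ((h @ [v]) @ [u]) = take (Suc k) (h @ [v])" by (simp_all add: nth_append)
      then show ?thesis using prover.prems(5)[OF k] that(2) by metis
    qed
  qed (use hist prover.prems(6) in auto)
  moreover have "hd ((h @ [v]) @ [u]) = hd (h @ [v])" by (simp add: hd_append)
  ultimately show ?case by (simp only:)
next
  case (challenger x y \<rho>)
  have v: "v < length V" using challenger.prems(1) by (auto simp: history_def T_simps)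
  obtain u where e: "(v, u) \<in> edges G" "nm u = y" using pick[OF v, of y] challenger by blast
  have hist: "history G ((h @ [v]) @ [u])"
    using challenger.prems(1) e(1) unfolding history_def edge_T by (auto simp: successively_append_iff T_simps)
  have "\<exists>g u' r. history G (g @ [u']) \<and> hd (g @ [u']) = hd ((h @ [v]) @ [u]) \<and> (\<forall>u \<in> set g. sk (nm u) = 0) \<and> sk (nm u') = Suc r \<and> brk (map nm g) r \<and>
     (\<forall>k. Suc k < length (g @ [u']) \<longrightarrow> pro (nm ((g @ [u']) ! k)) \<longrightarrow> (g @ [u']) ! Suc k = s (take (Suc k) (g @ [u'])))"
  proof (rule challenger.IH)
    show "regs (map nm (h @ [v])) = nxt x \<rho>" using challenger.prems by (simp add: track_simps)
    show "sk (nm u) = 0" if "u \<in> set (h @ [v])" for u using that challenger.prems(2,4) challenger.hyps by auto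
    show "((h @ [v]) @ [u]) ! Suc k = s (take (Suc k) ((h @ [v]) @ [u]))"
      if "Suc k < length ((h @ [v]) @ [u])" "pro (nm (((h @ [v]) @ [u]) ! k))" for k
    proof (cases "k = length h")
      case True then show ?thesis using that challenger.prems(2) challenger.hyps by (simp add: nth_append)
    next
      case False
      then have k: "Suc k < length (h @ [v])" using that by simp
      then have "((h @ [v]) @ [u]) ! k = (h @ [v]) ! k" "((h @ [v]) @ [u]) ! Suc k = (h @ [v]) ! Suc k"
        "take (Suc k) ((h @ [v]) @ [u]) = take (Suc k) (h @ [v])" by (simp_all add: nth_append)
      then show ?thesis using challenger.prems(5)[OF k] that(2) by metis
    qed
  qed (use hist e challenger.prems(6) in auto)
  moreover have "hd ((h @ [v]) @ [u]) = hd (h @ [v])" by (simp add: hd_append)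
  ultimately show ?case by (simp only:)
qed

lemma not_Att_if_NE:
  assumes "constrained_NE_exists G (sv T) (\<lambda>i. th T ! i)"
  shows "\<not> Att (nm 0) r0"
proof
  assume att: "Att (nm 0) r0"
  have pl: "players G = {0, Suc 0}" by (auto simp: T_simps)
  have sv: "sv T < nv T" using V by (simp add: T_simps)
  obtain \<sigma> where ne: "nash_equilibrium G (sv T) \<sigma>" and
    t: "th T ! 1 = pay G (Suc 0) (outcome G \<sigma> (sv T)) \<or> (th T ! 1, pay G (Suc 0) (outcome G \<sigma> (sv T))) \<in> pref G (Suc 0)"
    using assms unfolding constrained_NE_exists_def pl by auto
  have prof: "strategy_profile G \<sigma>" using ne by (simp add: nash_equilibrium_def)
  have st: "strategy G 0 (\<sigma> 0)" "strategy G (Suc 0) (\<sigma> (Suc 0))" using prof unfolding strategy_profile_def pl by auto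
  note op = outcome_props[OF synt_T prof sv]
  let ?w = "outcome G \<sigma> (sv T)"
  note pref1 = pref_T(2)
  \<comment> \<open>As 0 is never attained, the threshold is met through the preference, which
    forces an odd payoff.\<close>
  have "pay G (Suc 0) ?w \<noteq> 0"
  proof (cases "\<exists>n. sk (nm (?w n)) \<noteq> 0")
    case False
    then show ?thesis using pay_T(1)[OF play_words[OF op(1)]] by simp
  next
    case True
    define n where "n = (LEAST n. sk (nm (?w n)) \<noteq> 0)"
    have n: "sk (nm (?w n)) \<noteq> 0" unfolding n_def by (rule LeastI_ex[OF True])
    then obtain r where r: "sk (nm (?w n)) = Suc r" by (cases "sk (nm (?w n))") auto
    have lt: "sk (nm (?w k)) = 0" if "k < n" for k using not_less_Least that unfolding n_def by blast
    show ?thesis using pay_T(2)[OF play_words[OF op(1)] r lt] by (simp split: if_splits)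
  qed
  then have odd: "odd (pay G (Suc 0) ?w) \<and> pay G (Suc 0) ?w < 2 + 2 * R" using t unfolding pref1 prefs_T by (auto simp: T_simps)
  obtain g u r where g: "history G (g @ [u])" "hd (g @ [u]) = 0" "\<And>u. u \<in> set g \<Longrightarrow> sk (nm u) = 0" "sk (nm u) = Suc r" "brk (map nm g) r"
    and gs: "\<And>k. Suc k < length (g @ [u]) \<Longrightarrow> pro (nm ((g @ [u]) ! k)) \<Longrightarrow> (g @ [u]) ! Suc k = \<sigma> 0 (take (Suc k) (g @ [u]))"
  proof -
    have "history G ([] @ [0])" using V by (auto simp: history_def T_simps)
    from Att_path[OF att this refl _ _ _ st(1)] show thesis
      using that by (auto simp: track_simps)
  qed
  let ?g = "g @ [u]"
  \<comment> \<open>Player 1 moves along the history found above as long as it lasts. The moves of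
    player 0 on it are those of \<open>\<sigma> 0\<close>, so the resulting play begins with
    it.\<close>
  define \<tau> where "\<tau> = (\<lambda>h. if length h < length ?g \<and> h = take (length h) ?g then ?g ! length h else \<sigma> (Suc 0) h)"
  have edge: "(?g ! k, ?g ! Suc k) \<in> edges G" if "Suc k < length ?g" for k
    using g(1) that unfolding history_def successively_conv_nth by blast
  have \<tau>: "strategy G (Suc 0) \<tau>"
    unfolding strategy_def
  proof (intro allI impI)
    fix h assume h: "history G h \<and> last h \<in> owned G (Suc 0)"
    show "(last h, \<tau> h) \<in> edges G"
    proof (cases "length h < length ?g \<and> h = take (length h) ?g")
      case True
      obtain l where l: "length h = Suc l" using h by (cases h) (auto simp: history_def)
      have hne: "h \<noteq> []" using l by auto
      have "last h = h ! l" using l by (simp add: last_conv_nth[OF hne])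
      also have "\<dots> = take (length h) ?g ! l" using conjunct2[OF True] by (rule arg_cong)
      also have "\<dots> = ?g ! l" by (rule nth_take) (use l in simp)
      finally show ?thesis using edge[of l] True unfolding \<tau>_def l[symmetric] using l by simp
    next
      case False
      then show ?thesis using st(2) h unfolding \<tau>_def strategy_def by auto
    qed
  qed
  have prof': "strategy_profile G (\<sigma>(Suc 0 := \<tau>))" using prof \<tau> unfolding strategy_profile_def by auto
  note ot = outcome_props[OF synt_T prof' sv]
  define w' where "w' = outcome G (\<sigma>(Suc 0 := \<tau>)) (sv T)"
  note ot = ot[folded w'_def]
  have c0: "consistent G 0 (\<sigma> 0) w'" and c1: "consistent G (Suc 0) \<tau> w'"
    using ot(3)[of 0] ot(3)[of "Suc 0"] by (simp_all add: T_simps)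
  have ww: "w' \<in> words T" by (rule play_words[OF ot(1)])
  have wl: "w' n < length V" for n using ww by (auto simp: words_def omega_words_def T_simps)
  have pre: "k < length ?g \<Longrightarrow> map w' [0..<Suc k] = take (Suc k) ?g" for k
  proof (induction k)
    case 0
    have "?g \<noteq> []" by simp
    then have "take (Suc 0) ?g = [hd ?g]" by (cases ?g) (simp_all only: take_Suc_Cons take_0 list.sel)
    then show ?case using ot(2) g(2) by (simp add: T_simps del: fun_upd_apply)
  next
    case (Suc k)
    have IH: "map w' [0..<Suc k] = take (Suc k) ?g" using Suc by simp
    have wk: "w' k = ?g ! k" using arg_cong[OF IH, of "\<lambda>l. l ! k"] Suc.prems by (simp add: nth_append)
    have "w' (Suc k) = ?g ! Suc k"
    proof (cases "pro (nm (w' k))")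
      case True
      then have "w' (Suc k) = \<sigma> 0 (map w' [0..<Suc k])" using c0 own0[OF wl[of k], of 0] unfolding consistent_def by simp
      then show ?thesis using gs[OF Suc.prems] True unfolding IH wk by simp
    next
      case False
      then have "w' (Suc k) = \<tau> (map w' [0..<Suc k])" using c1 own0[OF wl[of k], of "Suc 0"] unfolding consistent_def by simp
      moreover have "length (take (Suc k) ?g) = Suc k" using Suc.prems by simp
      ultimately show ?thesis using Suc.prems unfolding IH \<tau>_def by (simp del: take_append append_take_drop_id)
    qed
    then have "map w' [0..<Suc (Suc k)] = take (Suc k) ?g @ [?g ! Suc k]" using IH by simp
    also have "\<dots> = take (Suc (Suc k)) ?g" using take_Suc_conv_app_nth[OF Suc.prems] by simp
    finally show ?case .
  qed
  have all: "map w' [0..<Suc (length g)] = g @ [u]" using pre[of "length g"] by simp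
  have g': "map w' [0..<length g] = g" and u': "w' (length g) = u" using all by simp_all
  have lt: "sk (nm (w' k)) = 0" if "k < length g" for k
  proof -
    have "w' k = g ! k" using arg_cong[OF g', of "\<lambda>l. l ! k"] that by simp
    then show ?thesis using g(3) that by simp
  qed
  have "pay G (Suc 0) w' = 2 + 2 * r"
  proof -
    have "map (\<lambda>k. nm (w' k)) [0..<length g] = map nm (map w' [0..<length g])" by (simp add: comp_def)
    then have "brk (map (\<lambda>k. nm (w' k)) [0..<length g]) r" unfolding g' using g(5) by simp
    then show ?thesis using pay_T(2)[OF ww, of "length g" r] lt g(4) u' by simp
  qed
  moreover have "r < R" using sk[OF nm_in[OF wl[of "length g"]]] u' g(4) by simp
  ultimately have "(pay G (Suc 0) ?w, pay G (Suc 0) w') \<in> pref G (Suc 0)"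
    unfolding pref1 prefs_T using odd by simp
  then show False using ne \<tau> unfolding nash_equilibrium_def pl w'_def by blast
qed

theorem reduction: "encode (inst T) \<in> constrained_NE_problem \<longleftrightarrow> \<not> Att (hd V) r0"
proof -
  have v: "valid_instance (inst T)" unfolding valid_inst using synt_T exact_T by blast
  have "encode (inst T) \<in> constrained_NE_problem \<longleftrightarrow>
      constrained_NE_exists G (start_vertex (inst T)) (\<lambda>i. thresholds (inst T) ! i)"
  proof
    assume "encode (inst T) \<in> constrained_NE_problem"
    then obtain X where "encode (inst T) = encode X" "constrained_NE_exists (game_of X) (start_vertex X) (\<lambda>i. thresholds X ! i)"
      unfolding constrained_NE_problem_def by blast
    moreover have "inst T = X" using injD[OF inj_encode calculation(1)] .
    ultimately show "constrained_NE_exists G (start_vertex (inst T)) (\<lambda>i. thresholds (inst T) ! i)" by blast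
  next
    assume "constrained_NE_exists G (start_vertex (inst T)) (\<lambda>i. thresholds (inst T) ! i)"
    then show "encode (inst T) \<in> constrained_NE_problem"
      unfolding constrained_NE_problem_def using v by blast
  qed
  moreover have "hd V = nm 0" using V by (simp add: nm_def hd_conv_nth)
  ultimately show ?thesis using NE_if_not_Att not_Att_if_NE by auto
qed

end

section \<open>Arithmetic on registers\<close>

text \<open>Decrementing and incrementing both flip a bit exactly if the carry arrives, and differ
  in \<open>carry\<close> only. The carry into the lowest bit is \<open>True\<close>, the 1 to be
  subtracted or added.\<close>

definition new_bit :: "nat \<Rightarrow> bool \<Rightarrow> bool \<Rightarrow> bool" where
  "new_bit o' c b = (if o' = 3 then False else if o' = 1 then b else b \<noteq> c)"

definition carry :: "nat \<Rightarrow> bool \<Rightarrow> bool \<Rightarrow> bool" where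
  "carry o' c b = (c \<and> (if o' = 0 then \<not> b else b))"

text \<open>
  The operations \<open>0\<close>, \<open>1\<close>, \<open>2\<close>, \<open>3\<close> on a block of registers decrement it, leave it unchanged,
  increment it and set it to zero.  The first component is the carry, the second one tells
  whether the result is zero so far.
\<close>

primrec pst :: "nat \<Rightarrow> nat \<Rightarrow> (nat \<Rightarrow> bool) \<Rightarrow> nat \<Rightarrow> bool \<times> bool \<times> (nat \<Rightarrow> bool)" where
  "pst o' s \<rho> 0 = (True, True, \<rho>)"
| "pst o' s \<rho> (Suc j) = (case pst o' s \<rho> j of (c, z, \<rho>') \<Rightarrow>
     let b = \<rho> (s + j); n = new_bit o' c b in (carry o' c b, z \<and> \<not> n, \<rho>'(s + j := n)))"

primrec val :: "(nat \<Rightarrow> bool) \<Rightarrow> nat \<Rightarrow> nat \<Rightarrow> nat" where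
  "val \<rho> s 0 = 0"
| "val \<rho> s (Suc n) = val \<rho> s n + (if \<rho> (s + n) then 2 ^ n else 0)"

lemma val_lt: "val \<rho> s n < 2 ^ n"
  by (induction n) auto

lemma val_cong: "(\<And>j. j < n \<Longrightarrow> \<rho> (s + j) = \<rho>' (s + j)) \<Longrightarrow> val \<rho> s n = val \<rho>' s n"
  by (induction n) auto

lemma pst_other: "r < s \<or> s + j \<le> r \<Longrightarrow> snd (snd (pst o' s \<rho> j)) r = \<rho> r"
  by (induction j) (auto simp: Let_def split: prod.splits)

lemma pst_val:
  assumes "pst o' s \<rho> n = (c, z, \<rho>')"
  shows "z \<longleftrightarrow> val \<rho>' s n = 0"
    "o' = 0 \<Longrightarrow> val \<rho>' s n + 1 = val \<rho> s n + (if c then 2 ^ n else 0)"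
    "o' = 1 \<Longrightarrow> val \<rho>' s n = val \<rho> s n"
    "o' = 2 \<Longrightarrow> val \<rho>' s n + (if c then 2 ^ n else 0) = val \<rho> s n + 1"
    "o' = 3 \<Longrightarrow> val \<rho>' s n = 0"
proof -
  have "(z \<longleftrightarrow> val \<rho>' s n = 0) \<and> (o' = 0 \<longrightarrow> val \<rho>' s n + 1 = val \<rho> s n + (if c then 2 ^ n else 0)) \<and>
    (o' = 1 \<longrightarrow> val \<rho>' s n = val \<rho> s n) \<and> (o' = 2 \<longrightarrow> val \<rho>' s n + (if c then 2 ^ n else 0) = val \<rho> s n + 1) \<and>
    (o' = 3 \<longrightarrow> val \<rho>' s n = 0)"
    using assms
  proof (induction n arbitrary: c z \<rho>')
    case (Suc n)
    obtain c1 z1 \<rho>1 where 1: "pst o' s \<rho> n = (c1, z1, \<rho>1)" by (rule prod_cases3)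
    let ?b = "\<rho> (s + n)"
    let ?n = "new_bit o' c1 ?b"
    have 2: "c = carry o' c1 ?b" "z = (z1 \<and> \<not> ?n)" "\<rho>' = \<rho>1(s + n := ?n)"
      using Suc.prems 1 by (simp_all add: Let_def)
    have "val \<rho>' s n = val \<rho>1 s n" unfolding 2 by (rule val_cong) simp
    then have v: "val \<rho>' s (Suc n) = val \<rho>1 s n + (if ?n then 2 ^ n else 0)" unfolding 2 by simp
    note IH = Suc.IH[OF 1]
    have "z \<longleftrightarrow> val \<rho>' s (Suc n) = 0" unfolding v 2(2) using IH by simp
    moreover have "o' = 0 \<longrightarrow> val \<rho>' s (Suc n) + 1 = val \<rho> s (Suc n) + (if c then 2 ^ Suc n else 0)"
      unfolding v 2(1) using IH by (cases c1; cases ?b) (auto simp: new_bit_def carry_def)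
    moreover have "o' = 1 \<longrightarrow> val \<rho>' s (Suc n) = val \<rho> s (Suc n)"
      unfolding v using IH by (auto simp: new_bit_def)
    moreover have "o' = 2 \<longrightarrow> val \<rho>' s (Suc n) + (if c then 2 ^ Suc n else 0) = val \<rho> s (Suc n) + 1"
      unfolding v 2(1) using IH by (cases c1; cases ?b) (auto simp: new_bit_def carry_def)
    moreover have "o' = 3 \<longrightarrow> val \<rho>' s (Suc n) = 0"
      unfolding v using IH by (auto simp: new_bit_def)
    ultimately show ?case by blast
  qed simp
  then show "z \<longleftrightarrow> val \<rho>' s n = 0"
    "o' = 0 \<Longrightarrow> val \<rho>' s n + 1 = val \<rho> s n + (if c then 2 ^ n else 0)"
    "o' = 1 \<Longrightarrow> val \<rho>' s n = val \<rho> s n"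
    "o' = 2 \<Longrightarrow> val \<rho>' s n + (if c then 2 ^ n else 0) = val \<rho> s n + 1"
    "o' = 3 \<Longrightarrow> val \<rho>' s n = 0" by blast+
qed

text \<open>Operation \<open>o'\<close> adds \<open>o' - 1\<close>, so the code 0, 1 or 2 of a head
  move is itself the operation that turns a distance from the new head position into one from the
  old.\<close>

lemma pst_mod:
  assumes p: "pst o' s \<rho> n = (c, z, \<rho>')" and d: "int (val \<rho> s n) = d mod 2 ^ n" and o: "o' \<in> {0, 1, 2}"
  shows "int (val \<rho>' s n) = (d + (int o' - 1)) mod 2 ^ n"
proof -
  have b: "0 \<le> int (val \<rho>' s n)" "int (val \<rho>' s n) < 2 ^ n" using val_lt[of \<rho>' s n] by (simp_all flip: of_nat_less_iff)
  consider "o' = 0" | "o' = 1" | "o' = 2" using o by blast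
  then have "\<exists>q. int (val \<rho>' s n) = int (val \<rho> s n) + (int o' - 1) + q * 2 ^ n"
  proof cases
    case 1
    then have "int (val \<rho>' s n) + 1 = int (val \<rho> s n) + (if c then 2 ^ n else 0)"
      using arg_cong[OF pst_val(2)[OF p 1], of int] by (simp split: if_splits)
    then show ?thesis using 1 by (intro exI[of _ "if c then 1 else 0"]) auto
  next
    case 2 then show ?thesis using pst_val(3)[OF p 2] by (intro exI[of _ 0]) auto
  next
    case 3
    then have "int (val \<rho>' s n) + (if c then 2 ^ n else 0) = int (val \<rho> s n) + 1"
      using arg_cong[OF pst_val(4)[OF p 3], of int] by (simp split: if_splits)
    then show ?thesis using 3 by (intro exI[of _ "if c then - 1 else 0"]) auto
  qed
  then obtain q where "int (val \<rho>' s n) = int (val \<rho> s n) + (int o' - 1) + q * 2 ^ n" by blast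
  then have "int (val \<rho>' s n) mod 2 ^ n = (int (val \<rho> s n) + (int o' - 1)) mod 2 ^ n" by simp
  also have "\<dots> = (d + (int o' - 1)) mod 2 ^ n" unfolding d by (simp add: mod_add_left_eq)
  finally show ?thesis using b by simp
qed

section \<open>The game of a Turing machine\<close>

text \<open>
  An entry \<open>(q', ss, q, acts)\<close> says that the machine in state \<open>q'\<close> reading \<open>ss\<close> goes to state
  \<open>q\<close> and performs \<open>acts\<close>, with moves coded as \<open>0\<close>, \<open>1\<close>, \<open>2\<close>.  The prover claims that, at the
  time stored in the first \<open>m\<close> registers, the machine is in state \<open>q\<close> and tape \<open>i\<close> contains
  \<open>a\<close> at the distance from the head stored in the next \<open>m\<close> registers (modulo \<open>2 ^ m\<close>).
  Vertices are tuples of a kind, \<open>q\<close>, \<open>i\<close>, \<open>a\<close>, the index of an entry, a position in a block of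
  registers, and three bits.  The kinds are: \<open>0\<close> claim; \<open>1\<close> to \<open>4\<close> the prover announces the
  next bit while decrementing the time, testing it for zero, moving the distance, or
  resetting it; \<open>5\<close> to \<open>8\<close> the same with the bit announced; \<open>9\<close> sink; \<open>10\<close> the challenger
  chooses a claim about the previous configuration; \<open>11\<close> lost and \<open>12\<close> won by the prover;
  \<open>13\<close> start.
\<close>

type_synonym ent = "nat \<times> nat list \<times> nat \<times> (nat \<times> nat) list"
type_synonym node = "nat \<times> nat \<times> nat \<times> nat \<times> nat \<times> nat \<times> bool \<times> bool \<times> bool"

definition entry :: "ent list \<Rightarrow> nat \<Rightarrow> ent" where "entry D e = nthd (0, [], 0, []) D e"
definition src :: "ent \<Rightarrow> nat" where "src x = fst x"
definition reads :: "ent \<Rightarrow> nat \<Rightarrow> nat" where "reads x i = nthd 0 (fst (snd x)) i"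
definition tgt :: "ent \<Rightarrow> nat" where "tgt x = fst (snd (snd x))"
definition act :: "ent \<Rightarrow> nat \<Rightarrow> nat \<times> nat" where "act x i = nthd (0, 1) (snd (snd (snd x))) i"

definition lost :: node where "lost = (11, 0, 0, 0, 0, 0, False, False, False)"
definition won :: node where "won = (12, 0, 0, 0, 0, 0, False, False, False)"
definition start :: node where "start = (13, 0, 0, 0, 0, 0, False, False, False)"
definition sink :: "nat \<Rightarrow> node" where "sink r = (9, 0, 0, 0, 0, r, False, False, False)"
definition claim :: "nat \<Rightarrow> nat \<Rightarrow> nat \<Rightarrow> node" where "claim q i a = (0, q, i, a, 0, 0, False, False, False)"
definition pick :: "nat \<Rightarrow> nat \<Rightarrow> nat \<Rightarrow> nat \<Rightarrow> nat \<Rightarrow> nat \<Rightarrow> bool \<Rightarrow> bool \<Rightarrow> node" where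
  "pick kd q i a e j c z = (kd, q, i, a, e, j, c, z, False)"

definition op :: "ent list \<Rightarrow> nat \<Rightarrow> nat \<Rightarrow> nat \<Rightarrow> nat" where
  "op D kd i e = (if kd = 1 then 0 else if kd = 2 then 1 else if kd = 3 then snd (act (entry D e) i) else 3)"

definition blk :: "nat \<Rightarrow> nat \<Rightarrow> nat" where "blk m kd = (if kd \<le> 2 then 0 else m)"

text \<open>The exit of a pass over a block. A borrow out of the time means that there is no earlier
  configuration. If the distance from the previous head position is zero, the cell was just written,
  and the claimed content must be the written symbol.\<close>

definition fin :: "ent list \<Rightarrow> nat \<Rightarrow> nat \<Rightarrow> nat \<Rightarrow> nat \<Rightarrow> nat \<Rightarrow> bool \<Rightarrow> bool \<Rightarrow> node" where
  "fin D kd q i a e c z =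
     (if kd = 1 then if c then lost else pick 3 q i a e 0 True True
      else if kd = 2 then if z then won else lost
      else if kd = 3 then if z \<and> a \<noteq> fst (act (entry D e) i) then lost else (10, q, i, a, e, 0, False, z, False)
      else claim q i a)"

text \<open>The prover justifies a claim as initial, for \<open>q0\<close> and a blank at time zero,
  or by an entry leading to \<open>q\<close>; \<open>lost\<close> keeps the choice nonempty. At kind
  10 the challenger questions the old content of the cell, unless it was just overwritten, or one of
  the symbols read, at distance zero.\<close>

definition nsc :: "ent list \<Rightarrow> nat \<Rightarrow> nat \<Rightarrow> nat \<Rightarrow> nat \<Rightarrow> nat \<Rightarrow> node \<Rightarrow> node list" where
  "nsc D k A m q0 qa = (\<lambda>(kd, q, i, a, e, j, c, z, b).
     if kd = 0 then lost # (if q = q0 \<and> a = 0 then [pick 2 q i a e 0 True True] else []) @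
       map (\<lambda>e. pick 1 q i a e 0 True True) (filter (\<lambda>e. tgt (entry D e) = q) [0..<length D])
     else if kd \<le> 4 then
       if j < m then map (\<lambda>b. (kd + 4, q, i, a, e, j, c, z, b)) [False, True] else [fin D kd q i a e c z]
     else if kd \<le> 8 then
       if j < m then [pick (kd - 4) q i a e (Suc j) (carry (op D (kd - 4) i e) c b) (z \<and> \<not> new_bit (op D (kd - 4) i e) c b),
           sink (blk m (kd - 4) + j)]
       else [won]
     else if kd = 9 then [sink j]
     else if kd = 10 then (if z then [] else [claim (src (entry D e)) i a]) @
       map (\<lambda>i. pick 4 (src (entry D e)) i (reads (entry D e) i) e 0 True True) [0..<k]
     else if kd = 11 then [lost, sink 0]
     else if kd = 13 then map (claim qa 0) [0..<A]
     else [won])"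

definition npro :: "node \<Rightarrow> bool" where
  "npro x = (fst x \<le> 4 \<or> fst x = 12 \<or> fst x = 13)"

definition nck :: "nat \<Rightarrow> node \<Rightarrow> nat" where
  "nck m = (\<lambda>(kd, q, i, a, e, j, c, z, b). if 5 \<le> kd \<and> kd \<le> 8 \<and> j < m then Suc (blk m (kd - 4) + j)
     else if kd = 11 then 1 else 0)"

definition ncb :: "node \<Rightarrow> bool" where
  "ncb = (\<lambda>(kd, q, i, a, e, j, c, z, b). kd \<noteq> 11 \<and> b)"

definition ncn :: "ent list \<Rightarrow> node \<Rightarrow> bool" where
  "ncn D = (\<lambda>(kd, q, i, a, e, j, c, z, b). kd = 11 \<or> new_bit (op D (kd - 4) i e) c b)"

definition nsk :: "node \<Rightarrow> nat" where
  "nsk = (\<lambda>(kd, q, i, a, e, j, c, z, b). if kd = 9 then Suc j else 0)"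

definition bools :: "bool list" where "bools = [False, True]"

definition nodes :: "ent list \<Rightarrow> nat \<Rightarrow> nat \<Rightarrow> nat \<Rightarrow> nat \<Rightarrow> node list" where
  "nodes D k Q A m = start #
     concat (map (\<lambda>kd. concat (map (\<lambda>q. concat (map (\<lambda>i. concat (map (\<lambda>a. concat (map (\<lambda>e. concat (map (\<lambda>j.
     concat (map (\<lambda>c. concat (map (\<lambda>z. map (\<lambda>b. (kd, q, i, a, e, j, c, z, b)) bools)
       bools)) bools)) [0..<Suc (2 * m)])) [0..<length D])) [0..<A])) [0..<k])) [0..<Q])) [0..<14])"

lemma nodes_start: "nodes D k Q A m \<noteq> []" "hd (nodes D k Q A m) = start"
  by (simp_all add: nodes_def)

lemma set_nodes: "Q > 0 \<Longrightarrow> k > 0 \<Longrightarrow> A > 0 \<Longrightarrow> D \<noteq> [] \<Longrightarrow> (kd, q, i, a, e, j, c, z, b) \<in> set (nodes D k Q A m) \<longleftrightarrow>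
    kd < 14 \<and> q < Q \<and> i < k \<and> a < A \<and> e < length D \<and> j \<le> 2 * m"
proof -
  have b: "x \<in> set bools" for x by (cases x) (simp_all add: bools_def)
  assume "Q > 0" "k > 0" "A > 0" "D \<noteq> []"
  then show ?thesis unfolding nodes_def start_def
    by (auto simp: image_iff b less_Suc_eq_le simp del: upt_Suc)
qed

lemma ex_entry: "(\<exists>x \<in> set D. P x) \<longleftrightarrow> (\<exists>e < length D. P (entry D e))"
proof
  assume "\<exists>x \<in> set D. P x"
  then obtain x where x: "x \<in> set D" "P x" by blast
  then obtain e where "e < length D" "D ! e = x" by (auto simp: in_set_conv_nth)
  then show "\<exists>e < length D. P (entry D e)" using x(2) by (intro exI[of _ e]) (simp add: entry_def nthd)
next
  assume "\<exists>e < length D. P (entry D e)"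
  then obtain e where e: "e < length D" "P (entry D e)" by blast
  then have "entry D e \<in> set D" by (simp add: entry_def nthd)
  then show "\<exists>x \<in> set D. P x" using e(2) by (rule bexI[rotated])
qed

text \<open>Contents are addressed relative to the head, so no head position is stored and the
  symbols read are at distance zero. \<open>det\<close> speaks of every applicable entry, as the
  prover may name any of them.\<close>

locale tmgame =
  fixes D :: "ent list" and k Q A m q0 qa :: nat and st :: "nat \<Rightarrow> nat" and cell :: "nat \<Rightarrow> nat \<Rightarrow> int \<Rightarrow> nat"
  assumes k: "k > 0" and A: "A > 0" and q0: "q0 < Q" and qa: "qa < Q"
    and ents: "\<And>x. x \<in> set D \<Longrightarrow> src x < Q \<and> tgt x < Q \<and> (\<forall>i < k. reads x i < A \<and> fst (act x i) < A \<and> snd (act x i) < 3)"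
    and st_0: "st 0 = q0" and cell_0: "\<And>i d. i < k \<Longrightarrow> cell 0 i d = 0"
    and cell_lt: "\<And>t i d. i < k \<Longrightarrow> cell t i d < A"
    and st_Suc: "\<And>t. \<exists>x \<in> set D. src x = st t \<and> (\<forall>i < k. reads x i = cell t i 0)"
    and det: "\<And>t x. x \<in> set D \<Longrightarrow> src x = st t \<Longrightarrow> (\<And>i. i < k \<Longrightarrow> reads x i = cell t i 0) \<Longrightarrow>
       tgt x = st (Suc t) \<and> (\<forall>i < k. \<forall>d. cell (Suc t) i d =
         (if d + (int (snd (act x i)) - 1) = 0 then fst (act x i) else cell t i (d + (int (snd (act x i)) - 1))))"
begin

lemma D_ne: "D \<noteq> []" and Q_pos: "Q > 0"
  using st_Suc[of 0] q0 by auto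

lemma entry_in: "e < length D \<Longrightarrow> entry D e \<in> set D"
  by (simp add: entry_def nthd)

lemmas node_defs = lost_def won_def start_def sink_def claim_def pick_def
lemmas in_nodes = set_nodes[OF Q_pos k A D_ne]

sublocale reggame start "nodes D k Q A m" "nsc D k A m q0 qa" npro "nck m" ncb "ncn D" nsk "Suc (2 * m)" "\<lambda>r. r < m"
proof
  show "nodes D k Q A m \<noteq> []" by (rule nodes_start)
  fix x assume "x \<in> set (nodes D k Q A m)"
  moreover obtain kd q i a e j c z b where x: "x = (kd, q, i, a, e, j, c, z, b)" by (metis prod.exhaust)
  ultimately have h: "kd < 14" "q < Q" "i < k" "a < A" "e < length D" "j \<le> 2 * m" using in_nodes by auto
  note pos = Q_pos k A D_ne
  have dl: "0 < length D" using D_ne by simp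
  have e: "src (entry D e) < Q" "\<And>i. i < k \<Longrightarrow> reads (entry D e) i < A" using ents[OF entry_in[OF h(5)]] by blast+
  have sp: "{lost, won} \<subseteq> set (nodes D k Q A m)" "r \<le> 2 * m \<Longrightarrow> sink r \<in> set (nodes D k Q A m)"
    "q' < Q \<Longrightarrow> i' < k \<Longrightarrow> a' < A \<Longrightarrow> claim q' i' a' \<in> set (nodes D k Q A m)"
    "kd' < 14 \<Longrightarrow> q' < Q \<Longrightarrow> i' < k \<Longrightarrow> a' < A \<Longrightarrow> e' < length D \<Longrightarrow> j' \<le> 2 * m \<Longrightarrow>
      pick kd' q' i' a' e' j' c' z' \<in> set (nodes D k Q A m)" for r q' i' a' kd' e' j' c' z'
    using pos dl by (simp_all add: node_defs in_nodes)
  have fin: "fin D kd' q i a e c z \<in> set (nodes D k Q A m)" for kd' c z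
    using sp h by (auto simp: fin_def in_nodes)
  show "nsc D k A m q0 qa x \<noteq> [] \<and> set (nsc D k A m q0 qa x) \<subseteq> set (nodes D k Q A m)"
  proof -
    consider "kd = 0" | "1 \<le> kd" "kd \<le> 4" | "5 \<le> kd" "kd \<le> 8" | "kd = 9" | "kd = 10" | "kd = 11" | "kd = 13" | "kd = 12"
      using h(1) by linarith
    then show ?thesis
    proof cases
      case 1 then show ?thesis using sp(1) sp(4)[of _ q i a] h unfolding x by (auto simp: nsc_def)
    next
      case 2 then show ?thesis using fin h unfolding x by (simp add: nsc_def in_nodes)
    next
      case 3 then show ?thesis using sp h unfolding x by (simp add: nsc_def blk_def)
    next
      case 4 then show ?thesis using sp(2) h unfolding x by (simp add: nsc_def)
    next
      case 5 then show ?thesis using sp(3,4) e h k unfolding x by (auto simp: nsc_def)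
    next
      case 6 then show ?thesis using sp unfolding x by (simp add: nsc_def)
    next
      case 7 then show ?thesis using sp(3) A k qa unfolding x by (auto simp: nsc_def)
    next
      case 8 then show ?thesis using sp unfolding x by (simp add: nsc_def)
    qed
  qed
  fix r
  show "nck m x = Suc r \<Longrightarrow> \<not> npro x \<and> (\<exists>y \<in> set (nsc D k A m q0 qa x). nsk y = Suc r)"
    unfolding x nck_def npro_def nsc_def nsk_def by (auto simp: sink_def split: if_splits)
  show "nsk x = Suc r \<Longrightarrow> r < Suc (2 * m)"
    using h unfolding x nsk_def by (auto split: if_splits)
qed

lemma Att_iff: "Att x \<rho> \<longleftrightarrow> nsk x = 0 \<and> ((\<exists>r. nck m x = Suc r \<and> \<rho> r \<noteq> ncb x) \<or>
    (if npro x then \<forall>y \<in> set (nsc D k A m q0 qa x). Att y (nxt x \<rho>)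
     else \<exists>y \<in> set (nsc D k A m q0 qa x). Att y (nxt x \<rho>)))"
  by (subst Att.simps) (auto split: if_splits)

lemma nxt_same: "nck m x = 0 \<Longrightarrow> nxt x \<rho> = \<rho>"
  and nxt_upd: "nck m x = Suc r \<Longrightarrow> nxt x \<rho> = \<rho>(r := ncn D x)"
  by (auto simp: nxt_def fun_eq_iff)

lemma Att_sink: "\<not> Att (sink r) \<rho>"
  by (subst Att_iff) (simp add: sink_def nsk_def)

text \<open>\<open>won\<close> belongs to the prover and leads only to itself, so no finite
  derivation can put it into the attractor.\<close>

lemma Att_won: "\<not> Att won \<rho>"
proof -
  have "Att x \<rho> \<Longrightarrow> x \<noteq> won" for x
  proof (induction rule: Att.induct)
    case (caught x r \<rho>)
    then show ?case by (auto simp: won_def nck_def)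
  next
    case (prover x \<rho>)
    have "nsc D k A m q0 qa won = [won]" by (simp add: nsc_def won_def)
    then show ?case using prover.IH[of won] by auto
  next
    case (challenger x y \<rho>)
    then show ?case by (auto simp: won_def npro_def)
  qed
  then show ?thesis by blast
qed

text \<open>At \<open>lost\<close>, register 0 is claimed to be \<open>False\<close> and then set to
  \<open>True\<close>, so the claim is wrong at the second visit at the latest.\<close>

lemma Att_lost: "Att lost \<rho>"
proof -
  have 1: "Att lost \<rho>" if "\<rho> 0" for \<rho>
    by (rule caught[of _ 0]) (use that in \<open>simp_all add: lost_def nsk_def nck_def ncb_def\<close>)
  have "nxt lost \<rho> 0" by (subst nxt_upd[of _ 0]) (simp_all add: lost_def nck_def ncn_def)
  then have "Att lost (nxt lost \<rho>)" by (rule 1)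
  moreover have "nsk lost = 0" "\<not> npro lost" "lost \<in> set (nsc D k A m q0 qa lost)"
    by (simp_all add: lost_def nsk_def npro_def nsc_def)
  ultimately show ?thesis by (rule challenger[rotated 3])
qed

text \<open>Announcing the wrong bit leads into the attractor by \<open>caught\<close>, and after
  the true bit a bet on the sink fails. So the pass is in effect deterministic.\<close>

lemma Att_pick_step:
  assumes "1 \<le> kd" "kd \<le> 4" "j < m"
  shows "Att (pick kd q i a e j c z) \<rho> \<longleftrightarrow>
    (let b = \<rho> (blk m kd + j); o' = op D kd i e
     in Att (pick kd q i a e (Suc j) (carry o' c b) (z \<and> \<not> new_bit o' c b)) (\<rho>(blk m kd + j := new_bit o' c b)))"
proof -
  let ?C = "\<lambda>b. (kd + 4, q, i, a, e, j, c, z, b)"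
  have "nxt (pick kd q i a e j c z) \<rho> = \<rho>" using assms by (intro nxt_same) (simp add: nck_def pick_def)
  then have 1: "Att (pick kd q i a e j c z) \<rho> \<longleftrightarrow> Att (?C False) \<rho> \<and> Att (?C True) \<rho>"
    using assms by (subst Att_iff) (simp add: pick_def nsk_def nck_def npro_def nsc_def)
  have n: "nxt (?C b) \<rho> = \<rho>(blk m kd + j := new_bit (op D kd i e) c b)" for b
    using assms by (subst nxt_upd[of _ "blk m kd + j"]) (simp_all add: nck_def ncn_def)
  have 2: "Att (?C b) \<rho> \<longleftrightarrow> \<rho> (blk m kd + j) \<noteq> b \<or>
      Att (pick kd q i a e (Suc j) (carry (op D kd i e) c b) (z \<and> \<not> new_bit (op D kd i e) c b)) (\<rho>(blk m kd + j := new_bit (op D kd i e) c b))" for b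
  proof -
    have "nsc D k A m q0 qa (?C b) = [pick kd q i a e (Suc j) (carry (op D kd i e) c b) (z \<and> \<not> new_bit (op D kd i e) c b),
        sink (blk m kd + j)]" using assms by (simp add: nsc_def)
    moreover have "nck m (?C b) = Suc (blk m kd + j)" "nsk (?C b) = 0" "\<not> npro (?C b)" "ncb (?C b) = b"
      using assms by (simp_all add: nck_def nsk_def npro_def ncb_def)
    ultimately show ?thesis by (subst Att_iff) (simp add: Att_sink n)
  qed
  show ?thesis unfolding 1 2 Let_def by (cases "\<rho> (blk m kd + j)") auto
qed

lemma Att_pass:
  assumes "1 \<le> kd" "kd \<le> 4" "pst (op D kd i e) (blk m kd) \<rho> m = (c, z, \<rho>')"
  shows "Att (pick kd q i a e 0 True True) \<rho> \<longleftrightarrow> Att (fin D kd q i a e c z) \<rho>'"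
proof -
  have "j \<le> m \<Longrightarrow> Att (pick kd q i a e 0 True True) \<rho> \<longleftrightarrow>
    (case pst (op D kd i e) (blk m kd) \<rho> j of (c, z, \<rho>') \<Rightarrow> Att (pick kd q i a e j c z) \<rho>')" for j
  proof (induction j)
    case (Suc j)
    obtain c z \<rho>' where p: "pst (op D kd i e) (blk m kd) \<rho> j = (c, z, \<rho>')" by (rule prod_cases3)
    have "\<rho>' (blk m kd + j) = \<rho> (blk m kd + j)" using pst_other[of "blk m kd + j" "blk m kd" j "op D kd i e" \<rho>] p by simp
    then show ?case using Suc p Att_pick_step[OF assms(1,2), of j q i a e c z \<rho>'] by (simp add: Let_def)
  qed simp
  from this[of m] have "Att (pick kd q i a e 0 True True) \<rho> \<longleftrightarrow> Att (pick kd q i a e m c z) \<rho>'"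
    using assms(3) by simp
  also have "nxt (pick kd q i a e m c z) \<rho>' = \<rho>'" using assms by (intro nxt_same) (simp add: nck_def pick_def)
  then have "Att (pick kd q i a e m c z) \<rho>' \<longleftrightarrow> Att (fin D kd q i a e c z) \<rho>'"
    using assms by (subst Att_iff) (simp add: pick_def nsk_def nck_def npro_def nsc_def)
  finally show ?thesis .
qed

lemma val_pst_other: "pst o' s \<rho> m = (c, z, \<rho>') \<Longrightarrow> s' + m \<le> s \<or> s + m \<le> s' \<Longrightarrow> val \<rho>' s' m = val \<rho> s' m"
  using pst_other[of _ s m o' \<rho>] by (intro val_cong) auto

text \<open>Induction on the time. One step back in time changes the distance by at most one, so
  \<open>\<bar>d\<bar> + int t < 2 ^ m\<close> is preserved; hence the residue kept in the registers
  is zero only if the distance itself is.\<close>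

lemma Att_claim:
  assumes "q < Q" "i < k" "a < A" "val \<rho> 0 m = t" "int (val \<rho> m m) = d mod 2 ^ m" "\<bar>d\<bar> + int t < 2 ^ m"
  shows "Att (claim q i a) \<rho> \<longleftrightarrow> \<not> (st t = q \<and> cell t i d = a)"
  using assms
proof (induction t arbitrary: q i a \<rho> d)
  have claim: "Att (claim q i a) \<rho> \<longleftrightarrow> (q = q0 \<and> a = 0 \<longrightarrow> val \<rho> 0 m \<noteq> 0) \<and>
      (\<forall>e < length D. tgt (entry D e) = q \<longrightarrow> Att (pick 1 q i a e 0 True True) \<rho>)" for q i a \<rho>
  proof -
    obtain c z \<rho>' where p: "pst (op D 2 i 0) (blk m 2) \<rho> m = (c, z, \<rho>')" by (rule prod_cases3)
    then have "z \<longleftrightarrow> val \<rho> 0 m = 0" using pst_val(1,3)[OF p] by (simp add: op_def blk_def)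
    then have 1: "Att (pick 2 q i a 0 0 True True) \<rho> \<longleftrightarrow> val \<rho> 0 m \<noteq> 0"
      using Att_pass[OF _ _ p, of q a] Att_won Att_lost by (simp add: fin_def)
    have "nxt (claim q i a) \<rho> = \<rho>" by (intro nxt_same) (simp add: nck_def claim_def)
    then show ?thesis using Att_lost 1
      by (subst Att_iff) (auto simp: claim_def nsk_def nck_def npro_def nsc_def)
  qed
  {
    case (0 q i a \<rho> d)
    have "Att (pick 1 q i a e 0 True True) \<rho>" for e
    proof -
      obtain c z \<rho>' where p: "pst (op D 1 i e) (blk m 1) \<rho> m = (c, z, \<rho>')" by (rule prod_cases3)
      have "c" using pst_val(2)[OF p] 0(4) by (auto simp: op_def blk_def split: if_splits)
      then show ?thesis using Att_pass[OF _ _ p, of q a] Att_lost by (simp add: fin_def)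
    qed
    then show ?case unfolding claim using 0 st_0 cell_0 by auto
  next
    case (Suc t q i a \<rho> d)
    have pick: "\<not> Att (pick 1 q i a e 0 True True) \<rho> \<longleftrightarrow> (let x = entry D e; d' = d + (int (snd (act x i)) - 1) in
        src x = st t \<and> (\<forall>i' < k. reads x i' = cell t i' 0) \<and> (if d' = 0 then fst (act x i) else cell t i d') = a)"
      if e: "e < length D" for e
    proof -
      let ?x = "entry D e"
      define d' where "d' = d + (int (snd (act ?x i)) - 1)"
      obtain c1 z1 \<rho>1 where p1: "pst (op D 1 i e) (blk m 1) \<rho> m = (c1, z1, \<rho>1)" by (rule prod_cases3)
      have "val \<rho>1 0 m + 1 = Suc t + (if c1 then 2 ^ m else 0)"
        using pst_val(2)[OF p1] Suc.prems(4) by (simp add: op_def blk_def)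
      \<comment> \<open>A borrow would make the new value at least \<open>2 ^ m\<close>.\<close>
      then have c1: "\<not> c1" and t1: "val \<rho>1 0 m = t" using val_lt[of \<rho>1 0 m] by (auto split: if_splits)
      have d1: "int (val \<rho>1 m m) = d mod 2 ^ m"
        using val_pst_other[OF p1, of m] Suc.prems(5) by (simp add: blk_def)
      have a1: "Att (pick 1 q i a e 0 True True) \<rho> \<longleftrightarrow> Att (pick 3 q i a e 0 True True) \<rho>1"
        using Att_pass[OF _ _ p1, of q a] c1 by (simp add: fin_def)
      have x: "src ?x < Q" "\<And>i. i < k \<Longrightarrow> reads ?x i < A" "snd (act ?x i) < 3"
        using ents[OF entry_in[OF e]] Suc.prems(2) by blast+
      obtain c2 z2 \<rho>2 where p2: "pst (op D 3 i e) (blk m 3) \<rho>1 m = (c2, z2, \<rho>2)" by (rule prod_cases3)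
      have p2': "pst (snd (act ?x i)) m \<rho>1 m = (c2, z2, \<rho>2)" using p2 by (simp add: op_def blk_def)
      have t2: "val \<rho>2 0 m = t" using val_pst_other[OF p2', of 0] t1 by simp
      have d2: "int (val \<rho>2 m m) = d' mod 2 ^ m" unfolding d'_def
        by (rule pst_mod[OF p2' d1]) (use x(3) in auto)
      have ab: "\<bar>d'\<bar> + int t < 2 ^ m" using Suc.prems(6) x(3) unfolding d'_def by auto
      have z2: "z2 \<longleftrightarrow> d' = 0"
      proof -
        have "z2 \<longleftrightarrow> d' mod 2 ^ m = 0" using pst_val(1)[OF p2'] d2 by (metis of_nat_eq_0_iff)
        also have "\<dots> \<longleftrightarrow> d' = 0"
        proof
          assume "d' mod 2 ^ m = 0"
          then have "2 ^ m dvd d'" by presburger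
          then show "d' = 0" using ab zdvd_not_zless[of "\<bar>d'\<bar>" "2 ^ m"] by fastforce
        qed simp
        finally show ?thesis .
      qed
      have pos: "0 < (2 :: int) ^ m - int t" using ab by linarith
      have a3: "Att (pick 4 (src ?x) i' (reads ?x i') e 0 True True) \<rho>2 \<longleftrightarrow> \<not> (st t = src ?x \<and> cell t i' 0 = reads ?x i')"
        if i': "i' < k" for i'
      proof -
        obtain c3 z3 \<rho>3 where p3: "pst (op D 4 i' e) (blk m 4) \<rho>2 m = (c3, z3, \<rho>3)" by (rule prod_cases3)
        have p3': "pst 3 m \<rho>2 m = (c3, z3, \<rho>3)" using p3 by (simp add: op_def blk_def)
        have "Att (pick 4 (src ?x) i' (reads ?x i') e 0 True True) \<rho>2 \<longleftrightarrow> Att (claim (src ?x) i' (reads ?x i')) \<rho>3"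
          using Att_pass[OF _ _ p3] by (simp add: fin_def)
        also have "\<dots> \<longleftrightarrow> \<not> (st t = src ?x \<and> cell t i' 0 = reads ?x i')"
          by (rule Suc.IH[OF x(1) i' x(2)[OF i']])
            (use val_pst_other[OF p3', of 0] t2 pst_val(5)[OF p3'] pos in auto)
        finally show ?thesis .
      qed
      let ?ch = "(10, q, i, a, e, 0, False, z2, False)"
      have "nxt ?ch \<rho>2 = \<rho>2" by (intro nxt_same) (simp add: nck_def)
      then have "Att ?ch \<rho>2 \<longleftrightarrow> (\<not> z2 \<and> Att (claim (src ?x) i a) \<rho>2) \<or>
          (\<exists>i' < k. Att (pick 4 (src ?x) i' (reads ?x i') e 0 True True) \<rho>2)"
        by (subst Att_iff) (auto simp: nsk_def nck_def npro_def nsc_def)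
      also have "Att (claim (src ?x) i a) \<rho>2 \<longleftrightarrow> \<not> (st t = src ?x \<and> cell t i d' = a)"
        by (rule Suc.IH[OF x(1) Suc.prems(2,3) t2 d2 ab])
      finally have ch: "Att ?ch \<rho>2 \<longleftrightarrow> (\<not> z2 \<and> \<not> (st t = src ?x \<and> cell t i d' = a)) \<or>
          (\<exists>i' < k. \<not> (st t = src ?x \<and> cell t i' 0 = reads ?x i'))" using a3 by blast
      have "Att (pick 3 q i a e 0 True True) \<rho>1 \<longleftrightarrow> (z2 \<and> a \<noteq> fst (act ?x i)) \<or> Att ?ch \<rho>2"
        using Att_pass[OF _ _ p2, of q a] Att_lost by (auto simp: fin_def)
      then show ?thesis unfolding a1 ch unfolding z2 Let_def d'_def[symmetric] using k by auto
    qed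
    have "\<not> Att (claim q i a) \<rho> \<longleftrightarrow> (\<exists>x \<in> set D. tgt x = q \<and> src x = st t \<and> (\<forall>i' < k. reads x i' = cell t i' 0) \<and>
       (if d + (int (snd (act x i)) - 1) = 0 then fst (act x i) else cell t i (d + (int (snd (act x i)) - 1))) = a)"
      (is "_ \<longleftrightarrow> ?E")
    proof -
      have "\<not> Att (claim q i a) \<rho> \<longleftrightarrow> (\<exists>e < length D. tgt (entry D e) = q \<and> \<not> Att (pick 1 q i a e 0 True True) \<rho>)"
        unfolding claim using Suc.prems(4) by simp
      also have "\<dots> \<longleftrightarrow> ?E"
      proof -
        show ?thesis unfolding ex_entry
          by (rule ex_cong1, rule conj_cong[OF refl], rule conj_cong[OF refl], rule pick[unfolded Let_def])
      qed
      finally show ?thesis .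
    qed
    also have "\<dots> \<longleftrightarrow> st (Suc t) = q \<and> cell (Suc t) i d = a"
    proof
      assume ?E
      then obtain x where x: "x \<in> set D" "tgt x = q" "src x = st t" "\<And>i'. i' < k \<Longrightarrow> reads x i' = cell t i' 0"
        "(if d + (int (snd (act x i)) - 1) = 0 then fst (act x i) else cell t i (d + (int (snd (act x i)) - 1))) = a" by blast
      show "st (Suc t) = q \<and> cell (Suc t) i d = a" using det[OF x(1,3,4)] x(2,5) Suc.prems(2) by simp
    next
      assume h: "st (Suc t) = q \<and> cell (Suc t) i d = a"
      obtain x where x: "x \<in> set D" "src x = st t" "\<And>i. i < k \<Longrightarrow> reads x i = cell t i 0" using st_Suc[of t] by blast
      show ?E using det[OF x] h x Suc.prems(2) by (intro bexI[OF _ x(1)]) simp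
    qed
    finally show ?case by blast
  }
qed

text \<open>Initially the time registers are all \<open>True\<close>, which stands for
  \<open>2 ^ m - 1\<close>, and the distance is zero. The prover may choose the symbol under the
  first head, so that only the state is at stake.\<close>

theorem accepts: "encode (inst T) \<in> constrained_NE_problem \<longleftrightarrow> st (2 ^ m - 1) = qa"
proof -
  let ?r = "\<lambda>r. r < m"
  have v: "j \<le> m \<Longrightarrow> val ?r 0 j = 2 ^ j - 1" for j
  proof (induction j)
    case (Suc j)
    have "(1 :: nat) \<le> 2 ^ j" by simp
    then show ?case using Suc by simp
  qed simp
  have v': "val ?r m j = 0" for j by (induction j) simp_all
  have "Att (claim qa 0 a) ?r \<longleftrightarrow> \<not> (st (2 ^ m - 1) = qa \<and> cell (2 ^ m - 1) 0 0 = a)" if "a < A" for a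
    by (rule Att_claim[OF qa k that]) (use v v' in \<open>auto simp: of_nat_diff\<close>)
  moreover have "nxt start ?r = ?r" by (intro nxt_same) (simp add: nck_def start_def)
  then have "Att start ?r \<longleftrightarrow> (\<forall>a < A. Att (claim qa 0 a) ?r)"
    by (subst Att_iff) (auto simp: start_def nsk_def nck_def npro_def nsc_def)
  ultimately show ?thesis unfolding reduction nodes_start(2) using cell_lt[OF k] by auto
qed

end

section \<open>Hardness\<close>

fun dcode :: "direction \<Rightarrow> nat" where
  "dcode Move_Left = 0" | "dcode Stay = 1" | "dcode Move_Right = 2"

lemma dcode: "int (dcode d) - 1 = offset d" "dcode d < 3"
  by (cases d; simp)+

definition xsym :: "bool list \<Rightarrow> nat \<Rightarrow> nat" where
  "xsym x j = nthd 0 (map (\<lambda>b. if b then 2 else 1) x) j"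

lemma xsym: "xsym x j = string_contents x (int j)"
  by (auto simp: xsym_def string_contents_def nthd)

text \<open>
  The machine is started on empty tapes.  In the additional states \<open>num_states M + j\<close>, it writes
  the input from right to left.  Halting configurations are repeated.
\<close>

definition delta' :: "tm \<Rightarrow> bool list \<Rightarrow> nat \<Rightarrow> nat list \<Rightarrow> nat \<times> (nat \<times> direction) list" where
  "delta' M x q ss =
     (if q < num_states M then
        if q = accept_state M \<or> q = reject_state M then (q, map (\<lambda>s. (s, Stay)) ss) else transition M q ss
      else (if q = num_states M then start_state M else q - 1,
        (xsym x (q - num_states M), if q = num_states M then Stay else Move_Left) # map (\<lambda>s. (s, Stay)) (tl ss)))"

definition columns :: "tm \<Rightarrow> nat list list" where
  "columns M = List.n_lists (num_tapes M) [0..<num_symbols M]"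

text \<open>\<open>M\<close> is fixed, so \<open>columns M\<close> is a constant and only the
  writing states depend on \<open>x\<close>. The part for the states of \<open>M\<close> is formed
  with input \<open>[]\<close>, which makes it a constant of the reduction.\<close>

definition entries :: "tm \<Rightarrow> bool list \<Rightarrow> ent list" where
  "entries M x =
     concat (map (\<lambda>q. map (\<lambda>ss. (q, ss, fst (delta' M [] q ss), map (\<lambda>p. (fst p, dcode (snd p))) (snd (delta' M [] q ss))))
       (columns M)) [0..<num_states M]) @
     concat (map (\<lambda>j. map (\<lambda>ss. (num_states M + j, ss, if j = 0 then start_state M else num_states M + j - 1,
       (xsym x j, if j = 0 then 1 else 0) # map (\<lambda>s. (s, 1)) (tl ss))) (columns M)) [0..<Suc (length x)])"

definition tapes_ok :: "tm \<Rightarrow> tape list \<Rightarrow> bool" where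
  "tapes_ok M ts \<longleftrightarrow> length ts = num_tapes M \<and> (\<forall>i < num_tapes M. \<forall>p. fst (ts ! i) p < num_symbols M)"

definition stp :: "tm \<Rightarrow> bool list \<Rightarrow> config \<Rightarrow> config" where
  "stp M x cf = (fst (delta' M x (fst cf) (map read_tape (snd cf))),
     map2 act_tape (snd cf) (snd (delta' M x (fst cf) (map read_tape (snd cf)))))"

text \<open>On empty tapes every true claim at time zero is about a blank, at any distance. The
  first head starts just behind the space for the input, as writing proceeds down to cell 0.\<close>

definition blank_config :: "tm \<Rightarrow> bool list \<Rightarrow> config" where
  "blank_config M x = (num_states M + length x,
     (string_contents [], int (length x)) # replicate (num_tapes M - 1) (string_contents [], 0))"

definition reading_ok :: "tm \<Rightarrow> nat list \<Rightarrow> bool" where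
  "reading_ok M ss \<longleftrightarrow> length ss = num_tapes M \<and> set ss \<subseteq> {..<num_symbols M}"

locale machine_input =
  fixes M :: tm and x :: "bool list"
  assumes M: "wf_tm M"
begin

abbreviation "kk \<equiv> num_tapes M"
abbreviation "AA \<equiv> num_symbols M"
abbreviation "NN \<equiv> num_states M"
abbreviation "QQ \<equiv> num_states M + Suc (length x)"

lemma tm_pos: "kk > 0" "AA > 2" "start_state M < NN" "accept_state M < NN" "reject_state M < NN" "accept_state M \<noteq> reject_state M"
  using M unfolding wf_tm_def by auto

lemma columns: "ss \<in> set (columns M) \<longleftrightarrow> reading_ok M ss"
  unfolding columns_def reading_ok_def by (auto simp: set_n_lists)

lemma delta'_ok:
  assumes "q < QQ" "reading_ok M ss"
  shows "fst (delta' M x q ss) < QQ" "length (snd (delta' M x q ss)) = kk"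
    "i < kk \<Longrightarrow> fst (snd (delta' M x q ss) ! i) < AA"
    "q < NN \<Longrightarrow> fst (delta' M x q ss) < NN"
proof -
  have l: "length ss = kk" using assms(2) by (simp add: reading_ok_def)
  have ss: "length ss = kk" "\<And>i. i < kk \<Longrightarrow> ss ! i < AA"
    using l assms(2) unfolding reading_ok_def by (simp, metis lessThan_iff nth_mem subsetD)
  have xs: "xsym x j < AA" for j using tm_pos(2) by (auto simp: xsym string_contents_def)
  have "fst (delta' M x q ss) < QQ \<and> length (snd (delta' M x q ss)) = kk \<and>
    (\<forall>i < kk. fst (snd (delta' M x q ss) ! i) < AA) \<and> (q < NN \<longrightarrow> fst (delta' M x q ss) < NN)"
  proof (cases "q < NN")
    case True
    show ?thesis
    proof (cases "q = accept_state M \<or> q = reject_state M")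
      case h: True
      then show ?thesis using True ss by (simp add: delta'_def)
    next
      case False
      have "fst (transition M q ss) < NN \<and> length (snd (transition M q ss)) = kk \<and>
        (\<forall>(s, d) \<in> set (snd (transition M q ss)). s < AA)"
        using M True assms(2) unfolding wf_tm_def reading_ok_def by blast
      moreover from this have "fst (snd (transition M q ss) ! i) < AA" if "i < kk" for i
        using that nth_mem[of i "snd (transition M q ss)"] by (auto simp: case_prod_beta)
      ultimately show ?thesis using True False by (simp add: delta'_def)
    qed
  next
    case False
    have "fst (((xsym x (q - NN), if q = NN then Stay else Move_Left) # map (\<lambda>s. (s, Stay)) (tl ss)) ! i) < AA" if "i < kk" for i
      using that ss xs by (cases i) (auto simp: nth_tl)
    then show ?thesis using False ss(1) tm_pos(1,3) assms(1) by (auto simp: delta'_def)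
  qed
  then show "fst (delta' M x q ss) < QQ" "length (snd (delta' M x q ss)) = kk"
    "i < kk \<Longrightarrow> fst (snd (delta' M x q ss) ! i) < AA" "q < NN \<Longrightarrow> fst (delta' M x q ss) < NN" by blast+
qed

lemma entries: "e \<in> set (entries M x) \<longleftrightarrow> (\<exists>q < QQ. \<exists>ss. reading_ok M ss \<and>
    e = (q, ss, fst (delta' M x q ss), map (\<lambda>p. (fst p, dcode (snd p))) (snd (delta' M x q ss))))"
proof -
  let ?e = "\<lambda>q ss. (q, ss, fst (delta' M x q ss), map (\<lambda>p. (fst p, dcode (snd p))) (snd (delta' M x q ss)))"
  have 1: "(q, ss, fst (delta' M [] q ss), map (\<lambda>p. (fst p, dcode (snd p))) (snd (delta' M [] q ss))) = ?e q ss" if "q < NN" for q ss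
    using that by (simp add: delta'_def)
  have 2: "(NN + j, ss, if j = 0 then start_state M else NN + j - 1,
       (xsym x j, if j = 0 then 1 else 0) # map (\<lambda>s. (s, 1)) (tl ss)) = ?e (NN + j) ss" for j ss
    by (simp add: delta'_def)
  have "e \<in> set (entries M x) \<longleftrightarrow> (\<exists>q < NN. \<exists>ss \<in> set (columns M). e = ?e q ss) \<or> (\<exists>j < Suc (length x). \<exists>ss \<in> set (columns M). e = ?e (NN + j) ss)"
    unfolding entries_def 2 using 1 by (auto simp: image_iff simp del: upt_Suc)
  also have "\<dots> \<longleftrightarrow> (\<exists>q < QQ. \<exists>ss. reading_ok M ss \<and> e = ?e q ss)" (is "?l \<longleftrightarrow> ?r")
  proof
    assume ?l
    then show ?r
    proof
      assume "\<exists>q < NN. \<exists>ss \<in> set (columns M). e = ?e q ss"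
      then obtain q ss where q: "q < NN" "reading_ok M ss" "e = ?e q ss" unfolding columns[symmetric] by blast
      show ?r by (rule exI[of _ q], intro conjI, use q(1) in simp, rule exI[of _ ss], intro conjI q(2,3))
    next
      assume "\<exists>j < Suc (length x). \<exists>ss \<in> set (columns M). e = ?e (NN + j) ss"
      then obtain j ss where q: "j < Suc (length x)" "reading_ok M ss" "e = ?e (NN + j) ss" unfolding columns[symmetric] by blast
      show ?r by (rule exI[of _ "NN + j"], intro conjI, use q(1) in simp, rule exI[of _ ss], intro conjI q(2,3))
    qed
  next
    assume ?r
    then obtain q ss where q: "q < QQ" "reading_ok M ss" "e = ?e q ss" by blast
    show ?l
    proof (cases "q < NN")
      case False
      then have "q = NN + (q - NN)" "q - NN < Suc (length x)" using q(1) by simp_all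
      then have "\<exists>j < Suc (length x). q = NN + j" by blast
      then show ?thesis using q(2,3) unfolding columns[symmetric] by blast
    qed (use q(2,3) columns[symmetric] in blast)
  qed
  finally show ?thesis .
qed

lemma reading: "tapes_ok M ts \<Longrightarrow> reading_ok M (map read_tape ts)"
proof -
  have "read_tape t = fst t (snd t)" for t by (cases t) simp
  then show "tapes_ok M ts \<Longrightarrow> reading_ok M (map read_tape ts)"
    unfolding tapes_ok_def reading_ok_def by (auto simp: in_set_conv_nth) (metis fst_conv)
qed

lemma stp_ok:
  assumes "fst cf < QQ" "tapes_ok M (snd cf)"
  shows "fst (stp M x cf) < QQ" "tapes_ok M (snd (stp M x cf))"
    "i < kk \<Longrightarrow> snd (stp M x cf) ! i = act_tape (snd cf ! i) (snd (delta' M x (fst cf) (map read_tape (snd cf))) ! i)"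
proof -
  let ?a = "snd (delta' M x (fst cf) (map read_tape (snd cf)))"
  note dl = delta'_ok[OF assms(1) reading[OF assms(2)]]
  have l: "length (snd cf) = kk" using assms(2) by (simp add: tapes_ok_def)
  show "fst (stp M x cf) < QQ" using dl(1) by (simp add: stp_def)
  have n: "snd (stp M x cf) ! i = act_tape (snd cf ! i) (?a ! i)" if "i < kk" for i
    using that l dl(2) by (simp add: stp_def)
  then show "i < kk \<Longrightarrow> snd (stp M x cf) ! i = act_tape (snd cf ! i) (?a ! i)" .
  have "fst (act_tape (snd cf ! i) (?a ! i)) p < AA" if "i < kk" for i p
    using that dl(3)[OF that] assms(2) unfolding tapes_ok_def
    by (cases "snd cf ! i"; cases "?a ! i") (auto simp: fst_conv)
  then show "tapes_ok M (snd (stp M x cf))" unfolding tapes_ok_def using n l dl(2) by (simp add: stp_def)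
qed

definition cfg :: "nat \<Rightarrow> config" where "cfg t = (stp M x ^^ t) (blank_config M x)"
definition st :: "nat \<Rightarrow> nat" where "st t = fst (cfg t)"
definition cell :: "nat \<Rightarrow> nat \<Rightarrow> int \<Rightarrow> nat" where "cell t i d = fst (snd (cfg t) ! i) (snd (snd (cfg t) ! i) + d)"

lemma cfg_Suc: "cfg (Suc t) = stp M x (cfg t)"
  by (simp add: cfg_def)

lemma blank: "string_contents [] p = 0"
  by (simp add: string_contents_def)

lemma cfg_ok: "fst (cfg t) < QQ \<and> tapes_ok M (snd (cfg t))"
proof (induction t)
  case 0
  have "fst (((string_contents [], int (length x)) # replicate (kk - 1) (string_contents [], 0)) ! i) p < AA" if "i < kk" for i p
    using that tm_pos(2) by (cases i) (auto simp: blank)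
  then show ?case using tm_pos(1) by (simp add: cfg_def blank_config_def tapes_ok_def)
next
  case (Suc t)
  then show ?case using stp_ok unfolding cfg_Suc by blast
qed

lemma read_cell: "i < kk \<Longrightarrow> map read_tape (snd (cfg t)) ! i = cell t i 0"
  using cfg_ok[of t] by (cases "snd (cfg t) ! i") (auto simp: tapes_ok_def cell_def)

lemma cell_Suc:
  fixes t :: nat
  assumes "i < kk"
  defines "a \<equiv> snd (delta' M x (st t) (map read_tape (snd (cfg t)))) ! i"
  shows "cell (Suc t) i d = (if d + offset (snd a) = 0 then fst a else cell t i (d + offset (snd a)))"
proof -
  have "snd (cfg (Suc t)) ! i = act_tape (snd (cfg t) ! i) a"
    unfolding cfg_Suc a_def st_def using stp_ok(3)[OF _ _ assms(1)] cfg_ok[of t] by blast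
  then show ?thesis unfolding cell_def
    by (cases "snd (cfg t) ! i"; cases a) (auto simp: algebra_simps)
qed

sublocale tmgame "entries M x" kk QQ AA m "NN + length x" "accept_state M" st cell for m
proof
  show "kk > 0" "AA > 0" "NN + length x < QQ" "accept_state M < QQ" using tm_pos by auto
next
  fix e assume "e \<in> set (entries M x)"
  then obtain q ss where e: "q < QQ" "reading_ok M ss"
    "e = (q, ss, fst (delta' M x q ss), map (\<lambda>p. (fst p, dcode (snd p))) (snd (delta' M x q ss)))"
    unfolding entries by blast
  note dl = delta'_ok[OF e(1,2)]
  have "ss ! i < AA" if "i < kk" for i using e(2) that unfolding reading_ok_def by (metis lessThan_iff nth_mem subsetD)
  then show "src e < QQ \<and> tgt e < QQ \<and> (\<forall>i < kk. reads e i < AA \<and> fst (act e i) < AA \<and> snd (act e i) < 3)"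
    using e(1,2) dl dcode(2) by (simp add: e(3) src_def tgt_def reads_def act_def nthd reading_ok_def)
next
  show "st 0 = NN + length x" by (simp add: st_def cfg_def blank_config_def)
  show "cell 0 i d = 0" if "i < kk" for i d
    using that by (cases i) (auto simp: cell_def cfg_def blank_config_def blank)
  show "cell t i d < AA" if "i < kk" for t i d
    using cfg_ok[of t] that unfolding cell_def tapes_ok_def by blast
next
  fix t
  let ?ss = "map read_tape (snd (cfg t))"
  have ss: "reading_ok M ?ss" using reading cfg_ok by blast
  then have l: "length ?ss = kk" by (simp add: reading_ok_def)
  have q: "st t < QQ" using cfg_ok by (simp add: st_def)
  let ?e = "(st t, ?ss, fst (delta' M x (st t) ?ss), map (\<lambda>p. (fst p, dcode (snd p))) (snd (delta' M x (st t) ?ss)))"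
  have "?e \<in> set (entries M x)" unfolding entries using ss q by blast
  moreover have "\<forall>i < kk. reads ?e i = cell t i 0" using read_cell l by (simp add: reads_def nthd del: length_map)
  ultimately show "\<exists>e \<in> set (entries M x). src e = st t \<and> (\<forall>i < kk. reads e i = cell t i 0)"
    by (intro bexI[of _ ?e]) (simp_all add: src_def)
  fix e assume e: "e \<in> set (entries M x)" "src e = st t" "\<And>i. i < kk \<Longrightarrow> reads e i = cell t i 0"
  then obtain ss' where e': "reading_ok M ss'"
    "e = (st t, ss', fst (delta' M x (st t) ss'), map (\<lambda>p. (fst p, dcode (snd p))) (snd (delta' M x (st t) ss')))"
    unfolding entries by (auto simp: src_def)
  have "ss' = ?ss"
  proof (rule nth_equalityI)
    show "length ss' = length ?ss" using e'(1) l by (simp add: reading_ok_def)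
    fix i assume "i < length ss'"
    then have "i < kk" "ss' ! i = reads e i" using e' by (simp_all add: reading_ok_def reads_def nthd)
    then show "ss' ! i = ?ss ! i" using e(3) read_cell by simp
  qed
  then have e'': "e = ?e" using e'(2) by simp
  have la: "length (snd (delta' M x (st t) ?ss)) = kk" by (rule delta'_ok(2)[OF q ss])
  have "tgt e = st (Suc t)" unfolding e'' by (simp add: tgt_def st_def cfg_Suc stp_def)
  moreover have "cell (Suc t) i d = (if d + (int (snd (act e i)) - 1) = 0 then fst (act e i)
      else cell t i (d + (int (snd (act e i)) - 1)))" if "i < kk" for i d
  proof -
    let ?a = "snd (delta' M x (st t) ?ss) ! i"
    have "act e i = (fst ?a, dcode (snd ?a))" using that la unfolding e'' by (simp add: act_def nthd)
    then show ?thesis unfolding cell_Suc[OF that] by (simp add: dcode(1))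
  qed
  ultimately show "tgt e = st (Suc t) \<and> (\<forall>i < kk. \<forall>d. cell (Suc t) i d =
      (if d + (int (snd (act e i)) - 1) = 0 then fst (act e i) else cell t i (d + (int (snd (act e i)) - 1))))" by blast
qed

section \<open>The extended machine simulates \<open>M\<close>\<close>

lemma act_stay: "map2 act_tape ts (map (\<lambda>s. (s, Stay)) (map read_tape ts)) = ts"
  by (induction ts) auto

lemma write_step: "stp M x (NN + Suc r, (f, h) # replicate (kk - 1) (string_contents [], 0)) =
    (NN + r, (f(h := xsym x (Suc r)), h - 1) # replicate (kk - 1) (string_contents [], 0))"
  using act_stay[of "replicate (kk - 1) (string_contents [], 0)"] by (simp add: stp_def delta'_def)

lemma writing:
  "t \<le> length x \<Longrightarrow> cfg t = (NN + (length x - t),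
     (\<lambda>p. if int (length x - t) < p then string_contents x p else 0, int (length x - t)) #
       replicate (kk - 1) (string_contents [], 0))"
proof (induction t)
  case 0
  have "string_contents [] = (\<lambda>p. if int (length x) < p then string_contents x p else 0)"
    by (rule ext) (simp add: string_contents_def, linarith)
  then show ?case by (simp add: cfg_def blank_config_def)
next
  case (Suc t)
  let ?j = "length x - t"
  have j: "?j = Suc (length x - Suc t)" using Suc.prems by simp
  have f: "(\<lambda>p. if int ?j < p then string_contents x p else 0)(int ?j := xsym x ?j) =
      (\<lambda>p. if int (length x - Suc t) < p then string_contents x p else 0)"
    unfolding xsym using j by (auto simp: fun_eq_iff)
  have "cfg (Suc t) = stp M x (NN + ?j, (\<lambda>p. if int ?j < p then string_contents x p else 0, int ?j) #
       replicate (kk - 1) (string_contents [], 0))" using Suc unfolding cfg_Suc by simp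
  also have "\<dots> = (NN + ?j - 1, ((\<lambda>p. if int ?j < p then string_contents x p else 0)(int ?j := xsym x ?j), int ?j - 1) #
       replicate (kk - 1) (string_contents [], 0))"
    using write_step[of "length x - Suc t"] unfolding j by simp
  also have "\<dots> = (NN + (length x - Suc t),
     (\<lambda>p. if int (length x - Suc t) < p then string_contents x p else 0, int (length x - Suc t)) #
       replicate (kk - 1) (string_contents [], 0))" unfolding f using j by simp
  finally show ?case .
qed

lemma written: "cfg (Suc (length x)) = init_config M x"
proof -
  have f: "(\<lambda>p. if 0 < p then string_contents x p else 0)(0 := xsym x 0) = string_contents x"
    unfolding xsym by (auto simp: fun_eq_iff string_contents_def)
  have "cfg (Suc (length x)) = stp M x (NN, (\<lambda>p. if 0 < p then string_contents x p else 0, 0) #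
       replicate (kk - 1) (string_contents [], 0))" unfolding cfg_Suc using writing[of "length x"] by simp
  also have "\<dots> = (start_state M, ((\<lambda>p. if 0 < p then string_contents x p else 0)(0 := xsym x 0), 0) #
       replicate (kk - 1) (string_contents [], 0))"
    using act_stay[of "replicate (kk - 1) (string_contents [], 0)"] by (simp add: stp_def delta'_def)
  finally show ?thesis unfolding f init_config_def .
qed

lemma stp_step: "fst cf < NN \<Longrightarrow> stp M x cf = step M cf"
proof -
  assume q: "fst cf < NN"
  show "stp M x cf = step M cf"
  proof (cases "halting M cf")
    case True
    then show ?thesis using q act_stay[of "snd cf"] by (auto simp: stp_def step_def delta'_def halting_def)
  next
    case False
    then show ?thesis using q by (auto simp: stp_def step_def delta'_def halting_def Let_def case_prod_beta)
  qed
qed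

lemma simulates: "cfg (Suc (length x) + t) = (step M ^^ t) (init_config M x) \<and> fst (cfg (Suc (length x) + t)) < NN"
proof (induction t)
  case 0 then show ?case using written tm_pos(3) by (simp add: init_config_def)
next
  case (Suc t)
  let ?c = "cfg (Suc (length x) + t)"
  have "cfg (Suc (length x) + Suc t) = stp M x ?c" using cfg_Suc by simp
  moreover have "fst (stp M x ?c) < NN" unfolding stp_def fst_conv
    by (rule delta'_ok(4)[OF _ reading]) (use Suc cfg_ok in blast)+
  moreover have "stp M x ?c = step M ?c" by (rule stp_step) (use Suc in blast)
  moreover have "step M ?c = (step M ^^ Suc t) (init_config M x)" using Suc by simp
  ultimately show ?case by metis
qed

lemma step_halting: "halting M cf \<Longrightarrow> (step M ^^ t) cf = cf"
  by (induction t) (auto simp: step_def)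

text \<open>Halting configurations repeat, so the verdict can be inspected at any late enough time,
  in particular at the one the registers start with.\<close>

lemma accepting_state:
  assumes "fst ((step M ^^ t) (init_config M x)) = (if x \<in> L then accept_state M else reject_state M)"
    "Suc (length x) + t \<le> u"
  shows "st u = accept_state M \<longleftrightarrow> x \<in> L"
proof -
  obtain v where u: "u = Suc (length x) + (v + t)" using assms(2) by (metis add.commute add.left_commute le_Suc_ex)
  let ?c = "(step M ^^ t) (init_config M x)"
  have "halting M ?c" using assms(1) by (simp add: halting_def split: if_splits)
  then have "(step M ^^ (v + t)) (init_config M x) = ?c" by (simp add: funpow_add step_halting)
  then have "st u = fst ?c" unfolding st_def u using simulates[of "v + t"] by simp
  then show ?thesis using assms(1) tm_pos(6) by (simp split: if_splits)
qed

end

text \<open>\<open>length x ^ k + c\<close> covers the running time; the rest covers the steps that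
  write the input and the \<open>- 1\<close> in the initial time.\<close>

definition game_size :: "nat \<Rightarrow> nat \<Rightarrow> bool list \<Rightarrow> nat" where
  "game_size k c x = length x ^ k + c + length x + 2"

definition tm_inst :: "tm \<Rightarrow> nat \<Rightarrow> nat \<Rightarrow> bool list \<Rightarrow> tinst" where
  "tm_inst M k c x = (let D = entries M x; m = game_size k c x; q0 = num_states M + length x in
     mkT start (nodes D (num_tapes M) (num_states M + Suc (length x)) (num_symbols M) m)
       (nsc D (num_tapes M) (num_symbols M) m q0 (accept_state M)) npro (nck m) ncb (ncn D) nsk (Suc (2 * m)) (\<lambda>r. r < m))"

section \<open>Polynomial time of the reduction\<close>

lemma fp_mkT:
  fixes V :: "'e :: cod \<Rightarrow> 'n :: cod list"
  assumes V: "fp V" and R: "fp R" and f: "fp (\<lambda>p. sc (fst p) (snd p))" "fp (\<lambda>p. pro (fst p) (snd p))"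
    "fp (\<lambda>p. ck (fst p) (snd p))" "fp (\<lambda>p. cb (fst p) (snd p))" "fp (\<lambda>p. cn (fst p) (snd p))"
    "fp (\<lambda>p. sk (fst p) (snd p))" "fp (\<lambda>p. r0 (fst p) (snd p))"
  shows "fp (\<lambda>e. mkT d (V e) (sc e) (pro e) (ck e) (cb e) (cn e) (sk e) (R e) (r0 e))"
proof -
  note [fp_intros] = fp_comp[OF V] fp_comp[OF R] fp_bin[of sc, OF f(1)] fp_bin[of pro, OF f(2)] fp_bin[of ck, OF f(3)]
    fp_bin[of cb, OF f(4)] fp_bin[of cn, OF f(5)] fp_bin[of sk, OF f(6)] fp_bin[of r0, OF f(7)]
  have e: "map (pay_step a b c d p q) W = map (\<lambda>y. pay_step a b c d p q y) W"
    "map (pay_tab a b c d r W) P = map (\<lambda>p. pay_tab a b c d r W p) P" for a b c d p q W r P by (rule refl)+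
  show ?thesis unfolding mkT_def pay_tab_def pay_step_def pay_prio_def pay_reg_def
    by (intro fp_intros)
qed

lemma fp_entry [fp_intros]: "fp D \<Longrightarrow> fp e \<Longrightarrow> fp (\<lambda>x. entry (D x) (e x))"
  unfolding entry_def by (intro fp_intros)
lemma fp_src [fp_intros]: "fp e \<Longrightarrow> fp (\<lambda>x. src (e x))" unfolding src_def by (intro fp_intros)
lemma fp_tgt [fp_intros]: "fp e \<Longrightarrow> fp (\<lambda>x. tgt (e x))" unfolding tgt_def by (intro fp_intros)
lemma fp_reads [fp_intros]: "fp e \<Longrightarrow> fp i \<Longrightarrow> fp (\<lambda>x. reads (e x) (i x))" unfolding reads_def by (intro fp_intros)
lemma fp_act [fp_intros]: "fp e \<Longrightarrow> fp i \<Longrightarrow> fp (\<lambda>x. act (e x) (i x))" unfolding act_def by (intro fp_intros)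

lemma fp_xsym [fp_intros]: "fp x \<Longrightarrow> fp j \<Longrightarrow> fp (\<lambda>e. xsym (x e) (j e))"
  unfolding xsym_def by (intro fp_intros)

lemma fp_entries: "fp (\<lambda>x. entries M x)"
  unfolding entries_def by (intro fp_intros)
lemmas fp_entries' [fp_intros] = fp_comp[OF fp_entries]

lemma fp_game_size [fp_intros]: "fp x \<Longrightarrow> fp (\<lambda>e. game_size k c (x e))"
  unfolding game_size_def by (intro fp_intros)

lemma fp_new_bit [fp_intros]: "fp f \<Longrightarrow> fp g \<Longrightarrow> fp h \<Longrightarrow> fp (\<lambda>x. new_bit (f x) (g x) (h x))"
  unfolding new_bit_def by (intro fp_intros)
lemma fp_carry [fp_intros]: "fp f \<Longrightarrow> fp g \<Longrightarrow> fp h \<Longrightarrow> fp (\<lambda>x. carry (f x) (g x) (h x))"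
  unfolding carry_def by (intro fp_intros)
lemma fp_op [fp_intros]: "fp D \<Longrightarrow> fp f \<Longrightarrow> fp g \<Longrightarrow> fp h \<Longrightarrow> fp (\<lambda>x. op (D x) (f x) (g x) (h x))"
  unfolding op_def by (intro fp_intros)
lemma fp_blk [fp_intros]: "fp f \<Longrightarrow> fp g \<Longrightarrow> fp (\<lambda>x. blk (f x) (g x))"
  unfolding blk_def by (intro fp_intros)
lemma fp_sink [fp_intros]: "fp f \<Longrightarrow> fp (\<lambda>x. sink (f x))"
  unfolding sink_def by (intro fp_intros)
lemma fp_claim [fp_intros]: "fp f \<Longrightarrow> fp g \<Longrightarrow> fp h \<Longrightarrow> fp (\<lambda>x. claim (f x) (g x) (h x))"
  unfolding claim_def by (intro fp_intros)
lemma fp_pick [fp_intros]: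
  "fp f1 \<Longrightarrow> fp f2 \<Longrightarrow> fp f3 \<Longrightarrow> fp f4 \<Longrightarrow> fp f5 \<Longrightarrow> fp f6 \<Longrightarrow> fp f7 \<Longrightarrow> fp f8 \<Longrightarrow>
    fp (\<lambda>x. pick (f1 x) (f2 x) (f3 x) (f4 x) (f5 x) (f6 x) (f7 x) (f8 x))"
  unfolding pick_def by (intro fp_intros)
lemma fp_fin [fp_intros]:
  "fp D \<Longrightarrow> fp f1 \<Longrightarrow> fp f2 \<Longrightarrow> fp f3 \<Longrightarrow> fp f4 \<Longrightarrow> fp f5 \<Longrightarrow> fp f6 \<Longrightarrow> fp f7 \<Longrightarrow>
    fp (\<lambda>x. fin (D x) (f1 x) (f2 x) (f3 x) (f4 x) (f5 x) (f6 x) (f7 x))"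
  unfolding fin_def by (intro fp_intros)

lemma fp_nsc0: "fp (\<lambda>p. nsc (fst p) k A (fst (snd p)) (fst (snd (snd p))) qa (snd (snd (snd p))))"
  unfolding nsc_def by (intro fp_intros)
lemmas fp_nsc [fp_intros] = fp_quad[of "\<lambda>D m q0 x. nsc D k A m q0 qa x" for k A qa, OF fp_nsc0]
lemma fp_npro [fp_intros]: "fp x \<Longrightarrow> fp (\<lambda>e. npro (x e))"
  unfolding npro_def by (intro fp_intros)
lemma fp_nck [fp_intros]: "fp m \<Longrightarrow> fp x \<Longrightarrow> fp (\<lambda>e. nck (m e) (x e))"
  unfolding nck_def by (intro fp_intros)
lemma fp_ncb [fp_intros]: "fp x \<Longrightarrow> fp (\<lambda>e. ncb (x e))"
  unfolding ncb_def by (intro fp_intros)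
lemma fp_ncn [fp_intros]: "fp D \<Longrightarrow> fp x \<Longrightarrow> fp (\<lambda>e. ncn (D e) (x e))"
  unfolding ncn_def by (intro fp_intros)
lemma fp_nsk [fp_intros]: "fp x \<Longrightarrow> fp (\<lambda>e. nsk (x e))"
  unfolding nsk_def by (intro fp_intros)
lemma fp_nodes0: "fp (\<lambda>p. nodes (fst p) k (fst (snd p)) A (snd (snd p)))"
  unfolding nodes_def by (intro fp_intros)
lemmas fp_nodes [fp_intros] = fp_tri[of "\<lambda>D Q m. nodes D k Q A m" for k A, OF fp_nodes0]

lemma fp_tm_inst: "fp (tm_inst M k c)"
proof -
  have "fp (\<lambda>x. tm_inst M k c x)"
    unfolding tm_inst_def Let_def by (intro fp_mkT fp_intros)
  then show ?thesis by simp
qed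

text \<open>The finitely many values before \<open>n0\<close> are absorbed by their sum, and the
  constant factor \<open>c\<close> by \<open>c \<le> 2 ^ c\<close>.\<close>

lemma exponential_bound:
  assumes "(\<lambda>n. real (T n)) \<in> O(\<lambda>n. 2 ^ (n ^ k))"
  shows "\<exists>c. \<forall>n. T n \<le> 2 ^ (n ^ k + c)"
proof -
  obtain C where "\<forall>\<^sub>F n in sequentially. norm (real (T n)) \<le> C * norm ((2 :: real) ^ (n ^ k))"
    using assms by (auto elim: landau_o.bigE)
  then obtain n0 where n0: "\<And>n. n \<ge> n0 \<Longrightarrow> real (T n) \<le> C * 2 ^ (n ^ k)"
    unfolding eventually_sequentially by auto
  define c where "c = nat \<lceil>C\<rceil> + (\<Sum>n < n0. T n)"
  have "T n \<le> 2 ^ (n ^ k + c)" for n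
  proof -
    have "T n \<le> c * 2 ^ (n ^ k)"
    proof (cases "n0 \<le> n")
      case True
      have "real (T n) \<le> real (nat \<lceil>C\<rceil>) * 2 ^ (n ^ k)"
        using n0[OF True] by (rule order_trans) (intro mult_right_mono real_nat_ceiling_ge, simp)
      then have "real (T n) \<le> real (nat \<lceil>C\<rceil> * 2 ^ (n ^ k))" by simp
      then have "T n \<le> nat \<lceil>C\<rceil> * 2 ^ (n ^ k)" by (simp only: of_nat_le_iff)
      also have "\<dots> \<le> c * 2 ^ (n ^ k)" by (intro mult_right_mono) (simp_all add: c_def)
      finally show ?thesis .
    next
      case False
      then have "T n \<le> (\<Sum>n < n0. T n)" by (intro member_le_sum) auto
      then have "T n \<le> c * 1" by (simp add: c_def)
      also have "\<dots> \<le> c * 2 ^ (n ^ k)" by (intro mult_left_mono) auto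
      finally show ?thesis .
    qed
    also have "\<dots> \<le> 2 ^ c * 2 ^ (n ^ k)" by (intro mult_right_mono) (simp_all add: less_imp_le)
    finally show ?thesis by (simp add: power_add mult.commute)
  qed
  then show ?thesis by blast
qed

lemma game_size_bound:
  assumes "t \<le> 2 ^ (length x ^ k + c)"
  shows "Suc (length x) + t \<le> 2 ^ game_size k c x - 1"
proof -
  let ?a = "(2 :: nat) ^ (length x ^ k + c)" and ?b = "(2 :: nat) ^ length x"
  have "2 ^ game_size k c x = 4 * (?a * ?b)" by (simp add: game_size_def power_add)
  moreover have "?a \<le> ?a * ?b" "?b \<le> ?a * ?b" "1 \<le> ?a * ?b" by simp_all
  moreover have "length x < ?b" by (rule less_exp)
  ultimately show ?thesis using assms by linarith
qed

theorem NE_problem_hard: "EXPTIME_hard_on two_player_instances constrained_NE_problem"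
  unfolding EXPTIME_hard_on_def
proof
  fix L assume "L \<in> EXPTIME"
  then obtain k M tb where wf: "wf_tm M" and dec: "decides_within M L tb" and tb: "(\<lambda>n. real (tb n)) \<in> O(\<lambda>n. 2 ^ (n ^ k))"
    unfolding EXPTIME_def DTIME_def by blast
  obtain c where c: "\<And>n. tb n \<le> 2 ^ (n ^ k + c)" using exponential_bound[OF tb] by blast
  define f where "f = (\<lambda>x. encT (tm_inst M k c x))"
  have "polytime_computable f" unfolding f_def
    by (rule polytime_if_fp[OF fp_comp[OF fp_encT fp_tm_inst]])
  moreover have "f x \<in> two_player_instances \<and> (x \<in> L \<longleftrightarrow> f x \<in> constrained_NE_problem)" for x
  proof -
    interpret machine_input M x by unfold_locales (rule wf)
    let ?m = "game_size k c x"
    have e: "f x = encode (inst (T ?m))" unfolding f_def encode_inst T_def tm_inst_def Let_def by simp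
    obtain t where t: "t \<le> tb (length x)"
      "fst ((step M ^^ t) (init_config M x)) = (if x \<in> L then accept_state M else reject_state M)"
      using dec unfolding decides_within_def by blast
    have "Suc (length x) + t \<le> 2 ^ ?m - 1"
      using game_size_bound c t(1) order_trans by blast
    from accepting_state[OF t(2) this] show ?thesis unfolding e using accepts[of ?m] two_players[of ?m] by simp
  qed
  ultimately show "\<exists>f. polytime_computable f \<and> (\<forall>x. f x \<in> two_player_instances \<and> (x \<in> L \<longleftrightarrow> f x \<in> constrained_NE_problem))"
    by blast
qed

theorem theorem11:
  shows "EXPTIME_complete constrained_NE_problem \<and>
         EXPTIME_hard_on two_player_instances constrained_NE_problem"
proof -
  have "EXPTIME_hard constrained_NE_problem"
    unfolding EXPTIME_hard_def EXPTIME_hard_on_def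
  proof
    fix L assume "L \<in> EXPTIME"
    then obtain f where "polytime_computable f" "\<And>x. x \<in> L \<longleftrightarrow> f x \<in> constrained_NE_problem"
      using NE_problem_hard unfolding EXPTIME_hard_on_def by meson
    then show "\<exists>f. polytime_computable f \<and> (\<forall>x. f x \<in> UNIV \<and> (x \<in> L \<longleftrightarrow> f x \<in> constrained_NE_problem))"
      by (intro exI[of _ f]) simp
  qed
  then show ?thesis using NE_problem_in_EXPTIME NE_problem_hard unfolding EXPTIME_complete_def by blast
qed

end
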